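(* The groups of birational automorphisms of the foliations $\mathcal{F}_3$, $\mathcal{F}_4$ and $\mathcal{F}_6$ are: \begin{itemize} \item for $\mathcal{F}_3$, a group of order six, isomorphic to the group $S_3$ of permutations in three symbols; \item for $\mathcal{F}_4$, a group of order two (generated by an involution); and \item for $\mathcal{F}_6$, trivial. \end{itemize}
   Context: A birational automorphism of a foliation $\mathcal{F}$ on a projective surface $M$ is a birational self-map of $M$ preserving $\mathcal{F}$. Let $\omega$ be a primitive cubic root of unity and $\mathrm{i}=\sqrt{-1}$. $\mathcal{F}_3$ (Brunella's very special foliation): let $\mathcal{E}_3$ be the foliation on $\mathbb{P}^2$ given by $\omega^2YZ\,\mathrm{d}X+\omega XZ\,\mathrm{d}Y+XY\,\mathrm{d}Z=0$; it is preserved by $T_3(X:Y:Z)=(Z:X:Y)$. $\mathcal{F}_3$ is the foliation induced by $\mathcal{E}_3$ on the minimal desingularization of $\mathbb{P}^2/\langle T_3\rangle$. $\mathcal{F}_4$ (Santos): let $\mathcal{E}_4$ be the foliation on $\mathbb{P}^1\times\mathbb{P}^1$ given in the affine chart $(X,Y)$ by $Y\,\mathrm{d}X-\mathrm{i}X\,\mathrm{d}Y=0$; it is preserved by the order-four automorphism $T_4(X,Y)=(Y,1/X)$. $\mathcal{F}_4$ is the foliation induced by $\mathcal{E}_4$ on the minimal desingularization of $(\mathbb{P}^1\times\mathbb{P}^1)/\langle T_4\rangle$. $\mathcal{F}_6$ (Santos): let $\mathrm{Bl}_3(\mathbb{P}^2)$ be the blow-up of $\mathbb{P}^2$ at the three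 points $(1:0:0)$, $(0:1:0)$, $(0:0:1)$, and $\mathcal{E}_6$ the transform of $\mathcal{E}_3$ on it. With $Q(X:Y:Z)=(YZ:ZX:XY)$, the birational map $T_3\circ Q$ induces an order-six biholomorphism $T_6$ of $\mathrm{Bl}_3(\mathbb{P}^2)$ preserving $\mathcal{E}_6$. $\mathcal{F}_6$ is the foliation induced by $\mathcal{E}_6$ on the minimal desingularization of $\mathrm{Bl}_3(\mathbb{P}^2)/\langle T_6\rangle$. *)

theory Defs
  imports "HOL-Analysis.Function_Topology" "HOL-Algebra.Ring" "HOL-Algebra.Generated_Groups" "HOL-Algebra.Sym_Groups"
begin

section \<open>Spaces with functions\<close>

text \<open>
  Varieties are treated as spaces with functions: a topological space together with, for each open
  set, a set of regular complex-valued functions. Membership in \<open>rg X U\<close> only concerns the values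
  on \<open>U\<close>; the values elsewhere are junk.
\<close>

record 'a fspace =
  tp :: "'a topology"
  rg :: "'a set \<Rightarrow> ('a \<Rightarrow> complex) set"

abbreviation pts :: "'a fspace \<Rightarrow> 'a set" where
  "pts X \<equiv> topspace (tp X)"

definition open_sub :: "'a fspace \<Rightarrow> 'a set \<Rightarrow> 'a fspace" where
  "open_sub X U = \<lparr>tp = subtopology (tp X) U, rg = rg X\<rparr>"

definition morphism :: "'a fspace \<Rightarrow> 'b fspace \<Rightarrow> ('a \<Rightarrow> 'b) \<Rightarrow> bool" where
  "morphism X Y f \<longleftrightarrow> continuous_map (tp X) (tp Y) f \<and>
     (\<forall>V g. openin (tp Y) V \<and> g \<in> rg Y V \<longrightarrow> g \<circ> f \<in> rg X (pts X \<inter> f -` V))"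

definition isomorphism :: "'a fspace \<Rightarrow> 'b fspace \<Rightarrow> ('a \<Rightarrow> 'b) \<Rightarrow> bool" where
  "isomorphism X Y f \<longleftrightarrow> morphism X Y f \<and>
     (\<exists>g. morphism Y X g \<and> (\<forall>x\<in>pts X. g (f x) = x) \<and> (\<forall>y\<in>pts Y. f (g y) = y))"

definition nopen :: "'a fspace \<Rightarrow> 'a set \<Rightarrow> bool" where
  "nopen X U \<longleftrightarrow> openin (tp X) U \<and> U \<noteq> {}"

definition irreducible_space :: "'a topology \<Rightarrow> bool" where
  "irreducible_space T \<longleftrightarrow> topspace T \<noteq> {} \<and>
     (\<forall>U V. openin T U \<and> openin T V \<and> U \<noteq> {} \<and> V \<noteq> {} \<longrightarrow> U \<inter> V \<noteq> {})"

definition irreducible_chain :: "'a topology \<Rightarrow> nat \<Rightarrow> bool" where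
  "irreducible_chain T n \<longleftrightarrow> (\<exists>Z :: nat \<Rightarrow> 'a set.
     (\<forall>i\<le>n. closedin T (Z i) \<and> irreducible_space (subtopology T (Z i))) \<and>
     (\<forall>i<n. Z i \<subset> Z (Suc i)))"

definition has_krull_dim :: "'a topology \<Rightarrow> nat \<Rightarrow> bool" where
  "has_krull_dim T n \<longleftrightarrow> irreducible_chain T n \<and> \<not> irreducible_chain T (Suc n)"


section \<open>Products of projective spaces and their closed subvarieties\<close>

text \<open>
  A list \<open>ns = [n\<^sub>1, \<dots>, n\<^sub>k]\<close> stands for the product of the projective spaces of dimensions
  \<open>n\<^sub>1, \<dots>, n\<^sub>k\<close>. A tuple of homogeneous coordinate vectors is a list of lists, \<open>v ! i ! j\<close> being
  the \<open>j\<close>-th homogeneous coordinate on the \<open>i\<close>-th factor; a point is the set of all such tuples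
  representing it.
\<close>

type_synonym mvec = "complex list list"
type_synonym mpoint = "mvec set"

definition mvecs :: "nat list \<Rightarrow> mvec set" where
  "mvecs ns = {v. length v = length ns \<and>
     (\<forall>i<length ns. length (v ! i) = Suc (ns ! i) \<and> (\<exists>j\<le>ns ! i. v ! i ! j \<noteq> 0))}"

definition mscale :: "complex list \<Rightarrow> mvec \<Rightarrow> mvec" where
  "mscale cs v = map2 (\<lambda>c. map ((*) c)) cs v"

definition mpt :: "mvec \<Rightarrow> mpoint" where
  "mpt v = {mscale cs v | cs. length cs = length v \<and> 0 \<notin> set cs}"

definition mpoints :: "nat list \<Rightarrow> mpoint set" where
  "mpoints ns = mpt ` mvecs ns"

inductive_set polyfun :: "nat list \<Rightarrow> (mvec \<Rightarrow> complex) set" for ns :: "nat list" where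
  const: "(\<lambda>v. c) \<in> polyfun ns"
| coord: "i < length ns \<Longrightarrow> j \<le> ns ! i \<Longrightarrow> (\<lambda>v. v ! i ! j) \<in> polyfun ns"
| add: "P \<in> polyfun ns \<Longrightarrow> Q \<in> polyfun ns \<Longrightarrow> (\<lambda>v. P v + Q v) \<in> polyfun ns"
| mult: "P \<in> polyfun ns \<Longrightarrow> Q \<in> polyfun ns \<Longrightarrow> (\<lambda>v. P v * Q v) \<in> polyfun ns"

text \<open>Multihomogeneous polynomials, \<open>d i\<close> being the degree in the coordinates of the \<open>i\<close>-th factor.\<close>

definition mhom :: "nat list \<Rightarrow> (nat \<Rightarrow> nat) \<Rightarrow> (mvec \<Rightarrow> complex) \<Rightarrow> bool" where
  "mhom ns d P \<longleftrightarrow> P \<in> polyfun ns \<and>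
     (\<forall>v\<in>mvecs ns. \<forall>cs. length cs = length ns \<and> 0 \<notin> set cs \<longrightarrow>
        P (mscale cs v) = (\<Prod>i<length ns. cs ! i ^ d i) * P v)"

definition zariski :: "nat list \<Rightarrow> mpoint topology" where
  "zariski ns = topology_generated_by
     {{p \<in> mpoints ns. \<forall>v\<in>p. P v \<noteq> 0} | P d. mhom ns d P}"

text \<open>The subset \<open>Z\<close> of the product of projective spaces with its reduced induced structure.\<close>

definition mp :: "nat list \<Rightarrow> mpoint set \<Rightarrow> mpoint fspace" where
  "mp ns Z = \<lparr>tp = subtopology (zariski ns) Z,
     rg = (\<lambda>U. {f. \<forall>p\<in>U. \<exists>V P Q d. openin (subtopology (zariski ns) Z) V \<and> p \<in> V \<and> V \<subseteq> U \<and>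
        mhom ns d P \<and> mhom ns d Q \<and> (\<forall>q\<in>V. \<forall>v\<in>q. Q v \<noteq> 0 \<and> f q = P v / Q v)})\<rparr>"

definition projective_variety :: "mpoint fspace \<Rightarrow> bool" where
  "projective_variety M \<longleftrightarrow>
     (\<exists>n Z. closedin (zariski [n]) Z \<and> M = mp [n] Z \<and> irreducible_space (tp M))"

text \<open>
  Regularity of the local ring at a point of a surface: its maximal ideal, formed by the germs of
  regular functions vanishing at \<open>p\<close>, is generated by two elements.
\<close>

definition smooth_surface_at :: "'a fspace \<Rightarrow> 'a \<Rightarrow> bool" where
  "smooth_surface_at X p \<longleftrightarrow> (\<exists>U s t. openin (tp X) U \<and> p \<in> U \<and>
     s \<in> rg X U \<and> t \<in> rg X U \<and> s p = 0 \<and> t p = 0 \<and>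
     (\<forall>V f. openin (tp X) V \<and> p \<in> V \<and> f \<in> rg X V \<and> f p = 0 \<longrightarrow>
        (\<exists>W a b. openin (tp X) W \<and> p \<in> W \<and> W \<subseteq> U \<inter> V \<and> a \<in> rg X W \<and> b \<in> rg X W \<and>
           (\<forall>x\<in>W. f x = a x * s x + b x * t x))))"

definition smooth_projective_surface :: "mpoint fspace \<Rightarrow> bool" where
  "smooth_projective_surface M \<longleftrightarrow> projective_variety M \<and> has_krull_dim (tp M) 2 \<and>
     (\<forall>p\<in>pts M. smooth_surface_at M p)"


section \<open>Rational functions and birational maps\<close>

text \<open>
  On an irreducible space \<open>X\<close>, with \<open>S U\<close> the admissible maps on the open set \<open>U\<close> (regular functions,
  or morphisms to a given variety), a rational map is the class of the pairs \<open>(V, g)\<close>, \<open>g \<in> S V\<close>,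
  that agree with a given one on some nonempty open set.
\<close>

definition gcls ::
  "'a fspace \<Rightarrow> ('a set \<Rightarrow> ('a \<Rightarrow> 'b) set) \<Rightarrow> 'a set \<Rightarrow> ('a \<Rightarrow> 'b) \<Rightarrow> ('a set \<times> ('a \<Rightarrow> 'b)) set" where
  "gcls X S U f = {(V, g). nopen X V \<and> g \<in> S V \<and>
     (\<exists>W. nopen X W \<and> W \<subseteq> U \<inter> V \<and> (\<forall>x\<in>W. f x = g x))}"

type_synonym 'a ratfun = "('a set \<times> ('a \<Rightarrow> complex)) set"
type_synonym 'a ratmap = "('a set \<times> ('a \<Rightarrow> 'a)) set"

abbreviation rcls :: "'a fspace \<Rightarrow> 'a set \<Rightarrow> ('a \<Rightarrow> complex) \<Rightarrow> 'a ratfun" where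
  "rcls X \<equiv> gcls X (rg X)"

definition rconst :: "'a fspace \<Rightarrow> complex \<Rightarrow> 'a ratfun" where
  "rconst X c = rcls X (pts X) (\<lambda>x. c)"

definition ffield :: "'a fspace \<Rightarrow> 'a ratfun ring" where
  "ffield X = \<lparr>carrier = {rcls X U f | U f. nopen X U \<and> f \<in> rg X U},
     monoid.mult = (\<lambda>A B. \<Union>(U, f)\<in>A. \<Union>(V, g)\<in>B. rcls X (U \<inter> V) (\<lambda>x. f x * g x)),
     monoid.one = rconst X 1,
     ring.zero = rconst X 0,
     ring.add = (\<lambda>A B. \<Union>(U, f)\<in>A. \<Union>(V, g)\<in>B. rcls X (U \<inter> V) (\<lambda>x. f x + g x))\<rparr>"

text \<open>Pull-back of rational functions under a dominant rational map given by \<open>p\<close> on \<open>U\<close>.\<close>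

definition pull :: "'a fspace \<Rightarrow> 'a set \<Rightarrow> ('a \<Rightarrow> 'b) \<Rightarrow> 'b ratfun \<Rightarrow> 'a ratfun" where
  "pull X U p h = (\<Union>(V, k)\<in>h. rcls X (U \<inter> p -` V) (k \<circ> p))"

abbreviation mcls :: "'a fspace \<Rightarrow> 'a set \<Rightarrow> ('a \<Rightarrow> 'a) \<Rightarrow> 'a ratmap" where
  "mcls X \<equiv> gcls X (\<lambda>U. {f. morphism (open_sub X U) X f})"

definition Bir :: "'a fspace \<Rightarrow> 'a ratmap monoid" where
  "Bir X = \<lparr>carrier = {mcls X U f | U f.
       \<exists>V. nopen X U \<and> nopen X V \<and> isomorphism (open_sub X U) (open_sub X V) f},
     monoid.mult = (\<lambda>A B. \<Union>(U, f)\<in>A. \<Union>(V, g)\<in>B. mcls X (V \<inter> g -` U) (f \<circ> g)),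
     monoid.one = mcls X (pts X) id\<rparr>"


section \<open>Foliations\<close>

text \<open>
  A foliation on a surface is given by a nonzero rational vector field up to multiplication by a
  nonzero rational function; it is represented by the line spanned by that vector field over the
  field of rational functions. Rational vector fields are the \<open>\<complex>\<close>-derivations of this field.
\<close>

definition rvfields :: "'a fspace \<Rightarrow> ('a ratfun \<Rightarrow> 'a ratfun) set" where
  "rvfields X = {D \<in> carrier (ffield X) \<rightarrow>\<^sub>E carrier (ffield X).
     (\<forall>g\<in>carrier (ffield X). \<forall>h\<in>carrier (ffield X).
        D (g \<oplus>\<^bsub>ffield X\<^esub> h) = D g \<oplus>\<^bsub>ffield X\<^esub> D h \<and>
        D (g \<otimes>\<^bsub>ffield X\<^esub> h) = (D g \<otimes>\<^bsub>ffield X\<^esub> h) \<oplus>\<^bsub>ffield X\<^esub> (g \<otimes>\<^bsub>ffield X\<^esub> D h)) \<and>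
     (\<forall>c. D (rconst X c) = \<zero>\<^bsub>ffield X\<^esub>)}"

definition foliation :: "'a fspace \<Rightarrow> ('a ratfun \<Rightarrow> 'a ratfun) set \<Rightarrow> bool" where
  "foliation X F \<longleftrightarrow> (\<exists>D\<in>rvfields X. (\<exists>h\<in>carrier (ffield X). D h \<noteq> \<zero>\<^bsub>ffield X\<^esub>) \<and>
     F = {\<lambda>h\<in>carrier (ffield X). f \<otimes>\<^bsub>ffield X\<^esub> D h | f. f \<in> carrier (ffield X)})"

text \<open>\<open>D'\<close> on \<open>Y\<close> is the image of \<open>D\<close> on \<open>X\<close> under the rational map given by \<open>p\<close> on \<open>U\<close>.\<close>

definition related ::
  "'a fspace \<Rightarrow> 'b fspace \<Rightarrow> 'a set \<Rightarrow> ('a \<Rightarrow> 'b) \<Rightarrow>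
   ('a ratfun \<Rightarrow> 'a ratfun) \<Rightarrow> ('b ratfun \<Rightarrow> 'b ratfun) \<Rightarrow> bool" where
  "related X Y U p D D' \<longleftrightarrow>
     (\<forall>h\<in>carrier (ffield Y). D (pull X U p h) = pull X U p (D' h))"

text \<open>
  For a dominant rational map between surfaces, the foliation \<open>E\<close> is the pull-back of the
  foliation \<open>F\<close> when the (unique) lifts of the vector fields tangent to \<open>F\<close> are tangent to \<open>E\<close>.
\<close>

definition pulls_back ::
  "'a fspace \<Rightarrow> 'b fspace \<Rightarrow> 'a set \<Rightarrow> ('a \<Rightarrow> 'b) \<Rightarrow>
   ('b ratfun \<Rightarrow> 'b ratfun) set \<Rightarrow> ('a ratfun \<Rightarrow> 'a ratfun) set \<Rightarrow> bool" where
  "pulls_back X Y U p F E \<longleftrightarrow> (\<forall>D'\<in>F. \<exists>D\<in>E. related X Y U p D D')"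

definition BirFol :: "'a fspace \<Rightarrow> ('a ratfun \<Rightarrow> 'a ratfun) set \<Rightarrow> 'a ratmap monoid" where
  "BirFol M F = (Bir M)\<lparr>carrier := {A \<in> carrier (Bir M). \<forall>(U, f)\<in>A. pulls_back M M U f F F}\<rparr>"


section \<open>Quotients and minimal desingularizations\<close>

definition orb :: "('a \<Rightarrow> 'a) \<Rightarrow> 'a \<Rightarrow> 'a set" where
  "orb T x = range (\<lambda>k. (T ^^ k) x)"

text \<open>
  The quotient of \<open>X\<close> by the cyclic group generated by an automorphism \<open>T\<close> of finite order: the
  orbit space with the quotient topology, whose regular functions are the invariant ones.
\<close>

definition quot_topology :: "'a topology \<Rightarrow> ('a \<Rightarrow> 'a) \<Rightarrow> 'a set topology" where
  "quot_topology X T = topology (\<lambda>V. V \<subseteq> orb T ` topspace X \<and> openin X (topspace X \<inter> orb T -` V))"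

lemma openin_quot_topology:
  "openin (quot_topology X T) V \<longleftrightarrow>
     V \<subseteq> orb T ` topspace X \<and> openin X (topspace X \<inter> orb T -` V)"
proof -
  have "istopology (\<lambda>V. V \<subseteq> orb T ` topspace X \<and> openin X (topspace X \<inter> orb T -` V))"
    unfolding istopology_def
  proof (intro conjI allI impI)
    fix S S' :: "'a set set"
    assume S: "S \<subseteq> orb T ` topspace X \<and> openin X (topspace X \<inter> orb T -` S)"
      and S': "S' \<subseteq> orb T ` topspace X \<and> openin X (topspace X \<inter> orb T -` S')"
    show "S \<inter> S' \<subseteq> orb T ` topspace X" using S by blast
    have "topspace X \<inter> orb T -` (S \<inter> S') = (topspace X \<inter> orb T -` S) \<inter> (topspace X \<inter> orb T -` S')"
      by blast
    then show "openin X (topspace X \<inter> orb T -` (S \<inter> S'))" using S S' by auto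
  next
    fix \<K> :: "'a set set set"
    assume K: "\<forall>K\<in>\<K>. K \<subseteq> orb T ` topspace X \<and> openin X (topspace X \<inter> orb T -` K)"
    show "\<Union>\<K> \<subseteq> orb T ` topspace X" using K by blast
    have "topspace X \<inter> orb T -` \<Union>\<K> = (\<Union>K\<in>\<K>. topspace X \<inter> orb T -` K)" by blast
    moreover have "openin X (\<Union>K\<in>\<K>. topspace X \<inter> orb T -` K)" using K by (intro openin_Union) blast
    ultimately show "openin X (topspace X \<inter> orb T -` \<Union>\<K>)" by (simp only:)
  qed
  then show ?thesis by (simp add: quot_topology_def)
qed

definition quot :: "'a fspace \<Rightarrow> ('a \<Rightarrow> 'a) \<Rightarrow> 'a set fspace" where
  "quot X T = \<lparr>tp = quot_topology (tp X) T,
     rg = (\<lambda>V. {f. f \<circ> orb T \<in> rg X (pts X \<inter> orb T -` V)})\<rparr>"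

definition birational_morphism :: "'a fspace \<Rightarrow> 'b fspace \<Rightarrow> ('a \<Rightarrow> 'b) \<Rightarrow> bool" where
  "birational_morphism X Y r \<longleftrightarrow> morphism X Y r \<and>
     (\<exists>U V. nopen X U \<and> nopen Y V \<and> isomorphism (open_sub X U) (open_sub Y V) r)"

text \<open>
  Projectivity of the source makes the map proper. A desingularization is minimal when all the
  others factor through it.
\<close>

definition desingularization :: "mpoint fspace \<Rightarrow> 'b fspace \<Rightarrow> (mpoint \<Rightarrow> 'b) \<Rightarrow> bool" where
  "desingularization M Y r \<longleftrightarrow> smooth_projective_surface M \<and> birational_morphism M Y r"

definition minimal_desingularization :: "mpoint fspace \<Rightarrow> 'b fspace \<Rightarrow> (mpoint \<Rightarrow> 'b) \<Rightarrow> bool" where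
  "minimal_desingularization M Y r \<longleftrightarrow> desingularization M Y r \<and>
     (\<forall>M' r'. desingularization M' Y r' \<longrightarrow>
        (\<exists>s. morphism M' M s \<and> (\<forall>x\<in>pts M'. r' x = r (s x))))"

text \<open>
  \<open>M\<close> is a minimal desingularization of the quotient of \<open>X\<close> by \<open>T\<close>, and \<open>F\<close> is the foliation on it
  induced by \<open>E\<close>: \<open>G\<close> is the foliation on the quotient whose pull-back to \<open>X\<close> is \<open>E\<close>, and whose
  pull-back to \<open>M\<close> is \<open>F\<close>.
\<close>

definition induced_on_desingularized_quotient ::
  "'a fspace \<Rightarrow> ('a \<Rightarrow> 'a) \<Rightarrow> ('a ratfun \<Rightarrow> 'a ratfun) set \<Rightarrow>
   mpoint fspace \<Rightarrow> (mpoint ratfun \<Rightarrow> mpoint ratfun) set \<Rightarrow> bool" where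
  "induced_on_desingularized_quotient X T E M F \<longleftrightarrow> foliation M F \<and>
     (\<exists>r G. minimal_desingularization M (quot X T) r \<and> foliation (quot X T) G \<and>
        pulls_back X (quot X T) (pts X) (orb T) G E \<and>
        pulls_back M (quot X T) (pts M) r G F)"


section \<open>The three foliations\<close>

text \<open>The rational function \<open>P / Q\<close> for multihomogeneous \<open>P\<close> and \<open>Q\<close> of the same degree.\<close>

definition rquot :: "mpoint fspace \<Rightarrow> (mvec \<Rightarrow> complex) \<Rightarrow> (mvec \<Rightarrow> complex) \<Rightarrow> mpoint ratfun" where
  "rquot X P Q = rcls X {p \<in> pts X. \<forall>v\<in>p. Q v \<noteq> 0} (\<lambda>p. let v = (SOME v. v \<in> p) in P v / Q v)"

text \<open>The foliation \<open>A dx + B dy = 0\<close> as the vector fields annihilated by the form.\<close>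

definition form_kernel ::
  "'a fspace \<Rightarrow> 'a ratfun \<Rightarrow> 'a ratfun \<Rightarrow> 'a ratfun \<Rightarrow> 'a ratfun \<Rightarrow> ('a ratfun \<Rightarrow> 'a ratfun) set" where
  "form_kernel X A x B y = {D \<in> rvfields X.
     (A \<otimes>\<^bsub>ffield X\<^esub> D x) \<oplus>\<^bsub>ffield X\<^esub> (B \<otimes>\<^bsub>ffield X\<^esub> D y) = \<zero>\<^bsub>ffield X\<^esub>}"

definition P2 :: "mpoint fspace" where
  "P2 = mp [2] (mpoints [2])"

definition P1P1 :: "mpoint fspace" where
  "P1P1 = mp [1, 1] (mpoints [1, 1])"

text \<open>
  Maps between products of projective spaces are given on points by taking images under maps of
  homogeneous coordinates, which map classes onto classes (wherever they do not vanish).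
\<close>

definition T3 :: "mpoint \<Rightarrow> mpoint" where
  "T3 p = (\<lambda>v. [[v!0!2, v!0!0, v!0!1]]) ` p"

definition Q2 :: "mpoint \<Rightarrow> mpoint" where
  "Q2 p = (\<lambda>v. [[v!0!1 * v!0!2, v!0!2 * v!0!0, v!0!0 * v!0!1]]) ` p"

text \<open>
  The form \<open>\<omega>\<^sup>2 YZ dX + \<omega> XZ dY + XY dZ\<close> in the chart \<open>Z = 1\<close>, with coordinates \<open>x = X/Z\<close> and
  \<open>y = Y/Z\<close>: it becomes \<open>\<omega>\<^sup>2 y dx + \<omega> x dy\<close>.
\<close>

definition E3 :: "complex \<Rightarrow> (mpoint ratfun \<Rightarrow> mpoint ratfun) set" where
  "E3 w = form_kernel P2
     (rquot P2 (\<lambda>v. w^2 * v!0!1) (\<lambda>v. v!0!2)) (rquot P2 (\<lambda>v. v!0!0) (\<lambda>v. v!0!2))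
     (rquot P2 (\<lambda>v. w * v!0!0) (\<lambda>v. v!0!2)) (rquot P2 (\<lambda>v. v!0!1) (\<lambda>v. v!0!2))"

text \<open>The affine coordinates \<open>(X, Y)\<close> stand for the point \<open>((X:1), (Y:1))\<close>.\<close>

definition T4 :: "mpoint \<Rightarrow> mpoint" where
  "T4 p = (\<lambda>v. [[v!1!0, v!1!1], [v!0!1, v!0!0]]) ` p"

definition E4 :: "(mpoint ratfun \<Rightarrow> mpoint ratfun) set" where
  "E4 = form_kernel P1P1
     (rquot P1P1 (\<lambda>v. v!1!0) (\<lambda>v. v!1!1)) (rquot P1P1 (\<lambda>v. v!0!0) (\<lambda>v. v!0!1))
     (rquot P1P1 (\<lambda>v. - \<i> * v!0!0) (\<lambda>v. v!0!1)) (rquot P1P1 (\<lambda>v. v!1!0) (\<lambda>v. v!1!1))"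

text \<open>
  The blow-up of the plane at the three coordinate points: the points
  \<open>((X:Y:Z), (a\<^sub>1:b\<^sub>1), (a\<^sub>2:b\<^sub>2), (a\<^sub>3:b\<^sub>3))\<close> with \<open>Y b\<^sub>1 = Z a\<^sub>1\<close>, \<open>X b\<^sub>2 = Z a\<^sub>2\<close>, \<open>X b\<^sub>3 = Y a\<^sub>3\<close>, the
  \<open>i\<close>-th equation blowing up the point where its two coordinates vanish.
\<close>

definition Bl3 :: "mpoint fspace" where
  "Bl3 = mp [2, 1, 1, 1] {p \<in> mpoints [2, 1, 1, 1]. \<forall>v\<in>p.
     v!0!1 * v!1!1 = v!0!2 * v!1!0 \<and> v!0!0 * v!2!1 = v!0!2 * v!2!0 \<and> v!0!0 * v!3!1 = v!0!1 * v!3!0}"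

definition blowdown :: "mpoint \<Rightarrow> mpoint" where
  "blowdown p = (\<lambda>v. [v!0]) ` p"

definition E6 :: "complex \<Rightarrow> (mpoint ratfun \<Rightarrow> mpoint ratfun) set" where
  "E6 w = {D \<in> rvfields Bl3. \<exists>D'\<in>E3 w. related Bl3 P2 (pts Bl3) blowdown D D'}"

text \<open>The automorphism of the blow-up induced by a birational map of the plane; it is unique.\<close>

definition is_T6 :: "(mpoint \<Rightarrow> mpoint) \<Rightarrow> bool" where
  "is_T6 T \<longleftrightarrow> isomorphism Bl3 Bl3 T \<and>
     (\<exists>W. nopen Bl3 W \<and> (\<forall>p\<in>W. blowdown (T p) = T3 (Q2 (blowdown p))))"

definition is_F3 :: "complex \<Rightarrow> mpoint fspace \<Rightarrow> (mpoint ratfun \<Rightarrow> mpoint ratfun) set \<Rightarrow> bool" where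
  "is_F3 w M F \<longleftrightarrow> induced_on_desingularized_quotient P2 T3 (E3 w) M F"

definition is_F4 :: "mpoint fspace \<Rightarrow> (mpoint ratfun \<Rightarrow> mpoint ratfun) set \<Rightarrow> bool" where
  "is_F4 M F \<longleftrightarrow> induced_on_desingularized_quotient P1P1 T4 E4 M F"

definition is_F6 :: "complex \<Rightarrow> mpoint fspace \<Rightarrow> (mpoint ratfun \<Rightarrow> mpoint ratfun) set \<Rightarrow> bool" where
  "is_F6 w M F \<longleftrightarrow> (\<exists>T. is_T6 T \<and> induced_on_desingularized_quotient Bl3 T (E6 w) M F)"

end

theory Submission
  imports Defs "HOL-Computational_Algebra.Polynomial_Factorial" "HOL-Computational_Algebra.Field_as_Ring"
begin

text \<open>
  The function field of \<open>M\<close> is the field of invariants, in the field of rational functions in \<open>x\<close> and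
  \<open>y\<close>, of the monomial automorphism \<open>T\<close> given by the cyclic group, and the foliation is spanned by
  a multiple of \<open>x \<partial>\<^sub>x + l y \<partial>\<^sub>y\<close>, an eigenvector of \<open>T\<close> with primitive eigenvalue. A Lagrange
  resolvent \<open>z\<close> generates the field of all rational functions over the invariants, and \<open>z \<delta>\<close> and
  \<open>\<theta> / z\<close> act on the invariants, where \<open>\<delta> = x \<partial>\<^sub>x + l y \<partial>\<^sub>y\<close> and \<open>\<theta>\<close> is the analogous derivation with
  the inverse eigenvalue, commuting with \<open>\<delta>\<close>. Comparing the bracket of these two derivations with
  its transform under an automorphism of the invariants that preserves the foliation shows that the
  automorphism extends to all rational functions, \<open>z\<close> being sent to an invariant multiple of \<open>z\<close>.
  Since \<open>l\<close> is irrational, the eigenvectors of \<open>\<delta>\<close> are the monomials, so the extension is a monomial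
  map; its exponents form a unit of the ring of Eisenstein or Gaussian integers, and commutation
  with \<open>T\<close> leaves finitely many coefficients. Conversely, these maps are automorphisms of the torus
  that commute with \<open>T\<close> and preserve the line spanned by \<open>\<delta>\<close>.
\<close>

text \<open>Extending an automorphism \<open>\<sigma>\<close> of the invariants is a Kummer problem:
  the big field is generated by an \<open>n\<close>-th root \<open>z\<close> of the invariant
  \<open>f = z ^ n\<close>, so \<open>\<sigma>\<close> extends once \<open>\<sigma> f\<close> is an
  \<open>n\<close>-th power. The bracket decides this because \<open>\<delta>\<close> and
  \<open>\<theta>\<close> commute: the bracket of \<open>z \<delta>\<close> and
  \<open>\<theta> / z\<close> then has only logarithmic derivatives of \<open>f\<close> as
  coefficients, up to the factor \<open>n\<close>. If \<open>h\<close> is the coefficient of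
  \<open>\<theta> / z\<close> in its own transform, the comparison says that \<open>\<delta>\<close>
  kills \<open>h ^ n * \<sigma> f / f\<close>. First integrals of \<open>\<delta>\<close> are
  constant, so \<open>z\<close> can go to a constant multiple of \<open>z / h\<close>.

  The slope is read off the form: \<open>w^2 y dx + w x dy\<close> vanishes on
  \<open>x d/dx + l y d/dy\<close> for \<open>l = - w\<close>, and \<open>y dx - \<i> x dy\<close>
  for \<open>l = - \<i>\<close>; \<open>\<theta>\<close> has the complex conjugate slope.

  The geometric obstacle is that functions and maps are classes on varying open sets. They are moved
  to general points of the plane: a filter of complements of curves, and for each space a map from
  general points that embeds its function field into the rational functions of \<open>x\<close> and
  \<open>y\<close>.\<close>

hide_const (open) Polynomial.order

lemma add_self_eq_0: "a = a + a \<Longrightarrow> a = (0::'a::ab_group_add)"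
  by (metis add_cancel_right_right)

text \<open>Geometry enters only through formal rules. By \<open>\<delta>T\<close>,
  \<open>\<theta>T\<close> and \<open>Tz\<close> the characters cancel in
  \<open>z * \<delta> u\<close> and \<open>\<theta> u / z\<close>, so both operators commute with
  \<open>T\<close>. The irrationality of the slope survives as \<open>ker\<close>, and the dimension
  two of the surface as \<open>derivation_span\<close> together with \<open>indep\<close>.\<close>

locale cyclic_foliation =
  fixes cst :: "complex \<Rightarrow> 'k::field" and T \<delta> \<theta> :: "'k \<Rightarrow> 'k" and z :: 'k and \<chi> :: complex and n :: nat
  assumes cst_add: "cst (a + b) = cst a + cst b"
    and cst_mult: "cst (a * b) = cst a * cst b"
    and cst_1: "cst 1 = 1"
    and T_add: "T (u + v) = T u + T v"
    and T_mult: "T (u * v) = T u * T v"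
    and T_cst: "T (cst c) = cst c"
    and n_pos: "n > 0"
    and T_order: "(T ^^ n) u = u"
    and \<delta>_add: "\<delta> (u + v) = \<delta> u + \<delta> v"
    and \<delta>_mult: "\<delta> (u * v) = \<delta> u * v + u * \<delta> v"
    and \<delta>_cst: "\<delta> (cst c) = 0"
    and \<theta>_add: "\<theta> (u + v) = \<theta> u + \<theta> v"
    and \<theta>_mult: "\<theta> (u * v) = \<theta> u * v + u * \<theta> v"
    and \<theta>_cst: "\<theta> (cst c) = 0"
    and \<delta>\<theta>: "\<delta> (\<theta> u) = \<theta> (\<delta> u)"
    and \<delta>T: "\<delta> (T u) = cst \<chi> * T (\<delta> u)"
    and \<theta>T: "\<theta> (T u) = cst (inverse \<chi>) * T (\<theta> u)"
    and ker: "\<delta> u = 0 \<Longrightarrow> u \<in> range cst"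
    and \<chi>_n: "\<chi> ^ n = 1"
    and \<chi>_primitive: "0 < k \<Longrightarrow> k < n \<Longrightarrow> \<chi> ^ k \<noteq> 1"
    and z_nz: "z \<noteq> 0"
    and Tz: "T z = cst \<chi> * z"
    and derivation_span: "(\<And>u v. E (u + v) = E u + E v) \<Longrightarrow> (\<And>u v. E (u * v) = E u * v + u * E v) \<Longrightarrow>
         (\<And>c. E (cst c) = 0) \<Longrightarrow> \<exists>p q. \<forall>u. E u = p * \<theta> u + q * \<delta> u"
    and indep: "(\<And>u. p * \<theta> u + q * \<delta> u = 0) \<Longrightarrow> p = 0 \<and> q = 0"
begin

lemma cst_0 [simp]: "cst 0 = 0"
  using cst_add[of 0 0] by (intro add_self_eq_0) simp

lemma cst_eq_0 [simp]: "cst c = 0 \<longleftrightarrow> c = 0"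
proof
  assume "cst c = 0"
  show "c = 0"
  proof (rule ccontr)
    assume "c \<noteq> 0"
    then have "cst (c * inverse c) = 1" by (simp add: cst_1)
    with \<open>cst c = 0\<close> show False unfolding cst_mult by simp
  qed
qed simp

lemma cst_power: "cst (c ^ k) = cst c ^ k"
  by (induction k) (auto simp: cst_1 cst_mult)

lemma cst_inverse: "c \<noteq> 0 \<Longrightarrow> cst (inverse c) = inverse (cst c)"
  using cst_mult[of c "inverse c"] by (simp add: cst_1 inverse_unique)

lemma cst_of_nat: "cst (of_nat k) = of_nat k"
  by (induction k) (auto simp: cst_1 cst_add)

lemma cst_sum: "cst (sum g A) = (\<Sum>i\<in>A. cst (g i))"
  by (induction A rule: infinite_finite_induct) (auto simp: cst_add)

lemma of_nat_n_nz [simp]: "(of_nat n :: 'k) \<noteq> 0"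
  using cst_eq_0[of "of_nat n"] n_pos unfolding cst_of_nat by simp

lemma \<chi>_nz [simp]: "\<chi> \<noteq> 0"
  using \<chi>_n n_pos by (metis power_0_left zero_neq_one neq0_conv)

definition L :: "'k set" where "L = {u. T u = u}"

lemma T_0 [simp]: "T 0 = 0" using T_cst[of 0] by simp
lemma T_1 [simp]: "T 1 = 1" using T_cst[of 1] by (simp add: cst_1)

lemma T_power: "T (u ^ k) = T u ^ k"
  by (induction k) (auto simp: T_mult)

lemma T_sum: "T (sum g A) = (\<Sum>i\<in>A. T (g i))"
  by (induction A rule: infinite_finite_induct) (auto simp: T_add)

lemma T_minus: "T (- u) = - T u"
  using T_add[of u "- u"] by (simp add: add_eq_0_iff)

lemma T_inverse: "T (inverse u) = inverse (T u)"
proof (cases "u = 0")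
  case False
  then show ?thesis using T_mult[of u "inverse u"] by (simp add: inverse_unique)
qed simp

lemma T_divide: "T (u / v) = T u / T v"
  by (simp add: divide_inverse T_mult T_inverse)

lemma T_pow_add: "(T ^^ k) (u + v) = (T ^^ k) u + (T ^^ k) v"
  by (induction k) (auto simp: T_add)

lemma T_pow_mult: "(T ^^ k) (u * v) = (T ^^ k) u * (T ^^ k) v"
  by (induction k) (auto simp: T_mult)

lemma T_pow_L: "u \<in> L \<Longrightarrow> (T ^^ k) u = u"
  by (induction k) (auto simp: L_def)

lemma T_pow_z: "(T ^^ k) z = cst (\<chi> ^ k) * z"
  by (induction k) (auto simp: cst_1 T_mult T_cst Tz cst_mult mult_ac)

lemma T_pow_pow: "(T ^^ k) (u ^ j) = ((T ^^ k) u) ^ j"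
  by (induction k) (auto simp: T_power)

lemma L_add: "u \<in> L \<Longrightarrow> v \<in> L \<Longrightarrow> u + v \<in> L" by (simp add: L_def T_add)
lemma L_mult: "u \<in> L \<Longrightarrow> v \<in> L \<Longrightarrow> u * v \<in> L" by (simp add: L_def T_mult)
lemma L_cst: "cst c \<in> L" by (simp add: L_def T_cst)
lemma L_inverse: "u \<in> L \<Longrightarrow> inverse u \<in> L" by (simp add: L_def T_inverse)
lemma L_divide: "u \<in> L \<Longrightarrow> v \<in> L \<Longrightarrow> u / v \<in> L" by (simp add: L_def T_divide)
lemma L_power: "u \<in> L \<Longrightarrow> u ^ k \<in> L" by (simp add: L_def T_power)

lemma L_0: "0 \<in> L" and L_1: "1 \<in> L" by (simp_all add: L_def)
lemma L_minus: "u \<in> L \<Longrightarrow> - u \<in> L" by (simp add: L_def T_minus)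
lemma L_of_nat: "of_nat k \<in> L" using L_cst[of "of_nat k"] by (simp add: cst_of_nat)

subsection \<open>Eigenspace decomposition\<close>

text \<open>The average is the projector onto the eigenspace of \<open>T\<close> for
  \<open>\<chi> ^ i\<close>; dividing by \<open>z ^ i\<close>, an eigenvector for the same value,
  leaves an invariant coefficient.\<close>

definition comp :: "nat \<Rightarrow> 'k \<Rightarrow> 'k" where
  "comp i u = cst (inverse (of_nat n)) * (\<Sum>k<n. cst (inverse (\<chi> ^ i) ^ k) * (T ^^ k) u) / z ^ i"

lemma comp_add: "comp i (u + v) = comp i u + comp i v"
  by (simp add: comp_def T_pow_add sum.distrib ring_distribs add_divide_distrib)

lemma comp_in_L: "comp i u \<in> L"
proof -
  define c where "c = inverse (\<chi> ^ i)"
  define S where "S = (\<Sum>k<n. cst (c ^ k) * (T ^^ k) u)"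
  have c: "c * \<chi> ^ i = 1" by (simp add: c_def)
  have cn: "c ^ n = 1"
    by (simp add: c_def power_inverse) (metis \<chi>_n mult.commute power_mult power_one)
  have "T S = (\<Sum>k<n. cst (c ^ k) * (T ^^ Suc k) u)"
    by (simp add: S_def T_sum T_mult T_cst)
  also have "\<dots> = (\<Sum>k<n. cst (\<chi> ^ i) * (cst (c ^ Suc k) * (T ^^ Suc k) u))"
  proof (rule sum.cong[OF refl])
    fix k
    have "c ^ k = \<chi> ^ i * c ^ Suc k" using c by (simp add: mult.assoc[symmetric] mult.commute[of _ c])
    then have "cst (c ^ k) = cst (\<chi> ^ i) * cst (c ^ Suc k)" by (simp only: cst_mult)
    then show "cst (c ^ k) * (T ^^ Suc k) u = cst (\<chi> ^ i) * (cst (c ^ Suc k) * (T ^^ Suc k) u)"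
      by (simp only: mult.assoc)
  qed
  also have "\<dots> = cst (\<chi> ^ i) * (\<Sum>k<n. cst (c ^ Suc k) * (T ^^ Suc k) u)"
    by (simp only: sum_distrib_left)
  \<comment> \<open>The two end terms of the sum over \<open>k < Suc n\<close> agree, because
    \<open>c ^ n = 1\<close> and \<open>T ^^ n\<close> is the identity; so shifting the index does
    not change the sum.\<close>
  also have "(\<Sum>k<n. cst (c ^ Suc k) * (T ^^ Suc k) u) = S"
  proof -
    have "(\<Sum>k<Suc n. cst (c ^ k) * (T ^^ k) u) = cst 1 * u + (\<Sum>k<n. cst (c ^ Suc k) * (T ^^ Suc k) u)"
      by (subst sum.lessThan_Suc_shift) simp
    moreover have "(\<Sum>k<Suc n. cst (c ^ k) * (T ^^ k) u) = S + cst 1 * u"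
      by (simp add: S_def cn T_order)
    ultimately show ?thesis by simp
  qed
  finally have TS: "T S = cst (\<chi> ^ i) * S" .
  have "comp i u = cst (inverse (of_nat n)) * S / z ^ i" by (simp only: comp_def S_def c_def)
  then show ?thesis
    by (simp add: L_def T_divide T_mult T_cst T_power TS Tz power_mult_distrib cst_power)
qed

lemma root_sum:
  assumes "\<zeta> ^ n = 1" "\<zeta> \<noteq> (1::complex)"
  shows "(\<Sum>k<n. \<zeta> ^ k) = 0"
  using assms by (simp add: geometric_sum)

text \<open>Orthogonality of characters: after the sums are swapped, the inner sum of powers of
  \<open>inverse (\<chi> ^ k)\<close> vanishes for \<open>0 < k < n\<close>, since
  \<open>\<chi>\<close> is a primitive root of unity.\<close>

lemma comp_sum: "(\<Sum>i<n. comp i u * z ^ i) = u"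
proof -
  have "(\<Sum>i<n. comp i u * z ^ i) =
      (\<Sum>i<n. \<Sum>k<n. cst (inverse (of_nat n)) * (cst (inverse (\<chi> ^ i) ^ k) * (T ^^ k) u))"
    by (intro sum.cong refl) (simp add: comp_def z_nz sum_distrib_left)
  also have "\<dots> = (\<Sum>k<n. \<Sum>i<n. cst (inverse (of_nat n)) * (cst (inverse (\<chi> ^ i) ^ k) * (T ^^ k) u))"
    by (rule sum.swap)
  also have "\<dots> = (\<Sum>k<n. cst (inverse (of_nat n)) * cst (\<Sum>i<n. inverse (\<chi> ^ k) ^ i) * (T ^^ k) u)"
    by (intro sum.cong refl)
      (simp add: cst_sum sum_distrib_left sum_distrib_right power_inverse power_mult[symmetric] mult_ac)
  also have "\<dots> = (\<Sum>k<n. if k = 0 then u else 0)"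
  proof (intro sum.cong refl)
    fix k assume "k \<in> {..<n}"
    then have k: "k < n" by simp
    show "cst (inverse (of_nat n)) * cst (\<Sum>i<n. inverse (\<chi> ^ k) ^ i) * (T ^^ k) u = (if k = 0 then u else 0)"
    proof (cases "k = 0")
      case True
      have "cst (inverse (of_nat n)) * cst (of_nat n) = cst (inverse (of_nat n) * of_nat n)" by (simp only: cst_mult)
      also have "\<dots> = 1" using n_pos by (simp add: cst_1)
      finally show ?thesis using True by simp
    next
      case False
      have "inverse (\<chi> ^ k) ^ n = 1"
        by (simp add: power_inverse) (metis \<chi>_n mult.commute power_mult power_one)
      moreover have "inverse (\<chi> ^ k) \<noteq> 1" using \<chi>_primitive[of k] False k
        by (metis inverse_1 inverse_inverse_eq neq0_conv)
      ultimately show ?thesis using root_sum False by simp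
    qed
  qed
  also have "\<dots> = u" using n_pos by simp
  finally show ?thesis .
qed

text \<open>The second orthogonality relation. Together with \<open>comp_sum\<close> it makes
  \<open>1, z, ..., z ^ (n - 1)\<close> a basis of the big field over \<open>L\<close>.\<close>

lemma comp_homogeneous:
  assumes "a \<in> L" "i < n" "j < n"
  shows "comp i (a * z ^ j) = (if i = j then a else 0)"
proof -
  define \<zeta> where "\<zeta> = \<chi> ^ j * inverse (\<chi> ^ i)"
  have "(\<Sum>k<n. cst (inverse (\<chi> ^ i) ^ k) * (T ^^ k) (a * z ^ j)) = (\<Sum>k<n. cst (\<zeta> ^ k) * (a * z ^ j))"
  proof (intro sum.cong refl)
    fix k
    show "cst (inverse (\<chi> ^ i) ^ k) * (T ^^ k) (a * z ^ j) = cst (\<zeta> ^ k) * (a * z ^ j)"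
      by (simp add: \<zeta>_def T_pow_mult T_pow_L assms T_pow_pow T_pow_z power_mult_distrib cst_mult
          cst_power[symmetric] power_mult[symmetric] mult_ac)
  qed
  also have "\<dots> = cst (\<Sum>k<n. \<zeta> ^ k) * (a * z ^ j)" by (simp add: cst_sum sum_distrib_right)
  finally have S: "comp i (a * z ^ j) = cst (inverse (of_nat n) * (\<Sum>k<n. \<zeta> ^ k)) * (a * z ^ j) / z ^ i"
    by (simp add: comp_def cst_mult)
  show ?thesis
  proof (cases "i = j")
    case True
    then have "\<zeta> = 1" by (simp add: \<zeta>_def)
    then show ?thesis using S True n_pos z_nz by (simp add: cst_1)
  next
    case False
    have "\<zeta> ^ n = 1" unfolding \<zeta>_def power_mult_distrib power_inverse
      by (metis \<chi>_n mult.commute power_mult power_one inverse_1 mult_1)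
    moreover have "\<zeta> \<noteq> 1"
    proof
      assume "\<zeta> = 1"
      then have eq: "\<chi> ^ j = \<chi> ^ i" by (simp add: \<zeta>_def field_simps)
      show False
      proof (cases "i < j")
        case True
        have "\<chi> ^ j = \<chi> ^ i * \<chi> ^ (j - i)" using True by (simp add: power_add[symmetric])
        then show False using eq \<chi>_primitive[of "j - i"] True assms by simp
      next
        case F: False
        have "\<chi> ^ i = \<chi> ^ j * \<chi> ^ (i - j)" using F by (simp add: power_add[symmetric])
        then show False using eq \<chi>_primitive[of "i - j"] F False assms by simp
      qed
    qed
    ultimately show ?thesis using S False root_sum by simp
  qed
qed

text \<open>By \<open>comp_sum\<close> every element is a sum of terms \<open>a * z ^ i\<close> with
  \<open>a\<close> in \<open>L\<close>. Product rules, multiplicativity and commutation relations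
  are later checked on such terms only.\<close>

lemma additive_eqI:
  fixes F G :: "'k \<Rightarrow> 'k"
  assumes "\<And>u v. F (u + v) = F u + F v" "\<And>u v. G (u + v) = G u + G v"
    and "\<And>a i. a \<in> L \<Longrightarrow> i < n \<Longrightarrow> F (a * z ^ i) = G (a * z ^ i)"
  shows "F u = G u"
proof -
  have zero: "F 0 = 0" "G 0 = 0"
    using assms(1)[of 0 0] assms(2)[of 0 0] by (auto intro!: add_self_eq_0)
  have "F (\<Sum>i<m. comp i u * z ^ i) = G (\<Sum>i<m. comp i u * z ^ i)" if "m \<le> n" for m
    using that by (induction m) (auto simp: zero assms comp_in_L)
  from this[of n] show ?thesis by (simp add: comp_sum)
qed

text \<open>The Kummer datum of the extension of \<open>L\<close> by \<open>z\<close>.\<close>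

definition f :: 'k where "f = z ^ n"

lemma f_in_L: "f \<in> L"
  by (simp add: f_def L_def T_power Tz power_mult_distrib cst_power[symmetric] \<chi>_n cst_1)

lemma f_nz: "f \<noteq> 0" by (simp add: f_def z_nz)

text \<open>Differentiating \<open>z ^ n = f\<close> forces the logarithmic derivative of
  \<open>z\<close>, called \<open>e\<close> in the proof, and with it the value on every basis
  element; characteristic zero permits the division by \<open>n\<close>.\<close>

lemma derivation_extends:
  fixes E :: "'k \<Rightarrow> 'k"
  assumes add: "\<And>u v. u \<in> L \<Longrightarrow> v \<in> L \<Longrightarrow> E (u + v) = E u + E v"
    and mult: "\<And>u v. u \<in> L \<Longrightarrow> v \<in> L \<Longrightarrow> E (u * v) = E u * v + u * E v"
  obtains D where "\<And>u v. D (u + v) = D u + D v" "\<And>u v. D (u * v) = D u * v + u * D v"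
    "\<And>u. u \<in> L \<Longrightarrow> D u = E u"
proof -
  define e where "e = E f / (of_nat n * f)"
  define D where "D u = (\<Sum>i<n. (E (comp i u) + of_nat i * e * comp i u) * z ^ i)" for u
  have E0: "E 0 = 0" using add[OF L_0 L_0] by (intro add_self_eq_0) simp
  have D_add: "D (u + v) = D u + D v" for u v
    by (simp add: D_def comp_add add comp_in_L sum.distrib[symmetric] algebra_simps)
  have hom1: "D (a * z ^ i) = (E a + of_nat i * e * a) * z ^ i" if "a \<in> L" "i < n" for a i
  proof -
    have "D (a * z ^ i) = (\<Sum>j<n. if j = i then (E a + of_nat i * e * a) * z ^ i else 0)"
      unfolding D_def by (intro sum.cong refl) (auto simp: comp_homogeneous that E0)
    also have "\<dots> = (E a + of_nat i * e * a) * z ^ i" using that by simp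
    finally show ?thesis .
  qed
  \<comment> \<open>A product of two basis powers has exponent below \<open>2 * n\<close>; one
    reduction by \<open>z ^ n = f\<close> brings it back below \<open>n\<close>.\<close>
  have hom2: "D (a * z ^ i) = (E a + of_nat i * e * a) * z ^ i" if "a \<in> L" "i < 2 * n" for a i
  proof (cases "i < n")
    case False
    then have zi: "z ^ i = f * z ^ (i - n)" by (simp add: f_def power_add[symmetric])
    have "of_nat i = (of_nat n + of_nat (i - n) :: 'k)" using False by (simp flip: of_nat_add)
    moreover have "D (a * z ^ i) = (E (a * f) + of_nat (i - n) * e * (a * f)) * z ^ (i - n)"
      using hom1[of "a * f" "i - n"] that False by (simp add: zi L_mult f_in_L mult_ac)
    moreover have "E f = of_nat n * e * f" using f_nz by (simp add: e_def)
    ultimately show ?thesis using that by (simp add: mult f_in_L zi algebra_simps)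
  qed (use that hom1 in blast)
  have D_mult1: "D (a * z ^ i * v) = D (a * z ^ i) * v + a * z ^ i * D v" if "a \<in> L" "i < n" for a i v
  proof (rule additive_eqI[where F = "\<lambda>v. D (a * z ^ i * v)" and G = "\<lambda>v. D (a * z ^ i) * v + a * z ^ i * D v"])
    fix b j assume b: "b \<in> L" "j < n"
    have "a * z ^ i * (b * z ^ j) = (a * b) * z ^ (i + j)" by (simp add: power_add mult_ac)
    then have "D (a * z ^ i * (b * z ^ j)) = D ((a * b) * z ^ (i + j))" by (simp only:)
    also have "\<dots> = (E (a * b) + of_nat (i + j) * e * (a * b)) * z ^ (i + j)"
      by (rule hom2) (use that b in \<open>auto simp: L_mult\<close>)
    finally have "D (a * z ^ i * (b * z ^ j)) = (E (a * b) + of_nat (i + j) * e * (a * b)) * z ^ (i + j)" .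
    then show "D (a * z ^ i * (b * z ^ j)) = D (a * z ^ i) * (b * z ^ j) + a * z ^ i * D (b * z ^ j)"
      using that b by (simp add: hom1 mult power_add algebra_simps)
  qed (auto simp: D_add algebra_simps)
  have D_mult: "D (u * v) = D u * v + u * D v" for u v
  proof (rule additive_eqI[where F = "\<lambda>u. D (u * v)" and G = "\<lambda>u. D u * v + u * D v"])
  qed (simp_all add: D_add distrib_left distrib_right D_mult1)
  have "D u = E u" if "u \<in> L" for u using hom1[OF that n_pos] by simp
  with D_add D_mult show ?thesis using that by blast
qed

text \<open>The only relation satisfied by \<open>z\<close> over \<open>L\<close> is
  \<open>z ^ n = f\<close>, so any \<open>n\<close>-th root \<open>Z\<close> of
  \<open>\<sigma> f\<close> may serve as its image. Finding such a root is what
  \<open>automorphism_lifts\<close> is about.\<close>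

lemma hom_extends:
  fixes \<sigma> :: "'k \<Rightarrow> 'k"
  assumes add: "\<And>u v. u \<in> L \<Longrightarrow> v \<in> L \<Longrightarrow> \<sigma> (u + v) = \<sigma> u + \<sigma> v"
    and mult: "\<And>u v. u \<in> L \<Longrightarrow> v \<in> L \<Longrightarrow> \<sigma> (u * v) = \<sigma> u * \<sigma> v"
    and Z: "Z ^ n = \<sigma> f"
  shows "\<exists>S. (\<forall>u v. S (u + v) = S u + S v) \<and> (\<forall>u v. S (u * v) = S u * S v) \<and>
    (\<forall>u\<in>L. S u = \<sigma> u) \<and> (\<forall>a\<in>L. \<forall>i<n. S (a * z ^ i) = \<sigma> a * Z ^ i)"
proof -
  define S where "S u = (\<Sum>i<n. \<sigma> (comp i u) * Z ^ i)" for u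
  have \<sigma>0: "\<sigma> 0 = 0" using add[OF L_0 L_0] by (intro add_self_eq_0) simp
  have S_add: "S (u + v) = S u + S v" for u v
    by (simp add: S_def comp_add add comp_in_L sum.distrib[symmetric] algebra_simps)
  have hom1: "S (a * z ^ i) = \<sigma> a * Z ^ i" if "a \<in> L" "i < n" for a i
  proof -
    have "S (a * z ^ i) = (\<Sum>j<n. if j = i then \<sigma> a * Z ^ i else 0)"
      unfolding S_def by (intro sum.cong refl) (auto simp: comp_homogeneous that \<sigma>0)
    also have "\<dots> = \<sigma> a * Z ^ i" using that by simp
    finally show ?thesis .
  qed
  have hom2: "S (a * z ^ i) = \<sigma> a * Z ^ i" if "a \<in> L" "i < 2 * n" for a i
  proof (cases "i < n")
    case False
    then have zi: "z ^ i = f * z ^ (i - n)" by (simp add: f_def power_add[symmetric])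
    have Zi: "Z ^ i = \<sigma> f * Z ^ (i - n)" unfolding Z[symmetric] using False by (simp add: power_add[symmetric])
    have "S (a * z ^ i) = \<sigma> (a * f) * Z ^ (i - n)"
      using hom1[of "a * f" "i - n"] that False by (simp add: zi L_mult f_in_L mult_ac)
    then show ?thesis using that by (simp add: mult f_in_L Zi)
  qed (use that hom1 in blast)
  have S_mult1: "S (a * z ^ i * v) = S (a * z ^ i) * S v" if "a \<in> L" "i < n" for a i v
  proof (rule additive_eqI[where F = "\<lambda>v. S (a * z ^ i * v)" and G = "\<lambda>v. S (a * z ^ i) * S v"])
    fix b j assume b: "b \<in> L" "j < n"
    have "a * z ^ i * (b * z ^ j) = (a * b) * z ^ (i + j)" by (simp add: power_add mult_ac)
    then have "S (a * z ^ i * (b * z ^ j)) = S ((a * b) * z ^ (i + j))" by (simp only:)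
    also have "\<dots> = \<sigma> (a * b) * Z ^ (i + j)"
      by (rule hom2) (use that b in \<open>auto simp: L_mult\<close>)
    finally have "S (a * z ^ i * (b * z ^ j)) = \<sigma> (a * b) * Z ^ (i + j)" .
    then show "S (a * z ^ i * (b * z ^ j)) = S (a * z ^ i) * S (b * z ^ j)"
      using that b by (simp add: hom1 mult power_add algebra_simps)
  qed (auto simp: S_add algebra_simps)
  have S_mult: "S (u * v) = S u * S v" for u v
  proof (rule additive_eqI[where F = "\<lambda>u. S (u * v)" and G = "\<lambda>u. S u * S v"])
  qed (simp_all add: S_add distrib_left distrib_right S_mult1)
  have "S u = \<sigma> u" if "u \<in> L" for u using hom1[OF that n_pos] by simp
  with S_add S_mult hom1 show ?thesis by (intro exI[of _ S]) simp
qed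

subsection \<open>Lifting automorphisms of the fixed field\<close>

definition \<delta>' :: "'k \<Rightarrow> 'k" where "\<delta>' u = z * \<delta> u"
definition \<theta>' :: "'k \<Rightarrow> 'k" where "\<theta>' u = \<theta> u / z"

lemma \<delta>'_L: "u \<in> L \<Longrightarrow> \<delta>' u \<in> L"
  unfolding L_def \<delta>'_def mem_Collect_eq T_mult Tz using \<delta>T[of u] by (metis mult.assoc mult.commute)

lemma T_\<theta>: "T (\<theta> u) = cst \<chi> * \<theta> (T u)"
proof -
  have "\<theta> (T u) = inverse (cst \<chi>) * T (\<theta> u)" using \<theta>T[of u] by (simp add: cst_inverse)
  then show ?thesis by (simp add: mult.assoc[symmetric])
qed

lemma \<theta>'_L: "u \<in> L \<Longrightarrow> \<theta>' u \<in> L"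
  by (simp add: L_def \<theta>'_def T_divide Tz z_nz T_\<theta>)

lemma \<delta>_power: "\<delta> (u ^ k) = of_nat k * u ^ (k - 1) * \<delta> u"
proof (induction k)
  case 0
  show ?case using \<delta>_cst[of 1] by (simp add: cst_1)
next
  case (Suc k)
  then show ?case by (cases k) (auto simp: \<delta>_mult algebra_simps)
qed

lemma derivation_power:
  fixes D :: "'k \<Rightarrow> 'k"
  assumes "\<And>u v. D (u * v) = D u * v + u * D v"
  shows "D (u ^ k) = of_nat k * u ^ (k - 1) * D u"
proof (induction k)
  case 0
  show ?case using assms[of 1 1] by (auto intro!: add_self_eq_0)
next
  case (Suc k)
  then show ?case by (cases k) (auto simp: assms algebra_simps)
qed

text \<open>A derivation that kills \<open>f = z ^ n\<close> kills \<open>z\<close> in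
  characteristic zero, hence every power of \<open>z\<close>.\<close>

lemma derivation_eq_0:
  fixes D :: "'k \<Rightarrow> 'k"
  assumes add: "\<And>u v. D (u + v) = D u + D v" and mult: "\<And>u v. D (u * v) = D u * v + u * D v"
    and L: "\<And>u. u \<in> L \<Longrightarrow> D u = 0"
  shows "D u = 0"
proof -
  have "of_nat n * z ^ (n - 1) * D z = 0"
    using L[OF f_in_L] derivation_power[of D z n, OF mult] by (simp add: f_def)
  then have "D z = 0" by (simp add: z_nz)
  then have "D (z ^ i) = 0" for i using derivation_power[of D z i, OF mult] by simp
  then show ?thesis
    by - (rule additive_eqI[where F = D and G = "\<lambda>_. 0"], auto simp: add mult L)
qed

lemma indep_L:
  assumes "\<And>u. u \<in> L \<Longrightarrow> p * \<theta>' u + q * \<delta>' u = 0"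
  shows "p = 0" "q = 0"
proof -
  have "p * \<theta>' u + q * \<delta>' u = 0" for u
  proof (rule derivation_eq_0[where D = "\<lambda>u. p * \<theta>' u + q * \<delta>' u"])
    show "p * \<theta>' u + q * \<delta>' u = 0" if "u \<in> L" for u using assms[OF that] .
  qed (simp_all add: \<theta>'_def \<delta>'_def \<delta>_add \<theta>_add \<delta>_mult \<theta>_mult add_divide_distrib algebra_simps)
  then have "p / z * \<theta> u + q * z * \<delta> u = 0" for u by (simp add: \<theta>'_def \<delta>'_def mult_ac)
  from indep[OF this] show "p = 0" "q = 0" by (simp_all add: z_nz)
qed

text \<open>After extension to the big field the derivation is a combination of
  \<open>\<theta>\<close> and \<open>\<delta>\<close>. Rescaled by \<open>z\<close>, the
  coefficients become invariant: \<open>T\<close> fixes the values on \<open>L\<close>, and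
  \<open>\<theta>'\<close> and \<open>\<delta>'\<close> are independent already there.\<close>

lemma derivation_span_L:
  fixes E :: "'k \<Rightarrow> 'k"
  assumes E_L: "\<And>u. u \<in> L \<Longrightarrow> E u \<in> L"
    and add: "\<And>u v. u \<in> L \<Longrightarrow> v \<in> L \<Longrightarrow> E (u + v) = E u + E v"
    and mult: "\<And>u v. u \<in> L \<Longrightarrow> v \<in> L \<Longrightarrow> E (u * v) = E u * v + u * E v"
    and const: "\<And>c. E (cst c) = 0"
  obtains h k where "h \<in> L" "k \<in> L" "\<And>u. u \<in> L \<Longrightarrow> E u = h * \<theta>' u + k * \<delta>' u"
proof -
  obtain D where D: "\<And>u v. D (u + v) = D u + D v" "\<And>u v. D (u * v) = D u * v + u * D v"
    "\<And>u. u \<in> L \<Longrightarrow> D u = E u"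
    using derivation_extends[of E, OF add mult] by metis
  have "D (cst c) = 0" for c by (simp add: D(3) L_cst const)
  then obtain p q where "\<And>u. D u = p * \<theta> u + q * \<delta> u"
    using derivation_span[of D] D(1,2) by metis
  then have E: "E u = (p * z) * \<theta>' u + (q / z) * \<delta>' u" if "u \<in> L" for u
    using D(3)[OF that] by (simp add: \<theta>'_def \<delta>'_def z_nz)
  define h where "h = p * z"
  define k where "k = q / z"
  have "(T h - h) * \<theta>' u + (T k - k) * \<delta>' u = 0" if u: "u \<in> L" for u
  proof -
    have "T (E u) = T h * \<theta>' u + T k * \<delta>' u"
      using \<theta>'_L[OF u] \<delta>'_L[OF u] by (simp add: E[OF u] T_add T_mult L_def flip: h_def k_def)
    moreover have "T (E u) = h * \<theta>' u + k * \<delta>' u"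
      using E_L[OF u] E[OF u] by (simp add: L_def h_def k_def)
    ultimately show ?thesis by (simp add: algebra_simps)
  qed
  from indep_L[OF this] have "h \<in> L" "k \<in> L" by (simp_all add: L_def)
  then show ?thesis using that[of h k] E by (simp add: h_def k_def)
qed

theorem automorphism_lifts:
  fixes \<sigma> D :: "'k \<Rightarrow> 'k"
  assumes \<sigma>_L: "\<sigma> ` L = L"
    and \<sigma>_add: "\<And>u v. u \<in> L \<Longrightarrow> v \<in> L \<Longrightarrow> \<sigma> (u + v) = \<sigma> u + \<sigma> v"
    and \<sigma>_mult: "\<And>u v. u \<in> L \<Longrightarrow> v \<in> L \<Longrightarrow> \<sigma> (u * v) = \<sigma> u * \<sigma> v"
    and \<sigma>_cst: "\<And>c. \<sigma> (cst c) = cst c"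
    and D_L: "\<And>u. u \<in> L \<Longrightarrow> D u \<in> L"
    and D_nz: "u0 \<in> L" "D u0 \<noteq> 0"
    and D_\<delta>: "\<And>u. u \<in> L \<Longrightarrow> D u = f0 * \<delta> u"
    and \<sigma>_D: "\<And>u. u \<in> L \<Longrightarrow> \<sigma> (D u) = g * D (\<sigma> u)"
  shows "\<exists>S g1. (\<forall>u v. S (u + v) = S u + S v) \<and> (\<forall>u v. S (u * v) = S u * S v) \<and>
    (\<forall>u\<in>L. S u = \<sigma> u) \<and> (\<forall>u. S (T u) = T (S u)) \<and> surj S \<and>
    g1 \<noteq> 0 \<and> (\<forall>u. S (\<delta> u) = g1 * \<delta> (S u))"
proof -
  have \<sigma>_in: "\<sigma> u \<in> L" if "u \<in> L" for u using \<sigma>_L that by blast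
  have \<sigma>0: "\<sigma> 0 = 0" using \<sigma>_cst[of 0] by simp
  have \<sigma>1: "\<sigma> 1 = 1" using \<sigma>_cst[of 1] by (simp add: cst_1)
  have \<sigma>_nz: "\<sigma> u \<noteq> 0" if "u \<in> L" "u \<noteq> 0" for u
    using \<sigma>_mult[OF that(1) L_inverse[OF that(1)]] that \<sigma>1 by auto
  have \<sigma>_minus: "\<sigma> (- u) = - \<sigma> u" if "u \<in> L" for u
    using \<sigma>_add[OF that L_minus[OF that]] \<sigma>0 by (simp add: add_eq_0_iff)
  have \<sigma>_inj: "u = v" if "u \<in> L" "v \<in> L" "\<sigma> u = \<sigma> v" for u v
  proof -
    have "\<sigma> (u + - v) = \<sigma> u + - \<sigma> v" by (simp only: \<sigma>_add L_minus \<sigma>_minus that)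
    then have "u + - v = 0" using \<sigma>_nz[OF L_add[OF that(1) L_minus[OF that(2)]]] that(3) by force
    then show ?thesis by simp
  qed
  have \<sigma>_inv: "\<sigma> (inverse u) = inverse (\<sigma> u)" if "u \<in> L" for u
  proof (cases "u = 0")
    case False
    then show ?thesis using \<sigma>_mult[OF that L_inverse[OF that]] \<sigma>1 by (simp add: inverse_unique)
  qed (simp add: \<sigma>0)
  have \<sigma>_power: "\<sigma> (u ^ k) = \<sigma> u ^ k" if "u \<in> L" for u k
    by (induction k) (auto simp: \<sigma>1 \<sigma>_mult that L_power)
  have \<sigma>_of_nat: "\<sigma> (of_nat k) = of_nat k" for k
    using \<sigma>_cst[of "of_nat k"] by (simp add: cst_of_nat)
  define \<tau> where "\<tau> u = (SOME v. v \<in> L \<and> \<sigma> v = u)" for u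
  have \<tau>: "\<tau> u \<in> L \<and> \<sigma> (\<tau> u) = u" if "u \<in> L" for u
  proof -
    have "u \<in> \<sigma> ` L" using that by (simp only: \<sigma>_L)
    then show ?thesis unfolding \<tau>_def by - (rule someI_ex, blast)
  qed
  have \<tau>_\<sigma>: "\<tau> (\<sigma> u) = u" if "u \<in> L" for u
    using \<tau>[OF \<sigma>_in[OF that]] that by - (rule \<sigma>_inj, auto)
  have \<tau>_add: "\<tau> (u + v) = \<tau> u + \<tau> v" if "u \<in> L" "v \<in> L" for u v
    using \<tau>[of "u + v"] \<tau>[of u] \<tau>[of v] that by - (rule \<sigma>_inj, auto simp: L_add \<sigma>_add)
  have \<tau>_mult: "\<tau> (u * v) = \<tau> u * \<tau> v" if "u \<in> L" "v \<in> L" for u v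
    using \<tau>[of "u * v"] \<tau>[of u] \<tau>[of v] that by - (rule \<sigma>_inj, auto simp: L_mult \<sigma>_mult)
  have \<tau>_cst: "\<tau> (cst c) = cst c" for c
    using \<tau>[OF L_cst[of c]] by - (rule \<sigma>_inj, auto simp: L_cst \<sigma>_cst)
  \<comment> \<open>\<open>D\<close> is a multiple of \<open>\<delta>'\<close>, and the factor is a
    quotient of two invariant values at \<open>u0\<close>. So \<open>\<sigma>\<close> may be applied
    to it, and the hypothesis on \<open>D\<close> becomes one on \<open>\<delta>'\<close> with a new
    factor \<open>g'\<close>.\<close>
  define r where "r = f0 / z"
  have D_r: "D u = r * \<delta>' u" if "u \<in> L" for u
    using D_\<delta>[OF that] by (simp add: r_def \<delta>'_def z_nz)
  have "\<delta>' u0 \<noteq> 0" "r \<noteq> 0" using D_nz D_r by auto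
  then have "r = D u0 / \<delta>' u0" using D_r[OF D_nz(1)] by simp
  then have r_L: "r \<in> L" by (simp add: L_divide D_L D_nz \<delta>'_L)
  define g' where "g' = g * r / \<sigma> r"
  have \<sigma>r: "\<sigma> r \<noteq> 0" using \<sigma>_nz r_L \<open>r \<noteq> 0\<close> by blast
  have \<sigma>_\<delta>': "\<sigma> (\<delta>' u) = g' * \<delta>' (\<sigma> u)" if "u \<in> L" for u
  proof -
    have "\<sigma> r * \<sigma> (\<delta>' u) = g * (r * \<delta>' (\<sigma> u))"
      using \<sigma>_D[OF that] by (simp add: D_r that \<sigma>_in \<sigma>_mult r_L \<delta>'_L)
    then show ?thesis using \<sigma>r by (simp add: g'_def field_simps)
  qed
  obtain u1 where u1: "u1 \<in> L" "\<delta>' u1 \<noteq> 0"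
    using indep_L(2)[of 0 1] by fastforce
  have g'_nz: "g' \<noteq> 0" using \<sigma>_\<delta>'[OF u1(1)] \<sigma>_nz[OF \<delta>'_L[OF u1(1)] u1(2)] by auto
  have g'_L: "g' \<in> L"
  proof -
    have nz: "\<delta>' (\<sigma> u1) \<noteq> 0" using \<sigma>_\<delta>'[OF u1(1)] \<sigma>_nz[OF \<delta>'_L[OF u1(1)] u1(2)] by auto
    then have "g' = \<sigma> (\<delta>' u1) / \<delta>' (\<sigma> u1)" using \<sigma>_\<delta>'[OF u1(1)] by simp
    then show ?thesis by (simp add: L_divide \<sigma>_in \<delta>'_L u1)
  qed
  \<comment> \<open>The transform of \<open>\<theta>'\<close> by \<open>\<sigma>\<close>. It is a
    derivation of \<open>L\<close>, so \<open>derivation_span_L\<close> expands it; the coefficient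
    \<open>h\<close> of \<open>\<theta>'\<close> will determine \<open>\<sigma> f\<close>.\<close>
  define E where "E u = \<sigma> (\<theta>' (\<tau> u))" for u
  have \<theta>'_add: "\<theta>' (u + v) = \<theta>' u + \<theta>' v" for u v by (simp add: \<theta>'_def \<theta>_add add_divide_distrib)
  have \<theta>'_mult: "\<theta>' (u * v) = \<theta>' u * v + u * \<theta>' v" for u v by (simp add: \<theta>'_def \<theta>_mult add_divide_distrib)
  have \<delta>'_add: "\<delta>' (u + v) = \<delta>' u + \<delta>' v" for u v by (simp add: \<delta>'_def \<delta>_add algebra_simps)
  have \<delta>'_mult: "\<delta>' (u * v) = \<delta>' u * v + u * \<delta>' v" for u v by (simp add: \<delta>'_def \<delta>_mult algebra_simps)
  obtain h k where hk: "h \<in> L" "k \<in> L" "\<And>u. u \<in> L \<Longrightarrow> E u = h * \<theta>' u + k * \<delta>' u"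
  proof (rule derivation_span_L[of E])
    show "E u \<in> L" if "u \<in> L" for u using \<tau>[OF that] by (simp add: E_def \<sigma>_in \<theta>'_L)
    show "E (u + v) = E u + E v" if "u \<in> L" "v \<in> L" for u v
      using \<tau>[OF that(1)] \<tau>[OF that(2)] by (simp add: E_def \<tau>_add that \<theta>'_add \<sigma>_add \<theta>'_L)
    show "E (u * v) = E u * v + u * E v" if "u \<in> L" "v \<in> L" for u v
      using \<tau>[OF that(1)] \<tau>[OF that(2)]
      by (simp add: E_def \<tau>_mult that \<theta>'_mult \<sigma>_add \<theta>'_L L_mult \<sigma>_mult)
    show "E (cst c) = 0" for c by (simp add: E_def \<tau>_cst \<theta>'_def \<theta>_cst \<sigma>0)
  qed blast
  have \<sigma>_\<theta>': "\<sigma> (\<theta>' u) = h * \<theta>' (\<sigma> u) + k * \<delta>' (\<sigma> u)" if "u \<in> L" for u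
    using hk(3)[OF \<sigma>_in[OF that]] by (simp add: E_def \<tau>_\<sigma> that)
  \<comment> \<open>Otherwise the transforms of \<open>\<theta>'\<close> and
    \<open>\<delta>'\<close> would be proportional, and undoing \<open>\<sigma>\<close> would make
    \<open>\<theta>'\<close> and \<open>\<delta>'\<close> dependent.\<close>
  have h_nz: "h \<noteq> 0"
  proof
    assume h0: "h = 0"
    have "1 * \<theta>' u + (- \<tau> (k / g')) * \<delta>' u = 0" if "u \<in> L" for u
    proof -
      have kg: "k / g' \<in> L" by (simp add: L_divide hk g'_L)
      have "\<sigma> (\<tau> (k / g') * \<delta>' u) = k / g' * (g' * \<delta>' (\<sigma> u))"
        using \<tau>[OF kg] that by (simp add: \<sigma>_mult \<delta>'_L \<sigma>_\<delta>')
      also have "\<dots> = \<sigma> (\<theta>' u)" using g'_nz \<sigma>_\<theta>'[OF that] h0 by simp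
      finally have "\<tau> (k / g') * \<delta>' u = \<theta>' u"
        using \<tau>[OF kg] that by - (rule \<sigma>_inj, auto simp: L_mult \<delta>'_L \<theta>'_L)
      then show ?thesis by simp
    qed
    from indep_L(1)[OF this] show False by simp
  qed
  \<comment> \<open>Compare the two expressions of the transform of the bracket of \<open>\<delta>'\<close> and \<open>\<theta>'\<close>.\<close>
  define p where "p = - (\<delta>' f / (of_nat n * f))"
  define q where "q = - (\<theta> z / z ^ 2)"
  \<comment> \<open>The coefficient \<open>p\<close> is simply \<open>- \<delta> z\<close>; it is
    written through the invariant \<open>f\<close> so that \<open>\<sigma> p\<close> can be computed
    from the rule for \<open>\<delta>'\<close>.\<close>
  have "z ^ n = z * z ^ (n - 1)" using n_pos by (simp add: power_eq_if)
  then have "of_nat n * f * \<delta> z = z * (of_nat n * z ^ (n - 1) * \<delta> z)" by (simp add: f_def)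
  then have "\<delta>' f = of_nat n * f * \<delta> z" by (simp only: \<delta>'_def f_def \<delta>_power)
  then have p_eq: "p = - \<delta> z" using f_nz by (simp add: p_def)
  have p_L: "p \<in> L" by (simp add: p_def L_minus L_divide L_mult \<delta>'_L f_in_L L_of_nat)
  have q_L: "q \<in> L"
  proof -
    have 1: "\<theta> (T z) = cst \<chi> * \<theta> z" by (simp add: Tz \<theta>_mult \<theta>_cst)
    then have "T (\<theta> z) = cst \<chi> ^ 2 * \<theta> z" by (simp add: T_\<theta> power2_eq_square mult_ac)
    then show ?thesis by (simp add: L_def q_def T_minus T_divide T_power Tz power_mult_distrib)
  qed
  have \<delta>_inv: "\<delta> (u / z) = \<delta> u / z - u * \<delta> z / z ^ 2" for u
  proof -
    have "\<delta> (u / z * z) = \<delta> (u / z) * z + u / z * \<delta> z" by (rule \<delta>_mult)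
    then show ?thesis using z_nz by (simp add: field_simps power2_eq_square)
  qed
  \<comment> \<open>As \<open>\<delta>\<close> and \<open>\<theta>\<close> commute, only the
    derivatives of the factors \<open>z\<close> and \<open>1 / z\<close> survive.\<close>
  have bracket: "\<delta>' (\<theta>' u) - \<theta>' (\<delta>' u) = p * \<theta>' u + q * \<delta>' u" for u
    using z_nz by (simp add: p_eq q_def \<theta>'_def \<delta>'_def \<delta>_inv \<theta>_mult \<delta>\<theta> field_simps power2_eq_square)
  \<comment> \<open>The transform of the bracket is expanded in two ways, by transforming each
    operator and by transforming the right-hand side of \<open>bracket\<close>; the equation is the
    \<open>\<theta>'\<close>-coefficient of the comparison.\<close>
  have coeff: "g' * \<delta>' h + g' * h * p = \<sigma> p * h"
  proof -
    have "(g' * \<delta>' h + g' * h * p - \<sigma> p * h) * \<theta>' v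
        + (g' * \<delta>' k - h * \<theta>' g' - k * \<delta>' g' + g' * h * q - \<sigma> p * k - \<sigma> q * g') * \<delta>' v = 0" if v: "v \<in> L" for v
    proof -
      define u where "u = \<tau> v"
      have u: "u \<in> L" "\<sigma> u = v" using \<tau>[OF v] by (simp_all add: u_def)
      have "\<sigma> (\<delta>' (\<theta>' u)) = g' * \<delta>' (h * \<theta>' v + k * \<delta>' v)"
        using u by (simp add: \<sigma>_\<delta>' \<sigma>_\<theta>' \<theta>'_L)
      moreover have "\<sigma> (\<theta>' (\<delta>' u)) = h * \<theta>' (g' * \<delta>' v) + k * \<delta>' (g' * \<delta>' v)"
        using u by (simp add: \<sigma>_\<delta>' \<sigma>_\<theta>' \<delta>'_L)
      moreover have "\<sigma> (\<delta>' (\<theta>' u)) = \<sigma> (\<theta>' (\<delta>' u) + (p * \<theta>' u + q * \<delta>' u))"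
        using bracket[of u] by (simp add: algebra_simps)
      then have "\<sigma> (\<delta>' (\<theta>' u)) = \<sigma> (\<theta>' (\<delta>' u)) + \<sigma> p * (h * \<theta>' v + k * \<delta>' v) + \<sigma> q * (g' * \<delta>' v)"
        using u by (simp add: \<sigma>_add \<sigma>_mult L_add L_mult p_L q_L \<delta>'_L \<theta>'_L \<sigma>_\<delta>' \<sigma>_\<theta>')
      ultimately have "g' * \<delta>' (h * \<theta>' v + k * \<delta>' v) = h * \<theta>' (g' * \<delta>' v) + k * \<delta>' (g' * \<delta>' v)
          + \<sigma> p * (h * \<theta>' v + k * \<delta>' v) + \<sigma> q * (g' * \<delta>' v)"
        by (simp only:)
      moreover have "\<delta>' (\<theta>' v) = \<theta>' (\<delta>' v) + p * \<theta>' v + q * \<delta>' v"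
        using bracket[of v] by (simp add: algebra_simps)
      ultimately show ?thesis
        by (simp add: \<delta>'_add \<delta>'_mult \<theta>'_mult) (simp add: algebra_simps)
    qed
    from indep_L(1)[OF this] show ?thesis by simp
  qed
  have \<sigma>f_nz: "\<sigma> f \<noteq> 0" by (simp add: \<sigma>_nz f_in_L f_nz)
  have "\<sigma> p = - (g' * \<delta>' (\<sigma> f) / (of_nat n * \<sigma> f))"
    by (simp add: p_def \<sigma>_minus divide_inverse \<sigma>_inv \<sigma>_mult L_mult L_inverse \<delta>'_L f_in_L L_of_nat
        \<sigma>_of_nat \<sigma>_\<delta>' L_minus)
  then have "g' * (\<delta>' h + h * p + h * \<delta>' (\<sigma> f) / (of_nat n * \<sigma> f)) = g' * \<delta>' h + g' * h * p - \<sigma> p * h"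
    by (simp add: algebra_simps)
  then have "g' * (\<delta>' h + h * p + h * \<delta>' (\<sigma> f) / (of_nat n * \<sigma> f)) = 0" using coeff by simp
  then have "\<delta>' h + h * p + h * \<delta>' (\<sigma> f) / (of_nat n * \<sigma> f) = 0" using g'_nz by simp
  then have eq1: "of_nat n * f * \<sigma> f * \<delta>' h - h * \<sigma> f * \<delta>' f + h * f * \<delta>' (\<sigma> f) = 0"
    using \<sigma>f_nz f_nz by (simp add: p_def field_simps)
  \<comment> \<open>With denominators cleared, \<open>eq1\<close> says that the logarithmic
    derivative of this element along \<open>\<delta>'\<close> vanishes. So it is a constant
    \<open>c0\<close>, and an \<open>n\<close>-th root \<open>c1\<close> of \<open>c0\<close> gives
    the root \<open>Z = c1 * z / h\<close> of \<open>\<sigma> f\<close>.\<close>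
  define c where "c = h ^ n * \<sigma> f / f"
  have "\<delta>' c = 0"
  proof -
    have "c * f = h ^ n * \<sigma> f" using f_nz by (simp add: c_def)
    then have "\<delta>' (c * f) = \<delta>' (h ^ n * \<sigma> f)" by simp
    moreover have "\<delta>' (h ^ n) = of_nat n * h ^ (n - 1) * \<delta>' h" by (rule derivation_power[of \<delta>', OF \<delta>'_mult])
    ultimately have 2: "\<delta>' c * f + c * \<delta>' f = of_nat n * h ^ (n - 1) * \<delta>' h * \<sigma> f + h ^ n * \<delta>' (\<sigma> f)"
      by (simp add: \<delta>'_mult)
    have hn: "h ^ n = h ^ (n - 1) * h" using n_pos by (metis power_minus_mult)
    have "\<delta>' c * f = of_nat n * h ^ (n - 1) * \<delta>' h * \<sigma> f + h ^ n * \<delta>' (\<sigma> f) - c * \<delta>' f"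
      using 2 by (simp only: eq_diff_eq)
    then have "\<delta>' c * f * f = (of_nat n * h ^ (n - 1) * \<delta>' h * \<sigma> f + h ^ n * \<delta>' (\<sigma> f) - c * \<delta>' f) * f"
      by (simp only:)
    also have "\<dots> = (of_nat n * h ^ (n - 1) * \<delta>' h * \<sigma> f + h ^ n * \<delta>' (\<sigma> f)) * f - (c * f) * \<delta>' f"
      by (simp add: algebra_simps)
    also have "\<dots> = h ^ (n - 1) * (of_nat n * f * \<sigma> f * \<delta>' h - h * \<sigma> f * \<delta>' f + h * f * \<delta>' (\<sigma> f))"
      unfolding \<open>c * f = h ^ n * \<sigma> f\<close> hn by (simp add: algebra_simps)
    finally show ?thesis using eq1 f_nz by simp
  qed
  then have "\<delta> c = 0" by (simp add: \<delta>'_def z_nz)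
  then obtain c0 where c0: "c = cst c0" using ker by blast
  have "c \<noteq> 0" using h_nz \<sigma>f_nz f_nz by (simp add: c_def)
  then have "c0 \<noteq> 0" using c0 by auto
  then have "card {z. z ^ n = c0} \<noteq> 0" using n_pos by (simp add: card_nth_roots)
  then have "{z. z ^ n = c0} \<noteq> {}" by (metis card.empty)
  then obtain c1 where c1: "c1 ^ n = c0" by blast
  with \<open>c0 \<noteq> 0\<close> n_pos have c1_nz: "c1 \<noteq> 0" by auto
  define Z where "Z = cst c1 * z / h"
  have Z_n: "Z ^ n = \<sigma> f"
    using h_nz f_nz c0 by (simp add: Z_def power_mult_distrib power_divide cst_power[symmetric] c1 c_def flip: f_def)
      (simp add: field_simps)
  have Z_nz: "Z \<noteq> 0" using c1_nz h_nz z_nz by (simp add: Z_def)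
  have "\<exists>S. (\<forall>u v. S (u + v) = S u + S v) \<and> (\<forall>u v. S (u * v) = S u * S v) \<and>
    (\<forall>u\<in>L. S u = \<sigma> u) \<and> (\<forall>a\<in>L. \<forall>i<n. S (a * z ^ i) = \<sigma> a * Z ^ i)"
    by (rule hom_extends[OF \<sigma>_add \<sigma>_mult Z_n])
  then obtain S where S_add: "\<And>u v. S (u + v) = S u + S v" and S_mult: "\<And>u v. S (u * v) = S u * S v"
    and S_L: "\<And>u. u \<in> L \<Longrightarrow> S u = \<sigma> u" and S_hom: "\<And>a i. a \<in> L \<Longrightarrow> i < n \<Longrightarrow> S (a * z ^ i) = \<sigma> a * Z ^ i"
    by blast
  have TZ: "T Z = cst \<chi> * Z"
    using hk(1) by (simp add: Z_def T_divide T_mult T_cst Tz L_def mult_ac)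
  have S_T: "S (T u) = T (S u)" for u
  proof (rule additive_eqI[where F = "\<lambda>u. S (T u)" and G = "\<lambda>u. T (S u)"])
    fix a i assume a: "a \<in> L" "i < n"
    then have Ta: "T a = a" "T (\<sigma> a) = \<sigma> a" using \<sigma>_in[of a] by (simp_all add: L_def)
    have 1: "T (a * z ^ i) = (cst (\<chi> ^ i) * a) * z ^ i"
      by (simp add: T_mult T_power Tz Ta power_mult_distrib cst_power mult_ac)
    have "S (T (a * z ^ i)) = \<sigma> (cst (\<chi> ^ i) * a) * Z ^ i"
      unfolding 1 by (rule S_hom) (use a in \<open>auto simp: L_mult L_cst\<close>)
    also have "\<dots> = cst (\<chi> ^ i) * \<sigma> a * Z ^ i" by (simp only: \<sigma>_mult[OF L_cst a(1)] \<sigma>_cst)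
    also have "\<dots> = T (\<sigma> a * Z ^ i)"
      by (simp add: T_mult T_power TZ Ta power_mult_distrib cst_power mult_ac)
    also have "\<dots> = T (S (a * z ^ i))" by (simp only: S_hom[OF a])
    finally show "S (T (a * z ^ i)) = T (S (a * z ^ i))" .
  qed (auto simp: S_add T_add)
  have S_power: "S (u ^ i) = S u ^ i" for u i
    by (induction i) (auto simp: S_mult S_L[OF L_1] \<sigma>1)
  \<comment> \<open>\<open>S_hom\<close> reaches the exponent \<open>1\<close> only for
    \<open>1 < n\<close>; for \<open>n = 1\<close> the element \<open>z\<close> is \<open>f\<close>
    and lies in \<open>L\<close>.\<close>
  have S_z: "S z = Z"
  proof (cases "n = 1")
    case True
    then have "f = z" unfolding f_def by simp
    then show ?thesis using Z_n True S_L[OF f_in_L] by simp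
  next
    case False
    then have "1 < n" using n_pos by simp
    from S_hom[OF L_1 this] show ?thesis by (simp add: \<sigma>1)
  qed
  have "surj S"
  proof -
    have L_sub: "u \<in> range S" if "u \<in> L" for u
    proof
      show "u = S (\<tau> u)" using \<tau>[OF that] S_L by simp
    qed simp
    have mult_closed: "u * v \<in> range S" if "u \<in> range S" "v \<in> range S" for u v
      using that by (auto simp: S_mult[symmetric])
    have add_closed: "u + v \<in> range S" if "u \<in> range S" "v \<in> range S" for u v
      using that by (auto simp: S_add[symmetric])
    have "h / cst c1 \<in> L" by (simp add: L_divide hk L_cst)
    then have "S z * (h / cst c1) \<in> range S" using L_sub mult_closed by blast
    moreover have "S z * (h / cst c1) = z" using c1_nz h_nz by (simp add: S_z Z_def)
    ultimately have z: "z \<in> range S" by simp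
    have zi: "z ^ i \<in> range S" for i
      by (induction i) (auto intro: mult_closed z L_sub L_1)
    have "(\<Sum>i<m. comp i u * z ^ i) \<in> range S" for m u
      by (induction m) (auto intro: add_closed mult_closed zi L_sub comp_in_L L_0)
    from this[where m = n] show ?thesis by (auto simp: comp_sum)
  qed
  have S_\<delta>': "S (\<delta>' u) = g' * \<delta>' (S u)" for u
  proof (rule additive_eqI[where F = "\<lambda>u. S (\<delta>' u)" and G = "\<lambda>u. g' * \<delta>' (S u)"])
    fix a i assume a: "a \<in> L" "i < n"
    \<comment> \<open>The rule known on \<open>L\<close> is carried to \<open>z\<close> by
      differentiating \<open>z ^ n = f\<close> and its image \<open>Z ^ n = \<sigma> f\<close> and
      cancelling \<open>n * Z ^ (n - 1)\<close>.\<close>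
    have "S (\<delta>' f) = g' * \<delta>' (\<sigma> f)" by (simp add: S_L \<delta>'_L f_in_L \<sigma>_\<delta>')
    moreover have "\<delta>' f = of_nat n * z ^ (n - 1) * \<delta>' z"
      unfolding f_def by (rule derivation_power[of \<delta>', OF \<delta>'_mult])
    moreover have "\<delta>' (\<sigma> f) = of_nat n * Z ^ (n - 1) * \<delta>' Z"
      unfolding Z_n[symmetric] by (rule derivation_power[of \<delta>', OF \<delta>'_mult])
    moreover have "S (of_nat m) = of_nat m" for m by (simp add: S_L L_of_nat \<sigma>_of_nat)
    ultimately have "of_nat n * Z ^ (n - 1) * S (\<delta>' z) = of_nat n * Z ^ (n - 1) * (g' * \<delta>' Z)"
      by (simp add: S_mult S_power S_z mult_ac)
    then have S\<delta>z: "S (\<delta>' z) = g' * \<delta>' Z" using Z_nz by simp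
    have "\<delta>' (a * z ^ i) = \<delta>' a * z ^ i + a * (of_nat i * z ^ (i - 1) * \<delta>' z)"
      by (simp add: \<delta>'_mult derivation_power[of \<delta>', OF \<delta>'_mult])
    then have "S (\<delta>' (a * z ^ i)) = g' * \<delta>' (\<sigma> a) * Z ^ i + \<sigma> a * (of_nat i * Z ^ (i - 1) * (g' * \<delta>' Z))"
      using a by (simp add: S_add S_mult S_power S_z S\<delta>z S_L \<delta>'_L \<sigma>_\<delta>' L_of_nat \<sigma>_of_nat)
    moreover have "\<delta>' (S (a * z ^ i)) = \<delta>' (\<sigma> a) * Z ^ i + \<sigma> a * (of_nat i * Z ^ (i - 1) * \<delta>' Z)"
      using a by (simp add: S_hom \<delta>'_mult derivation_power[of \<delta>', OF \<delta>'_mult])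
    ultimately show "S (\<delta>' (a * z ^ i)) = g' * \<delta>' (S (a * z ^ i))" by (simp add: algebra_simps)
  qed (auto simp: S_add \<delta>'_add algebra_simps)
  have S_\<delta>: "S (\<delta> u) = (g' * z / Z) * \<delta> (S u)" for u
    using S_\<delta>'[of u] Z_nz by (simp add: \<delta>'_def S_mult S_z field_simps)
  show ?thesis
    using S_add S_mult S_L S_T \<open>surj S\<close> S_\<delta> g'_nz z_nz Z_nz
    by (intro exI[of _ S] exI[of _ "g' * z / Z"]) simp
qed

end

subsection \<open>Polynomials and rational functions in two variables\<close>

type_synonym bpoly = "complex poly poly"
type_synonym ratfield = "complex poly poly fract"

text \<open>This is \<open>x d/dx + l y d/dy\<close>, the inner variable being \<open>x\<close> and
  the outer one \<open>y\<close>: \<open>pCons 0\<close> after \<open>pderiv\<close> multiplies by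
  the variable again. Monomials are eigenvectors, which \<open>coeff_dpol\<close> expresses.\<close>

definition dpol :: "complex \<Rightarrow> bpoly \<Rightarrow> bpoly" where
  "dpol l P = map_poly (\<lambda>c. pCons 0 (pderiv c)) P + smult [:l:] (pCons 0 (pderiv P))"

lemma coeff_dpol: "coeff (coeff (dpol l P) j) i = (of_nat i + l * of_nat j) * coeff (coeff P j) i"
proof -
  have "coeff (pCons 0 (pderiv c)) i = of_nat i * coeff c i" for c :: "complex poly"
    by (cases i) (auto simp: coeff_pderiv)
  moreover have "coeff (pCons 0 (pderiv P)) j = of_nat j * coeff P j"
    by (cases j) (auto simp: coeff_pderiv)
  ultimately show ?thesis
    by (simp add: dpol_def coeff_map_poly of_nat_poly algebra_simps del: smult_pCons)
qed

lemma bpoly_eqI: "(\<And>j i. coeff (coeff P j) i = coeff (coeff Q j) i) \<Longrightarrow> P = (Q :: bpoly)"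
  by (intro poly_eqI)

lemma dpol_add: "dpol l (P + Q) = dpol l P + dpol l Q"
  by (rule bpoly_eqI) (simp add: coeff_dpol algebra_simps)

lemma dpol_smult: "dpol l (smult c P) = smult (pCons 0 (pderiv c)) P + smult c (dpol l P)"
proof -
  have "map_poly (\<lambda>c. pCons 0 (pderiv c)) (smult c P)
      = smult (pCons 0 (pderiv c)) P + smult c (map_poly (\<lambda>c. pCons 0 (pderiv c)) P)"
    by (rule poly_eqI) (simp add: coeff_map_poly pderiv_mult algebra_simps)
  then show ?thesis by (simp add: dpol_def pderiv_smult smult_add_right algebra_simps)
qed

lemma dpol_pCons: "dpol l (pCons c P) = [:pCons 0 (pderiv c):] + smult [:l:] (pCons 0 P) + pCons 0 (dpol l P)"
  by (simp add: dpol_def map_poly_pCons pderiv_pCons smult_add_right)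

lemma dpol_mult: "dpol l (P * Q) = dpol l P * Q + P * dpol l Q"
proof (induction P)
  case 0
  show ?case by (simp add: dpol_def)
next
  case (pCons c P)
  have "dpol l (pCons 0 R) = smult [:l:] (pCons 0 R) + pCons 0 (dpol l R)" for R
    by (simp add: dpol_pCons)
  then show ?case
    by (simp add: dpol_add dpol_smult dpol_pCons pCons.IH smult_add_right smult_add_left distrib_right distrib_left)
qed

lemma dpol_0 [simp]: "dpol l 0 = 0" by (simp add: dpol_def)

definition dF :: "complex \<Rightarrow> ratfield \<Rightarrow> ratfield" where
  "dF l u = (let p = quot_of_fract u in Fract (dpol l (fst p) * snd p - fst p * dpol l (snd p)) (snd p ^ 2))"

text \<open>\<open>dF\<close> is defined by the reduced fraction; differentiating the
  cross-multiplied identity \<open>c * b = a * d\<close> carries the quotient rule over to any other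
  fraction.\<close>

lemma dF_Fract:
  assumes "b \<noteq> 0"
  shows "dF l (Fract a b) = Fract (dpol l a * b - a * dpol l b) (b ^ 2)"
proof -
  define c d where "c = fst (quot_of_fract (Fract a b))" and "d = snd (quot_of_fract (Fract a b))"
  have d: "d \<noteq> 0" by (simp add: d_def)
  have "Fract c d = Fract a b" by (simp add: c_def d_def)
  then have cb: "c * b = a * d" using assms d by (simp add: eq_fract)
  then have "dpol l (c * b) = dpol l (a * d)" by simp
  then have D: "dpol l c * b + c * dpol l b = dpol l a * d + a * dpol l d" by (simp add: dpol_mult)
  have "(dpol l c * d - c * dpol l d) * b ^ 2 = (dpol l a * b - a * dpol l b) * d ^ 2"
  proof -
    have "(dpol l c * d - c * dpol l d) * b ^ 2
        = d * b * (dpol l c * b + c * dpol l b) - d * (c * b) * dpol l b - b * (c * b) * dpol l d"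
      by (simp add: power2_eq_square algebra_simps)
    also have "\<dots> = d * b * (dpol l a * d + a * dpol l d) - d * (a * d) * dpol l b - b * (a * d) * dpol l d"
      by (simp only: D cb)
    also have "\<dots> = (dpol l a * b - a * dpol l b) * d ^ 2"
      by (simp add: power2_eq_square algebra_simps)
    finally show ?thesis .
  qed
  then show ?thesis using assms d by (simp add: dF_def Let_def c_def d_def eq_fract)
qed

lemma dF_to_fract: "dF l (to_fract a) = to_fract (dpol l a)"
proof -
  have "dpol l 1 = 0" by (rule bpoly_eqI) (auto simp: coeff_dpol)
  then show ?thesis by (simp add: to_fract_def dF_Fract)
qed

lemma dF_add: "dF l (u + v) = dF l u + dF l v"
proof (cases u)
  case (Fract a b)
  obtain c d where v: "v = Fract c d" "d \<noteq> 0" by (cases v)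
  show ?thesis using Fract v
    by (simp add: dF_Fract eq_fract dpol_add dpol_mult power2_eq_square algebra_simps)
qed

lemma dF_mult: "dF l (u * v) = dF l u * v + u * dF l v"
proof (cases u)
  case (Fract a b)
  obtain c d where v: "v = Fract c d" "d \<noteq> 0" by (cases v)
  show ?thesis using Fract v
    by (simp add: dF_Fract eq_fract dpol_mult power2_eq_square algebra_simps)
qed

definition cst :: "complex \<Rightarrow> ratfield" where "cst c = to_fract [:[:c:]:]"
definition VX :: ratfield where "VX = to_fract [:[:0, 1:]:]"
definition VY :: ratfield where "VY = to_fract [:0, 1:]"

lemma cst_simps: "cst (a + b) = cst a + cst b" "cst (a * b) = cst a * cst b" "cst 1 = 1" "cst 0 = 0"
  by (simp_all add: cst_def flip: to_fract_add to_fract_mult one_pCons to_fract_1)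

lemma VX_nz [simp]: "VX \<noteq> 0" and VY_nz [simp]: "VY \<noteq> 0"
  by (simp_all add: VX_def VY_def)

lemma bpoly_induct [case_names cst X Y add mult]:
  assumes cst: "\<And>c. P [:[:c:]:]" and X: "P [:[:0, 1:]:]" and Y: "P [:0, 1:]"
    and add: "\<And>p q. P p \<Longrightarrow> P q \<Longrightarrow> P (p + q)" and mult: "\<And>p q. P p \<Longrightarrow> P q \<Longrightarrow> P (p * q)"
  shows "P (p :: bpoly)"
proof -
  have 1: "P [:c:]" for c
  proof (induction c)
    case 0
    show ?case using cst[of 0] by simp
  next
    case (pCons a c)
    have "[:pCons a c:] = [:[:a:]:] + [:[:0, 1:]:] * [:c:]" by simp
    then show ?case using add[OF cst mult[OF X pCons(2)]] by (simp only:)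
  qed
  show ?thesis
  proof (induction p)
    case 0
    show ?case using cst[of 0] by simp
  next
    case (pCons c p)
    have "pCons c p = [:c:] + [:0, 1:] * p" by simp
    then show ?case using add[OF 1 mult[OF Y pCons(2)]] by (simp only:)
  qed
qed

lemma ratfield_induct [case_names cst X Y add mult divide]:
  assumes cst: "\<And>c. P (cst c)" and X: "P VX" and Y: "P VY"
    and add: "\<And>u v. P u \<Longrightarrow> P v \<Longrightarrow> P (u + v)" and mult: "\<And>u v. P u \<Longrightarrow> P v \<Longrightarrow> P (u * v)"
    and divide: "\<And>u v. P u \<Longrightarrow> P v \<Longrightarrow> v \<noteq> 0 \<Longrightarrow> P (u / v)"
  shows "P u"
proof -
  have 2: "P (to_fract p)" for p
    by (induction p rule: bpoly_induct) (use assms in \<open>auto simp: cst_def VX_def VY_def\<close>)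
  obtain a b where "u = Fract a b" "b \<noteq> 0" by (cases u)
  then show ?thesis using divide[OF 2 2, of b a] by (simp add: Fract_conv_to_fract)
qed

lemma dF_cst: "dF l (cst c) = 0"
proof -
  have "dpol l [:[:c:]:] = 0" by (simp add: dpol_pCons pderiv_pCons)
  then show ?thesis by (simp add: cst_def dF_to_fract)
qed

lemma dF_0 [simp]: "dF l 0 = 0"
  using dF_cst[of l 0] by (simp add: cst_simps)

lemma dF_X: "dF l VX = VX"
proof -
  have "dpol l [:[:0, 1:]:] = [:[:0, 1:]:]" by (simp add: dpol_pCons pderiv_pCons)
  then show ?thesis by (simp add: VX_def dF_to_fract)
qed

lemma dF_Y: "dF l VY = cst l * VY"
proof -
  have "dpol l [:0, 1:] = [:[:l:]:] * [:0, 1:]" by (simp add: dpol_pCons pderiv_pCons)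
  then show ?thesis by (simp add: VY_def cst_def dF_to_fract flip: to_fract_mult)
qed

lemma derivation_ratfield_eqI:
  fixes D E :: "ratfield \<Rightarrow> ratfield"
  assumes D: "\<And>u v. D (u + v) = D u + D v" "\<And>u v. D (u * v) = D u * v + u * D v"
    and E: "\<And>u v. E (u + v) = E u + E v" "\<And>u v. E (u * v) = E u * v + u * E v"
    and eq: "\<And>c. D (cst c) = E (cst c)" "D VX = E VX" "D VY = E VY"
  shows "D u = E u"
proof (induction u rule: ratfield_induct)
  case (divide u v)
  have "D (u / v) * v + u / v * D v = E (u / v) * v + u / v * E v"
    using D(2)[of "u / v" v] E(2)[of "u / v" v] divide by simp
  then show ?case using divide by simp
qed (simp_all add: D E eq)

text \<open>On the coordinates both derivations are diagonal with constant eigenvalues; sums and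
  products follow, and a quotient is reached by applying both sides to
  \<open>u / v * v\<close>.\<close>

lemma dF_commute: "dF l (dF m u) = dF m (dF l u)"
proof (induction u rule: ratfield_induct)
  case (divide u v)
  have "dF l (dF m (u / v * v)) = dF m (dF l (u / v * v))" using divide by simp
  then have "dF l (dF m (u / v)) * v = dF m (dF l (u / v)) * v"
    by (simp only: dF_add dF_mult divide) (simp add: algebra_simps divide)
  then show ?case using divide by simp
qed (simp_all add: dF_add dF_mult dF_cst dF_X dF_Y)

lemma derivation_ratfield_span:
  fixes E :: "ratfield \<Rightarrow> ratfield"
  assumes "l \<noteq> m"
    and E: "\<And>u v. E (u + v) = E u + E v" "\<And>u v. E (u * v) = E u * v + u * E v" "\<And>c. E (cst c) = 0"
  shows "\<exists>p q. \<forall>u. E u = p * dF m u + q * dF l u"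
proof -
  \<comment> \<open>The coefficients solve the linear system \<open>p + q = a\<close>,
    \<open>m p + l q = b\<close> for the logarithmic derivatives \<open>a\<close>, \<open>b\<close>
    of the two coordinates; its determinant is \<open>l - m\<close>.\<close>
  define a where "a = E VX / VX"
  define b where "b = E VY / VY"
  have lm: "cst l - cst m \<noteq> 0" using assms(1) by (simp add: cst_def)
  define q where "q = (b - cst m * a) / (cst l - cst m)"
  define p where "p = a - q"
  have "E u = p * dF m u + q * dF l u" for u
  proof (rule derivation_ratfield_eqI[where D = E and E = "\<lambda>u. p * dF m u + q * dF l u"])
    show "E VX = p * dF m VX + q * dF l VX" by (simp add: p_def a_def dF_X algebra_simps)
    have "p * cst m + q * cst l = cst m * a + q * (cst l - cst m)" by (simp add: p_def algebra_simps)
    also have "\<dots> = b" using lm by (simp add: q_def)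
    finally have "E VY = (p * cst m + q * cst l) * VY" by (simp add: b_def)
    then show "E VY = p * dF m VY + q * dF l VY" by (simp add: dF_Y algebra_simps)
  qed (simp_all add: E dF_add dF_mult dF_cst algebra_simps)
  then show ?thesis by blast
qed

lemma dF_independent:
  assumes "l \<noteq> m" "\<And>u. p * dF m u + q * dF l u = 0"
  shows "p = 0 \<and> q = 0"
proof -
  have 1: "(p + q) * VX = 0" using assms(2)[of VX] by (simp add: dF_X algebra_simps)
  then have pq: "p = - q" by (simp add: add_eq_0_iff)
  have "q * (cst l - cst m) * VY = 0" using assms(2)[of VY] by (simp add: dF_Y pq algebra_simps)
  moreover have "cst l - cst m \<noteq> 0" using assms(1) by (simp add: cst_def)
  ultimately show ?thesis using pq by simp
qed

lemma cst_eq_0 [simp]: "cst c = 0 \<longleftrightarrow> c = 0"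
  by (simp add: cst_def)

lemma cst_minus: "cst (- c) = - cst c"
  by (simp add: cst_def flip: to_fract_uminus)

lemma dF_eigen_mult:
  "dF l u = cst a * u \<Longrightarrow> dF l v = cst b * v \<Longrightarrow> dF l (u * v) = cst (a + b) * (u * v)"
  by (simp add: dF_mult cst_simps algebra_simps)

lemma dF_eigen_inverse:
  assumes "dF l u = cst a * u"
  shows "dF l (inverse u) = cst (- a) * inverse u"
proof (cases "u = 0")
  case True
  then show ?thesis using dF_cst[of l 0] by (simp add: cst_simps)
next
  case False
  have "dF l (u * inverse u) = 0" using False dF_cst[of l 1] by (simp add: cst_simps)
  then have "dF l u * inverse u + u * dF l (inverse u) = 0" by (simp only: dF_mult)
  moreover have "dF l u * inverse u = cst a" using False assms by simp
  ultimately have "u * dF l (inverse u) = - cst a"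
    by (simp add: eq_neg_iff_add_eq_0 add.commute)
  then have "inverse u * (u * dF l (inverse u)) = inverse u * - cst a" by simp
  then show ?thesis using False by (simp add: cst_minus mult.commute mult.assoc[symmetric])
qed

lemma dF_eigen_power:
  assumes "dF l u = cst a * u"
  shows "dF l (u ^ k) = cst (of_nat k * a) * u ^ k"
proof (induction k)
  case 0
  show ?case using dF_cst[of l 1] by (simp add: cst_simps)
next
  case (Suc k)
  from dF_eigen_mult[OF assms Suc] show ?case by (simp add: algebra_simps)
qed

lemma dF_eigen_powi:
  assumes "dF l u = cst a * u"
  shows "dF l (u powi i) = cst (of_int i * a) * u powi i"
proof (cases "i \<ge> 0")
  case True
  then show ?thesis using dF_eigen_power[OF assms, of "nat i"] by (simp add: power_int_def)
next
  case False
  then show ?thesis using dF_eigen_inverse[OF dF_eigen_power[OF assms, of "nat (- i)"]]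
    by (simp add: power_int_def power_inverse)
qed

lemma dF_monomial:
  "dF l (cst c * VX powi i * VY powi j) = cst (of_int i + l * of_int j) * (cst c * VX powi i * VY powi j)"
proof -
  have "dF l VX = cst 1 * VX" by (simp add: dF_X cst_simps)
  from dF_eigen_mult[OF dF_eigen_powi[OF this, of i] dF_eigen_powi[OF dF_Y, of l j]]
  have "dF l (VX powi i * VY powi j) = cst (of_int i + l * of_int j) * (VX powi i * VY powi j)"
    by (simp add: mult.commute)
  then show ?thesis by (simp add: dF_mult dF_cst mult_ac)
qed

subsection \<open>Darboux polynomials\<close>

definition bmonom :: "complex \<Rightarrow> nat \<Rightarrow> nat \<Rightarrow> bpoly" where "bmonom c i j = monom (monom c i) j"

lemma bmonom_mult: "bmonom c i j * bmonom d k l = bmonom (c * d) (i + k) (j + l)"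
  by (simp add: bmonom_def mult_monom)

lemma to_fract_bmonom: "to_fract (bmonom c i j) = cst c * VX ^ i * VY ^ j"
proof -
  have p: "to_fract (x ^ k) = to_fract x ^ k" for x :: bpoly and k by (induction k) auto
  have "bmonom c i j = [:[:c:]:] * [:[:0, 1:]:] ^ i * [:0, 1:] ^ j"
    by (simp add: bmonom_def monom_altdef poly_const_pow mult_ac flip: smult_smult)
  then show ?thesis by (simp only: cst_def VX_def VY_def p to_fract_mult)
qed

text \<open>Integral independence of \<open>1\<close> and \<open>l\<close>: distinct monomials then
  have distinct eigenvalues under \<open>dpol l\<close>. For the complex slopes of the three
  foliations this holds because they are not real.\<close>

locale irrational =
  fixes l :: complex
  assumes irr: "of_int i + l * of_int j = 0 \<Longrightarrow> i = 0 \<and> j = 0"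
begin

lemma irr_nat:
  assumes "of_nat i + l * of_nat j = of_nat i' + l * of_nat j'"
  shows "i = i' \<and> j = j'"
proof -
  have "of_int (int i - int i') + l * of_int (int j - int j') = 0"
    using assms by (simp add: algebra_simps)
  from irr[OF this] show ?thesis by simp
qed

text \<open>\<open>dpol l\<close> raises the degree in neither variable, so the cofactor is a
  constant and the polynomial is an eigenvector. Since the monomials have distinct eigenvalues, only
  one of them can occur.\<close>

lemma darboux_monomial:
  assumes p: "p \<noteq> 0" "p dvd dpol l p"
  obtains c i j where "c \<noteq> 0" "p = bmonom c i j"
proof -
  obtain e where e: "dpol l p = e * p" using p(2) by (metis dvd_def mult.commute)
  have deg: "degree (dpol l p) \<le> degree p"
    by (rule degree_le) (auto intro!: poly_eqI simp: coeff_dpol coeff_eq_0)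
  obtain e0 where e0: "e = [:e0:]"
  proof (cases "e = 0")
    case False
    then have "degree e = 0" using deg p(1) by (simp add: e degree_mult_eq)
    then show ?thesis using that degree_eq_zeroE by blast
  qed (use that[of 0] in simp)
  \<comment> \<open>The cofactor is now free of \<open>y\<close>; comparing leading coefficients,
    whose degree in \<open>x\<close> does not grow either, removes \<open>x\<close> from it.\<close>
  define q where "q = lead_coeff p"
  have q: "q \<noteq> 0" using p(1) by (simp add: q_def)
  have e0q: "coeff (dpol l p) (degree p) = e0 * q" by (simp add: e e0 q_def)
  have deg2: "degree (coeff (dpol l p) (degree p)) \<le> degree q"
    by (rule degree_le) (auto simp: coeff_dpol coeff_eq_0 q_def)
  obtain e1 where e1: "e0 = [:e1:]"
  proof (cases "e0 = 0")
    case False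
    then have "degree e0 = 0" using deg2 q by (simp add: e0q degree_mult_eq)
    then show ?thesis using that degree_eq_zeroE by blast
  qed (use that[of 0] in simp)
  have eig: "(of_nat i + l * of_nat j) * coeff (coeff p j) i = e1 * coeff (coeff p j) i" for i j
  proof -
    have "coeff (coeff (dpol l p) j) i = e1 * coeff (coeff p j) i" by (simp add: e e0 e1)
    then show ?thesis by (simp only: coeff_dpol)
  qed
  obtain i0 j0 where ij: "coeff (coeff p j0) i0 \<noteq> 0" using p(1) bpoly_eqI[of p 0] by auto
  then have e1: "e1 = of_nat i0 + l * of_nat j0" using eig[of i0 j0] by simp
  have "coeff (coeff p j) i = 0" if "\<not> (i = i0 \<and> j = j0)" for i j
  proof (rule ccontr)
    assume "coeff (coeff p j) i \<noteq> 0"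
    then have "of_nat i + l * of_nat j = of_nat i0 + l * of_nat j0" using eig[of i j] e1 by simp
    then show False using irr_nat that by blast
  qed
  then have "p = bmonom (coeff (coeff p j0) i0) i0 j0"
    by (intro bpoly_eqI) (auto simp: bmonom_def)
  then show ?thesis using that ij by blast
qed

lemma prime_factors_monomial:
  assumes "A \<noteq> 0" "\<And>p. prime_elem p \<Longrightarrow> p dvd A \<Longrightarrow> \<exists>c i j. p = bmonom c i j"
  shows "\<exists>c i j. c \<noteq> 0 \<and> A = bmonom c i j"
  using assms
proof (induction A rule: prime_divisors_induct)
  case zero
  then show ?case by simp
next
  case (unit A)
  then obtain a where "A = [:a:]" "a dvd 1" by (auto simp: is_unit_poly_iff)
  moreover from this obtain b where b: "a = [:b:]" "b dvd 1" by (auto simp: is_unit_poly_iff)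
  moreover have "b \<noteq> 0" using b(2) by auto
  ultimately have "b \<noteq> 0" "A = bmonom b 0 0" by (simp_all add: bmonom_def monom_0)
  then show ?case by blast
next
  case (factor p A)
  then obtain c i j where p: "p = bmonom c i j" by (metis dvd_triv_left prime_imp_prime_elem)
  have "A \<noteq> 0" using factor by auto
  moreover have "\<exists>c i j. q = bmonom c i j" if "prime_elem q" "q dvd A" for q
    using factor.prems(2)[OF that(1)] that(2) by simp
  ultimately obtain d k m where A: "d \<noteq> 0" "A = bmonom d k m" using factor.IH by blast
  have "p \<noteq> 0" using factor.hyps by auto
  then have "c \<noteq> 0" using p by (auto simp: bmonom_def)
  then show ?case using A p bmonom_mult[of c i j d k m] by (metis no_zero_divisors)
qed

text \<open>The product rule for \<open>p ^ a * q\<close>, multiplied by \<open>p\<close> so that no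
  exponent \<open>a - 1\<close> appears and \<open>a = 0\<close> is covered too.\<close>

lemma dpol_power: "p * dpol l (p ^ a * q) = p ^ a * (of_nat a * dpol l p * q + p * dpol l q)"
proof (induction a)
  case (Suc a)
  have "p * dpol l (p ^ Suc a * q) = p * (dpol l p * (p ^ a * q) + p * dpol l (p ^ a * q))"
    by (simp add: dpol_mult mult.assoc)
  also have "\<dots> = p * (dpol l p * (p ^ a * q) + p ^ a * (of_nat a * dpol l p * q + p * dpol l q))"
    by (simp only: Suc)
  finally show ?case by (simp add: algebra_simps)
qed simp

text \<open>A residue argument along the curve \<open>p = 0\<close>. If \<open>p\<close> did not
  divide its own derivative, comparing the polar parts would give \<open>l * (a - b) = c - d\<close>
  for the multiplicities \<open>a\<close>, \<open>b\<close>, \<open>c\<close>, \<open>d\<close> of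
  \<open>p\<close> in \<open>A\<close>, \<open>B\<close>, \<open>C\<close>, \<open>D\<close>.
  Irrationality forces \<open>a = b\<close> and \<open>c = d\<close>, and coprimality then makes all
  four zero.\<close>

lemma log_derivative_prime:
  assumes nz: "A \<noteq> 0" "B \<noteq> 0" "C \<noteq> 0" "D \<noteq> 0" and cop: "coprime A B" "coprime C D"
    and eq: "[:[:l:]:] * (dpol l A * B - A * dpol l B) * (C * D) = (dpol l C * D - C * dpol l D) * (A * B)"
    and p: "prime_elem p" "p dvd A * B * C * D"
  shows "p dvd dpol l p"
proof (rule ccontr)
  assume np: "\<not> p dvd dpol l p"
  have p0: "p \<noteq> 0" "\<not> is_unit p" using p(1) by auto
  have decomp: "\<exists>k R. P = p ^ k * R \<and> \<not> p dvd R" if "P \<noteq> 0" for P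
    using multiplicity_decompose'[OF that p0(2)] by metis
  obtain a A0 where A: "A = p ^ a * A0" "\<not> p dvd A0" using decomp[OF nz(1)] by blast
  obtain b B0 where B: "B = p ^ b * B0" "\<not> p dvd B0" using decomp[OF nz(2)] by blast
  obtain c C0 where C: "C = p ^ c * C0" "\<not> p dvd C0" using decomp[OF nz(3)] by blast
  obtain d D0 where D: "D = p ^ d * D0" "\<not> p dvd D0" using decomp[OF nz(4)] by blast
  define dp where "dp = dpol l p"
  define A1 B1 C1 D1 where "A1 = dpol l A0" and "B1 = dpol l B0" and "C1 = dpol l C0" and "D1 = dpol l D0"
  have d1: "p * dpol l A = p ^ a * (of_nat a * dp * A0 + p * A1)" "p * dpol l B = p ^ b * (of_nat b * dp * B0 + p * B1)"
     "p * dpol l C = p ^ c * (of_nat c * dp * C0 + p * C1)" "p * dpol l D = p ^ d * (of_nat d * dp * D0 + p * D1)"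
    by (simp_all add: A B C D dpol_power dp_def A1_def B1_def C1_def D1_def)
  define N where "N = p ^ a * p ^ b * p ^ c * p ^ d"
  have N: "N \<noteq> 0" using p0 by (simp add: N_def)
  have "[:[:l:]:] * ((p * dpol l A) * B - A * (p * dpol l B)) * (C * D)
      = ((p * dpol l C) * D - C * (p * dpol l D)) * (A * B)"
    using arg_cong[OF eq, of "\<lambda>x. p * x"] by (simp add: algebra_simps)
  then have "N * ([:[:l:]:] * ((of_nat a * dp * A0 + p * A1) * B0 - A0 * (of_nat b * dp * B0 + p * B1)) * (C0 * D0))
      = N * (((of_nat c * dp * C0 + p * C1) * D0 - C0 * (of_nat d * dp * D0 + p * D1)) * (A0 * B0))"
    unfolding d1 unfolding A(1) B(1) C(1) D(1) N_def by (simp add: mult_ac right_diff_distrib left_diff_distrib)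
  then have eq': "[:[:l:]:] * ((of_nat a * dp * A0 + p * A1) * B0 - A0 * (of_nat b * dp * B0 + p * B1)) * (C0 * D0)
      = ((of_nat c * dp * C0 + p * C1) * D0 - C0 * (of_nat d * dp * D0 + p * D1)) * (A0 * B0)"
    by (rule mult_left_cancel[OF N, THEN iffD1])
  \<comment> \<open>The difference of the two residues. It is a constant polynomial, so being
    divisible by the non-unit \<open>p\<close> it must vanish.\<close>
  define k where "k = [:[:l:]:] * (of_nat a - of_nat b) - (of_nat c - of_nat d :: bpoly)"
  have "k * (dp * A0 * B0 * C0 * D0) = p * ((C1 * D0 - C0 * D1) * (A0 * B0) - [:[:l:]:] * (A1 * B0 - A0 * B1) * (C0 * D0))"
    unfolding k_def using eq' by (simp only: algebra_simps)
  then have "p dvd k * (dp * A0 * B0 * C0 * D0)" by simp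
  then have pk: "p dvd k" using p(1) np A B C D by (simp add: dp_def prime_elem_dvd_mult_iff)
  define k0 where "k0 = l * (of_nat a - of_nat b) - (of_nat c - of_nat d)"
  have kk: "k = [:[:k0:]:]" by (simp add: k_def k0_def of_nat_poly)
  have "k0 = 0"
  proof (rule ccontr)
    assume "k0 \<noteq> 0"
    then have "is_unit k" by (simp add: kk is_unit_poly_iff dvd_field_iff)
    then show False using pk p0 dvd_unit_imp_unit by blast
  qed
  then have "of_int (int d - int c) + l * of_int (int a - int b) = 0" by (simp add: k0_def algebra_simps)
  from irr[OF this] have "a = b" "c = d" by simp_all
  have "a = 0"
  proof (rule ccontr)
    assume "a \<noteq> 0"
    then have "p dvd A" "p dvd B" using A B \<open>a = b\<close> by (simp_all add: dvd_power)
    then show False using cop(1) p0 by (meson coprime_common_divisor)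
  qed
  moreover have "c = 0"
  proof (rule ccontr)
    assume "c \<noteq> 0"
    then have "p dvd C" "p dvd D" using C D \<open>c = d\<close> by (simp_all add: dvd_power)
    then show False using cop(2) p0 by (meson coprime_common_divisor)
  qed
  ultimately have "\<not> p dvd A * B * C * D"
    using A B C D p(1) \<open>a = b\<close> \<open>c = d\<close> by (simp add: prime_elem_dvd_mult_iff)
  then show False using p(2) by simp
qed

text \<open>The hypothesis is the relation inherited by the images of \<open>x\<close> and
  \<open>y\<close> under a map preserving the foliation. By \<open>log_derivative_prime\<close>
  every prime in the numerators and denominators is a Darboux polynomial, hence a monomial.\<close>

theorem log_derivative_monomial:
  assumes u: "u \<noteq> 0" and v: "v \<noteq> 0" and eq: "dF l v / v = cst l * (dF l u / u)"
  shows "\<exists>c i j d k m. c \<noteq> 0 \<and> d \<noteq> 0 \<and> u = cst c * VX powi i * VY powi j \<and> v = cst d * VX powi k * VY powi m"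
proof -
  define A B C D where "A = fst (quot_of_fract u)" and "B = snd (quot_of_fract u)"
    and "C = fst (quot_of_fract v)" and "D = snd (quot_of_fract v)"
  have uv: "u = Fract A B" "v = Fract C D" by (simp_all add: A_def B_def C_def D_def)
  have nz: "A \<noteq> 0" "B \<noteq> 0" "C \<noteq> 0" "D \<noteq> 0" using u v by (simp_all add: A_def B_def C_def D_def)
  have cop: "coprime A B" "coprime C D" by (simp_all add: A_def B_def C_def D_def coprime_quot_of_fract)
  have "dF l v * u = cst l * dF l u * v" using eq u v by (simp add: field_simps)
  then have "Fract ((dpol l C * D - C * dpol l D) * A) (D ^ 2 * B)
     = Fract ([:[:l:]:] * (dpol l A * B - A * dpol l B) * C) (B ^ 2 * D)"
    using nz by (simp add: uv dF_Fract cst_def to_fract_def)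
  then have "(dpol l C * D - C * dpol l D) * A * (B ^ 2 * D) = [:[:l:]:] * (dpol l A * B - A * dpol l B) * C * (D ^ 2 * B)"
    by (rule eq_fract(1)[THEN iffD1, rotated 2]) (use nz in simp_all)
  then have "(B * D) * ([:[:l:]:] * (dpol l A * B - A * dpol l B) * (C * D))
     = (B * D) * ((dpol l C * D - C * dpol l D) * (A * B))"
    by (simp only: power2_eq_square mult_ac)
  then have eq': "[:[:l:]:] * (dpol l A * B - A * dpol l B) * (C * D) = (dpol l C * D - C * dpol l D) * (A * B)"
    using nz by (metis mult_cancel_left no_zero_divisors)
  have mono: "\<exists>c i j. p = bmonom c i j" if "prime_elem p" "p dvd A * B * C * D" for p
    using log_derivative_prime[OF nz cop eq' that] darboux_monomial[of p] that(1) by (metis not_prime_elem_zero)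
  have dv: "A dvd A * B * C * D" "B dvd A * B * C * D" "C dvd A * B * C * D" "D dvd A * B * C * D"
    by (simp_all add: mult.assoc)
  obtain a i1 j1 where A: "a \<noteq> 0" "A = bmonom a i1 j1" using prime_factors_monomial[OF nz(1)] mono dv dvd_trans by metis
  obtain b i2 j2 where B: "b \<noteq> 0" "B = bmonom b i2 j2" using prime_factors_monomial[OF nz(2)] mono dv dvd_trans by metis
  obtain c i3 j3 where C: "c \<noteq> 0" "C = bmonom c i3 j3" using prime_factors_monomial[OF nz(3)] mono dv dvd_trans by metis
  obtain d i4 j4 where D: "d \<noteq> 0" "D = bmonom d i4 j4" using prime_factors_monomial[OF nz(4)] mono dv dvd_trans by metis
  have quot: "Fract (bmonom a i1 j1) (bmonom b i2 j2) = cst (a / b) * VX powi (int i1 - int i2) * VY powi (int j1 - int j2)"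
    if "b \<noteq> 0" for a b i1 j1 i2 j2
  proof -
    have "cst (a / b) * cst b = cst a" using that by (simp flip: cst_simps)
    moreover have "cst b \<noteq> 0" using that by (simp add: cst_def)
    ultimately have "cst (a / b) = cst a / cst b" by (simp add: field_simps)
    then show ?thesis by (simp add: Fract_conv_to_fract to_fract_bmonom power_int_diff)
  qed
  have "u = cst (a / b) * VX powi (int i1 - int i2) * VY powi (int j1 - int j2)"
    unfolding uv A B by (rule quot[OF B(1)])
  moreover have "v = cst (c / d) * VX powi (int i3 - int i4) * VY powi (int j3 - int j4)"
    unfolding uv C D by (rule quot[OF D(1)])
  moreover have "a / b \<noteq> 0" "c / d \<noteq> 0" using A B C D by simp_all
  ultimately show ?thesis by blast
qed

lemma dF_kernel:
  assumes "dF l u = 0"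
  shows "u \<in> range cst"
proof (cases "u = 0")
  case True
  then show ?thesis using cst_simps(4) by (metis rangeI)
next
  case False
  \<comment> \<open>The pair \<open>u\<close>, \<open>1\<close> satisfies the logarithmic relation
    with both sides zero, so \<open>u\<close> is a monomial; its eigenvalue is zero, so the
    exponents are too.\<close>
  obtain c i j where u: "c \<noteq> 0" "u = cst c * VX powi i * VY powi j"
    using log_derivative_monomial[of u 1] False assms dF_cst[of l 1] by (auto simp: cst_simps)
  have "cst (of_int i + l * of_int j) * u = 0" using assms dF_monomial[of l c i j] u by simp
  then have "of_int i + l * of_int j = 0" using False by simp
  from irr[OF this] show ?thesis using u by simp
qed

end

subsection \<open>Generic points of the plane and evaluation of rational functions\<close>

definition ev2 :: "bpoly \<Rightarrow> complex \<times> complex \<Rightarrow> complex" where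
  "ev2 P p = poly (poly P [:snd p:]) (fst p)"

lemma ev2_simps [simp]:
  "ev2 (P + Q) p = ev2 P p + ev2 Q p" "ev2 (P * Q) p = ev2 P p * ev2 Q p" "ev2 0 p = 0" "ev2 1 p = 1"
  "ev2 [:[:c:]:] p = c" "ev2 [:[:0, 1:]:] p = fst p" "ev2 [:0, 1:] p = snd p"
  "ev2 (P ^ k) p = ev2 P p ^ k" "ev2 (- P) p = - ev2 P p" "ev2 (P - Q) p = ev2 P p - ev2 Q p"
  by (simp_all add: ev2_def poly_power)

definition torus :: "(complex \<times> complex) set" where
  "torus = {p. fst p \<noteq> 0 \<and> snd p \<noteq> 0}"

lemma ev2_nonzero:
  assumes "P \<noteq> 0"
  obtains p where "p \<in> torus" "ev2 P p \<noteq> 0"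
proof -
  have inj: "inj_on (\<lambda>b. [:b:]) (UNIV - {0::complex})" by (rule inj_onI) simp
  have "infinite (UNIV - {0::complex})" by (simp add: infinite_UNIV_char_0)
  then have "infinite ((\<lambda>b. [:b:]) ` (UNIV - {0::complex}))" using finite_imageD inj by blast
  then have "\<not> (\<lambda>b. [:b:]) ` (UNIV - {0::complex}) \<subseteq> {y. poly P y = 0}"
    using poly_roots_finite[OF assms] finite_subset by blast
  then obtain b where b: "b \<noteq> 0" "poly P [:b:] \<noteq> 0" by auto
  have "infinite (UNIV - {0::complex})" by (simp add: infinite_UNIV_char_0)
  then have "\<not> UNIV - {0} \<subseteq> {x. poly (poly P [:b:]) x = 0}"
    using poly_roots_finite[OF b(2)] finite_subset by blast
  then obtain a where "a \<noteq> 0" "poly (poly P [:b:]) a \<noteq> 0" by auto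
  then show ?thesis using that[of "(a, b)"] b by (simp add: torus_def ev2_def)
qed

text \<open>The filter of complements of plane curves: \<open>eventually\<close> reads "at general
  points". Identities between rational functions can then be combined without tracking their
  domains.\<close>

definition generic :: "(complex \<times> complex) filter" where
  "generic = Abs_filter (\<lambda>\<phi>. \<exists>P. P \<noteq> 0 \<and> (\<forall>p. ev2 P p \<noteq> 0 \<longrightarrow> \<phi> p))"

lemma eventually_generic:
  "eventually \<phi> generic \<longleftrightarrow> (\<exists>P. P \<noteq> 0 \<and> (\<forall>p. ev2 P p \<noteq> 0 \<longrightarrow> \<phi> p))"
  unfolding generic_def
proof (rule eventually_Abs_filter, rule is_filter.intro)
  show "\<exists>P. P \<noteq> 0 \<and> (\<forall>p. ev2 P p \<noteq> 0 \<longrightarrow> True)" by (intro exI[of _ 1]) simp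
next
  fix \<phi> \<psi> :: "complex \<times> complex \<Rightarrow> bool"
  assume "\<exists>P. P \<noteq> 0 \<and> (\<forall>p. ev2 P p \<noteq> 0 \<longrightarrow> \<phi> p)" "\<exists>P. P \<noteq> 0 \<and> (\<forall>p. ev2 P p \<noteq> 0 \<longrightarrow> \<psi> p)"
  then obtain P Q where "P \<noteq> 0" "\<forall>p. ev2 P p \<noteq> 0 \<longrightarrow> \<phi> p" "Q \<noteq> 0" "\<forall>p. ev2 Q p \<noteq> 0 \<longrightarrow> \<psi> p" by blast
  then show "\<exists>P. P \<noteq> 0 \<and> (\<forall>p. ev2 P p \<noteq> 0 \<longrightarrow> \<phi> p \<and> \<psi> p)" by (intro exI[of _ "P * Q"]) simp
qed blast

lemma eventually_generic_ev2: "P \<noteq> 0 \<Longrightarrow> \<forall>\<^sub>F p in generic. ev2 P p \<noteq> 0"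
  by (auto simp: eventually_generic)

lemma eventually_generic_ex:
  assumes "eventually \<phi> generic"
  obtains p where "p \<in> torus" "\<phi> p"
  using assms ev2_nonzero unfolding eventually_generic by metis

lemma generic_nontrivial [simp]: "generic \<noteq> bot"
proof
  assume "generic = bot"
  then have "\<forall>\<^sub>F p in generic. False" by simp
  then show False by (rule eventually_generic_ex)
qed

lemma eventually_torus: "\<forall>\<^sub>F p in generic. p \<in> torus"
proof -
  have "ev2 ([:[:0, 1:]:] * [:0, 1:]) p = fst p * snd p" for p by (simp only: ev2_simps)
  then show ?thesis
    unfolding eventually_generic by (intro exI[of _ "[:[:0, 1:]:] * [:0, 1:]"]) (auto simp: torus_def)
qed

text \<open>The value is taken on the reduced fraction and is junk where its denominator vanishes,
  so the algebraic rules for \<open>evF\<close> hold along \<open>generic\<close> only.\<close>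

definition evF :: "ratfield \<Rightarrow> complex \<times> complex \<Rightarrow> complex" where
  "evF u p = ev2 (fst (quot_of_fract u)) p / ev2 (snd (quot_of_fract u)) p"

lemma evF_to_fract: "evF (to_fract P) p = ev2 P p"
  by (simp add: evF_def)

lemma evF_cst [simp]: "evF (cst c) p = c" and evF_VX [simp]: "evF VX p = fst p" and evF_VY [simp]: "evF VY p = snd p"
  by (simp_all add: cst_def VX_def VY_def evF_to_fract)

lemma evF_0 [simp]: "evF 0 p = 0" and evF_1 [simp]: "evF 1 p = 1"
  by (simp_all add: evF_def)

lemma evF_Fract:
  assumes "b \<noteq> 0"
  shows "\<forall>\<^sub>F p in generic. evF (Fract a b) p = ev2 a p / ev2 b p"
proof -
  define c d where "c = fst (quot_of_fract (Fract a b))" and "d = snd (quot_of_fract (Fract a b))"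
  have d: "d \<noteq> 0" by (simp add: d_def)
  have "Fract c d = Fract a b" by (simp add: c_def d_def)
  then have cb: "c * b = a * d" using assms d by (simp add: eq_fract)
  have "\<forall>\<^sub>F p in generic. ev2 b p \<noteq> 0 \<and> ev2 d p \<noteq> 0"
    using eventually_generic_ev2[OF assms] eventually_generic_ev2[OF d] by (rule eventually_conj)
  then show ?thesis
  proof (rule eventually_mono)
    fix p assume "ev2 b p \<noteq> 0 \<and> ev2 d p \<noteq> 0"
    moreover have "ev2 c p * ev2 b p = ev2 a p * ev2 d p" using cb by (metis ev2_simps(2))
    ultimately show "evF (Fract a b) p = ev2 a p / ev2 b p"
      by (simp add: evF_def field_simps flip: c_def d_def)
  qed
qed

lemma evF_nonzero:
  assumes "u \<noteq> 0"
  shows "\<forall>\<^sub>F p in generic. evF u p \<noteq> 0"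
proof -
  have "fst (quot_of_fract u) \<noteq> 0" "snd (quot_of_fract u) \<noteq> 0" using assms by simp_all
  from eventually_conj[OF this[THEN eventually_generic_ev2]] show ?thesis
    by (rule eventually_mono) (simp add: evF_def)
qed

lemma evF_add: "\<forall>\<^sub>F p in generic. evF (u + v) p = evF u p + evF v p"
proof -
  obtain a b where u: "u = Fract a b" "b \<noteq> 0" by (cases u)
  obtain c d where v: "v = Fract c d" "d \<noteq> 0" by (cases v)
  have "\<forall>\<^sub>F p in generic. evF (Fract (a * d + c * b) (b * d)) p = ev2 (a * d + c * b) p / ev2 (b * d) p"
    by (rule evF_Fract) (simp add: u v)
  with evF_Fract[OF u(2), of a] evF_Fract[OF v(2), of c] eventually_generic_ev2[OF u(2)] eventually_generic_ev2[OF v(2)]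
  show ?thesis
  proof eventually_elim
    case (elim p)
    have "u + v = Fract (a * d + c * b) (b * d)" using u v by simp
    then show ?case using elim by (simp add: u(1) v(1) add_frac_eq del: add_fract)
  qed
qed

lemma evF_mult: "\<forall>\<^sub>F p in generic. evF (u * v) p = evF u p * evF v p"
proof -
  obtain a b where u: "u = Fract a b" "b \<noteq> 0" by (cases u)
  obtain c d where v: "v = Fract c d" "d \<noteq> 0" by (cases v)
  have "\<forall>\<^sub>F p in generic. evF (Fract (a * c) (b * d)) p = ev2 (a * c) p / ev2 (b * d) p"
    by (rule evF_Fract) (simp add: u v)
  with evF_Fract[OF u(2), of a] evF_Fract[OF v(2), of c]
  show ?thesis
    by eventually_elim (use u v in simp)
qed

lemma evF_uminus: "\<forall>\<^sub>F p in generic. evF (- u) p = - evF u p"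
proof -
  have "cst (- 1) * u = - u" by (simp add: cst_minus cst_simps)
  with evF_mult[of "cst (- 1)" u] show ?thesis by (simp del: mult_minus1)
qed

lemma evF_diff: "\<forall>\<^sub>F p in generic. evF (u - v) p = evF u p - evF v p"
  using evF_add[of u "- v"] evF_uminus[of v] by eventually_elim simp

lemma evF_inverse: "\<forall>\<^sub>F p in generic. evF (inverse u) p = inverse (evF u p)"
proof (cases "u = 0")
  case False
  then have 1: "evF (u * inverse u) p = 1" for p by simp
  from evF_mult[of u "inverse u"] evF_nonzero[OF False] show ?thesis
  proof eventually_elim
    case (elim p)
    then show ?case using 1[of p] by (simp add: inverse_unique)
  qed
qed simp

lemma evF_divide: "\<forall>\<^sub>F p in generic. evF (u / v) p = evF u p / evF v p"
  using evF_mult[of u "inverse v"] evF_inverse[of v] by eventually_elim (simp add: divide_inverse)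

lemma evF_power: "\<forall>\<^sub>F p in generic. evF (u ^ k) p = evF u p ^ k"
proof (induction k)
  case (Suc k)
  with evF_mult[of u "u ^ k"] show ?case by eventually_elim simp
qed simp

lemma evF_powi: "\<forall>\<^sub>F p in generic. evF (u powi k) p = evF u p powi k"
proof (cases "k \<ge> 0")
  case True
  then show ?thesis using evF_power[of u "nat k"] by (simp add: power_int_def)
next
  case False
  from evF_power[of "inverse u" "nat (- k)"] evF_inverse[of u] show ?thesis
    by eventually_elim (use False in \<open>simp add: power_int_def\<close>)
qed

lemma evF_eqI:
  assumes "\<forall>\<^sub>F p in generic. evF u p = evF v p"
  shows "u = v"
proof (rule ccontr)
  assume "u \<noteq> v"
  then have "\<forall>\<^sub>F p in generic. evF (u - v) p \<noteq> 0" by (simp add: evF_nonzero)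
  with assms evF_diff[of u v] have "\<forall>\<^sub>F p in generic. False" by eventually_elim simp
  then show False by simp
qed

subsection \<open>Pull-back of rational functions by maps of the torus\<close>

text \<open>These are the Laurent polynomials, regarded as functions on the torus.\<close>

definition clearable :: "(complex \<times> complex \<Rightarrow> complex) \<Rightarrow> bool" where
  "clearable f \<longleftrightarrow> (\<exists>N A. \<forall>p\<in>torus. ev2 A p = (fst p * snd p) ^ N * f p)"

lemma clearable_ev2: "clearable (ev2 P)"
  unfolding clearable_def by (intro exI[of _ 0] exI[of _ P]) simp

lemma clearable_const: "clearable (\<lambda>p. c)"
  using clearable_ev2[of "[:[:c:]:]"] by (simp add: clearable_def)

lemma clearable_fst: "clearable fst"
  using clearable_ev2[of "[:[:0, 1:]:]"] by (simp add: clearable_def)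

lemma clearable_snd: "clearable snd"
  using clearable_ev2[of "[:0, 1:]"] by (simp add: clearable_def)

lemma clearable_inverse_fst: "clearable (\<lambda>p. inverse (fst p))"
  unfolding clearable_def by (intro exI[of _ 1] exI[of _ "[:0, 1:]"]) (auto simp: torus_def)

lemma clearable_inverse_snd: "clearable (\<lambda>p. inverse (snd p))"
  unfolding clearable_def by (intro exI[of _ 1] exI[of _ "[:[:0, 1:]:]"]) (auto simp: torus_def)

lemma clearable_add:
  assumes "clearable f" "clearable g"
  shows "clearable (\<lambda>p. f p + g p)"
proof -
  obtain N A M B where "\<forall>p\<in>torus. ev2 A p = (fst p * snd p) ^ N * f p"
    "\<forall>p\<in>torus. ev2 B p = (fst p * snd p) ^ M * g p" using assms by (auto simp: clearable_def)
  then have "\<forall>p\<in>torus. ev2 (A * ([:[:0, 1:]:] * [:0, 1:]) ^ M + B * ([:[:0, 1:]:] * [:0, 1:]) ^ N) p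
      = (fst p * snd p) ^ (N + M) * (f p + g p)"
    by (simp add: power_add algebra_simps del: mult_pCons_left mult_pCons_right)
  then show ?thesis unfolding clearable_def by blast
qed

lemma clearable_mult:
  assumes "clearable f" "clearable g"
  shows "clearable (\<lambda>p. f p * g p)"
proof -
  obtain N A M B where "\<forall>p\<in>torus. ev2 A p = (fst p * snd p) ^ N * f p"
    "\<forall>p\<in>torus. ev2 B p = (fst p * snd p) ^ M * g p" using assms by (auto simp: clearable_def)
  then have "\<forall>p\<in>torus. ev2 (A * B) p = (fst p * snd p) ^ (N + M) * (f p * g p)"
    by (simp add: power_add)
  then show ?thesis unfolding clearable_def by blast
qed

lemma clearable_power: "clearable f \<Longrightarrow> clearable (\<lambda>p. f p ^ k)"
  by (induction k) (auto intro: clearable_const clearable_mult)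

lemma clearable_cong: "(\<And>p. p \<in> torus \<Longrightarrow> f p = g p) \<Longrightarrow> clearable f \<longleftrightarrow> clearable g"
  by (simp add: clearable_def)

text \<open>The inverses of the components are included because composing a Laurent polynomial with
  \<open>t\<close> brings them in. Surjectivity onto the torus makes \<open>t\<close> dominant, so
  that general points are sent to general points.\<close>

definition torus_map :: "(complex \<times> complex \<Rightarrow> complex \<times> complex) \<Rightarrow> bool" where
  "torus_map t \<longleftrightarrow> t ` torus = torus \<and> clearable (\<lambda>p. fst (t p)) \<and> clearable (\<lambda>p. snd (t p)) \<and>
     clearable (\<lambda>p. inverse (fst (t p))) \<and> clearable (\<lambda>p. inverse (snd (t p)))"

lemma torus_map_torus: "torus_map t \<Longrightarrow> p \<in> torus \<Longrightarrow> t p \<in> torus"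
  by (auto simp: torus_map_def)

lemma clearable_ev2_comp:
  assumes "torus_map t"
  shows "clearable (\<lambda>p. ev2 P (t p))"
proof (induction P rule: bpoly_induct)
qed (use assms in \<open>auto simp: torus_map_def clearable_const intro: clearable_add clearable_mult\<close>)

lemma clearable_comp:
  assumes "torus_map t" "clearable f"
  shows "clearable (\<lambda>p. f (t p))"
proof -
  obtain N A where A: "\<forall>p\<in>torus. ev2 A p = (fst p * snd p) ^ N * f p"
    using assms(2) by (auto simp: clearable_def)
  have "clearable (\<lambda>p. (inverse (fst (t p)) * inverse (snd (t p))) ^ N * ev2 A (t p))"
    using assms(1) unfolding torus_map_def
    by (intro clearable_mult clearable_power clearable_ev2_comp assms) auto
  then show ?thesis
  proof (rule clearable_cong[THEN iffD1, rotated])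
    fix p assume "p \<in> torus"
    then have p: "t p \<in> torus" by (rule torus_map_torus[OF assms(1)])
    then have nz: "fst (t p) \<noteq> 0" "snd (t p) \<noteq> 0" by (auto simp: torus_def)
    have "ev2 A (t p) = (fst (t p) * snd (t p)) ^ N * f (t p)" using A p by blast
    then show "(inverse (fst (t p)) * inverse (snd (t p))) ^ N * ev2 A (t p) = f (t p)"
      using nz by (simp add: power_mult_distrib power_inverse field_simps)
  qed
qed

lemma torus_map_id: "torus_map (\<lambda>p. p)"
  by (simp add: torus_map_def clearable_fst clearable_snd clearable_inverse_fst clearable_inverse_snd)

lemma torus_map_comp:
  assumes "torus_map s" "torus_map t"
  shows "torus_map (\<lambda>p. s (t p))"
proof -
  have "(\<lambda>p. s (t p)) ` torus = s ` (t ` torus)" by (simp add: image_image)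
  also have "\<dots> = torus" using assms by (simp add: torus_map_def)
  finally show ?thesis
    using assms clearable_comp[OF assms(2), of "\<lambda>p. fst (s p)"] clearable_comp[OF assms(2), of "\<lambda>p. snd (s p)"]
      clearable_comp[OF assms(2), of "\<lambda>p. inverse (fst (s p))"]
      clearable_comp[OF assms(2), of "\<lambda>p. inverse (snd (s p))"]
    by (simp add: torus_map_def)
qed

lemma torus_map_funpow: "torus_map t \<Longrightarrow> torus_map (t ^^ k)"
proof (induction k)
  case 0
  show ?case using torus_map_id by (simp add: id_def)
next
  case (Suc k)
  then show ?case using torus_map_comp[of t "t ^^ k"] by (simp add: comp_def)
qed

lemma clearable_ratfield:
  assumes "clearable f"
  obtains u where "\<forall>\<^sub>F p in generic. evF u p = f p"
proof -
  obtain N A where A: "\<forall>p\<in>torus. ev2 A p = (fst p * snd p) ^ N * f p"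
    using assms by (auto simp: clearable_def)
  define D where "D = ([:[:0, 1:]:] * [:0, 1:] :: bpoly) ^ N"
  have "D \<noteq> 0" by (simp add: D_def)
  from evF_Fract[OF this, of A] eventually_torus have "\<forall>\<^sub>F p in generic. evF (Fract A D) p = f p"
  proof eventually_elim
    case (elim p)
    have "ev2 D p = (fst p * snd p) ^ N" unfolding D_def by (simp only: ev2_simps)
    moreover have "ev2 A p = (fst p * snd p) ^ N * f p" using elim A by blast
    ultimately show ?case using elim by (simp add: torus_def)
  qed
  then show ?thesis using that by blast
qed

lemma eventually_torus_map:
  assumes t: "torus_map t" and "eventually \<phi> generic"
  shows "\<forall>\<^sub>F p in generic. \<phi> (t p)"
proof -
  obtain P where P: "P \<noteq> 0" "\<forall>p. ev2 P p \<noteq> 0 \<longrightarrow> \<phi> p" using assms(2) by (auto simp: eventually_generic)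
  obtain N A where A: "\<forall>p\<in>torus. ev2 A p = (fst p * snd p) ^ N * ev2 P (t p)"
    using clearable_ev2_comp[OF t, of P] by (auto simp: clearable_def)
  \<comment> \<open>A torus point off the curve has a preimage by surjectivity. There the cleared
    form \<open>A\<close> of \<open>P\<close> after \<open>t\<close> is nonzero, so \<open>A\<close>
    is not the zero polynomial.\<close>
  obtain p0 where p0: "p0 \<in> torus" "ev2 P p0 \<noteq> 0" using ev2_nonzero[OF P(1)] .
  then have "p0 \<in> t ` torus" using t by (simp add: torus_map_def)
  then obtain p1 where p1: "p1 \<in> torus" "p0 = t p1" by blast
  have "ev2 A p1 = (fst p1 * snd p1) ^ N * ev2 P (t p1)" using A p1 by blast
  then have "ev2 A p1 \<noteq> 0" using p1 p0 by (simp add: torus_def)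
  then have "A \<noteq> 0" by auto
  from eventually_torus eventually_generic_ev2[OF this] show ?thesis
  proof eventually_elim
    case (elim p)
    have "ev2 A p = (fst p * snd p) ^ N * ev2 P (t p)" using A elim by blast
    then have "ev2 P (t p) \<noteq> 0" using elim by auto
    then show ?case using P by blast
  qed
qed

text \<open>The pull-back is fixed by its values at general points: \<open>evF_pb\<close> provides
  existence and \<open>evF_eqI\<close> uniqueness.\<close>

definition pb :: "(complex \<times> complex \<Rightarrow> complex \<times> complex) \<Rightarrow> ratfield \<Rightarrow> ratfield" where
  "pb t u = (SOME v. \<forall>\<^sub>F p in generic. evF v p = evF u (t p))"

lemma evF_pb:
  assumes t: "torus_map t"
  shows "\<forall>\<^sub>F p in generic. evF (pb t u) p = evF u (t p)"
  unfolding pb_def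
proof (rule someI_ex)
  define a b where "a = fst (quot_of_fract u)" and "b = snd (quot_of_fract u)"
  obtain v where v: "\<forall>\<^sub>F p in generic. evF v p = ev2 a (t p)"
    by (rule clearable_ratfield[OF clearable_ev2_comp[OF t]])
  obtain w where w: "\<forall>\<^sub>F p in generic. evF w p = ev2 b (t p)"
    by (rule clearable_ratfield[OF clearable_ev2_comp[OF t]])
  from evF_divide[of v w] v w have "\<forall>\<^sub>F p in generic. evF (v / w) p = evF u (t p)"
    by eventually_elim (simp add: evF_def[of u] a_def b_def)
  then show "\<exists>v. \<forall>\<^sub>F p in generic. evF v p = evF u (t p)" by blast
qed

lemma pb_eqI:
  assumes "torus_map t" "\<forall>\<^sub>F p in generic. evF v p = evF u (t p)"
  shows "pb t u = v"
  by (rule evF_eqI) (use evF_pb[OF assms(1), of u] assms(2) in \<open>eventually_elim, simp\<close>)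

lemma pb_add:
  assumes t: "torus_map t"
  shows "pb t (u + v) = pb t u + pb t v"
proof (rule pb_eqI[OF t])
  show "\<forall>\<^sub>F p in generic. evF (pb t u + pb t v) p = evF (u + v) (t p)"
    using evF_add[of "pb t u" "pb t v"] evF_pb[OF t, of u] evF_pb[OF t, of v] eventually_torus_map[OF t evF_add[of u v]]
    by eventually_elim simp
qed

lemma pb_mult:
  assumes t: "torus_map t"
  shows "pb t (u * v) = pb t u * pb t v"
proof (rule pb_eqI[OF t])
  show "\<forall>\<^sub>F p in generic. evF (pb t u * pb t v) p = evF (u * v) (t p)"
    using evF_mult[of "pb t u" "pb t v"] evF_pb[OF t, of u] evF_pb[OF t, of v] eventually_torus_map[OF t evF_mult[of u v]]
    by eventually_elim simp
qed

lemma pb_cst: "torus_map t \<Longrightarrow> pb t (cst c) = cst c"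
  by (rule pb_eqI) auto

lemma pb_comp:
  assumes s: "torus_map s" and t: "torus_map t"
  shows "pb (\<lambda>p. s (t p)) u = pb t (pb s u)"
proof (rule pb_eqI[OF torus_map_comp[OF s t]])
  show "\<forall>\<^sub>F p in generic. evF (pb t (pb s u)) p = evF u (s (t p))"
    using evF_pb[OF t, of "pb s u"] eventually_torus_map[OF t evF_pb[OF s, of u]] by eventually_elim simp
qed

lemma pb_funpow:
  assumes t: "torus_map t"
  shows "pb (t ^^ k) u = (pb t ^^ k) u"
proof (induction k arbitrary: u)
  case 0
  show ?case using pb_eqI[OF torus_map_id, of u u] by (simp add: id_def)
next
  case (Suc k)
  have "t ^^ Suc k = (\<lambda>p. t ((t ^^ k) p))" by (simp add: fun_eq_iff)
  then have "pb (t ^^ Suc k) u = pb (\<lambda>p. t ((t ^^ k) p)) u" by (simp only:)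
  also have "\<dots> = pb (t ^^ k) (pb t u)" by (rule pb_comp[OF t torus_map_funpow[OF t]])
  also have "\<dots> = (pb t ^^ Suc k) u" by (simp only: Suc.IH funpow_Suc_right comp_apply)
  finally show ?case .
qed

lemma pb_cong:
  assumes "torus_map t" "\<And>p. p \<in> torus \<Longrightarrow> s p = t p"
  shows "pb s u = pb t u"
proof -
  have "(\<forall>\<^sub>F p in generic. evF v p = evF u (s p)) \<longleftrightarrow> (\<forall>\<^sub>F p in generic. evF v p = evF u (t p))" for v
    by (rule eventually_subst, rule eventually_mono[OF eventually_torus]) (simp add: assms)
  then show ?thesis by (simp add: pb_def)
qed

text \<open>A field homomorphism over the constants is substitution of the images of
  \<open>x\<close> and \<open>y\<close>; this turns an algebraic lift back into a map of
  points.\<close>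

lemma hom_evF:
  fixes S :: "ratfield \<Rightarrow> ratfield"
  assumes S: "\<And>u v. S (u + v) = S u + S v" "\<And>u v. S (u * v) = S u * S v" "\<And>c. S (cst c) = cst c"
    and m: "\<forall>\<^sub>F p in generic. evF (S VX) p = fst (m p)" "\<forall>\<^sub>F p in generic. evF (S VY) p = snd (m p)"
  shows "\<forall>\<^sub>F p in generic. evF (S u) p = evF u (m p)"
proof -
  have poly: "\<forall>\<^sub>F p in generic. evF (S (to_fract P)) p = ev2 P (m p)" for P
  proof (induction P rule: bpoly_induct)
    case (cst c)
    show ?case using S(3)[of c] by (simp add: cst_def evF_to_fract)
  next
    case (add P Q)
    from evF_add[of "S (to_fract P)" "S (to_fract Q)"] add show ?case by eventually_elim (simp add: S)
  next
    case (mult P Q)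
    from evF_mult[of "S (to_fract P)" "S (to_fract Q)"] mult show ?case by eventually_elim (simp add: S)
  qed (use m in \<open>simp_all add: VX_def VY_def\<close>)
  define a b where "a = fst (quot_of_fract u)" and "b = snd (quot_of_fract u)"
  have b: "to_fract b \<noteq> 0" by (simp add: b_def)
  have u: "u = to_fract a / to_fract b" by (simp add: a_def b_def flip: Fract_conv_to_fract)
  have "S 1 = 1" using S(3)[of 1] by (simp add: cst_simps)
  then have "S (to_fract b) * S (inverse (to_fract b)) = 1" using b by (simp flip: S(2))
  then have Su: "S u = S (to_fract a) / S (to_fract b)"
    unfolding u by (simp add: divide_inverse S(2) inverse_unique)
  from evF_divide[of "S (to_fract a)" "S (to_fract b)"] poly[of a] poly[of b] show ?thesis
    by eventually_elim (simp add: Su evF_def[of u] a_def b_def)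
qed

subsection \<open>Toric quotients\<close>

lemma pb_nonzero: "torus_map t \<Longrightarrow> u \<noteq> 0 \<Longrightarrow> pb t u \<noteq> 0"
  using pb_mult[of t u "inverse u"] pb_cst[of t 1] by (auto simp: cst_simps)

text \<open>Both sides obey the same product rule along \<open>pb t\<close>, so agreement on the
  coordinates propagates; quotients are recovered from \<open>u / v * v\<close>.\<close>

lemma dF_pb:
  assumes t: "torus_map t" and X: "dF a (pb t VX) = cst c * pb t VX" and Y: "dF a (pb t VY) = cst (c * a) * pb t VY"
  shows "dF a (pb t u) = cst c * pb t (dF a u)"
proof (induction u rule: ratfield_induct)
  case (cst b)
  show ?case using pb_cst[OF t, of 0] by (simp add: pb_cst t dF_cst cst_simps)
next
  case X
  show ?case by (simp add: assms(2) dF_X)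
next
  case Y
  show ?case by (simp add: assms(3) dF_Y pb_mult pb_cst t cst_simps)
next
  case (divide u v)
  have "dF a (pb t (u / v * v)) = cst c * pb t (dF a (u / v * v))" using divide by simp
  then have "dF a (pb t (u / v)) * pb t v = cst c * pb t (dF a (u / v)) * pb t v"
    by (simp only: pb_mult[OF t] dF_mult pb_add[OF t] divide(2)) (simp add: algebra_simps)
  then show ?case using pb_nonzero[OF t divide(3)] by simp
qed (simp_all add: pb_add pb_mult dF_add dF_mult t algebra_simps)

locale ratfield_hom =
  fixes S :: "ratfield \<Rightarrow> ratfield"
  assumes hom_add: "S (u + v) = S u + S v" and hom_mult: "S (u * v) = S u * S v" and hom_cst: "S (cst c) = cst c"
begin

lemma hom_0 [simp]: "S 0 = 0" and hom_1 [simp]: "S 1 = 1"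
  using hom_cst[of 0] hom_cst[of 1] by (simp_all add: cst_simps)

lemma hom_nonzero: "u \<noteq> 0 \<Longrightarrow> S u \<noteq> 0"
  using hom_mult[of u "inverse u"] by auto

lemma hom_inverse: "S (inverse u) = inverse (S u)"
proof (cases "u = 0")
  case False
  then show ?thesis using hom_mult[of u "inverse u"] by (simp add: inverse_unique)
qed simp

lemma hom_power: "S (u ^ k) = S u ^ k"
  by (induction k) (auto simp: hom_mult)

lemma hom_powi: "S (u powi k) = S u powi k"
  by (simp add: power_int_def hom_power hom_inverse)

lemma hom_monomial: "S (cst c * VX powi i * VY powi j) = cst c * S VX powi i * S VY powi j"
  by (simp add: hom_mult hom_powi hom_cst)

end

lemma ratfield_hom_pb: "torus_map t \<Longrightarrow> ratfield_hom (pb t)"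
  by unfold_locales (auto simp: pb_add pb_mult pb_cst)

lemma ratfield_hom_comp: "ratfield_hom S \<Longrightarrow> ratfield_hom S' \<Longrightarrow> ratfield_hom (\<lambda>u. S (S' u))"
  by (simp add: ratfield_hom_def)

lemma cst_powi: "cst (c powi i) = cst c powi i"
proof -
  have p: "cst (c ^ k) = cst c ^ k" for c k by (induction k) (auto simp: cst_simps)
  have "cst (inverse c) = inverse (cst c)" for c
  proof (cases "c = 0")
    case False
    then have "cst c * cst (inverse c) = 1" by (simp flip: cst_simps)
    then show ?thesis by (simp add: inverse_unique)
  qed (simp add: cst_simps)
  then show ?thesis by (simp add: power_int_def p)
qed

lemma monomial_comp:
  "cst c * (cst c' * VX powi i' * VY powi j') powi i * (cst d' * VX powi k' * VY powi m') powi j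
    = cst (c * c' powi i * d' powi j) * VX powi (i' * i + k' * j) * VY powi (j' * i + m' * j)"
  unfolding power_int_mult_distrib cst_simps cst_powi power_int_mult[symmetric]
  by (simp add: power_int_add mult_ac)

context irrational
begin

lemma monomial_inject:
  assumes "c \<noteq> 0" and eq: "cst c * VX powi i * VY powi j = cst d * VX powi k * VY powi m"
  shows "c = d \<and> i = k \<and> j = m"
proof -
  let ?M = "cst c * VX powi i * VY powi j"
  have M: "?M \<noteq> 0" using assms(1) by simp
  have "cst (of_int i + l * of_int j) * ?M = dF l ?M" by (rule dF_monomial[symmetric])
  also have "\<dots> = cst (of_int k + l * of_int m) * ?M" unfolding eq by (rule dF_monomial)
  finally have "cst (of_int i + l * of_int j) * ?M = cst (of_int k + l * of_int m) * ?M" .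
  then have "cst (of_int i + l * of_int j) = cst (of_int k + l * of_int m)" using M by simp
  then have "cst (of_int (i - k) + l * of_int (j - m)) = 0"
    using cst_simps(1)[of "of_int (i - k) + l * of_int (j - m)" "of_int k + l * of_int m"] by (simp add: algebra_simps)
  then have "of_int (i - k) + l * of_int (j - m) = 0" by simp
  from irr[OF this] have ij: "i = k" "j = m" by simp_all
  then have "cst c = cst d" using eq by simp
  then show ?thesis using ij by (simp add: cst_def)
qed

text \<open>Applying \<open>S\<close> to the eigenvalue equations of \<open>x\<close> and
  \<open>y\<close> gives the logarithmic derivatives \<open>1 / g\<close> and \<open>l / g\<close>
  of their images, the situation of \<open>log_derivative_monomial\<close>. The last equation
  compares the eigenvalues of the two monomials found.\<close>

lemma foliated_hom_monomial:
  assumes "ratfield_hom S" and g: "\<And>u. S (dF l u) = g * dF l (S u)"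
  shows "\<exists>c i j d k m. c \<noteq> 0 \<and> d \<noteq> 0 \<and> S VX = cst c * VX powi i * VY powi j \<and> S VY = cst d * VX powi k * VY powi m
     \<and> of_int k + l * of_int m = l * (of_int i + l * of_int j)"
proof -
  interpret ratfield_hom S by fact
  have nz: "S VX \<noteq> 0" "S VY \<noteq> 0" by (simp_all add: hom_nonzero)
  have X: "S VX = g * dF l (S VX)" using g[of VX] by (simp add: dF_X)
  have Y: "cst l * S VY = g * dF l (S VY)" using g[of VY] by (simp add: dF_Y hom_mult hom_cst)
  have g0: "g \<noteq> 0" using X nz by auto
  have X': "dF l (S VX) / S VX = 1 / g"
  proof -
    have "dF l (S VX) = S VX / g" using X g0 by (metis nonzero_mult_div_cancel_left)
    then show ?thesis using nz by simp
  qed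
  have Y': "dF l (S VY) / S VY = cst l * (1 / g)"
  proof -
    have "dF l (S VY) = cst l * S VY / g" using Y g0 by (metis nonzero_mult_div_cancel_left)
    then show ?thesis using nz by simp
  qed
  obtain c i j d k m where m: "c \<noteq> 0" "d \<noteq> 0" "S VX = cst c * VX powi i * VY powi j" "S VY = cst d * VX powi k * VY powi m"
    using log_derivative_monomial[OF nz, unfolded X' Y', OF refl] by blast
  have "dF l (S VX) / S VX = cst (of_int i + l * of_int j)" "dF l (S VY) / S VY = cst (of_int k + l * of_int m)"
    using nz dF_monomial[of l c i j] dF_monomial[of l d k m] unfolding m by (simp_all add: nonzero_divide_eq_eq)
  then have "cst (of_int k + l * of_int m) = cst (l * (of_int i + l * of_int j))"
    using X' Y' by (simp add: cst_simps)
  then have "of_int k + l * of_int m = l * (of_int i + l * of_int j)" by (simp add: cst_def)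
  then show ?thesis using m by blast
qed

end

text \<open>\<open>X\<close> and \<open>Y\<close> encode on the coordinates that the pull-back
  multiplies \<open>dF l\<close> by the character \<open>\<chi>\<close>; \<open>X'\<close> and
  \<open>Y'\<close> give the inverse character for the companion slope \<open>l'\<close>.
  \<open>dF_pb\<close> spreads both to all rational functions.\<close>

locale toric_quotient = irrational +
  fixes t :: "complex \<times> complex \<Rightarrow> complex \<times> complex" and \<chi> :: complex and n :: nat and l' :: complex
  assumes t: "torus_map t" and n_pos: "n > 0" and t_order: "p \<in> torus \<Longrightarrow> (t ^^ n) p = p"
    and \<chi>_n: "\<chi> ^ n = 1" and \<chi>_primitive: "0 < k \<Longrightarrow> k < n \<Longrightarrow> \<chi> ^ k \<noteq> 1" and ll': "l \<noteq> l'"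
    and X: "dF l (pb t VX) = cst \<chi> * pb t VX" and Y: "dF l (pb t VY) = cst (\<chi> * l) * pb t VY"
    and X': "dF l' (pb t VX) = cst (inverse \<chi>) * pb t VX" and Y': "dF l' (pb t VY) = cst (inverse \<chi> * l') * pb t VY"
begin

lemma pb_order: "(pb t ^^ n) u = u"
proof -
  have "pb (t ^^ n) u = pb (\<lambda>p. p) u" by (rule pb_cong[OF torus_map_id]) (rule t_order)
  also have "\<dots> = u" by (rule pb_eqI[OF torus_map_id]) simp
  finally show ?thesis by (simp add: pb_funpow t)
qed

lemma \<chi>_nz [simp]: "\<chi> \<noteq> 0"
  using \<chi>_n n_pos by (metis power_0_left zero_neq_one neq0_conv)

definition z :: ratfield where "z = (\<Sum>k<n. cst (inverse \<chi> ^ k) * (pb t ^^ k) VX)"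

lemma pb_sum: "pb t (sum g A) = (\<Sum>i\<in>A. pb t (g i))"
  using pb_cst[OF t, of 0] by (induction A rule: infinite_finite_induct) (auto simp: pb_add t cst_simps)

lemma pb_z: "pb t z = cst \<chi> * z"
proof -
  have "pb t z = (\<Sum>k<n. cst (inverse \<chi> ^ k) * (pb t ^^ Suc k) VX)"
    by (simp add: z_def pb_sum pb_mult pb_cst t)
  also have "\<dots> = (\<Sum>k<n. cst \<chi> * (cst (inverse \<chi> ^ Suc k) * (pb t ^^ Suc k) VX))"
  proof (rule sum.cong[OF refl])
    fix k
    have "inverse \<chi> ^ k = \<chi> * inverse \<chi> ^ Suc k" by simp
    then have "cst (inverse \<chi> ^ k) = cst \<chi> * cst (inverse \<chi> ^ Suc k)" by (simp only: cst_simps)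
    then show "cst (inverse \<chi> ^ k) * (pb t ^^ Suc k) VX = cst \<chi> * (cst (inverse \<chi> ^ Suc k) * (pb t ^^ Suc k) VX)"
      by (simp only: mult.assoc)
  qed
  also have "\<dots> = cst \<chi> * (\<Sum>k<n. cst (inverse \<chi> ^ Suc k) * (pb t ^^ Suc k) VX)"
    by (simp only: sum_distrib_left)
  also have "(\<Sum>k<n. cst (inverse \<chi> ^ Suc k) * (pb t ^^ Suc k) VX) = z"
  proof -
    have "(\<Sum>k<Suc n. cst (inverse \<chi> ^ k) * (pb t ^^ k) VX)
        = cst 1 * VX + (\<Sum>k<n. cst (inverse \<chi> ^ Suc k) * (pb t ^^ Suc k) VX)"
      by (subst sum.lessThan_Suc_shift) simp
    moreover have "(\<Sum>k<Suc n. cst (inverse \<chi> ^ k) * (pb t ^^ k) VX) = z + cst 1 * VX"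
      using \<chi>_n by (simp add: z_def pb_order power_inverse)
    ultimately show ?thesis by simp
  qed
  finally show ?thesis .
qed

lemma dF_pb_X: "dF l ((pb t ^^ k) VX) = cst (\<chi> ^ k) * (pb t ^^ k) VX"
proof (induction k)
  case 0
  show ?case by (simp add: dF_X cst_simps)
next
  case (Suc k)
  show ?case by (simp add: dF_pb[OF t X Y] Suc pb_mult pb_cst t cst_simps)
qed

lemma dF_sum: "dF a (sum g A) = (\<Sum>i\<in>A. dF a (g i))"
  by (induction A rule: infinite_finite_induct) (auto simp: dF_add)

lemma cst_sum: "cst (sum g A) = (\<Sum>i\<in>A. cst (g i))"
  by (induction A rule: infinite_finite_induct) (auto simp: cst_simps)

text \<open>The \<open>k\<close>-th summand of the resolvent is an eigenvector of
  \<open>dF l\<close> for \<open>\<chi> ^ k\<close>. Summing the first \<open>n\<close> iterates of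
  \<open>dF l\<close> therefore keeps only the term \<open>k = 0\<close>, which is \<open>n\<close>
  times \<open>VX\<close>.\<close>

lemma z_nonzero: "z \<noteq> 0"
proof
  assume z0: "z = 0"
  have iter: "(dF l ^^ j) z = (\<Sum>k<n. cst (inverse \<chi> ^ k * (\<chi> ^ k) ^ j) * (pb t ^^ k) VX)" for j
  proof (induction j)
    case (Suc j)
    have "(dF l ^^ Suc j) z = (\<Sum>k<n. cst (inverse \<chi> ^ k * (\<chi> ^ k) ^ j) * (cst (\<chi> ^ k) * (pb t ^^ k) VX))"
      by (simp add: Suc dF_sum dF_mult dF_cst dF_pb_X)
    then show ?case by (simp add: cst_simps mult_ac)
  qed (simp add: z_def)
  have "(dF l ^^ j) z = 0" for j by (induction j) (auto simp: z0)
  then have "0 = (\<Sum>j<n. \<Sum>k<n. cst (inverse \<chi> ^ k * (\<chi> ^ k) ^ j) * (pb t ^^ k) VX)"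
    unfolding iter by simp
  also have "\<dots> = (\<Sum>k<n. \<Sum>j<n. cst (inverse \<chi> ^ k * (\<chi> ^ k) ^ j) * (pb t ^^ k) VX)"
    by (rule sum.swap)
  also have "\<dots> = (\<Sum>k<n. cst (inverse \<chi> ^ k * (\<Sum>j<n. (\<chi> ^ k) ^ j)) * (pb t ^^ k) VX)"
    by (simp only: sum_distrib_right[symmetric] cst_sum[symmetric] sum_distrib_left[symmetric])
  also have "\<dots> = (\<Sum>k<n. if k = 0 then cst (of_nat n) * VX else 0)"
  proof (intro sum.cong refl)
    fix k assume "k \<in> {..<n}"
    show "cst (inverse \<chi> ^ k * (\<Sum>j<n. (\<chi> ^ k) ^ j)) * (pb t ^^ k) VX = (if k = 0 then cst (of_nat n) * VX else 0)"
    proof (cases "k = 0")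
      case False
      have "(\<chi> ^ k) ^ n = 1" by (metis \<chi>_n mult.commute power_mult power_one)
      then have "(\<Sum>j<n. (\<chi> ^ k) ^ j) = 0"
        using geometric_sum[of "\<chi> ^ k" n] \<chi>_primitive[of k] False \<open>k \<in> {..<n}\<close> by simp
      then show ?thesis using False by (simp add: cst_simps)
    qed simp
  qed
  also have "\<dots> = cst (of_nat n) * VX" using n_pos by simp
  finally show False using n_pos by simp
qed

sublocale cf: cyclic_foliation cst "pb t" "dF l" "dF l'" z \<chi> n
proof
  show "\<exists>p q. \<forall>u. E u = p * dF l' u + q * dF l u"
    if "\<And>u v. E (u + v) = E u + E v" "\<And>u v. E (u * v) = E u * v + u * E v" "\<And>c. E (cst c) = 0" for E
    by (rule derivation_ratfield_span[OF ll']) (fact that)+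
  show "p = 0 \<and> q = 0" if "\<And>u. p * dF l' u + q * dF l u = 0" for p q
    by (rule dF_independent[OF ll' that])
qed (simp_all add: cst_simps pb_add pb_mult pb_cst t n_pos pb_order dF_add dF_mult dF_cst dF_commute[of l l']
      dF_pb[OF t X Y] dF_pb[OF t X' Y'] dF_kernel \<chi>_n \<chi>_primitive z_nonzero pb_z)

abbreviation L :: "ratfield set" where "L \<equiv> cf.L"

lemma L_iff: "u \<in> L \<longleftrightarrow> pb t u = u"
  by (simp add: cf.L_def)

lemma L_funpow: "u \<in> L \<Longrightarrow> (pb t ^^ k) u = u"
  by (rule cf.T_pow_L)

end

locale foliated_automorphism = toric_quotient +
  fixes \<sigma> D :: "ratfield \<Rightarrow> ratfield" and f0 g u0 :: ratfield
  assumes \<sigma>_L: "\<sigma> ` L = L"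
    and \<sigma>_add: "\<And>u v. u \<in> L \<Longrightarrow> v \<in> L \<Longrightarrow> \<sigma> (u + v) = \<sigma> u + \<sigma> v"
    and \<sigma>_mult: "\<And>u v. u \<in> L \<Longrightarrow> v \<in> L \<Longrightarrow> \<sigma> (u * v) = \<sigma> u * \<sigma> v"
    and \<sigma>_cst: "\<And>c. \<sigma> (cst c) = cst c"
    and D_L: "\<And>u. u \<in> L \<Longrightarrow> D u \<in> L"
    and D_nz: "u0 \<in> L" "D u0 \<noteq> 0"
    and D_\<delta>: "\<And>u. u \<in> L \<Longrightarrow> D u = f0 * dF l u"
    and \<sigma>_D: "\<And>u. u \<in> L \<Longrightarrow> \<sigma> (D u) = g * D (\<sigma> u)"
begin

text \<open>The inverse of the lift also preserves the foliation and is thus monomial. The two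
  integer matrices of exponents are inverse to each other, so the determinant is a unit of the
  integers.\<close>

lemma monomial_lift:
  "\<exists>S c i j d k m. ratfield_hom S \<and> (\<forall>u\<in>L. S u = \<sigma> u) \<and> (\<forall>u. S (pb t u) = pb t (S u)) \<and>
     c \<noteq> 0 \<and> d \<noteq> 0 \<and> S VX = cst c * VX powi i * VY powi j \<and> S VY = cst d * VX powi k * VY powi m \<and>
     of_int k + l * of_int m = l * (of_int i + l * of_int j) \<and> \<bar>i * m - j * k\<bar> = 1"
proof -
  have "\<exists>S g1. (\<forall>u v. S (u + v) = S u + S v) \<and> (\<forall>u v. S (u * v) = S u * S v) \<and>
    (\<forall>u\<in>L. S u = \<sigma> u) \<and> (\<forall>u. S (pb t u) = pb t (S u)) \<and> surj S \<and>
    g1 \<noteq> 0 \<and> (\<forall>u. S (dF l u) = g1 * dF l (S u))"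
    by (rule cf.automorphism_lifts[OF \<sigma>_L \<sigma>_add \<sigma>_mult \<sigma>_cst D_L D_nz D_\<delta> \<sigma>_D])
  then obtain S g1 where S_add: "\<And>u v. S (u + v) = S u + S v" and S_mult: "\<And>u v. S (u * v) = S u * S v"
    and S_L: "\<And>u. u \<in> L \<Longrightarrow> S u = \<sigma> u" and S_T: "\<And>u. S (pb t u) = pb t (S u)" and S_surj: "surj S"
    and g1: "g1 \<noteq> 0" and S_\<delta>: "\<And>u. S (dF l u) = g1 * dF l (S u)" by blast
  interpret S: ratfield_hom S
    by unfold_locales (simp_all add: S_add S_mult S_L cf.L_cst \<sigma>_cst)
  have "inj S"
  proof (rule injI)
    fix u v assume "S u = S v"
    then have "S (u - v) = 0" using S_add[of "u - v" v] by simp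
    then show "u = v" using S.hom_nonzero[of "u - v"] by auto
  qed
  define R where "R = Hilbert_Choice.inv S"
  have RS: "R (S u) = u" and SR: "S (R u) = u" for u
    using \<open>inj S\<close> S_surj by (simp_all add: R_def surj_f_inv_f)
  interpret R: ratfield_hom R
    by unfold_locales (rule injD[OF \<open>inj S\<close>], simp add: SR S_add S_mult S.hom_cst)+
  have R_\<delta>: "R (dF l u) = (1 / R g1) * dF l (R u)" for u
  proof -
    have "R (S (dF l (R u))) = R g1 * R (dF l u)" unfolding S_\<delta> SR by (rule R.hom_mult)
    then show ?thesis using R.hom_nonzero[OF g1] by (simp add: RS)
  qed
  obtain c i j d k m where S: "c \<noteq> 0" "d \<noteq> 0" "S VX = cst c * VX powi i * VY powi j" "S VY = cst d * VX powi k * VY powi m"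
     "of_int k + l * of_int m = l * (of_int i + l * of_int j)"
    using foliated_hom_monomial[OF S.ratfield_hom_axioms S_\<delta>] by blast
  obtain c' i' j' d' k' m' where R: "R VX = cst c' * VX powi i' * VY powi j'" "R VY = cst d' * VX powi k' * VY powi m'"
    using foliated_hom_monomial[OF R.ratfield_hom_axioms R_\<delta>] by blast
  have "cst 1 * VX powi 1 * VY powi 0 = R (S VX)" by (simp add: RS cst_simps)
  also have "\<dots> = cst (c * c' powi i * d' powi j) * VX powi (i' * i + k' * j) * VY powi (j' * i + m' * j)"
    unfolding S R.hom_monomial R monomial_comp ..
  finally have 1: "1 = i' * i + k' * j" "0 = j' * i + m' * j" using monomial_inject[OF one_neq_zero] by blast+
  have "cst 1 * VX powi 0 * VY powi 1 = R (S VY)" by (simp add: RS cst_simps)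
  also have "\<dots> = cst (d * c' powi k * d' powi m) * VX powi (i' * k + k' * m) * VY powi (j' * k + m' * m)"
    unfolding S R.hom_monomial R monomial_comp ..
  finally have 2: "0 = i' * k + k' * m" "1 = j' * k + m' * m" using monomial_inject[OF one_neq_zero] by blast+
  have "(i * m - j * k) * (i' * m' - j' * k') = (i' * i + k' * j) * (j' * k + m' * m) - (j' * i + m' * j) * (i' * k + k' * m)"
    by (simp add: algebra_simps)
  also have "\<dots> = 1" by (simp flip: 1 2)
  finally have "\<bar>i * m - j * k\<bar> = 1" using zdvd1_eq by (metis dvd_triv_left)
  then show ?thesis using S S_L S_T S.ratfield_hom_axioms by blast
qed

end

subsection \<open>The three toric quotients\<close>

text \<open>These are \<open>T3\<close>, \<open>T4\<close> and \<open>T3\<close> after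
  \<open>Q2\<close> in affine coordinates: \<open>X / Z\<close>, \<open>Y / Z\<close> on the plane,
  and the given chart on the product of two lines.\<close>

definition t3 :: "complex \<times> complex \<Rightarrow> complex \<times> complex" where "t3 p = (1 / snd p, fst p / snd p)"
definition t4 :: "complex \<times> complex \<Rightarrow> complex \<times> complex" where "t4 p = (snd p, 1 / fst p)"
definition t6 :: "complex \<times> complex \<Rightarrow> complex \<times> complex" where "t6 p = (snd p, snd p / fst p)"

lemmas clearable_intros = clearable_fst clearable_snd clearable_inverse_fst clearable_inverse_snd clearable_mult

lemma torus_map_t3: "torus_map t3"
proof -
  have "p \<in> torus \<Longrightarrow> t3 p \<in> torus \<and> p = t3 (snd p / fst p, 1 / fst p)" for p
    by (auto simp: torus_def t3_def prod_eq_iff)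
  moreover have "p \<in> torus \<Longrightarrow> (snd p / fst p, 1 / fst p) \<in> torus" for p by (auto simp: torus_def)
  ultimately have "t3 ` torus = torus" by blast
  then show ?thesis by (auto simp: torus_map_def t3_def divide_inverse intro!: clearable_intros)
qed

lemma torus_map_t4: "torus_map t4"
proof -
  have "p \<in> torus \<Longrightarrow> t4 p \<in> torus \<and> p = t4 (1 / snd p, fst p)" for p
    by (auto simp: torus_def t4_def prod_eq_iff)
  moreover have "p \<in> torus \<Longrightarrow> (1 / snd p, fst p) \<in> torus" for p by (auto simp: torus_def)
  ultimately have "t4 ` torus = torus" by blast
  then show ?thesis by (auto simp: torus_map_def t4_def divide_inverse intro!: clearable_intros)
qed

lemma torus_map_t6: "torus_map t6"
proof -
  have "p \<in> torus \<Longrightarrow> t6 p \<in> torus \<and> p = t6 (fst p / snd p, fst p)" for p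
    by (auto simp: torus_def t6_def prod_eq_iff)
  moreover have "p \<in> torus \<Longrightarrow> (fst p / snd p, fst p) \<in> torus" for p by (auto simp: torus_def)
  ultimately have "t6 ` torus = torus" by blast
  then show ?thesis by (auto simp: torus_map_def t6_def divide_inverse intro!: clearable_intros)
qed

lemma pb_monomial:
  assumes "torus_map t" "\<And>p. p \<in> torus \<Longrightarrow> evF u (t p) = c * fst p powi i * snd p powi j"
  shows "pb t u = cst c * VX powi i * VY powi j"
proof (rule pb_eqI[OF assms(1)])
  show "\<forall>\<^sub>F p in generic. evF (cst c * VX powi i * VY powi j) p = evF u (t p)"
    using evF_mult[of "cst c * VX powi i" "VY powi j"] evF_mult[of "cst c" "VX powi i"] evF_powi[of VX i] evF_powi[of VY j]
      eventually_torus
    by eventually_elim (simp add: assms(2))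
qed

lemma pb_t3: "pb t3 VX = cst 1 * VX powi 0 * VY powi (- 1)" "pb t3 VY = cst 1 * VX powi 1 * VY powi (- 1)"
  by (intro pb_monomial torus_map_t3; simp add: t3_def divide_inverse)+

lemma pb_t4: "pb t4 VX = cst 1 * VX powi 0 * VY powi 1" "pb t4 VY = cst 1 * VX powi (- 1) * VY powi 0"
  by (intro pb_monomial torus_map_t4; simp add: t4_def divide_inverse)+

lemma pb_t6: "pb t6 VX = cst 1 * VX powi 0 * VY powi 1" "pb t6 VY = cst 1 * VX powi (- 1) * VY powi 1"
  by (intro pb_monomial torus_map_t6; simp add: t6_def divide_inverse)+

lemma irrational_nonreal: "Im l \<noteq> 0 \<Longrightarrow> irrational l"
proof
  fix i j assume "Im l \<noteq> 0" "of_int i + l * of_int j = 0"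
  then have "Im (of_int i + l * of_int j) = 0" "Re (of_int i + l * of_int j) = 0" by simp_all
  then show "i = 0 \<and> j = 0" using \<open>Im l \<noteq> 0\<close> by auto
qed

lemma cube_root_unity:
  assumes "w ^ 3 = 1" "w \<noteq> (1::complex)"
  shows "w ^ 2 + w + 1 = 0" "Im w \<noteq> 0"
proof -
  have "(w - 1) * (w ^ 2 + w + 1) = w ^ 3 - 1" by (simp add: power2_eq_square power3_eq_cube algebra_simps)
  then show 1: "w ^ 2 + w + 1 = 0" using assms by simp
  show "Im w \<noteq> 0"
  proof
    assume "Im w = 0"
    then have "Re (w ^ 2 + w + 1) = Re w ^ 2 + Re w + 1" by (simp add: power2_eq_square)
    then have "Re w ^ 2 + Re w + 1 = 0" using 1 by simp
    moreover have "(Re w + 1 / 2) ^ 2 = Re w ^ 2 + Re w + 1 / 4" by (simp add: power2_sum power_divide)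
    ultimately have "(Re w + 1 / 2) ^ 2 = - 3 / 4" by simp
    moreover have "0 \<le> (Re w + 1 / 2) ^ 2" by simp
    ultimately show False by linarith
  qed
qed

text \<open>The slope \<open>- w\<close> solves \<open>w^2 + w * l = 0\<close>, the condition that
  the form vanishes on the vector field; \<open>- (w ^ 2)\<close> is its complex conjugate. The
  character appears on \<open>1 / y\<close>, the pull-back of \<open>x\<close>, whose eigenvalue is
  \<open>- l = w\<close>.\<close>

lemma toric_quotient_3:
  assumes w: "w ^ 3 = 1" "w \<noteq> 1"
  shows "toric_quotient (- w) t3 w 3 (- (w ^ 2))"
proof -
  interpret irrational "- w" by (rule irrational_nonreal) (simp add: cube_root_unity[OF w])
  note w2 = cube_root_unity(1)[OF w]
  have w0: "w \<noteq> 0" using w by auto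
  have inv: "inverse w = w ^ 2" using w by (intro inverse_unique) (simp add: power2_eq_square power3_eq_cube mult_ac)
  have w1: "w + 1 = - (w ^ 2)" "1 + w ^ 2 = - w" using w2 by (simp_all add: algebra_simps eq_neg_iff_add_eq_0)
  show ?thesis
  proof
    show "(t3 ^^ 3) p = p" if "p \<in> torus" for p
      using that by (auto simp: numeral_3_eq_3 t3_def torus_def)
    show "w ^ k \<noteq> 1" if "0 < k" "k < 3" for k
    proof -
      have "k = 1 \<or> k = 2" using that by auto
      moreover have "w ^ 2 \<noteq> 1"
      proof
        assume "w ^ 2 = 1"
        moreover have "w ^ 3 = w ^ 2 * w" by (simp add: power2_eq_square power3_eq_cube)
        ultimately show False using w by simp
      qed
      ultimately show ?thesis using w by auto
    qed
    show "- w \<noteq> - (w ^ 2)" using w w0 by (auto simp: power2_eq_square)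
    show "dF (- w) (pb t3 VX) = cst w * pb t3 VX" "dF (- (w ^ 2)) (pb t3 VX) = cst (inverse w) * pb t3 VX"
      unfolding pb_t3 dF_monomial by (simp_all add: inv)
    have e1: "of_int 1 + - w * of_int (- 1) = w * - w" using w1 by (simp add: power2_eq_square add.commute)
    have "inverse w * - (w ^ 2) = - w" unfolding inv using w by (simp add: power2_eq_square power3_eq_cube mult_ac)
    then have e2: "of_int 1 + - (w ^ 2) * of_int (- 1) = inverse w * - (w ^ 2)" using w1 by simp
    show "dF (- w) (pb t3 VY) = cst (w * - w) * pb t3 VY"
      "dF (- (w ^ 2)) (pb t3 VY) = cst (inverse w * - (w ^ 2)) * pb t3 VY"
      unfolding pb_t3 dF_monomial e1 e2 by simp_all
  qed (simp_all add: torus_map_t3 w)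
qed

text \<open>The foliation is that of \<open>E3\<close>, so the slopes are the same; the character
  becomes the primitive sixth root of unity \<open>- w\<close>, the eigenvalue of \<open>y\<close>,
  which is the pull-back of \<open>x\<close>.\<close>

lemma toric_quotient_6:
  assumes w: "w ^ 3 = 1" "w \<noteq> 1"
  shows "toric_quotient (- w) t6 (- w) 6 (- (w ^ 2))"
proof -
  interpret irrational "- w" by (rule irrational_nonreal) (simp add: cube_root_unity[OF w])
  note w2 = cube_root_unity(1)[OF w]
  have w0: "w \<noteq> 0" using w by auto
  have inv: "inverse (- w) = - (w ^ 2)" using w by (intro inverse_unique) (simp add: power2_eq_square power3_eq_cube mult_ac)
  have w3: "w * (w * w) = 1" using w by (simp add: power3_eq_cube mult_ac)
  have w1: "- 1 - w = w * w" using w2 by (simp add: algebra_simps power2_eq_square eq_neg_iff_add_eq_0)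
      (metis add.commute add_eq_0_iff diff_conv_add_uminus minus_add_distrib)
  show ?thesis
  proof
    show "(t6 ^^ 6) p = p" if "p \<in> torus" for p
      using that by (auto simp: eval_nat_numeral t6_def torus_def)
    have "w ^ 6 = (w ^ 3) ^ 2" by (simp flip: power_mult)
    then show "(- w) ^ 6 = 1" using w by simp
    show "(- w) ^ k \<noteq> 1" if "0 < k" "k < 6" for k
    proof
      assume "(- w) ^ k = 1"
      then have k1: "w ^ k = (- 1) ^ k" by (metis minus_one_mult_self mult.left_neutral mult.commute mult.assoc power_minus)
      have "(w ^ k) ^ 3 = 1" by (metis w(1) mult.commute power_mult power_one)
      then have "((- 1 :: complex) ^ k) ^ 3 = 1" using k1 by simp
      then have "even k" by (cases "even k") auto
      then have "k = 2 \<or> k = 4" using that by (auto elim!: evenE)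
      then have "w ^ 2 = 1 \<or> w ^ 4 = 1" using k1 by auto
      moreover have "w ^ 4 = w" using w3 by (simp add: eval_nat_numeral)
      moreover have "w ^ 2 = 1 \<Longrightarrow> w = 1" using w3 by (simp add: power2_eq_square)
      ultimately show False using w by auto
    qed
    show "- w \<noteq> - (w ^ 2)" using w w0 by (auto simp: power2_eq_square)
    show "dF (- w) (pb t6 VX) = cst (- w) * pb t6 VX" "dF (- (w ^ 2)) (pb t6 VX) = cst (inverse (- w)) * pb t6 VX"
      unfolding pb_t6 dF_monomial inv by simp_all
    have e1: "of_int (- 1) + - w * of_int 1 = - w * - w" using w1 by simp
    have e2: "of_int (- 1) + - (w ^ 2) * of_int 1 = inverse (- w) * - (w ^ 2)"
      unfolding inv using w1 w3 by (simp add: power2_eq_square mult_ac) (simp add: algebra_simps)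
    show "dF (- w) (pb t6 VY) = cst (- w * - w) * pb t6 VY"
      "dF (- (w ^ 2)) (pb t6 VY) = cst (inverse (- w) * - (w ^ 2)) * pb t6 VY"
      unfolding pb_t6 dF_monomial e1 e2 by simp_all
  qed (simp_all add: torus_map_t6)
qed

text \<open>The slope solves \<open>1 - \<i> * l = 0\<close>, and the companion slope is its
  conjugate. The pull-back of \<open>x\<close> is \<open>y\<close>, so the character equals the
  slope.\<close>

lemma toric_quotient_4: "toric_quotient (- \<i>) t4 (- \<i>) 4 \<i>"
proof -
  interpret irrational "- \<i>" by (rule irrational_nonreal) simp
  show ?thesis
  proof
    show "(t4 ^^ 4) p = p" if "p \<in> torus" for p
      using that by (auto simp: eval_nat_numeral t4_def torus_def)
    show "(- \<i>) ^ k \<noteq> 1" if "0 < k" "k < 4" for k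
    proof -
      have "k = 1 \<or> k = 2 \<or> k = 3" using that by auto
      then show ?thesis by (auto simp: eval_nat_numeral complex_eq_iff)
    qed
    show "dF (- \<i>) (pb t4 VX) = cst (- \<i>) * pb t4 VX" "dF \<i> (pb t4 VX) = cst (inverse (- \<i>)) * pb t4 VX"
     "dF (- \<i>) (pb t4 VY) = cst (- \<i> * - \<i>) * pb t4 VY" "dF \<i> (pb t4 VY) = cst (inverse (- \<i>) * \<i>) * pb t4 VY"
      unfolding pb_t4 dF_monomial by (simp_all add: cst_minus)
  qed (simp_all add: torus_map_t4 eval_nat_numeral complex_eq_iff)
qed

section \<open>Reduction of the monomial lift to finitely many diagonal maps\<close>

context foliated_automorphism
begin

text \<open>Powers of \<open>pb t\<close> act trivially on \<open>L\<close>. The lift may therefore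
  be precomposed with any of them, and one can be chosen that straightens the exponents.\<close>

lemma geometric_lift:
  assumes "ratfield_hom S" "\<forall>u\<in>L. S u = \<sigma> u"
    and "S ((pb t ^^ k) VX) = cst c * VX powi i * VY powi 0" "S ((pb t ^^ k) VY) = cst d * VX powi 0 * VY powi i"
    and "u \<in> L"
  shows "\<forall>\<^sub>F p in generic. evF (\<sigma> u) p = evF u (c * fst p powi i, d * snd p powi i)"
proof -
  interpret S: ratfield_hom S by fact
  have fp: "(pb t ^^ k) u = pb (t ^^ k) u" for u by (simp add: pb_funpow t)
  have t': "torus_map (t ^^ k)" by (rule torus_map_funpow[OF t])
  have "\<forall>\<^sub>F p in generic. evF (S ((pb t ^^ k) u)) p = evF u (c * fst p powi i, d * snd p powi i)"
  proof (rule hom_evF[where S = "\<lambda>u. S ((pb t ^^ k) u)"])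
    show "\<forall>\<^sub>F p in generic. evF (S ((pb t ^^ k) VX)) p = fst (c * fst p powi i, d * snd p powi i)"
      unfolding assms(3) using evF_mult[of "cst c" "VX powi i"] evF_powi[of VX i] by eventually_elim simp
    show "\<forall>\<^sub>F p in generic. evF (S ((pb t ^^ k) VY)) p = snd (c * fst p powi i, d * snd p powi i)"
      unfolding assms(4) using evF_mult[of "cst d" "VY powi i"] evF_powi[of VY i] by eventually_elim simp
  qed (simp_all add: fp pb_add[OF t'] pb_mult[OF t'] pb_cst[OF t'] S.hom_add S.hom_mult S.hom_cst)
  then show ?thesis using assms(2,5) by (simp add: L_funpow)
qed

end

text \<open>The quadratic form is the norm of \<open>i + l * j\<close> for \<open>l = - w\<close>,
  that is, the determinant of the exponent matrix. Completing the square,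
  \<open>4 * N = A + 3 * B\<close>, bounds \<open>j\<close>.\<close>

lemma eisenstein_units:
  fixes i j :: int
  assumes "\<bar>i * (i + j) + j * j\<bar> = 1"
  shows "(i, j) \<in> {(1, 0), (- 1, 0), (0, 1), (0, - 1), (1, - 1), (- 1, 1)}"
proof -
  define N A B where "N = i * (i + j) + j * j" and "A = (2 * i + j) * (2 * i + j)" and "B = j * j"
  have "4 * N = A + 3 * B" by (simp add: N_def A_def B_def algebra_simps)
  moreover have "0 \<le> A" "0 \<le> B" by (simp_all add: A_def B_def)
  moreover have "\<bar>N\<bar> = 1" using assms by (simp add: N_def)
  ultimately have "N = 1" "B < 2 * 2" by linarith+
  then have eq: "i * (i + j) + j * j = 1" and jj: "j * j < 2 * 2" by (simp_all add: N_def B_def)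
  have "\<bar>j\<bar> < 2"
  proof (rule ccontr)
    assume "\<not> \<bar>j\<bar> < 2"
    then have "2 * 2 \<le> \<bar>j\<bar> * \<bar>j\<bar>" by (intro mult_mono) auto
    then show False using jj by simp
  qed
  then consider "j = 0" | "j = 1" | "j = - 1" by linarith
  then show ?thesis
  proof cases
    case 1
    then have "i * i = 1" using eq by simp
    then show ?thesis using 1 by (auto simp: zmult_eq_1_iff)
  next
    case 2
    then have "i * (i + 1) = 0" using eq by simp
    then show ?thesis using 2 by auto
  next
    case 3
    then have "i * (i - 1) = 0" using eq by (simp add: algebra_simps)
    then show ?thesis using 3 by auto
  qed
qed

text \<open>For the slope \<open>- \<i>\<close> the determinant of the exponents is the norm of a
  Gaussian integer.\<close>

lemma gauss_units:
  fixes i j :: int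
  assumes "\<bar>i * i + j * j\<bar> = 1"
  shows "(i, j) \<in> {(1, 0), (- 1, 0), (0, 1), (0, - 1)}"
proof -
  have "0 \<le> i * i" "0 \<le> j * j" by simp_all
  then have "i * i + j * j = 1" using assms by linarith
  then have "i * i = 0 \<and> j * j = 1 \<or> i * i = 1 \<and> j * j = 0" using \<open>0 \<le> i * i\<close> \<open>0 \<le> j * j\<close> by linarith
  then show ?thesis by (auto simp: zmult_eq_1_iff)
qed

text \<open>Substituting \<open>w ^ 2 = - 1 - w\<close> and comparing coordinates in the basis
  \<open>1\<close>, \<open>- w\<close> identifies the exponents as the matrix of multiplication by
  the Eisenstein integer \<open>i - w * j\<close>.\<close>

lemma irrational_eisenstein:
  fixes w :: complex
  assumes w: "w ^ 3 = 1" "w \<noteq> 1" and "of_int k + (- w) * of_int m = (- w) * (of_int i + (- w) * of_int j)"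
  shows "k = - j \<and> m = i + j"
proof -
  interpret irrational "- w" by (rule irrational_nonreal) (simp add: cube_root_unity[OF w])
  have w2: "w * w = - 1 - w" using cube_root_unity(1)[OF w] by (simp add: power2_eq_square algebra_simps eq_neg_iff_add_eq_0)
  have "(- w) * (of_int i + (- w) * of_int j) = - w * of_int i + (w * w) * of_int j" by (simp add: algebra_simps)
  also have "\<dots> = - of_int j - w * of_int (i + j)" unfolding w2 by (simp add: algebra_simps)
  finally have "of_int k + (- w) * of_int m = - of_int j - w * of_int (i + j)" by (simp only: assms(3))
  then have "of_int (k + j) + (- w) * of_int (m - (i + j)) = 0" by (simp add: algebra_simps)
  from irr[OF this] show ?thesis by auto
qed

lemma irrational_gauss:
  assumes "of_int k + (- \<i>) * of_int m = (- \<i>) * (of_int i + (- \<i>) * of_int j)"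
  shows "k = - j \<and> m = i"
proof -
  interpret irrational "- \<i>" by (rule irrational_nonreal) simp
  have "(- \<i>) * (of_int i + (- \<i>) * of_int j) = - of_int j + (- \<i>) * of_int i" by (simp add: algebra_simps)
  then have "of_int (k + j) + (- \<i>) * of_int (m - i) = 0" using assms by (simp add: algebra_simps)
  from irr[OF this] show ?thesis by auto
qed

lemma pb_funpow_monomial:
  assumes "torus_map t" "\<And>p. p \<in> torus \<Longrightarrow> evF u ((t ^^ k) p) = c * fst p powi i * snd p powi j"
  shows "(pb t ^^ k) u = cst c * VX powi i * VY powi j"
  using pb_monomial[OF torus_map_funpow[OF assms(1)] assms(2)] by (simp add: pb_funpow assms(1))

text \<open>On exponents the powers act as multiplication by cube roots of unity;
  \<open>diagonal_onI\<close> picks the pair of rows that is inverse, up to sign, to the unit of the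
  lift.\<close>

lemma pb_t3_powers:
  "(pb t3 ^^ 0) VX = cst 1 * VX powi 1 * VY powi 0" "(pb t3 ^^ 0) VY = cst 1 * VX powi 0 * VY powi 1"
  "(pb t3 ^^ 1) VX = cst 1 * VX powi 0 * VY powi (- 1)" "(pb t3 ^^ 1) VY = cst 1 * VX powi 1 * VY powi (- 1)"
  "(pb t3 ^^ 2) VX = cst 1 * VX powi (- 1) * VY powi 1" "(pb t3 ^^ 2) VY = cst 1 * VX powi (- 1) * VY powi 0"
  by (intro pb_funpow_monomial torus_map_t3; auto simp: t3_def divide_inverse torus_def numeral_2_eq_2)+

lemma pb_t4_powers:
  "(pb t4 ^^ 0) VX = cst 1 * VX powi 1 * VY powi 0" "(pb t4 ^^ 0) VY = cst 1 * VX powi 0 * VY powi 1"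
  "(pb t4 ^^ 1) VX = cst 1 * VX powi 0 * VY powi 1" "(pb t4 ^^ 1) VY = cst 1 * VX powi (- 1) * VY powi 0"
  "(pb t4 ^^ 2) VX = cst 1 * VX powi (- 1) * VY powi 0" "(pb t4 ^^ 2) VY = cst 1 * VX powi 0 * VY powi (- 1)"
  "(pb t4 ^^ 3) VX = cst 1 * VX powi 0 * VY powi (- 1)" "(pb t4 ^^ 3) VY = cst 1 * VX powi 1 * VY powi 0"
  by (intro pb_funpow_monomial torus_map_t4; auto simp: t4_def divide_inverse torus_def eval_nat_numeral)+

lemma pb_t6_powers:
  "(pb t6 ^^ 0) VX = cst 1 * VX powi 1 * VY powi 0" "(pb t6 ^^ 0) VY = cst 1 * VX powi 0 * VY powi 1"
  "(pb t6 ^^ 1) VX = cst 1 * VX powi 0 * VY powi 1" "(pb t6 ^^ 1) VY = cst 1 * VX powi (- 1) * VY powi 1"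
  "(pb t6 ^^ 2) VX = cst 1 * VX powi (- 1) * VY powi 1" "(pb t6 ^^ 2) VY = cst 1 * VX powi (- 1) * VY powi 0"
  "(pb t6 ^^ 3) VX = cst 1 * VX powi (- 1) * VY powi 0" "(pb t6 ^^ 3) VY = cst 1 * VX powi 0 * VY powi (- 1)"
  "(pb t6 ^^ 4) VX = cst 1 * VX powi 0 * VY powi (- 1)" "(pb t6 ^^ 4) VY = cst 1 * VX powi 1 * VY powi (- 1)"
  "(pb t6 ^^ 5) VX = cst 1 * VX powi 1 * VY powi (- 1)" "(pb t6 ^^ 5) VY = cst 1 * VX powi 1 * VY powi 0"
  by (intro pb_funpow_monomial torus_map_t6; auto simp: t6_def torus_def eval_nat_numeral field_simps)+

definition diagonal_on :: "(ratfield \<Rightarrow> ratfield) \<Rightarrow> (complex \<times> complex \<Rightarrow> complex \<times> complex) \<Rightarrow> nat \<Rightarrow> int \<Rightarrow> complex \<Rightarrow> complex \<Rightarrow> bool" where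
  "diagonal_on S t p s c d \<longleftrightarrow> c \<noteq> 0 \<and> d \<noteq> 0 \<and> S ((pb t ^^ p) VX) = cst c * VX powi s * VY powi 0 \<and>
     S ((pb t ^^ p) VY) = cst d * VX powi 0 * VY powi s"

lemma diagonal_onI:
  assumes "ratfield_hom S" and S: "S VX = cst c * VX powi i * VY powi j" "S VY = cst d * VX powi k * VY powi m"
    and t: "(pb t ^^ p) VX = cst 1 * VX powi i' * VY powi j'" "(pb t ^^ p) VY = cst 1 * VX powi k' * VY powi m'"
    and nz: "c \<noteq> 0" "d \<noteq> 0"
    and e: "i * i' + k * j' = s" "j * i' + m * j' = 0" "i * k' + k * m' = 0" "j * k' + m * m' = s"
  shows "\<exists>c d. diagonal_on S t p s c d"
proof -
  interpret ratfield_hom S by fact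
  have "S ((pb t ^^ p) VX) = cst (1 * c powi i' * d powi j') * VX powi s * VY powi 0"
    unfolding t hom_monomial S monomial_comp e ..
  moreover have "S ((pb t ^^ p) VY) = cst (1 * c powi k' * d powi m') * VX powi 0 * VY powi s"
    unfolding t hom_monomial S monomial_comp e ..
  moreover have "1 * c powi i' * d powi j' \<noteq> 0" "1 * c powi k' * d powi m' \<noteq> 0" using nz by simp_all
  ultimately show ?thesis unfolding diagonal_on_def by blast
qed

text \<open>Commutation with \<open>pb t\<close>, read on the coefficients of the monomials, says
  that the point \<open>(c, d)\<close> is fixed by the monomial map of the torus.\<close>

lemma diagonal_on_commute:
  assumes "irrational l" "ratfield_hom S" "torus_map t" "\<And>u. S (pb t u) = pb t (S u)" and "diagonal_on S t p s c d"
    and t: "pb t VX = cst 1 * VX powi i * VY powi j" "pb t VY = cst 1 * VX powi k * VY powi m"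
  shows "c powi i * d powi j = c" "c powi k * d powi m = d"
proof -
  interpret irrational l by fact
  interpret T: ratfield_hom "pb t" by (rule ratfield_hom_pb) fact
  have Tp: "ratfield_hom (pb t ^^ p)"
    using ratfield_hom_pb[OF torus_map_funpow[OF assms(3), of p]] pb_funpow[OF assms(3), of p] 
    by (simp add: ratfield_hom_def)
  interpret S: ratfield_hom "\<lambda>u. S ((pb t ^^ p) u)" by (rule ratfield_hom_comp[OF assms(2) Tp])
  have comm: "S ((pb t ^^ p) (pb t u)) = pb t (S ((pb t ^^ p) u))" for u
    by (metis assms(4) funpow_swap1)
  have S: "S ((pb t ^^ p) VX) = cst c * VX powi s * VY powi 0" "S ((pb t ^^ p) VY) = cst d * VX powi 0 * VY powi s"
     and nz: "c \<noteq> 0" "d \<noteq> 0"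
    using assms(5) by (auto simp: diagonal_on_def)
  have "cst (1 * c powi i * d powi j) * VX powi (s * i + 0 * j) * VY powi (0 * i + s * j)
      = cst (c * 1 powi s * 1 powi 0) * VX powi (i * s + k * 0) * VY powi (j * s + m * 0)"
    using comm[of VX] unfolding t(1) S.hom_monomial unfolding S T.hom_monomial unfolding t monomial_comp .
  from monomial_inject[OF _ this] nz show "c powi i * d powi j = c" by simp
  have "cst (1 * c powi k * d powi m) * VX powi (s * k + 0 * m) * VY powi (0 * k + s * m)
      = cst (d * 1 powi 0 * 1 powi s) * VX powi (i * 0 + k * s) * VY powi (j * 0 + m * s)"
    using comm[of VY] unfolding t(2) S.hom_monomial unfolding S T.hom_monomial unfolding t monomial_comp .
  from monomial_inject[OF _ this] nz show "c powi k * d powi m = d" by simp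
qed

lemma (in foliated_automorphism) diagonal_on_evF:
  assumes "ratfield_hom S" "\<forall>u\<in>L. S u = \<sigma> u" "diagonal_on S t p s c d" "u \<in> L"
  shows "\<forall>\<^sub>F q in generic. evF (\<sigma> u) q = evF u (c * fst q powi s, d * snd q powi s)"
  using geometric_lift[OF assms(1,2) _ _ assms(4)] assms(3) unfolding diagonal_on_def by blast

text \<open>Up to sign the six Eisenstein units are the powers of the unit of \<open>t3\<close>, so
  the exponent can be brought to \<open>1\<close> or \<open>- 1\<close>. The fixed points of
  \<open>t3\<close> in the torus are the \<open>(c, c ^ 2)\<close> with
  \<open>c ^ 3 = 1\<close>.\<close>

lemma foliated_automorphism_3:
  assumes w: "w ^ 3 = 1" "w \<noteq> 1" and fa: "foliated_automorphism (- w) t3 w 3 (- (w ^ 2)) \<sigma> D f0 g u0"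
  shows "\<exists>c s. c ^ 3 = 1 \<and> (s = 1 \<or> s = - 1) \<and> (\<forall>u. pb t3 u = u \<longrightarrow>
    (\<forall>\<^sub>F p in generic. evF (\<sigma> u) p = evF u (c * fst p powi s, c ^ 2 * snd p powi s)))"
proof -
  interpret foliated_automorphism "- w" t3 w 3 "- (w ^ 2)" \<sigma> D f0 g u0 by fact
  obtain S c i j d k m where S: "ratfield_hom S" "\<forall>u\<in>L. S u = \<sigma> u" "\<And>u. S (pb t3 u) = pb t3 (S u)"
     "c \<noteq> 0" "d \<noteq> 0" and XY: "S VX = cst c * VX powi i * VY powi j" "S VY = cst d * VX powi k * VY powi m"
     and "of_int k + (- w) * of_int m = (- w) * (of_int i + (- w) * of_int j)" and det: "\<bar>i * m - j * k\<bar> = 1"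
    using monomial_lift by blast
  then have km: "k = - j" "m = i + j" using irrational_eisenstein[OF w] by blast+
  have "(i, j) \<in> {(1, 0), (- 1, 0), (0, 1), (0, - 1), (1, - 1), (- 1, 1)}"
    using det by (intro eisenstein_units) (simp add: km)
  then have "(\<exists>c d. diagonal_on S t3 0 1 c d) \<or> (\<exists>c d. diagonal_on S t3 0 (- 1) c d) \<or>
      (\<exists>c d. diagonal_on S t3 1 1 c d) \<or> (\<exists>c d. diagonal_on S t3 1 (- 1) c d) \<or>
      (\<exists>c d. diagonal_on S t3 2 1 c d) \<or> (\<exists>c d. diagonal_on S t3 2 (- 1) c d)"
    using diagonal_onI[OF S(1) XY pb_t3_powers(1,2) S(4,5), of 1]
      diagonal_onI[OF S(1) XY pb_t3_powers(1,2) S(4,5), of "- 1"]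
      diagonal_onI[OF S(1) XY pb_t3_powers(3,4) S(4,5), of 1]
      diagonal_onI[OF S(1) XY pb_t3_powers(3,4) S(4,5), of "- 1"]
      diagonal_onI[OF S(1) XY pb_t3_powers(5,6) S(4,5), of 1]
      diagonal_onI[OF S(1) XY pb_t3_powers(5,6) S(4,5), of "- 1"]
    unfolding km by auto
  then have "\<exists>p s c d. (s = 1 \<or> s = - 1) \<and> diagonal_on S t3 p s c d" by blast
  then obtain p s c d where s: "s = 1 \<or> s = - 1" and diag: "diagonal_on S t3 p s c d" by blast
  note cd = diagonal_on_commute[OF irrational_axioms S(1) torus_map_t3 S(3) diag pb_t3]
  have nz: "c \<noteq> 0" "d \<noteq> 0" using diag by (auto simp: diagonal_on_def)
  have 1: "inverse d = c" using cd(1) by simp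
  have "c * c = d" using cd(2) by (simp add: 1)
  then have "c ^ 2 = d" by (simp add: power2_eq_square)
  moreover have "c ^ 3 = d * inverse d" unfolding 1 using \<open>c * c = d\<close> by (simp add: power3_eq_cube)
  then have "c ^ 3 = 1" using nz by simp
  ultimately show ?thesis using s diagonal_on_evF[OF S(1,2) diag] unfolding L_iff by blast
qed

text \<open>All four Gaussian units come from powers of \<open>t4\<close>, so the exponent becomes
  \<open>1\<close>; the fixed points of \<open>t4\<close> in the torus are \<open>(1, 1)\<close> and
  \<open>(- 1, - 1)\<close>.\<close>

lemma foliated_automorphism_4:
  assumes fa: "foliated_automorphism (- \<i>) t4 (- \<i>) 4 \<i> \<sigma> D f0 g u0"
  shows "\<exists>c. (c = 1 \<or> c = - 1) \<and> (\<forall>u. pb t4 u = u \<longrightarrow>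
    (\<forall>\<^sub>F p in generic. evF (\<sigma> u) p = evF u (c * fst p, c * snd p)))"
proof -
  interpret foliated_automorphism "- \<i>" t4 "- \<i>" 4 \<i> \<sigma> D f0 g u0 by fact
  obtain S c i j d k m where S: "ratfield_hom S" "\<forall>u\<in>L. S u = \<sigma> u" "\<And>u. S (pb t4 u) = pb t4 (S u)"
     "c \<noteq> 0" "d \<noteq> 0" and XY: "S VX = cst c * VX powi i * VY powi j" "S VY = cst d * VX powi k * VY powi m"
     and "of_int k + (- \<i>) * of_int m = (- \<i>) * (of_int i + (- \<i>) * of_int j)" and det: "\<bar>i * m - j * k\<bar> = 1"
    using monomial_lift by blast
  then have km: "k = - j" "m = i" using irrational_gauss by blast+
  have "(i, j) \<in> {(1, 0), (- 1, 0), (0, 1), (0, - 1)}"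
    using det by (intro gauss_units) (simp add: km)
  then have "\<exists>p c d. diagonal_on S t4 p 1 c d"
    using diagonal_onI[OF S(1) XY pb_t4_powers(1,2) S(4,5), of 1]
      diagonal_onI[OF S(1) XY pb_t4_powers(3,4) S(4,5), of 1]
      diagonal_onI[OF S(1) XY pb_t4_powers(5,6) S(4,5), of 1]
      diagonal_onI[OF S(1) XY pb_t4_powers(7,8) S(4,5), of 1]
    unfolding km by auto
  then obtain p c d where diag: "diagonal_on S t4 p 1 c d" by blast
  note cd = diagonal_on_commute[OF irrational_axioms S(1) torus_map_t4 S(3) diag pb_t4]
  have nz: "c \<noteq> 0" using diag by (auto simp: diagonal_on_def)
  have 1: "d = c" "inverse c = d" using cd by simp_all
  then have "c * c = c * inverse c" by simp
  then have "c * c = 1" using nz by simp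
  then have "c = 1 \<or> c = - 1" using square_eq_1_iff by blast
  then show ?thesis using 1 diagonal_on_evF[OF S(1,2) diag] L_iff by (intro exI[of _ c]) simp
qed

text \<open>All six Eisenstein units come from powers of \<open>t6\<close>, and
  \<open>(1, 1)\<close> is its only fixed point in the torus; so nothing but the identity remains on
  the invariants.\<close>

lemma foliated_automorphism_6:
  assumes w: "w ^ 3 = 1" "w \<noteq> 1" and fa: "foliated_automorphism (- w) t6 (- w) 6 (- (w ^ 2)) \<sigma> D f0 g u0"
    and u: "pb t6 u = u"
  shows "\<forall>\<^sub>F p in generic. evF (\<sigma> u) p = evF u p"
proof -
  interpret foliated_automorphism "- w" t6 "- w" 6 "- (w ^ 2)" \<sigma> D f0 g u0 by fact
  obtain S c i j d k m where S: "ratfield_hom S" "\<forall>u\<in>L. S u = \<sigma> u" "\<And>u. S (pb t6 u) = pb t6 (S u)"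
     "c \<noteq> 0" "d \<noteq> 0" and XY: "S VX = cst c * VX powi i * VY powi j" "S VY = cst d * VX powi k * VY powi m"
     and "of_int k + (- w) * of_int m = (- w) * (of_int i + (- w) * of_int j)" and det: "\<bar>i * m - j * k\<bar> = 1"
    using monomial_lift by blast
  then have km: "k = - j" "m = i + j" using irrational_eisenstein[OF w] by blast+
  have "(i, j) \<in> {(1, 0), (- 1, 0), (0, 1), (0, - 1), (1, - 1), (- 1, 1)}"
    using det by (intro eisenstein_units) (simp add: km)
  then have "\<exists>p c d. diagonal_on S t6 p 1 c d"
    using diagonal_onI[OF S(1) XY pb_t6_powers(1,2) S(4,5), of 1]
      diagonal_onI[OF S(1) XY pb_t6_powers(3,4) S(4,5), of 1]
      diagonal_onI[OF S(1) XY pb_t6_powers(5,6) S(4,5), of 1]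
      diagonal_onI[OF S(1) XY pb_t6_powers(7,8) S(4,5), of 1]
      diagonal_onI[OF S(1) XY pb_t6_powers(9,10) S(4,5), of 1]
      diagonal_onI[OF S(1) XY pb_t6_powers(11,12) S(4,5), of 1]
    unfolding km by auto
  then obtain p c d where diag: "diagonal_on S t6 p 1 c d" by blast
  note cd = diagonal_on_commute[OF irrational_axioms S(1) torus_map_t6 S(3) diag pb_t6]
  have nz: "c \<noteq> 0" "d \<noteq> 0" using diag by (auto simp: diagonal_on_def)
  have "d = c" "inverse c * d = d" using cd by simp_all
  then have "c = 1" "d = 1" using nz by auto
  then show ?thesis using diagonal_on_evF[OF S(1,2) diag] L_iff u by simp
qed

subsection \<open>Spaces with functions parametrized by generic points\<close>

text \<open>The second clause makes precise that values outside the open set are junk.\<close>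

definition presheaf :: "'a fspace \<Rightarrow> bool" where
  "presheaf Y \<longleftrightarrow> (\<forall>U V f. openin (tp Y) V \<and> V \<subseteq> U \<and> f \<in> rg Y U \<longrightarrow> f \<in> rg Y V) \<and>
     (\<forall>U f g. f \<in> rg Y U \<and> (\<forall>x\<in>U. f x = g x) \<longrightarrow> g \<in> rg Y U)"

lemma presheaf_restrict: "presheaf Y \<Longrightarrow> f \<in> rg Y U \<Longrightarrow> openin (tp Y) V \<Longrightarrow> V \<subseteq> U \<Longrightarrow> f \<in> rg Y V"
  unfolding presheaf_def by blast

lemma presheaf_cong: "presheaf Y \<Longrightarrow> f \<in> rg Y U \<Longrightarrow> (\<And>x. x \<in> U \<Longrightarrow> f x = g x) \<Longrightarrow> g \<in> rg Y U"
  unfolding presheaf_def by blast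

lemma pts_open_sub [simp]: "pts (open_sub X U) = pts X \<inter> U"
  by (simp add: open_sub_def)

lemma tp_open_sub [simp]: "tp (open_sub X U) = subtopology (tp X) U"
  by (simp add: open_sub_def)

lemma rg_open_sub [simp]: "rg (open_sub X U) = rg X"
  by (simp add: open_sub_def)

lemma morphism_rg:
  "morphism X Y f \<Longrightarrow> openin (tp Y) V \<Longrightarrow> g \<in> rg Y V \<Longrightarrow> g \<circ> f \<in> rg X (pts X \<inter> f -` V)"
  by (simp add: morphism_def)

lemma morphism_into_space:
  assumes "presheaf Y" "openin (tp Y) V" "openin (tp X) U" and f: "morphism (open_sub X U) (open_sub Y V) f"
  shows "morphism (open_sub X U) Y f"
  unfolding morphism_def
proof (intro conjI allI impI)
  show "continuous_map (tp (open_sub X U)) (tp Y) f"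
    using f by (simp add: morphism_def continuous_map_in_subtopology)
  fix W g assume W: "openin (tp Y) W \<and> g \<in> rg Y W"
  have img: "f x \<in> V" if "x \<in> pts (open_sub X U)" for x
    using f that by (auto simp: morphism_def continuous_map_in_subtopology)
  have "openin (subtopology (tp Y) V) (W \<inter> V)" using W by (auto simp: openin_subtopology)
  moreover have "g \<in> rg Y (W \<inter> V)"
    by (rule presheaf_restrict[OF assms(1), of _ W]) (use W assms(2) in auto)
  ultimately have "g \<circ> f \<in> rg X (pts (open_sub X U) \<inter> f -` (W \<inter> V))"
    using morphism_rg[OF f, of "W \<inter> V" g] by (simp del: vimage_Int)
  moreover have "pts (open_sub X U) \<inter> f -` (W \<inter> V) = pts (open_sub X U) \<inter> f -` W" using img by auto
  ultimately show "g \<circ> f \<in> rg (open_sub X U) (pts (open_sub X U) \<inter> f -` W)" by simp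
qed

definition birat :: "'a fspace \<Rightarrow> 'a set \<Rightarrow> 'a set \<Rightarrow> ('a \<Rightarrow> 'a) \<Rightarrow> bool" where
  "birat X U V f \<longleftrightarrow> nopen X U \<and> nopen X V \<and> isomorphism (open_sub X U) (open_sub X V) f"

text \<open>\<open>\<rho>\<close> is a generic parametrization of \<open>Y\<close> by the plane that
  identifies its function field with \<open>L\<close>. It need not be injective: for a quotient it
  sends a point to its orbit. \<open>filter\<close> matches nonempty open sets of \<open>Y\<close>
  with general points of the plane, in both directions.\<close>

locale model =
  fixes Y :: "'a fspace" and \<rho> :: "complex \<times> complex \<Rightarrow> 'a" and L :: "ratfield set"
  assumes presheaf: "presheaf Y"
    and filter: "(\<exists>W. nopen Y W \<and> (\<forall>y\<in>W. \<phi> y)) \<longleftrightarrow> (\<forall>\<^sub>F q in generic. \<phi> (\<rho> q))"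
    and regular: "nopen Y U \<Longrightarrow> f \<in> rg Y U \<Longrightarrow> \<exists>R\<in>L. \<forall>\<^sub>F q in generic. f (\<rho> q) = evF R q"
    and representable: "R \<in> L \<Longrightarrow> \<exists>U f. nopen Y U \<and> f \<in> rg Y U \<and> (\<forall>\<^sub>F q in generic. f (\<rho> q) = evF R q)"
    and L_cst: "cst c \<in> L" and L_add: "R \<in> L \<Longrightarrow> S \<in> L \<Longrightarrow> R + S \<in> L"
    and L_mult: "R \<in> L \<Longrightarrow> S \<in> L \<Longrightarrow> R * S \<in> L" and L_inverse: "R \<in> L \<Longrightarrow> inverse R \<in> L"
begin

lemma nopen_generic: "nopen Y W \<Longrightarrow> \<forall>\<^sub>F q in generic. \<rho> q \<in> W"
  using filter[of "\<lambda>y. y \<in> W"] by blast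

lemma generic_nopen: "\<forall>\<^sub>F q in generic. \<phi> (\<rho> q) \<Longrightarrow> \<exists>W. nopen Y W \<and> (\<forall>y\<in>W. \<phi> y)"
  using filter[of \<phi>] by blast

text \<open>Irreducibility of \<open>Y\<close>: both open sets contain the images of general
  points.\<close>

lemma nopen_Int:
  assumes "nopen Y U" "nopen Y V"
  shows "nopen Y (U \<inter> V)"
proof -
  have "\<forall>\<^sub>F q in generic. \<rho> q \<in> U \<inter> V"
    using nopen_generic[OF assms(1)] nopen_generic[OF assms(2)] by eventually_elim simp
  then obtain q where "\<rho> q \<in> U \<inter> V" by (rule eventually_generic_ex)
  then show ?thesis using assms by (auto simp: nopen_def)
qed

lemma L_0: "0 \<in> L" and L_1: "1 \<in> L"
  using L_cst[of 0] L_cst[of 1] by (simp_all add: cst_simps)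

lemma nopen_pts: "nopen Y (pts Y)"
proof -
  obtain U where "nopen Y U" using representable[OF L_0] by blast
  then show ?thesis using openin_subset by (fastforce simp: nopen_def)
qed

lemma generic_pts: "\<forall>\<^sub>F q in generic. \<rho> q \<in> pts Y"
  by (rule nopen_generic[OF nopen_pts])

definition cl :: "ratfield \<Rightarrow> 'a ratfun" where
  "cl R = {(V, g). nopen Y V \<and> g \<in> rg Y V \<and> (\<forall>\<^sub>F q in generic. g (\<rho> q) = evF R q)}"

lemma clD: "(V, g) \<in> cl R \<Longrightarrow> nopen Y V \<and> g \<in> rg Y V \<and> (\<forall>\<^sub>F q in generic. g (\<rho> q) = evF R q)"
  by (simp add: cl_def)

text \<open>Agreement on some nonempty open set is the same as agreement at general points. From
  here on classes of functions and of maps are handled through the filter.\<close>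

lemma gcls_eq:
  assumes U: "\<forall>\<^sub>F q in generic. \<rho> q \<in> U"
  shows "gcls Y S U f = {(V, g). nopen Y V \<and> g \<in> S V \<and> (\<forall>\<^sub>F q in generic. f (\<rho> q) = g (\<rho> q))}"
proof -
  have "(\<exists>W. nopen Y W \<and> W \<subseteq> U \<inter> V \<and> (\<forall>x\<in>W. f x = g x)) \<longleftrightarrow> (\<forall>\<^sub>F q in generic. f (\<rho> q) = g (\<rho> q))"
    if "nopen Y V" for V and g :: "'a \<Rightarrow> 'b"
  proof -
    have "(\<exists>W. nopen Y W \<and> W \<subseteq> U \<inter> V \<and> (\<forall>x\<in>W. f x = g x)) \<longleftrightarrow>
        (\<exists>W. nopen Y W \<and> (\<forall>x\<in>W. x \<in> U \<and> x \<in> V \<and> f x = g x))" by blast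
    also have "\<dots> \<longleftrightarrow> (\<forall>\<^sub>F q in generic. \<rho> q \<in> U \<and> \<rho> q \<in> V \<and> f (\<rho> q) = g (\<rho> q))" by (rule filter)
    also have "\<dots> \<longleftrightarrow> (\<forall>\<^sub>F q in generic. f (\<rho> q) = g (\<rho> q))"
      using U nopen_generic[OF that] by (simp add: eventually_conj_iff)
    finally show ?thesis .
  qed
  then show ?thesis unfolding gcls_def by blast
qed

lemma rcls_eq:
  assumes "\<forall>\<^sub>F q in generic. \<rho> q \<in> U" and f: "\<forall>\<^sub>F q in generic. f (\<rho> q) = evF R q"
  shows "rcls Y U f = cl R"
proof -
  have "(\<forall>\<^sub>F q in generic. f (\<rho> q) = g (\<rho> q)) \<longleftrightarrow> (\<forall>\<^sub>F q in generic. g (\<rho> q) = evF R q)" for g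
    by (rule eventually_subst) (use f in \<open>eventually_elim, auto\<close>)
  then show ?thesis unfolding gcls_eq[OF assms(1)] cl_def by simp
qed

lemma cl_nonempty: "R \<in> L \<Longrightarrow> \<exists>V g. (V, g) \<in> cl R"
  using representable by (simp add: cl_def)

lemma cl_inject: "cl R = cl S \<Longrightarrow> R \<in> L \<Longrightarrow> R = S"
proof (rule evF_eqI)
  assume "cl R = cl S" "R \<in> L"
  then obtain V g where "(V, g) \<in> cl R" "(V, g) \<in> cl S" using cl_nonempty by blast
  then have "\<forall>\<^sub>F q in generic. g (\<rho> q) = evF R q" "\<forall>\<^sub>F q in generic. g (\<rho> q) = evF S q"
    using clD by blast+
  then show "\<forall>\<^sub>F q in generic. evF R q = evF S q" by eventually_elim simp
qed

lemma carrier_ffield: "carrier (ffield Y) = cl ` L"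
proof (intro equalityI subsetI)
  fix A assume "A \<in> carrier (ffield Y)"
  then obtain U f where A: "A = rcls Y U f" "nopen Y U" "f \<in> rg Y U" by (auto simp: ffield_def)
  then obtain R where "R \<in> L" "\<forall>\<^sub>F q in generic. f (\<rho> q) = evF R q" using regular by blast
  then show "A \<in> cl ` L" using rcls_eq[OF nopen_generic[OF A(2)]] A by blast
next
  fix A assume "A \<in> cl ` L"
  then obtain R where R: "R \<in> L" "A = cl R" by blast
  then obtain U f where f: "nopen Y U" "f \<in> rg Y U" "\<forall>\<^sub>F q in generic. f (\<rho> q) = evF R q"
    using representable by blast
  then show "A \<in> carrier (ffield Y)"
    using rcls_eq[OF nopen_generic[OF f(1)] f(3)] R by (auto simp: ffield_def)
qed

lemma Union_cl:
  assumes "R \<in> L" "S \<in> L" and "\<And>U f V g. (U, f) \<in> cl R \<Longrightarrow> (V, g) \<in> cl S \<Longrightarrow> F U f V g = B"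
  shows "(\<Union>(U, f)\<in>cl R. \<Union>(V, g)\<in>cl S. F U f V g) = B"
  using cl_nonempty[OF assms(1)] cl_nonempty[OF assms(2)] assms(3) by fastforce

lemma ffield_mult: "R \<in> L \<Longrightarrow> S \<in> L \<Longrightarrow> cl R \<otimes>\<^bsub>ffield Y\<^esub> cl S = cl (R * S)"
  unfolding ffield_def monoid.simps ring.simps
proof (rule Union_cl)
  fix U f V g assume "(U, f) \<in> cl R" "(V, g) \<in> cl S"
  note 1 = clD[OF this(1)] and 2 = clD[OF this(2)]
  show "rcls Y (U \<inter> V) (\<lambda>x. f x * g x) = cl (R * S)"
  proof (rule rcls_eq)
    show "\<forall>\<^sub>F q in generic. \<rho> q \<in> U \<inter> V" by (rule nopen_generic[OF nopen_Int]) (use 1 2 in auto)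
    show "\<forall>\<^sub>F q in generic. f (\<rho> q) * g (\<rho> q) = evF (R * S) q"
      using 1[THEN conjunct2, THEN conjunct2] 2[THEN conjunct2, THEN conjunct2] evF_mult[of R S]
      by eventually_elim simp
  qed
qed

lemma ffield_add: "R \<in> L \<Longrightarrow> S \<in> L \<Longrightarrow> cl R \<oplus>\<^bsub>ffield Y\<^esub> cl S = cl (R + S)"
  unfolding ffield_def monoid.simps ring.simps
proof (rule Union_cl)
  fix U f V g assume "(U, f) \<in> cl R" "(V, g) \<in> cl S"
  note 1 = clD[OF this(1)] and 2 = clD[OF this(2)]
  show "rcls Y (U \<inter> V) (\<lambda>x. f x + g x) = cl (R + S)"
  proof (rule rcls_eq)
    show "\<forall>\<^sub>F q in generic. \<rho> q \<in> U \<inter> V" by (rule nopen_generic[OF nopen_Int]) (use 1 2 in auto)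
    show "\<forall>\<^sub>F q in generic. f (\<rho> q) + g (\<rho> q) = evF (R + S) q"
      using 1[THEN conjunct2, THEN conjunct2] 2[THEN conjunct2, THEN conjunct2] evF_add[of R S]
      by eventually_elim simp
  qed
qed

lemma rconst_eq: "rconst Y c = cl (cst c)"
  unfolding rconst_def by (rule rcls_eq[OF generic_pts]) simp

lemma ffield_zero: "\<zero>\<^bsub>ffield Y\<^esub> = cl 0"
  using rconst_eq[of 0] by (simp add: ffield_def cst_simps)

lemma rvfields_derivation:
  assumes D: "D \<in> rvfields Y"
  shows "\<exists>d. (\<forall>R\<in>L. d R \<in> L \<and> D (cl R) = cl (d R)) \<and> (\<forall>R\<in>L. \<forall>S\<in>L. d (R + S) = d R + d S) \<and>
     (\<forall>R\<in>L. \<forall>S\<in>L. d (R * S) = d R * S + R * d S) \<and> (\<forall>c. d (cst c) = 0)"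
proof -
  have "\<exists>S. S \<in> L \<and> D (cl R) = cl S" if "R \<in> L" for R
    using D that unfolding rvfields_def carrier_ffield by (auto simp: PiE_def Pi_def)
  then obtain d where d: "\<And>R. R \<in> L \<Longrightarrow> d R \<in> L \<and> D (cl R) = cl (d R)" by metis
  have add: "d (R + S) = d R + d S" if "R \<in> L" "S \<in> L" for R S
  proof -
    have "D (cl R \<oplus>\<^bsub>ffield Y\<^esub> cl S) = D (cl R) \<oplus>\<^bsub>ffield Y\<^esub> D (cl S)"
      using D that unfolding rvfields_def carrier_ffield by blast
    then have "cl (d (R + S)) = cl (d R + d S)" using that d by (simp add: ffield_add L_add)
    then show ?thesis by (rule cl_inject) (simp add: d L_add that)
  qed
  have mult: "d (R * S) = d R * S + R * d S" if "R \<in> L" "S \<in> L" for R S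
  proof -
    have "D (cl R \<otimes>\<^bsub>ffield Y\<^esub> cl S) = (D (cl R) \<otimes>\<^bsub>ffield Y\<^esub> cl S) \<oplus>\<^bsub>ffield Y\<^esub> (cl R \<otimes>\<^bsub>ffield Y\<^esub> D (cl S))"
      using D that unfolding rvfields_def carrier_ffield by blast
    then have "cl (d (R * S)) = cl (d R * S + R * d S)" using that d by (simp add: ffield_add ffield_mult L_add L_mult)
    then show ?thesis by (rule cl_inject) (simp add: d L_mult that)
  qed
  have "d (cst c) = 0" for c
  proof -
    have "D (rconst Y c) = \<zero>\<^bsub>ffield Y\<^esub>" using D unfolding rvfields_def by blast
    then have "cl (d (cst c)) = cl 0" using d[OF L_cst] by (simp add: rconst_eq ffield_zero)
    then show ?thesis by (rule cl_inject) (simp add: d L_cst)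
  qed
  then show ?thesis using d add mult by blast
qed

subsection \<open>The group of birational maps\<close>

definition gm :: "('a \<Rightarrow> 'a) \<Rightarrow> 'a ratmap" where
  "gm f = {(V, g). nopen Y V \<and> morphism (open_sub Y V) Y g \<and> (\<forall>\<^sub>F q in generic. f (\<rho> q) = g (\<rho> q))}"

lemma mcls_eq: "\<forall>\<^sub>F q in generic. \<rho> q \<in> U \<Longrightarrow> mcls Y U f = gm f"
  by (simp add: gcls_eq gm_def)

lemma gm_cong:
  assumes "\<forall>\<^sub>F q in generic. f (\<rho> q) = g (\<rho> q)"
  shows "gm f = gm g"
proof -
  have "(\<forall>\<^sub>F q in generic. f (\<rho> q) = h (\<rho> q)) \<longleftrightarrow> (\<forall>\<^sub>F q in generic. g (\<rho> q) = h (\<rho> q))" for h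
    by (rule eventually_subst) (use assms in \<open>eventually_elim, auto\<close>)
  then show ?thesis by (simp add: gm_def)
qed

lemma birat_morphism: "birat Y U V f \<Longrightarrow> morphism (open_sub Y U) Y f"
  by (rule morphism_into_space[OF presheaf, where V = V]) (auto simp: birat_def isomorphism_def nopen_def)

lemma birat_in_gm: "birat Y U V f \<Longrightarrow> (U, f) \<in> gm f"
  using birat_morphism by (auto simp: gm_def birat_def)

lemma gm_eqD: "birat Y U V f \<Longrightarrow> gm f = gm g \<Longrightarrow> \<forall>\<^sub>F q in generic. f (\<rho> q) = g (\<rho> q)"
  using birat_in_gm[of U V f] by (auto simp: gm_def eq_commute)

lemma birat_preimage:
  assumes f: "birat Y U V f" and W: "nopen Y W"
  shows "nopen Y (U \<inter> f -` W)"
proof -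
  have UV: "openin (tp Y) U" "openin (tp Y) V" using f by (auto simp: birat_def nopen_def)
  have sub: "U \<subseteq> pts Y" "V \<subseteq> pts Y" using UV openin_subset by auto
  obtain g where g: "morphism (open_sub Y U) (open_sub Y V) f" "morphism (open_sub Y V) (open_sub Y U) g" "\<forall>y\<in>pts (open_sub Y V). f (g y) = y"
    using f unfolding birat_def isomorphism_def by blast
  obtain y where y: "y \<in> W \<inter> V" using nopen_Int[OF W, of V] f by (auto simp: birat_def nopen_def)
  have "g y \<in> U" using g(2) y sub by (auto simp: morphism_def continuous_map_def)
  moreover have "f (g y) = y" using g(3) y sub by auto
  ultimately have ne: "U \<inter> f -` W \<noteq> {}" using y by auto
  have "continuous_map (subtopology (tp Y) U) (tp Y) f"
    using birat_morphism[OF f] by (simp add: morphism_def)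
  then have "openin (subtopology (tp Y) U) {x \<in> topspace (subtopology (tp Y) U). f x \<in> W}"
    using W openin_continuous_map_preimage by (fastforce simp: nopen_def)
  moreover have "{x \<in> topspace (subtopology (tp Y) U). f x \<in> W} = U \<inter> f -` W" using sub by auto
  ultimately have "openin (tp Y) (U \<inter> f -` W)" using UV openin_trans_full by metis
  then show ?thesis using ne by (simp add: nopen_def)
qed

text \<open>Nonempty open sets have nonempty open preimages under a birational map, so general
  points stay general.\<close>

lemma birat_generic:
  assumes f: "birat Y U V f" and \<phi>: "\<forall>\<^sub>F q in generic. \<phi> (\<rho> q)"
  shows "\<forall>\<^sub>F q in generic. \<phi> (f (\<rho> q))"
proof -
  obtain W where W: "nopen Y W" "\<forall>y\<in>W. \<phi> y" using generic_nopen[OF \<phi>] by blast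
  from nopen_generic[OF birat_preimage[OF f W(1)]] show ?thesis by eventually_elim (use W in auto)
qed

lemma birat_id: "birat Y (pts Y) (pts Y) id"
proof -
  have "morphism (open_sub Y (pts Y)) (open_sub Y (pts Y)) id"
    unfolding morphism_def
  proof (intro conjI allI impI)
    fix V g assume "openin (tp (open_sub Y (pts Y))) V \<and> g \<in> rg (open_sub Y (pts Y)) V"
    then have "V \<subseteq> pts Y" "g \<in> rg Y V" using openin_subset by (auto simp: subtopology_topspace)
    then show "g \<circ> id \<in> rg (open_sub Y (pts Y)) (pts (open_sub Y (pts Y)) \<inter> id -` V)"
      by (simp add: Int_absorb1)
  qed simp
  then show ?thesis unfolding birat_def isomorphism_def using nopen_pts by (auto intro!: exI[of _ id])
qed

lemma isomorphism_inverse: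
  assumes "isomorphism A B f"
  shows "\<exists>g. isomorphism B A g \<and> (\<forall>x\<in>pts A. g (f x) = x) \<and> (\<forall>y\<in>pts B. f (g y) = y)"
  using assms unfolding isomorphism_def by blast

lemma birat_inverse:
  assumes f: "birat Y U V f"
  obtains g where "birat Y V U g" "\<forall>\<^sub>F q in generic. g (f (\<rho> q)) = \<rho> q" "\<forall>\<^sub>F q in generic. f (g (\<rho> q)) = \<rho> q"
proof -
  obtain g where g: "isomorphism (open_sub Y V) (open_sub Y U) g"
      "\<forall>x\<in>pts (open_sub Y U). g (f x) = x" "\<forall>y\<in>pts (open_sub Y V). f (g y) = y"
    using f isomorphism_inverse unfolding birat_def by blast
  have sub: "U \<subseteq> pts Y" "V \<subseteq> pts Y" using f openin_subset by (auto simp: birat_def nopen_def)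
  have U: "\<forall>\<^sub>F q in generic. \<rho> q \<in> U" and V: "\<forall>\<^sub>F q in generic. \<rho> q \<in> V"
    using nopen_generic f by (auto simp: birat_def)
  show ?thesis
  proof
    show "birat Y V U g" using f g by (simp add: birat_def)
    show "\<forall>\<^sub>F q in generic. g (f (\<rho> q)) = \<rho> q" using U by eventually_elim (use g sub in auto)
    show "\<forall>\<^sub>F q in generic. f (g (\<rho> q)) = \<rho> q" using V by eventually_elim (use g sub in auto)
  qed
qed

end

section \<open>Restriction and composition of morphisms and isomorphisms\<close>

lemma morphism_restrict:
  assumes f: "morphism (open_sub X U) (open_sub Y V) f" and U': "openin (tp X) U'" "U' \<subseteq> U"
    and X: "presheaf X" "openin (tp X) U" and V': "openin (tp Y) V'" "V' \<subseteq> V" "\<And>x. x \<in> U' \<Longrightarrow> f x \<in> V'"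
  shows "morphism (open_sub X U') (open_sub Y V') f"
  unfolding morphism_def
proof (intro conjI allI impI)
  have c: "continuous_map (subtopology (tp X) U) (tp Y) f" and V: "f ` (pts X \<inter> U) \<subseteq> V"
    using f by (auto simp: morphism_def continuous_map_in_subtopology)
  have "continuous_map (subtopology (tp X) U') (tp Y) f"
    using c U'(2) by (metis continuous_map_from_subtopology_mono)
  then show "continuous_map (tp (open_sub X U')) (tp (open_sub Y V')) f"
    using V'(3) by (auto simp: continuous_map_in_subtopology)
  fix W g assume "openin (tp (open_sub Y V')) W \<and> g \<in> rg (open_sub Y V') W"
  then have W: "openin (tp Y) W" "W \<subseteq> V'" "g \<in> rg Y W"
    using V'(1) openin_open_subtopology by (fastforce)+
  then have "openin (subtopology (tp Y) V) W" using V' by (auto simp: openin_subtopology)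
  then have g: "g \<circ> f \<in> rg X (pts X \<inter> U \<inter> f -` W)" using f W by (auto simp: morphism_def)
  have "openin (subtopology (tp X) U) {x \<in> topspace (subtopology (tp X) U). f x \<in> W}"
    using c W(1) by (rule openin_continuous_map_preimage)
  moreover have "{x \<in> topspace (subtopology (tp X) U). f x \<in> W} = pts X \<inter> U \<inter> f -` W" by auto
  ultimately have "openin (tp X) (pts X \<inter> U \<inter> f -` W)" using X(2) openin_trans_full by metis
  then have "openin (tp X) (U' \<inter> (pts X \<inter> U \<inter> f -` W))" using U'(1) by blast
  moreover have "U' \<inter> (pts X \<inter> U \<inter> f -` W) = pts (open_sub X U') \<inter> f -` W" using U' by auto
  ultimately have "openin (tp X) (pts (open_sub X U') \<inter> f -` W)" by simp
  from presheaf_restrict[OF X(1) g this]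
  show "g \<circ> f \<in> rg (open_sub X U') (pts (open_sub X U') \<inter> f -` W)" using U'(2) by auto
qed

lemma morphism_comp:
  assumes "morphism X Y f" "morphism Y Z g"
  shows "morphism X Z (g \<circ> f)"
  unfolding morphism_def
proof (intro conjI allI impI)
  show "continuous_map (tp X) (tp Z) (g \<circ> f)"
    using assms by (auto simp: morphism_def intro: continuous_map_compose)
  fix V h assume V: "openin (tp Z) V \<and> h \<in> rg Z V"
  have f: "x \<in> pts X \<Longrightarrow> f x \<in> pts Y" for x using assms(1) by (auto simp: morphism_def continuous_map_def)
  have "openin (tp Y) {y \<in> topspace (tp Y). g y \<in> V}"
    using assms(2) V openin_continuous_map_preimage by (fastforce simp: morphism_def)
  moreover have "{y \<in> topspace (tp Y). g y \<in> V} = pts Y \<inter> g -` V" by auto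
  ultimately have "openin (tp Y) (pts Y \<inter> g -` V)" by simp
  moreover have "h \<circ> g \<in> rg Y (pts Y \<inter> g -` V)" using assms(2) V by (simp add: morphism_def)
  ultimately have "h \<circ> g \<circ> f \<in> rg X (pts X \<inter> f -` (pts Y \<inter> g -` V))" by (rule morphism_rg[OF assms(1)])
  moreover have "pts X \<inter> f -` (pts Y \<inter> g -` V) = pts X \<inter> (g \<circ> f) -` V" using f by auto
  ultimately show "h \<circ> (g \<circ> f) \<in> rg X (pts X \<inter> (g \<circ> f) -` V)" by (simp add: comp_assoc)
qed

lemma isomorphism_comp:
  assumes "isomorphism X Y f" "isomorphism Y Z g"
  shows "isomorphism X Z (g \<circ> f)"
proof -
  obtain f' where f: "morphism X Y f" "morphism Y X f'" "\<forall>x\<in>pts X. f' (f x) = x" "\<forall>y\<in>pts Y. f (f' y) = y"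
    using assms(1) unfolding isomorphism_def by blast
  obtain g' where g: "morphism Y Z g" "morphism Z Y g'" "\<forall>x\<in>pts Y. g' (g x) = x" "\<forall>y\<in>pts Z. g (g' y) = y"
    using assms(2) unfolding isomorphism_def by blast
  have "f x \<in> pts Y" if "x \<in> pts X" for x using f(1) that by (auto simp: morphism_def continuous_map_def)
  moreover have "g' z \<in> pts Y" if "z \<in> pts Z" for z using g(2) that by (auto simp: morphism_def continuous_map_def)
  ultimately show ?thesis
    unfolding isomorphism_def using morphism_comp[OF f(1) g(1)] morphism_comp[OF g(2) f(2)] f g
    by (intro conjI exI[of _ "f' \<circ> g'"]) auto
qed

lemma isomorphism_restrict:
  assumes f: "isomorphism (open_sub X U) (open_sub Y V) f" and X: "presheaf X" "openin (tp X) U"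
    and Y: "presheaf Y" "openin (tp Y) V" and U': "openin (tp X) U'" "U' \<subseteq> U"
  shows "\<exists>V'. openin (tp Y) V' \<and> V' = f ` U' \<and> isomorphism (open_sub X U') (open_sub Y V') f"
proof -
  obtain g where g: "morphism (open_sub X U) (open_sub Y V) f" "morphism (open_sub Y V) (open_sub X U) g"
      "\<forall>x\<in>pts (open_sub X U). g (f x) = x" "\<forall>y\<in>pts (open_sub Y V). f (g y) = y"
    using f unfolding isomorphism_def by blast
  have sub: "U \<subseteq> pts X" "V \<subseteq> pts Y" using X Y openin_subset by auto
  have gU: "g y \<in> U" if "y \<in> V" for y using g(2) that sub by (auto simp: morphism_def continuous_map_def)
  have fV: "f x \<in> V" if "x \<in> U" for x using g(1) that sub by (auto simp: morphism_def continuous_map_def)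
  have gf: "g (f x) = x" if "x \<in> U" for x using g(3) that sub by auto
  have fg: "f (g y) = y" if "y \<in> V" for y using g(4) that sub by auto
  define V' where "V' = V \<inter> g -` U'"
  have V'_eq: "V' = f ` U'"
  proof (intro equalityI subsetI)
    fix y assume "y \<in> V'"
    then show "y \<in> f ` U'" using fg by (force simp: V'_def)
  next
    fix y assume "y \<in> f ` U'"
    then show "y \<in> V'" using U'(2) fV gf by (auto simp: V'_def)
  qed
  have "continuous_map (subtopology (tp Y) V) (tp X) g"
    using g(2) by (simp add: morphism_def continuous_map_in_subtopology)
  then have "openin (subtopology (tp Y) V) {y \<in> topspace (subtopology (tp Y) V). g y \<in> U'}"
    using U'(1) by (rule openin_continuous_map_preimage)
  moreover have "{y \<in> topspace (subtopology (tp Y) V). g y \<in> U'} = V'" using sub by (auto simp: V'_def)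
  ultimately have V'o: "openin (tp Y) V'" using Y(2) openin_trans_full by metis
  have m1: "morphism (open_sub X U') (open_sub Y V') f"
    by (rule morphism_restrict[OF g(1) U' X V'o]) (use V'_eq in \<open>auto simp: V'_def\<close>)
  have m2: "morphism (open_sub Y V') (open_sub X U') g"
    by (rule morphism_restrict[OF g(2) V'o _ Y U']) (auto simp: V'_def)
  have "isomorphism (open_sub X U') (open_sub Y V') f"
    unfolding isomorphism_def using m1 m2 gf fg U'(2) V'_def by (intro conjI exI[of _ g]) auto
  then show ?thesis using V'o V'_eq by blast
qed

context model
begin

lemma birat_comp:
  assumes f: "birat Y U V f" and g: "birat Y U' V' g"
  shows "\<exists>A B. birat Y A B (f \<circ> g)"
proof -
  have o: "openin (tp Y) U" "openin (tp Y) V" "openin (tp Y) U'" "openin (tp Y) V'"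
    using f g by (auto simp: birat_def nopen_def)
  define A where "A = U' \<inter> g -` U"
  have A: "nopen Y A" unfolding A_def by (rule birat_preimage[OF g]) (use f in \<open>simp add: birat_def\<close>)
  have Ao: "openin (tp Y) A" "A \<subseteq> U'" using A by (auto simp: nopen_def A_def)
  have gi: "isomorphism (open_sub Y U') (open_sub Y V') g" using g by (simp add: birat_def)
  obtain C where C: "openin (tp Y) C" "C = g ` A" "isomorphism (open_sub Y A) (open_sub Y C) g"
    using isomorphism_restrict[OF gi presheaf o(3) presheaf o(4) Ao] by blast
  have CU: "C \<subseteq> U" using C(2) by (auto simp: A_def)
  have fi: "isomorphism (open_sub Y U) (open_sub Y V) f" using f by (simp add: birat_def)
  obtain B where B: "openin (tp Y) B" "B = f ` C" "isomorphism (open_sub Y C) (open_sub Y B) f"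
    using isomorphism_restrict[OF fi presheaf o(1) presheaf o(2) C(1) CU] by blast
  have "B \<noteq> {}" using A B(2) C(2) by (auto simp: nopen_def)
  then have "birat Y A B (f \<circ> g)"
    using A B isomorphism_comp[OF C(3) B(3)] by (simp add: birat_def nopen_def)
  then show ?thesis by blast
qed

lemma carrier_Bir: "carrier (Bir Y) = {gm f | f. \<exists>U V. birat Y U V f}"
proof -
  have "mcls Y U f = gm f" if "birat Y U V f" for U V f
    by (rule mcls_eq[OF nopen_generic]) (use that in \<open>simp add: birat_def\<close>)
  then have "{mcls Y U f | U f. \<exists>V. birat Y U V f} = {gm f | f. \<exists>U V. birat Y U V f}" by fast
  then show ?thesis by (simp add: Bir_def birat_def)
qed

lemma mult_Bir:
  assumes f: "birat Y U V f" and g: "birat Y U' V' g"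
  shows "gm f \<otimes>\<^bsub>Bir Y\<^esub> gm g = gm (f \<circ> g)"
proof -
  have eq: "mcls Y (B \<inter> g' -` A) (f' \<circ> g') = gm (f \<circ> g)" if "(A, f') \<in> gm f" "(B, g') \<in> gm g" for A f' B g'
  proof -
    have A: "nopen Y A" and f': "\<forall>\<^sub>F q in generic. f (\<rho> q) = f' (\<rho> q)" using that by (auto simp: gm_def)
    have B: "nopen Y B" and g': "\<forall>\<^sub>F q in generic. g (\<rho> q) = g' (\<rho> q)" using that by (auto simp: gm_def)
    have "\<forall>\<^sub>F q in generic. \<rho> q \<in> B \<inter> g' -` A"
      using nopen_generic[OF B] birat_generic[OF g nopen_generic[OF A]] g' by eventually_elim simp
    then have "mcls Y (B \<inter> g' -` A) (f' \<circ> g') = gm (f' \<circ> g')" by (rule mcls_eq)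
    also have "\<dots> = gm (f \<circ> g)"
      by (rule gm_cong) (use birat_generic[OF g f'] g' in \<open>eventually_elim, simp\<close>)
    finally show ?thesis .
  qed
  have "gm f \<otimes>\<^bsub>Bir Y\<^esub> gm g = (\<Union>(A, f')\<in>gm f. \<Union>(B, g')\<in>gm g. mcls Y (B \<inter> g' -` A) (f' \<circ> g'))"
    by (simp add: Bir_def)
  also have "\<dots> = gm (f \<circ> g)"
    using birat_in_gm[OF f] birat_in_gm[OF g] eq by fastforce
  finally show ?thesis .
qed

lemma one_Bir: "\<one>\<^bsub>Bir Y\<^esub> = gm id"
  using mcls_eq[OF generic_pts, of id] by (simp add: Bir_def)

lemma group_Bir: "group (Bir Y)"
proof (rule groupI)
  fix A B assume "A \<in> carrier (Bir Y)" "B \<in> carrier (Bir Y)"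
  then obtain f U V g U' V' where "A = gm f" "birat Y U V f" "B = gm g" "birat Y U' V' g"
    unfolding carrier_Bir by blast
  moreover from this obtain X1 X2 where "birat Y X1 X2 (f \<circ> g)" using birat_comp by blast
  ultimately show "A \<otimes>\<^bsub>Bir Y\<^esub> B \<in> carrier (Bir Y)"
    unfolding carrier_Bir using mult_Bir[of U V f U' V' g] by blast
next
  show "\<one>\<^bsub>Bir Y\<^esub> \<in> carrier (Bir Y)" unfolding one_Bir carrier_Bir using birat_id by blast
next
  fix A B C assume "A \<in> carrier (Bir Y)" "B \<in> carrier (Bir Y)" "C \<in> carrier (Bir Y)"
  then obtain f U V g U' V' h U'' V'' where
    A: "A = gm f" "birat Y U V f" and B: "B = gm g" "birat Y U' V' g" and C: "C = gm h" "birat Y U'' V'' h"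
    unfolding carrier_Bir by blast
  obtain X1 X2 where fg: "birat Y X1 X2 (f \<circ> g)" using birat_comp[OF A(2) B(2)] by blast
  obtain Z1 Z2 where gh: "birat Y Z1 Z2 (g \<circ> h)" using birat_comp[OF B(2) C(2)] by blast
  show "A \<otimes>\<^bsub>Bir Y\<^esub> B \<otimes>\<^bsub>Bir Y\<^esub> C = A \<otimes>\<^bsub>Bir Y\<^esub> (B \<otimes>\<^bsub>Bir Y\<^esub> C)"
    unfolding A(1) B(1) C(1) mult_Bir[OF A(2) B(2)] mult_Bir[OF B(2) C(2)] mult_Bir[OF fg C(2)] mult_Bir[OF A(2) gh]
    by (simp only: comp_assoc)
next
  fix A assume "A \<in> carrier (Bir Y)"
  then obtain f U V where A: "A = gm f" "birat Y U V f" unfolding carrier_Bir by blast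
  show "\<one>\<^bsub>Bir Y\<^esub> \<otimes>\<^bsub>Bir Y\<^esub> A = A"
    unfolding one_Bir A(1) mult_Bir[OF birat_id A(2)] by simp
  obtain g where g: "birat Y V U g" "\<forall>\<^sub>F q in generic. g (f (\<rho> q)) = \<rho> q" using birat_inverse[OF A(2)] by blast
  have "gm (g \<circ> f) = gm id" by (rule gm_cong) (use g(2) in simp)
  then have "gm g \<otimes>\<^bsub>Bir Y\<^esub> A = \<one>\<^bsub>Bir Y\<^esub>" unfolding A(1) mult_Bir[OF g(1) A(2)] one_Bir .
  then show "\<exists>B\<in>carrier (Bir Y). B \<otimes>\<^bsub>Bir Y\<^esub> A = \<one>\<^bsub>Bir Y\<^esub>" using g(1) unfolding carrier_Bir by blast
qed

subsection \<open>Action on rational functions\<close>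

text \<open>\<open>S\<close> is the pull-back of \<open>R\<close> by \<open>f\<close>. All
  representatives of \<open>R\<close> are quantified over, which makes uniqueness immediate and lets
  \<open>sg\<close> be evaluated on whichever representative is at hand.\<close>

definition star :: "('a \<Rightarrow> 'a) \<Rightarrow> ratfield \<Rightarrow> ratfield \<Rightarrow> bool" where
  "star f R S \<longleftrightarrow> S \<in> L \<and> (\<forall>V k. (V, k) \<in> cl R \<longrightarrow> (\<forall>\<^sub>F q in generic. f (\<rho> q) \<in> V \<and> k (f (\<rho> q)) = evF S q))"

lemma star_unique:
  assumes "R \<in> L" "star f R S" "star f R S'"
  shows "S = S'"
proof -
  obtain V k where k: "(V, k) \<in> cl R" using cl_nonempty[OF assms(1)] by blast
  have "\<forall>\<^sub>F q in generic. f (\<rho> q) \<in> V \<and> k (f (\<rho> q)) = evF S q"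
    "\<forall>\<^sub>F q in generic. f (\<rho> q) \<in> V \<and> k (f (\<rho> q)) = evF S' q" using assms k by (auto simp: star_def)
  then have "\<forall>\<^sub>F q in generic. evF S q = evF S' q" by eventually_elim simp
  then show ?thesis by (rule evF_eqI)
qed

lemma star_exists:
  assumes f: "birat Y U V f" and R: "R \<in> L"
  shows "\<exists>S. star f R S"
proof -
  obtain V0 k0 where k0: "(V0, k0) \<in> cl R" using cl_nonempty[OF R] by blast
  note c0 = clD[OF k0]
  have "k0 \<circ> f \<in> rg Y (pts (open_sub Y U) \<inter> f -` V0)"
    using morphism_rg[OF birat_morphism[OF f], of V0 k0] c0 by (simp add: nopen_def)
  moreover have "pts (open_sub Y U) \<inter> f -` V0 = U \<inter> f -` V0"
    using f openin_subset by (fastforce simp: birat_def nopen_def)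
  ultimately have "k0 \<circ> f \<in> rg Y (U \<inter> f -` V0)" by simp
  then obtain S where S: "S \<in> L" "\<forall>\<^sub>F q in generic. (k0 \<circ> f) (\<rho> q) = evF S q"
    using regular[OF birat_preimage[OF f]] c0 by blast
  have "\<forall>\<^sub>F q in generic. f (\<rho> q) \<in> W \<and> k (f (\<rho> q)) = evF S q" if "(W, k) \<in> cl R" for W k
  proof -
    note c = clD[OF that]
    have "\<forall>\<^sub>F q in generic. \<rho> q \<in> W \<and> k (\<rho> q) = k0 (\<rho> q)"
      using nopen_generic[OF c[THEN conjunct1]] c[THEN conjunct2, THEN conjunct2] c0[THEN conjunct2, THEN conjunct2]
      by eventually_elim simp
    from birat_generic[OF f this] S(2) show ?thesis by eventually_elim simp
  qed
  then show ?thesis using S(1) by (auto simp: star_def)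
qed

definition sg :: "('a \<Rightarrow> 'a) \<Rightarrow> ratfield \<Rightarrow> ratfield" where
  "sg f R = (SOME S. star f R S)"

lemma star_sg: "birat Y U V f \<Longrightarrow> R \<in> L \<Longrightarrow> star f R (sg f R)"
  unfolding sg_def by (rule someI_ex) (rule star_exists)

lemma sg_L: "birat Y U V f \<Longrightarrow> R \<in> L \<Longrightarrow> sg f R \<in> L"
  using star_sg by (simp add: star_def)

lemma sg_ev: "birat Y U V f \<Longrightarrow> R \<in> L \<Longrightarrow> (W, k) \<in> cl R \<Longrightarrow> \<forall>\<^sub>F q in generic. k (f (\<rho> q)) = evF (sg f R) q"
  using star_sg[of U V f R] unfolding star_def by (fastforce elim: eventually_mono)

lemma sg_eqI:
  assumes f: "birat Y U V f" and "R \<in> L" "(W, k) \<in> cl R" "\<forall>\<^sub>F q in generic. k (f (\<rho> q)) = evF S q"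
  shows "sg f R = S"
proof (rule evF_eqI)
  show "\<forall>\<^sub>F q in generic. evF (sg f R) q = evF S q"
    using sg_ev[OF assms(1-3)] assms(4) by eventually_elim simp
qed

lemma cl_generic: "(W, k) \<in> cl R \<Longrightarrow> \<forall>\<^sub>F q in generic. k (\<rho> q) = evF R q"
  using clD by blast

lemma sg_add:
  assumes f: "birat Y U V f" and R: "R \<in> L" "S \<in> L"
  shows "sg f (R + S) = sg f R + sg f S"
proof -
  obtain A k B m C h where k: "(A, k) \<in> cl R" "(B, m) \<in> cl S" "(C, h) \<in> cl (R + S)"
    using cl_nonempty[OF R(1)] cl_nonempty[OF R(2)] cl_nonempty[OF L_add[OF R]] by blast
  have "\<forall>\<^sub>F q in generic. h (\<rho> q) = k (\<rho> q) + m (\<rho> q)"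
    using cl_generic[OF k(1)] cl_generic[OF k(2)] cl_generic[OF k(3)] evF_add[of R S] by eventually_elim simp
  from birat_generic[OF f this] sg_ev[OF f R(1) k(1)] sg_ev[OF f R(2) k(2)] evF_add[of "sg f R" "sg f S"]
  have "\<forall>\<^sub>F q in generic. h (f (\<rho> q)) = evF (sg f R + sg f S) q" by eventually_elim simp
  then show ?thesis by (rule sg_eqI[OF f L_add[OF R] k(3)])
qed

lemma sg_mult:
  assumes f: "birat Y U V f" and R: "R \<in> L" "S \<in> L"
  shows "sg f (R * S) = sg f R * sg f S"
proof -
  obtain A k B m C h where k: "(A, k) \<in> cl R" "(B, m) \<in> cl S" "(C, h) \<in> cl (R * S)"
    using cl_nonempty[OF R(1)] cl_nonempty[OF R(2)] cl_nonempty[OF L_mult[OF R]] by blast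
  have "\<forall>\<^sub>F q in generic. h (\<rho> q) = k (\<rho> q) * m (\<rho> q)"
    using cl_generic[OF k(1)] cl_generic[OF k(2)] cl_generic[OF k(3)] evF_mult[of R S] by eventually_elim simp
  from birat_generic[OF f this] sg_ev[OF f R(1) k(1)] sg_ev[OF f R(2) k(2)] evF_mult[of "sg f R" "sg f S"]
  have "\<forall>\<^sub>F q in generic. h (f (\<rho> q)) = evF (sg f R * sg f S) q" by eventually_elim simp
  then show ?thesis by (rule sg_eqI[OF f L_mult[OF R] k(3)])
qed

lemma sg_cst:
  assumes f: "birat Y U V f"
  shows "sg f (cst c) = cst c"
proof -
  obtain A k where k: "(A, k) \<in> cl (cst c)" using cl_nonempty[OF L_cst] by blast
  have "\<forall>\<^sub>F q in generic. k (\<rho> q) = c" using cl_generic[OF k] by simp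
  from birat_generic[OF f this] show ?thesis by (intro sg_eqI[OF f L_cst k]) simp
qed

lemma sg_comp:
  assumes f: "birat Y U V f" and g: "birat Y U' V' g" and R: "R \<in> L"
  shows "sg (f \<circ> g) R = sg g (sg f R)"
proof -
  obtain A B where fg: "birat Y A B (f \<circ> g)" using birat_comp[OF f g] by blast
  obtain C k D m where k: "(C, k) \<in> cl R" "(D, m) \<in> cl (sg f R)"
    using cl_nonempty[OF R] cl_nonempty[OF sg_L[OF f R]] by blast
  have "\<forall>\<^sub>F q in generic. m (\<rho> q) = k (f (\<rho> q))"
    using cl_generic[OF k(2)] sg_ev[OF f R k(1)] by eventually_elim simp
  from birat_generic[OF g this] sg_ev[OF g sg_L[OF f R] k(2)]
  have "\<forall>\<^sub>F q in generic. k ((f \<circ> g) (\<rho> q)) = evF (sg g (sg f R)) q" by eventually_elim simp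
  then show ?thesis by (rule sg_eqI[OF fg R k(1)])
qed

lemma sg_cong:
  assumes f: "birat Y U V f" and g: "birat Y U' V' g" and eq: "\<forall>\<^sub>F q in generic. f (\<rho> q) = g (\<rho> q)" and R: "R \<in> L"
  shows "sg f R = sg g R"
proof -
  obtain C k where k: "(C, k) \<in> cl R" using cl_nonempty[OF R] by blast
  from sg_ev[OF g R k] eq have "\<forall>\<^sub>F q in generic. k (f (\<rho> q)) = evF (sg g R) q" by eventually_elim simp
  then show ?thesis by (rule sg_eqI[OF f R k])
qed

lemma sg_id: "R \<in> L \<Longrightarrow> sg id R = R"
  using cl_nonempty[of R] cl_generic by (fastforce intro: sg_eqI[OF birat_id])

lemma sg_inverse:
  assumes f: "birat Y U V f"
  obtains g where "birat Y V U g" "gm (g \<circ> f) = gm id" "gm (f \<circ> g) = gm id"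
    "\<And>R. R \<in> L \<Longrightarrow> sg f (sg g R) = R" "\<And>R. R \<in> L \<Longrightarrow> sg g (sg f R) = R"
proof -
  obtain g where g: "birat Y V U g" "\<forall>\<^sub>F q in generic. g (f (\<rho> q)) = \<rho> q" "\<forall>\<^sub>F q in generic. f (g (\<rho> q)) = \<rho> q"
    using birat_inverse[OF f] by blast
  obtain A B where gf: "birat Y A B (g \<circ> f)" using birat_comp[OF g(1) f] by blast
  obtain C D where fg: "birat Y C D (f \<circ> g)" using birat_comp[OF f g(1)] by blast
  have "sg f (sg g R) = R" "sg g (sg f R) = R" if "R \<in> L" for R
    using sg_comp[OF g(1) f that] sg_comp[OF f g(1) that] sg_cong[OF gf birat_id _ that] sg_cong[OF fg birat_id _ that]
      sg_id[OF that] g by simp_all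
  moreover have "gm (g \<circ> f) = gm id" "gm (f \<circ> g) = gm id" using g by (auto intro!: gm_cong)
  ultimately show ?thesis using that g(1) by blast
qed

lemma sg_surj: "birat Y U V f \<Longrightarrow> sg f ` L = L"
proof (intro equalityI subsetI)
  fix R assume f: "birat Y U V f" and R: "R \<in> L"
  obtain g where g: "birat Y V U g" "\<And>R. R \<in> L \<Longrightarrow> sg f (sg g R) = R" using sg_inverse[OF f] by metis
  then show "R \<in> sg f ` L" using R sg_L by (metis imageI)
qed (use sg_L in auto)

text \<open>The link between the geometric action \<open>sg\<close> and the algebra of
  \<open>pb\<close>: a torus map lying over \<open>f\<close> acts on the function field by its own
  pull-back.\<close>

lemma sg_torus_map:
  assumes f: "birat Y U V f" and m: "torus_map m" "\<forall>\<^sub>F q in generic. f (\<rho> q) = \<rho> (m q)" and R: "R \<in> L"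
  shows "sg f R = pb m R"
proof -
  obtain C k where k: "(C, k) \<in> cl R" using cl_nonempty[OF R] by blast
  from eventually_torus_map[OF m(1) cl_generic[OF k]] m(2) evF_pb[OF m(1), of R]
  have "\<forall>\<^sub>F q in generic. k (f (\<rho> q)) = evF (pb m R) q" by eventually_elim simp
  then show ?thesis by (rule sg_eqI[OF f R k])
qed

end

lemma pull_eq:
  assumes "model X \<rho> L" "model Y \<rho>' L'" and R: "R \<in> L'" and U: "\<forall>\<^sub>F q in generic. \<rho> q \<in> U"
    and k: "\<And>V k. (V, k) \<in> model.cl Y \<rho>' R \<Longrightarrow> \<forall>\<^sub>F q in generic. p (\<rho> q) \<in> V \<and> k (p (\<rho> q)) = evF S q"
  shows "pull X U p (model.cl Y \<rho>' R) = model.cl X \<rho> S"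
proof -
  interpret X: model X \<rho> L by fact
  interpret Y: model Y \<rho>' L' by fact
  have "rcls X (U \<inter> p -` V) (k \<circ> p) = X.cl S" if "(V, k) \<in> Y.cl R" for V k
  proof (rule X.rcls_eq)
    show "\<forall>\<^sub>F q in generic. \<rho> q \<in> U \<inter> p -` V" using U k[OF that] by eventually_elim simp
    show "\<forall>\<^sub>F q in generic. (k \<circ> p) (\<rho> q) = evF S q" using k[OF that] by eventually_elim simp
  qed
  then show ?thesis using Y.cl_nonempty[OF R] unfolding pull_def by fastforce
qed

text \<open>If \<open>p\<close> carries one parametrization to the other, both function fields sit
  in the same field of rational functions and the pull-back is an inclusion.\<close>

lemma pull_same:
  assumes "model X \<rho> L" "model Y \<rho>' L'" and R: "R \<in> L'" and U: "\<forall>\<^sub>F q in generic. \<rho> q \<in> U"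
    and p: "\<forall>\<^sub>F q in generic. p (\<rho> q) = \<rho>' q"
  shows "pull X U p (model.cl Y \<rho>' R) = model.cl X \<rho> R"
proof (rule pull_eq[OF assms(1-4)])
  interpret Y: model Y \<rho>' L' by fact
  fix V k assume "(V, k) \<in> Y.cl R"
  note c = Y.clD[OF this]
  show "\<forall>\<^sub>F q in generic. p (\<rho> q) \<in> V \<and> k (p (\<rho> q)) = evF R q"
    using p Y.nopen_generic[OF c[THEN conjunct1]] c[THEN conjunct2, THEN conjunct2] by eventually_elim simp
qed

subsection \<open>Quotients\<close>

lemma orb_self: "x \<in> orb T x"
  unfolding orb_def by (rule range_eqI[of _ _ 0]) simp

text \<open>\<open>orb\<close> collects forward iterates only; finite order at \<open>x\<close>
  brings the starting point back among them.\<close>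

lemma orb_step:
  assumes "(T ^^ n) x = x" "n > 0"
  shows "orb T (T x) = orb T x"
proof (intro equalityI subsetI)
  fix y assume "y \<in> orb T (T x)"
  then obtain k where "y = (T ^^ k) (T x)" by (auto simp: orb_def)
  then have "y = (T ^^ Suc k) x" by (simp add: funpow_swap1)
  then show "y \<in> orb T x" unfolding orb_def by blast
next
  fix y assume "y \<in> orb T x"
  then obtain k where k: "y = (T ^^ k) x" by (auto simp: orb_def)
  obtain m where m: "n = Suc m" using assms(2) by (cases n) auto
  have "y = (T ^^ k) ((T ^^ Suc m) x)" using k assms m by simp
  also have "\<dots> = (T ^^ (k + m)) (T x)" by (simp add: funpow_add funpow_swap1)
  finally show "y \<in> orb T (T x)" unfolding orb_def by blast
qed

lemma orb_funpow:
  assumes "\<And>x. x \<in> W \<Longrightarrow> T x \<in> W" "\<And>x. x \<in> W \<Longrightarrow> (T ^^ n) x = x" "n > 0" "x \<in> W"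
  shows "(T ^^ k) x \<in> W \<and> orb T ((T ^^ k) x) = orb T x"
proof (induction k)
  case (Suc k)
  then show ?case using assms orb_step[of n T "(T ^^ k) x"] by simp
qed (use assms in simp)

lemma orb_invariant:
  assumes "\<And>x. x \<in> W \<Longrightarrow> T x \<in> W" "x \<in> W"
  shows "orb T x \<subseteq> W"
proof -
  have "(T ^^ k) x \<in> W" for k by (induction k) (use assms in auto)
  then show ?thesis by (auto simp: orb_def)
qed

lemma openin_quot: "openin (tp (quot X T)) V \<longleftrightarrow> V \<subseteq> orb T ` pts X \<and> openin (tp X) (pts X \<inter> orb T -` V)"
  by (simp add: quot_def openin_quot_topology)

lemma rg_quot: "f \<in> rg (quot X T) V \<longleftrightarrow> f \<circ> orb T \<in> rg X (pts X \<inter> orb T -` V)"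
  by (simp add: quot_def)

lemma pts_quot: "pts (quot X T) = orb T ` pts X"
proof (intro equalityI subsetI)
  fix y assume "y \<in> pts (quot X T)"
  then show "y \<in> orb T ` pts X" using openin_topspace[of "tp (quot X T)"] unfolding openin_quot by blast
next
  fix y assume y: "y \<in> orb T ` pts X"
  have "pts X \<inter> orb T -` (orb T ` pts X) = pts X" by blast
  then have "openin (tp (quot X T)) (orb T ` pts X)" unfolding openin_quot by simp
  then show "y \<in> pts (quot X T)" using y openin_subset by blast
qed

lemma presheaf_quot:
  assumes "presheaf X"
  shows "presheaf (quot X T)"
  unfolding presheaf_def
proof (intro conjI allI impI)
  fix U V f assume a: "openin (tp (quot X T)) V \<and> V \<subseteq> U \<and> f \<in> rg (quot X T) U"
  show "f \<in> rg (quot X T) V" unfolding rg_quot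
    by (rule presheaf_restrict[OF assms, of _ "pts X \<inter> orb T -` U"]) (use a in \<open>auto simp: rg_quot openin_quot\<close>)
next
  fix U f g assume a: "f \<in> rg (quot X T) U \<and> (\<forall>x\<in>U. f x = g x)"
  show "g \<in> rg (quot X T) U" unfolding rg_quot
    by (rule presheaf_cong[OF assms, of "f \<circ> orb T"]) (use a in \<open>auto simp: rg_quot\<close>)
qed

lemma saturated_orb:
  assumes "W \<subseteq> pts X" "\<And>x. x \<in> W \<Longrightarrow> T x \<in> W"
  shows "pts X \<inter> orb T -` (orb T ` W) = W"
proof (intro equalityI subsetI)
  fix x assume "x \<in> pts X \<inter> orb T -` (orb T ` W)"
  then obtain a where "a \<in> W" "orb T x = orb T a" by auto
  then show "x \<in> W" using orb_self[of x T] orb_invariant[of W T a] assms(2) by auto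
qed (use assms in auto)

locale cyclic_model = model X j UNIV for X :: "'a fspace" and j +
  fixes T :: "'a \<Rightarrow> 'a" and t :: "complex \<times> complex \<Rightarrow> complex \<times> complex" and n :: nat
  assumes T_cont: "continuous_map (tp X) (tp X) T" and t: "torus_map t" and n: "n > 0"
    and t_order: "\<And>p. p \<in> torus \<Longrightarrow> (t ^^ n) p = p" and T_t: "\<forall>\<^sub>F q in generic. T (j q) = j (t q)"
begin

lemma T_pow_t: "\<forall>\<^sub>F q in generic. (T ^^ k) (j q) = j ((t ^^ k) q)"
proof (induction k)
  case (Suc k)
  from Suc eventually_torus_map[OF torus_map_funpow[OF t, of k] T_t] show ?case by eventually_elim simp
qed simp

lemma T_pow_n: "\<forall>\<^sub>F q in generic. (T ^^ n) (j q) = j q"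
  using T_pow_t[of n] eventually_torus by eventually_elim (simp add: t_order)

lemma T_pow_cont: "continuous_map (tp X) (tp X) (T ^^ k)"
proof (induction k)
  case (Suc k)
  from continuous_map_compose[OF Suc T_cont] show ?case by (simp only: funpow.simps)
qed simp

lemma invariant_neighbourhood:
  assumes "\<forall>\<^sub>F q in generic. \<psi> (j q)"
  shows "\<exists>W. nopen X W \<and> (\<forall>x\<in>W. \<psi> x \<and> (T ^^ n) x = x \<and> T x \<in> W)"
proof -
  have "\<forall>\<^sub>F q in generic. \<psi> (j q) \<and> (T ^^ n) (j q) = j q" using assms T_pow_n by (rule eventually_conj)
  then obtain N where N: "nopen X N" "\<forall>x\<in>N. \<psi> x \<and> (T ^^ n) x = x"
    using generic_nopen[of "\<lambda>x. \<psi> x \<and> (T ^^ n) x = x"] by blast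
  \<comment> \<open>An intersection of \<open>n\<close> translates of \<open>N\<close>; the term
    \<open>k = 0\<close> is \<open>N\<close> itself. It is stable under \<open>T\<close> because
    \<open>T ^^ n\<close> is the identity on \<open>N\<close>, which closes the cycle after the last
    translate.\<close>
  define W where "W = (\<Inter>k\<in>{..<n}. {x \<in> topspace (tp X). (T ^^ k) x \<in> N})"
  have "openin (tp X) W" unfolding W_def
  proof (rule openin_Inter)
    show "openin (tp X) A" if "A \<in> (\<lambda>k. {x \<in> topspace (tp X). (T ^^ k) x \<in> N}) ` {..<n}" for A
    proof -
      from that obtain k where "A = {x \<in> topspace (tp X). (T ^^ k) x \<in> N}" by blast
      then show ?thesis using openin_continuous_map_preimage[OF T_pow_cont, of N k] N by (simp add: nopen_def)
    qed
  qed (use n in auto)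
  moreover have "\<forall>\<^sub>F q in generic. \<forall>k\<in>{..<n}. (T ^^ k) (j q) \<in> N"
  proof (rule eventually_ball_finite)
    show "\<forall>k\<in>{..<n}. \<forall>\<^sub>F q in generic. (T ^^ k) (j q) \<in> N"
    proof
      fix k
      from T_pow_t[of k] eventually_torus_map[OF torus_map_funpow[OF t, of k] nopen_generic[OF N(1)]]
      show "\<forall>\<^sub>F q in generic. (T ^^ k) (j q) \<in> N" by eventually_elim simp
    qed
  qed simp
  with generic_pts have "\<forall>\<^sub>F q in generic. j q \<in> W" by eventually_elim (simp add: W_def)
  then obtain q where "j q \<in> W" by (rule eventually_generic_ex)
  ultimately have W: "nopen X W" by (auto simp: nopen_def)
  have "\<psi> x \<and> (T ^^ n) x = x \<and> T x \<in> W" if x: "x \<in> W" for x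
  proof -
    have k: "(T ^^ k) x \<in> N" if "k < n" for k using x that by (auto simp: W_def)
    have 0: "x \<in> N" using k[of 0] n by simp
    have Tx: "T x \<in> topspace (tp X)" using x n T_cont by (auto simp: W_def continuous_map_def)
    have "(T ^^ k) (T x) \<in> N" if "k < n" for k
    proof (cases "Suc k < n")
      case True
      then show ?thesis using k[of "Suc k"] by (simp add: funpow_swap1)
    next
      case False
      then have "n = Suc k" using that by simp
      then have "(T ^^ k) (T x) = (T ^^ n) x" by (simp add: funpow_swap1)
      then show ?thesis using 0 N by simp
    qed
    then show ?thesis using 0 N Tx by (auto simp: W_def)
  qed
  then show ?thesis using W by blast
qed

lemma nopen_quot:
  assumes W: "nopen X W" "\<And>x. x \<in> W \<Longrightarrow> T x \<in> W"
  shows "nopen (quot X T) (orb T ` W)"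
proof -
  have "W \<subseteq> pts X" using W(1) openin_subset by (auto simp: nopen_def)
  then show ?thesis using W saturated_orb[of W X T] by (auto simp: nopen_def openin_quot)
qed

text \<open>Functions regular on the quotient are the invariant ones, so their generic values give
  elements fixed by \<open>pb t\<close>. Conversely a fixed element is regular on some open set, and
  \<open>invariant_neighbourhood\<close> shrinks this set until the function descends to
  orbits.\<close>

theorem model_quot: "model (quot X T) (\<lambda>q. orb T (j q)) {u. pb t u = u}"
proof
  show "presheaf (quot X T)" by (rule presheaf_quot[OF presheaf])
  have nopen_pre: "nopen X (pts X \<inter> orb T -` V)" if "nopen (quot X T) V" for V
    using that by (auto simp: nopen_def openin_quot)
  show "(\<exists>W. nopen (quot X T) W \<and> (\<forall>y\<in>W. \<phi> y)) \<longleftrightarrow> (\<forall>\<^sub>F q in generic. \<phi> (orb T (j q)))" for \<phi>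
  proof
    assume "\<exists>W. nopen (quot X T) W \<and> (\<forall>y\<in>W. \<phi> y)"
    then obtain V where V: "nopen (quot X T) V" "\<forall>y\<in>V. \<phi> y" by blast
    from nopen_generic[OF nopen_pre[OF V(1)]] show "\<forall>\<^sub>F q in generic. \<phi> (orb T (j q))"
      by eventually_elim (use V in auto)
  next
    assume "\<forall>\<^sub>F q in generic. \<phi> (orb T (j q))"
    then obtain W where W: "nopen X W" "\<forall>x\<in>W. \<phi> (orb T x) \<and> (T ^^ n) x = x \<and> T x \<in> W"
      using invariant_neighbourhood[of "\<lambda>x. \<phi> (orb T x)"] by blast
    then have "nopen (quot X T) (orb T ` W)" by (intro nopen_quot) auto
    then show "\<exists>W. nopen (quot X T) W \<and> (\<forall>y\<in>W. \<phi> y)" using W by blast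
  qed
  show "\<exists>R\<in>{u. pb t u = u}. \<forall>\<^sub>F q in generic. f (orb T (j q)) = evF R q"
    if V: "nopen (quot X T) V" and f: "f \<in> rg (quot X T) V" for V f
  proof -
    obtain R where R: "\<forall>\<^sub>F q in generic. (f \<circ> orb T) (j q) = evF R q"
      using regular[OF nopen_pre[OF V]] f unfolding rg_quot by blast
    have "\<forall>\<^sub>F q in generic. evF R q = evF R (t q)"
      using R eventually_torus_map[OF t R] T_t T_pow_n
    proof eventually_elim
      case (elim q)
      then have "orb T (j (t q)) = orb T (j q)" using orb_step[OF _ n, of T "j q"] by simp
      then show ?case using elim by simp
    qed
    then have "pb t R = R" by (rule pb_eqI[OF t])
    then show ?thesis using R by auto
  qed
  show "\<exists>V f. nopen (quot X T) V \<and> f \<in> rg (quot X T) V \<and> (\<forall>\<^sub>F q in generic. f (orb T (j q)) = evF R q)"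
    if R: "R \<in> {u. pb t u = u}" for R
  proof -
    obtain U f0 where f0: "nopen X U" "f0 \<in> rg X U" "\<forall>\<^sub>F q in generic. f0 (j q) = evF R q"
      using representable[of R] by blast
    have "\<forall>\<^sub>F q in generic. j q \<in> U \<and> f0 (T (j q)) = f0 (j q)"
      using nopen_generic[OF f0(1)] f0(3) eventually_torus_map[OF t f0(3)] T_t evF_pb[OF t, of R]
      by eventually_elim (use R in simp)
    then obtain W where W: "nopen X W" "\<forall>x\<in>W. (x \<in> U \<and> f0 (T x) = f0 x) \<and> (T ^^ n) x = x \<and> T x \<in> W"
      using invariant_neighbourhood[of "\<lambda>x. x \<in> U \<and> f0 (T x) = f0 x"] by blast
    \<comment> \<open>An arbitrary representative of the orbit is evaluated; on \<open>W\<close> the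
      result is independent of it, since \<open>f0\<close> takes equal values at \<open>x\<close>
      and \<open>T x\<close>.\<close>
    define f where "f A = f0 (SOME x. x \<in> A)" for A
    have f: "f (orb T x) = f0 x" if x: "x \<in> W" for x
    proof -
      have "(T ^^ k) x \<in> W \<and> f0 ((T ^^ k) x) = f0 x" for k by (induction k) (use W x in auto)
      then have "\<forall>y\<in>orb T x. f0 y = f0 x" by (auto simp: orb_def)
      then show ?thesis unfolding f_def using someI[of "\<lambda>y. y \<in> orb T x", OF orb_self] by blast
    qed
    have sat: "pts X \<inter> orb T -` (orb T ` W) = W"
      by (rule saturated_orb) (use W openin_subset in \<open>auto simp: nopen_def\<close>)
    have "f0 \<in> rg X W" by (rule presheaf_restrict[OF presheaf f0(2)]) (use W in \<open>auto simp: nopen_def\<close>)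
    then have "f \<circ> orb T \<in> rg X W" by (rule presheaf_cong[OF presheaf]) (simp add: f)
    then have "f \<in> rg (quot X T) (orb T ` W)" by (simp add: rg_quot sat)
    moreover have "nopen (quot X T) (orb T ` W)" by (rule nopen_quot) (use W in auto)
    moreover have "\<forall>\<^sub>F q in generic. f (orb T (j q)) = evF R q"
      using nopen_generic[OF W(1)] f0(3) by eventually_elim (simp add: f)
    ultimately show ?thesis by blast
  qed
qed (auto simp: pb_cst pb_add pb_mult t ratfield_hom.hom_inverse[OF ratfield_hom_pb[OF t]])

end

context cyclic_model
begin

text \<open>An automorphism of a \<open>T\<close>-stable open set that commutes with
  \<open>T\<close> maps orbits to orbits. Its inverse commutes with \<open>T\<close> as well, so
  both descend by the same construction \<open>ind\<close>.\<close>

lemma birat_quot: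
  assumes W: "nopen X W" "\<And>x. x \<in> W \<Longrightarrow> T x \<in> W \<and> (T ^^ n) x = x"
    and \<phi>: "isomorphism (open_sub X W) (open_sub X W) \<phi>" "\<And>x. x \<in> W \<Longrightarrow> \<phi> (T x) = T (\<phi> x)"
    and m: "\<forall>\<^sub>F q in generic. \<phi> (j q) = j (m q)"
  shows "\<exists>\<psi>. birat (quot X T) (orb T ` W) (orb T ` W) \<psi> \<and> (\<forall>\<^sub>F q in generic. \<psi> (orb T (j q)) = orb T (j (m q)))"
proof -
  have Wo: "openin (tp X) W" "W \<subseteq> pts X" using W(1) openin_subset by (auto simp: nopen_def)
  have WX [simp]: "pts X \<inter> W = W" using Wo by blast
  have sat: "pts X \<inter> orb T -` (orb T ` W) = W" by (rule saturated_orb) (use W Wo in auto)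
  have Vo: "openin (tp (quot X T)) (orb T ` W)" using nopen_quot[OF W(1)] W(2) by (simp add: nopen_def)
  have orbW: "y \<in> W \<and> orb T y = orb T x" if "y \<in> orb T x" "x \<in> W" for x y
    using that orb_funpow[of W T n x] W(2) n unfolding orb_def by blast
  define ind :: "('a \<Rightarrow> 'a) \<Rightarrow> 'a set \<Rightarrow> 'a set" where "ind f A = orb T (f (SOME x. x \<in> A))" for f A
  have ind: "ind f (orb T x) = orb T (f x)" if f: "\<And>x. x \<in> W \<Longrightarrow> f (T x) = T (f x) \<and> f x \<in> W" and x: "x \<in> W" for f x
  proof -
    have "f ((T ^^ k) x) = (T ^^ k) (f x)" for k
    proof (induction k)
      case (Suc k)
      have "(T ^^ k) x \<in> W" using orb_funpow[of W T n x k] W(2) n x by blast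
      then show ?case using f Suc by simp
    qed simp
    then have "f y \<in> orb T (f x)" if "y \<in> orb T x" for y using that by (auto simp: orb_def)
    then have "orb T (f y) = orb T (f x)" if "y \<in> orb T x" for y using that orbW f x by blast
    then show ?thesis unfolding ind_def using someI[of "\<lambda>y. y \<in> orb T x", OF orb_self] by blast
  qed
  have mor: "morphism (open_sub (quot X T) (orb T ` W)) (open_sub (quot X T) (orb T ` W)) (ind f)"
    if f: "morphism (open_sub X W) (open_sub X W) f" "\<And>x. x \<in> W \<Longrightarrow> f (T x) = T (f x)" for f
  proof -
    have fW: "f x \<in> W" if "x \<in> W" for x using f(1) that Wo by (auto simp: morphism_def continuous_map_def)
    have fX: "f x \<in> pts X" if "x \<in> W" for x using fW[OF that] Wo by blast
    have ind_f: "ind f (orb T x) = orb T (f x)" if "x \<in> W" for x using ind f(2) fW that by blast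
    have pre: "pts X \<inter> orb T -` (orb T ` W \<inter> ind f -` A) = W \<inter> f -` (pts X \<inter> orb T -` A)" for A
    proof -
      have "pts X \<inter> orb T -` (orb T ` W \<inter> ind f -` A) = W \<inter> orb T -` (ind f -` A)" using sat by blast
      also have "\<dots> = W \<inter> f -` (pts X \<inter> orb T -` A)" using ind_f fX by auto
      finally show ?thesis .
    qed
    have key: "openin (tp (quot X T)) (orb T ` W \<inter> ind f -` A)" if A: "openin (tp (quot X T)) A" for A
    proof -
      have "continuous_map (subtopology (tp X) W) (tp X) f"
        using f(1) by (simp add: morphism_def continuous_map_in_subtopology)
      moreover have "openin (tp X) (pts X \<inter> orb T -` A)" using A by (simp add: openin_quot)
      ultimately have "openin (subtopology (tp X) W) {x \<in> topspace (subtopology (tp X) W). f x \<in> pts X \<inter> orb T -` A}"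
        by (rule openin_continuous_map_preimage)
      moreover have "{x \<in> topspace (subtopology (tp X) W). f x \<in> pts X \<inter> orb T -` A} = W \<inter> f -` (pts X \<inter> orb T -` A)"
        using Wo by auto
      ultimately have "openin (tp X) (W \<inter> f -` (pts X \<inter> orb T -` A))" using Wo(1) openin_trans_full by metis
      then show "openin (tp (quot X T)) (orb T ` W \<inter> ind f -` A)" unfolding openin_quot pre using Wo by auto
    qed
    have ptsV: "pts (quot X T) \<inter> orb T ` W = orb T ` W" using Wo by (auto simp: pts_quot)
    have img: "ind f y \<in> orb T ` W" if "y \<in> orb T ` W" for y using that ind_f fW by auto
    show ?thesis
      unfolding morphism_def
    proof (intro conjI allI impI)
      have "continuous_map (subtopology (tp (quot X T)) (orb T ` W)) (tp (quot X T)) (ind f)"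
        unfolding continuous_map_def
      proof (intro conjI allI impI)
        show "ind f \<in> topspace (subtopology (tp (quot X T)) (orb T ` W)) \<rightarrow> topspace (tp (quot X T))"
        proof (rule funcsetI)
          fix y assume "y \<in> topspace (subtopology (tp (quot X T)) (orb T ` W))"
          then have "ind f y \<in> orb T ` W" using img by simp
          then show "ind f y \<in> topspace (tp (quot X T))" using ptsV by blast
        qed
        fix A assume "openin (tp (quot X T)) A"
        note k = key[OF this]
        have "{x \<in> topspace (subtopology (tp (quot X T)) (orb T ` W)). ind f x \<in> A} = orb T ` W \<inter> ind f -` A"
          using ptsV by auto
        then show "openin (subtopology (tp (quot X T)) (orb T ` W))
            {x \<in> topspace (subtopology (tp (quot X T)) (orb T ` W)). ind f x \<in> A}"
          using k Vo by (simp add: openin_open_subtopology)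
      qed
      then show "continuous_map (tp (open_sub (quot X T) (orb T ` W))) (tp (open_sub (quot X T) (orb T ` W))) (ind f)"
        using img by (auto simp: continuous_map_in_subtopology)
      fix A g assume "openin (tp (open_sub (quot X T) (orb T ` W))) A \<and> g \<in> rg (open_sub (quot X T) (orb T ` W)) A"
      then have A: "openin (tp (quot X T)) A" "A \<subseteq> orb T ` W" and g: "g \<circ> orb T \<in> rg X (pts X \<inter> orb T -` A)"
        using Vo by (auto simp: openin_open_subtopology rg_quot)
      have "openin (tp X) (pts X \<inter> orb T -` A)" using A(1) by (simp add: openin_quot)
      moreover have "pts X \<inter> orb T -` A \<subseteq> W" using A(2) sat by blast
      ultimately have "openin (tp (open_sub X W)) (pts X \<inter> orb T -` A)" by (simp add: openin_open_subtopology Wo)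
      from morphism_rg[OF f(1) this] g
      have "(g \<circ> orb T) \<circ> f \<in> rg X (W \<inter> f -` (pts X \<inter> orb T -` A))" by (simp del: vimage_Int)
      then have "(g \<circ> ind f) \<circ> orb T \<in> rg X (W \<inter> f -` (pts X \<inter> orb T -` A))"
        by (rule presheaf_cong[OF presheaf]) (use ind_f in auto)
      then have "g \<circ> ind f \<in> rg (quot X T) (orb T ` W \<inter> ind f -` A)" by (simp only: rg_quot pre)
      then show "g \<circ> ind f \<in> rg (open_sub (quot X T) (orb T ` W)) (pts (open_sub (quot X T) (orb T ` W)) \<inter> ind f -` A)"
        using ptsV by simp
    qed
  qed
  obtain \<phi>' where \<phi>': "morphism (open_sub X W) (open_sub X W) \<phi>" "morphism (open_sub X W) (open_sub X W) \<phi>'"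
      "\<forall>x\<in>W. \<phi>' (\<phi> x) = x" "\<forall>x\<in>W. \<phi> (\<phi>' x) = x"
    using \<phi>(1) unfolding isomorphism_def pts_open_sub WX by blast
  have in_W: "\<phi> x \<in> W" "\<phi>' x \<in> W" if "x \<in> W" for x
    using \<phi>'(1,2) that Wo by (auto simp: morphism_def continuous_map_def)
  have comm': "\<phi>' (T x) = T (\<phi>' x)" if x: "x \<in> W" for x
  proof -
    have "\<phi> (T (\<phi>' x)) = T x" using \<phi>(2)[OF in_W(2)[OF x]] \<phi>'(4) x by simp
    then have "\<phi>' (T x) = \<phi>' (\<phi> (T (\<phi>' x)))" by simp
    also have "\<dots> = T (\<phi>' x)" using \<phi>'(3) W(2)[OF in_W(2)[OF x]] by blast
    finally show ?thesis .
  qed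
  have ind1: "ind \<phi> (orb T x) = orb T (\<phi> x)" "ind \<phi>' (orb T x) = orb T (\<phi>' x)" if "x \<in> W" for x
    using ind[of \<phi> x] ind[of \<phi>' x] \<phi>(2) comm' in_W that by blast+
  have ind_inv: "ind \<phi>' (ind \<phi> y) = y" "ind \<phi> (ind \<phi>' y) = y" if "y \<in> orb T ` W" for y
    using that ind1 in_W \<phi>' by auto
  have ptsV: "pts (open_sub (quot X T) (orb T ` W)) = orb T ` W" using Wo by (auto simp: pts_quot)
  have "isomorphism (open_sub (quot X T) (orb T ` W)) (open_sub (quot X T) (orb T ` W)) (ind \<phi>)"
    unfolding isomorphism_def ptsV
    using mor[OF \<phi>'(1) \<phi>(2)] mor[OF \<phi>'(2) comm'] ind_inv by blast
  then have "birat (quot X T) (orb T ` W) (orb T ` W) (ind \<phi>)"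
    using nopen_quot[OF W(1)] W(2) by (simp add: birat_def)
  moreover have "\<forall>\<^sub>F q in generic. ind \<phi> (orb T (j q)) = orb T (j (m q))"
    using nopen_generic[OF W(1)] m by eventually_elim (simp add: ind1)
  ultimately show ?thesis by blast
qed

end

subsection \<open>Desingularizations\<close>

lemma openin_preimage_morphism:
  assumes "morphism (open_sub X U) (open_sub Y V) f" "openin (tp X) U" "openin (tp Y) W"
  shows "openin (tp X) (U \<inter> f -` W)"
proof -
  have "continuous_map (subtopology (tp X) U) (tp Y) f"
    using assms(1) by (simp add: morphism_def continuous_map_in_subtopology)
  then have "openin (subtopology (tp X) U) {x \<in> topspace (subtopology (tp X) U). f x \<in> W}"
    using assms(3) by (rule openin_continuous_map_preimage)
  moreover have "{x \<in> topspace (subtopology (tp X) U). f x \<in> W} = U \<inter> f -` W"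
    using assms(2) openin_subset by fastforce
  ultimately show ?thesis using assms(2) openin_trans_full by metis
qed

text \<open>On the open sets where \<open>r\<close> is invertible, its inverse \<open>g\<close>
  carries the parametrization from \<open>Q\<close> to \<open>M\<close>, and conjugation by
  \<open>g\<close> carries birational self-maps over. Irreducibility of \<open>M\<close> ensures
  that every nonempty open set of \<open>M\<close> meets the domain of this identification.\<close>

theorem model_birational:
  assumes Q: "model Q \<pi> L" and r: "birational_morphism M Q r" and M: "presheaf M"
    and irr: "\<And>U V. nopen M U \<Longrightarrow> nopen M V \<Longrightarrow> U \<inter> V \<noteq> {}"
  shows "\<exists>\<rho>. model M \<rho> L \<and> (\<forall>\<^sub>F q in generic. r (\<rho> q) = \<pi> q) \<and>
    (\<forall>A B \<psi> m. birat Q A B \<psi> \<and> torus_map m \<and> (\<forall>\<^sub>F q in generic. \<psi> (\<pi> q) = \<pi> (m q)) \<longrightarrow>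
       (\<exists>U V f. birat M U V f \<and> (\<forall>\<^sub>F q in generic. f (\<rho> q) = \<rho> (m q))))"
proof -
  interpret Q: model Q \<pi> L by fact
  obtain U V g where U: "nopen M U" and V: "nopen Q V" and r1: "morphism (open_sub M U) (open_sub Q V) r"
    and g1: "morphism (open_sub Q V) (open_sub M U) g" and gr: "\<forall>x\<in>pts (open_sub M U). g (r x) = x"
    and rg: "\<forall>y\<in>pts (open_sub Q V). r (g y) = y"
    using r unfolding birational_morphism_def isomorphism_def by blast
  have Uo: "openin (tp M) U" "U \<subseteq> pts M" and Vo: "openin (tp Q) V" "V \<subseteq> pts Q"
    using U V openin_subset by (auto simp: nopen_def)
  have ptsU: "pts (open_sub M U) = U" and ptsV: "pts (open_sub Q V) = V" using Uo Vo by auto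
  have gr: "g (r x) = x" if "x \<in> U" for x using gr that ptsU by simp
  have rg: "r (g y) = y" if "y \<in> V" for y using rg that ptsV by simp
  have gU: "g y \<in> U" if "y \<in> V" for y using g1 that Vo by (auto simp: morphism_def continuous_map_def)
  have rV: "r x \<in> V" if "x \<in> U" for x using r1 that Uo by (auto simp: morphism_def continuous_map_def)
  have genV: "\<forall>\<^sub>F q in generic. \<pi> q \<in> V" by (rule Q.nopen_generic[OF V])
  define \<rho> where "\<rho> q = g (\<pi> q)" for q
  have r\<rho>: "\<forall>\<^sub>F q in generic. r (\<rho> q) = \<pi> q" using genV by eventually_elim (simp add: \<rho>_def rg)
  have g2: "morphism (open_sub Q V) M g" by (rule morphism_into_space[OF M Uo(1) Vo(1) g1])
  have r2: "morphism (open_sub M U) Q r" by (rule morphism_into_space[OF Q.presheaf Vo(1) Uo(1) r1])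
  have preQ: "nopen Q (V \<inter> g -` W)" if W: "nopen M W" for W
  proof -
    obtain x where "x \<in> W \<inter> U" using irr[OF W U] by auto
    then have "r x \<in> V \<inter> g -` W" using rV gr by auto
    moreover have "openin (tp Q) (V \<inter> g -` W)"
      by (rule openin_preimage_morphism[OF g1 Vo(1)]) (use W in \<open>simp add: nopen_def\<close>)
    ultimately show ?thesis by (auto simp: nopen_def)
  qed
  have preM: "nopen M (U \<inter> r -` A)" if A: "nopen Q A" for A
  proof -
    obtain y where "y \<in> A \<inter> V" using Q.nopen_Int[OF A V] by (auto simp: nopen_def)
    then have "g y \<in> U \<inter> r -` A" using gU rg by auto
    moreover have "openin (tp M) (U \<inter> r -` A)"
      by (rule openin_preimage_morphism[OF r1 Uo(1)]) (use A in \<open>simp add: nopen_def\<close>)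
    ultimately show ?thesis by (auto simp: nopen_def)
  qed
  have model: "model M \<rho> L"
  proof
    show "presheaf M" by fact
    show "(\<exists>W. nopen M W \<and> (\<forall>y\<in>W. \<phi> y)) \<longleftrightarrow> (\<forall>\<^sub>F q in generic. \<phi> (\<rho> q))" for \<phi>
    proof
      assume "\<exists>W. nopen M W \<and> (\<forall>y\<in>W. \<phi> y)"
      then obtain W where W: "nopen M W" "\<forall>y\<in>W. \<phi> y" by blast
      from Q.nopen_generic[OF preQ[OF W(1)]] show "\<forall>\<^sub>F q in generic. \<phi> (\<rho> q)"
        by eventually_elim (use W in \<open>auto simp: \<rho>_def\<close>)
    next
      assume "\<forall>\<^sub>F q in generic. \<phi> (\<rho> q)"
      then obtain W where W: "nopen Q W" "\<forall>y\<in>W. \<phi> (g y)" using Q.generic_nopen[of "\<lambda>y. \<phi> (g y)"]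
        unfolding \<rho>_def by blast
      have "\<forall>x\<in>U \<inter> r -` W. \<phi> x" using W gr by force
      then show "\<exists>W. nopen M W \<and> (\<forall>y\<in>W. \<phi> y)" using preM[OF W(1)] by blast
    qed
    show "\<exists>R\<in>L. \<forall>\<^sub>F q in generic. f (\<rho> q) = evF R q" if W: "nopen M W" and f: "f \<in> rg M W" for W f
    proof -
      have "f \<circ> g \<in> rg Q (V \<inter> g -` W)" using morphism_rg[OF g2, of W f] W f Vo
        by (simp add: nopen_def Int_absorb1)
      from Q.regular[OF preQ[OF W] this] show ?thesis by (simp add: \<rho>_def)
    qed
    show "\<exists>W f. nopen M W \<and> f \<in> rg M W \<and> (\<forall>\<^sub>F q in generic. f (\<rho> q) = evF R q)" if R: "R \<in> L" for R
    proof -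
      obtain A k where k: "nopen Q A" "k \<in> rg Q A" "\<forall>\<^sub>F q in generic. k (\<pi> q) = evF R q"
        using Q.representable[OF R] by blast
      have "k \<circ> r \<in> rg M (U \<inter> r -` A)" using morphism_rg[OF r2, of A k] k Uo
        by (simp add: nopen_def Int_absorb1)
      moreover have "\<forall>\<^sub>F q in generic. (k \<circ> r) (\<rho> q) = evF R q"
        using r\<rho> k(3) by eventually_elim simp
      ultimately show ?thesis using preM[OF k(1)] by blast
    qed
  qed (fact Q.L_cst Q.L_add Q.L_mult Q.L_inverse)+
  have "\<exists>U V f. birat M U V f \<and> (\<forall>\<^sub>F q in generic. f (\<rho> q) = \<rho> (m q))"
    if \<psi>: "birat Q A B \<psi>" and m: "torus_map m" "\<forall>\<^sub>F q in generic. \<psi> (\<pi> q) = \<pi> (m q)" for A B \<psi> m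
  proof -
    have AB: "openin (tp Q) A" "openin (tp Q) B" "isomorphism (open_sub Q A) (open_sub Q B) \<psi>"
      using \<psi> by (auto simp: birat_def nopen_def)
    \<comment> \<open>The domain is shrunk until it and its image under \<open>\<psi>\<close> both
      lie in \<open>V\<close>, where \<open>g\<close> is available.\<close>
    define A' where "A' = V \<inter> (A \<inter> \<psi> -` V)"
    have A': "nopen Q A'" unfolding A'_def by (rule Q.nopen_Int[OF V Q.birat_preimage[OF \<psi> V]])
    have A'o: "openin (tp Q) A'" "A' \<subseteq> A" "A' \<subseteq> V" using A' by (auto simp: nopen_def A'_def)
    obtain C where C: "openin (tp Q) C" "C = \<psi> ` A'" "isomorphism (open_sub Q A') (open_sub Q C) \<psi>"
      using isomorphism_restrict[OF AB(3) Q.presheaf AB(1) Q.presheaf AB(2) A'o(1,2)] by blast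
    have CV: "C \<subseteq> V" using C(2) by (auto simp: A'_def)
    have giso: "isomorphism (open_sub Q V) (open_sub M U) g"
      unfolding isomorphism_def ptsU ptsV using g1 r1 gr rg by blast
    obtain U1 where U1: "openin (tp M) U1" "U1 = g ` A'" "isomorphism (open_sub Q A') (open_sub M U1) g"
      using isomorphism_restrict[OF giso Q.presheaf Vo(1) \<open>presheaf M\<close> Uo(1) A'o(1,3)] by blast
    obtain U2 where U2: "openin (tp M) U2" "U2 = g ` C" "isomorphism (open_sub Q C) (open_sub M U2) g"
      using isomorphism_restrict[OF giso Q.presheaf Vo(1) \<open>presheaf M\<close> Uo(1) C(1) CV] by blast
    obtain h where h: "isomorphism (open_sub M U1) (open_sub Q A') h" "\<forall>y\<in>pts (open_sub Q A'). h (g y) = y"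
      using Q.isomorphism_inverse[OF U1(3)] by blast
    have "isomorphism (open_sub M U1) (open_sub M U2) (g \<circ> (\<psi> \<circ> h))"
      by (rule isomorphism_comp[OF isomorphism_comp[OF h(1) C(3)] U2(3)])
    moreover have "U1 \<noteq> {}" "U2 \<noteq> {}" using U1(2) U2(2) C(2) A' by (auto simp: nopen_def)
    ultimately have "birat M U1 U2 (g \<circ> (\<psi> \<circ> h))" using U1(1) U2(1) by (simp add: birat_def nopen_def)
    moreover have "\<forall>\<^sub>F q in generic. (g \<circ> (\<psi> \<circ> h)) (\<rho> q) = \<rho> (m q)"
      using Q.nopen_generic[OF A'] Q.generic_pts m(2)
      by eventually_elim (use h(2) in \<open>simp add: \<rho>_def\<close>)
    ultimately show ?thesis by blast
  qed
  then show ?thesis using model r\<rho> by blast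
qed

subsection \<open>Foliations\<close>

text \<open>This makes a birational map determined by its action on rational functions. The family
  is finite so that the generic equality of all its members can be combined into one.\<close>

definition separated_by_functions :: "'a fspace \<Rightarrow> bool" where
  "separated_by_functions Y \<longleftrightarrow> (\<exists>U (J :: nat set) k. nopen Y U \<and> finite J \<and> (\<forall>i\<in>J. k i \<in> rg Y U) \<and>
     (\<forall>x\<in>U. \<forall>y\<in>U. (\<forall>i\<in>J. k i x = k i y) \<longrightarrow> x = y))"

context model
begin

lemma sg_faithful:
  assumes sep: "separated_by_functions Y" and f: "birat Y U V f" and g: "birat Y U' V' g"
    and eq: "\<And>R. R \<in> L \<Longrightarrow> sg f R = sg g R"
  shows "gm f = gm g"
proof (rule gm_cong)
  obtain A and J :: "nat set" and k where A: "nopen Y A" "finite J" "\<forall>i\<in>J. k i \<in> rg Y A"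
      "\<forall>x\<in>A. \<forall>y\<in>A. (\<forall>i\<in>J. k i x = k i y) \<longrightarrow> x = y"
    using sep unfolding separated_by_functions_def by blast
  have "\<forall>\<^sub>F q in generic. \<forall>i\<in>J. k i (f (\<rho> q)) = k i (g (\<rho> q))"
  proof (rule eventually_ball_finite[OF A(2)], rule)
    fix i assume i: "i \<in> J"
    obtain R where R: "R \<in> L" "\<forall>\<^sub>F q in generic. k i (\<rho> q) = evF R q" using regular[OF A(1)] A(3) i by blast
    then have "(A, k i) \<in> cl R" using A i by (simp add: cl_def)
    from sg_ev[OF f R(1) this] sg_ev[OF g R(1) this] show "\<forall>\<^sub>F q in generic. k i (f (\<rho> q)) = k i (g (\<rho> q))"
      by eventually_elim (simp add: eq R)
  qed
  with birat_generic[OF f nopen_generic[OF A(1)]] birat_generic[OF g nopen_generic[OF A(1)]]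
  show "\<forall>\<^sub>F q in generic. f (\<rho> q) = g (\<rho> q)" by eventually_elim (use A(4) in blast)
qed

definition preserves :: "(ratfield \<Rightarrow> ratfield) \<Rightarrow> ('a \<Rightarrow> 'a) \<Rightarrow> bool" where
  "preserves d f \<longleftrightarrow> (\<exists>g\<in>L. \<forall>R\<in>L. sg f (d R) = g * d (sg f R))"

lemma pull_gm:
  assumes f: "birat Y U V f" and "(U', f') \<in> gm f" and R: "R \<in> L"
  shows "pull Y U' f' (cl R) = cl (sg f R)"
proof (rule pull_eq[OF model_axioms model_axioms R])
  have U': "nopen Y U'" and eq: "\<forall>\<^sub>F q in generic. f (\<rho> q) = f' (\<rho> q)" using assms(2) by (auto simp: gm_def)
  show "\<forall>\<^sub>F q in generic. \<rho> q \<in> U'" by (rule nopen_generic[OF U'])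
  fix W k assume "(W, k) \<in> cl R"
  then have "\<forall>\<^sub>F q in generic. f (\<rho> q) \<in> W \<and> k (f (\<rho> q)) = evF (sg f R) q"
    using star_sg[OF f R] by (simp add: star_def)
  with eq show "\<forall>\<^sub>F q in generic. f' (\<rho> q) \<in> W \<and> k (f' (\<rho> q)) = evF (sg f R) q"
    by eventually_elim simp
qed

text \<open>Both sides depend on a representative only through \<open>sg f\<close>. The foliation is
  the line spanned by \<open>D\<close> over the function field, so by multiplicativity of
  \<open>sg f\<close> the condition has to be tested on \<open>D\<close> alone.\<close>

lemma carrier_BirFol:
  assumes D: "D \<in> rvfields Y" "\<And>R. R \<in> L \<Longrightarrow> d R \<in> L \<and> D (cl R) = cl (d R)"
    and F: "F = {\<lambda>h\<in>carrier (ffield Y). f \<otimes>\<^bsub>ffield Y\<^esub> D h | f. f \<in> carrier (ffield Y)}"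
  shows "carrier (BirFol Y F) = {gm f | f. (\<exists>U V. birat Y U V f) \<and> preserves d f}"
proof -
  define lin where "lin a = (\<lambda>h\<in>carrier (ffield Y). cl a \<otimes>\<^bsub>ffield Y\<^esub> D h)" for a
  have F': "F = lin ` L" unfolding F lin_def using carrier_ffield by auto
  have lin: "lin a (cl R) = cl (a * d R)" if "a \<in> L" "R \<in> L" for a R
    using that D(2) by (simp add: lin_def carrier_ffield ffield_mult)
  have rel: "related Y Y U' f' (lin b) (lin a) \<longleftrightarrow> (\<forall>R\<in>L. b * d (sg f R) = sg f (a * d R))"
    if f: "birat Y U V f" and f': "(U', f') \<in> gm f" and ab: "a \<in> L" "b \<in> L" for U V f U' f' a b
  proof -
    have "related Y Y U' f' (lin b) (lin a) \<longleftrightarrow> (\<forall>R\<in>L. lin b (pull Y U' f' (cl R)) = pull Y U' f' (lin a (cl R)))"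
      by (simp add: related_def carrier_ffield)
    also have "\<dots> \<longleftrightarrow> (\<forall>R\<in>L. cl (b * d (sg f R)) = cl (sg f (a * d R)))"
      using ab D(2) by (simp add: pull_gm[OF f f'] lin sg_L[OF f] L_mult)
    also have "\<dots> \<longleftrightarrow> (\<forall>R\<in>L. b * d (sg f R) = sg f (a * d R))"
      using cl_inject ab D(2) sg_L[OF f] L_mult by metis
    finally show ?thesis .
  qed
  have pb: "pulls_back Y Y U' f' F F \<longleftrightarrow> preserves d f" if f: "birat Y U V f" and f': "(U', f') \<in> gm f" for U V f U' f'
  proof -
    have "pulls_back Y Y U' f' F F \<longleftrightarrow> (\<forall>a\<in>L. \<exists>b\<in>L. related Y Y U' f' (lin b) (lin a))"
      by (simp add: pulls_back_def F')
    also have "\<dots> \<longleftrightarrow> (\<forall>a\<in>L. \<exists>b\<in>L. \<forall>R\<in>L. b * d (sg f R) = sg f (a * d R))"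
      using rel[OF f f'] by simp
    also have "\<dots> \<longleftrightarrow> preserves d f"
    proof
      assume "\<forall>a\<in>L. \<exists>b\<in>L. \<forall>R\<in>L. b * d (sg f R) = sg f (a * d R)"
      then obtain b where "b \<in> L" "\<forall>R\<in>L. b * d (sg f R) = sg f (1 * d R)" using L_1 by blast
      then show "preserves d f" unfolding preserves_def by (intro bexI[of _ b]) auto
    next
      assume "preserves d f"
      then obtain g where g: "g \<in> L" "\<forall>R\<in>L. sg f (d R) = g * d (sg f R)" by (auto simp: preserves_def)
      show "\<forall>a\<in>L. \<exists>b\<in>L. \<forall>R\<in>L. b * d (sg f R) = sg f (a * d R)"
      proof
        fix a assume a: "a \<in> L"
        have "\<forall>R\<in>L. (sg f a * g) * d (sg f R) = sg f (a * d R)"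
          using g a D(2) by (simp add: sg_mult[OF f] mult.assoc)
        then show "\<exists>b\<in>L. \<forall>R\<in>L. b * d (sg f R) = sg f (a * d R)" using L_mult[OF sg_L[OF f a] g(1)] by blast
      qed
    qed
    finally show ?thesis .
  qed
  show ?thesis
  proof (intro equalityI subsetI)
    fix A assume "A \<in> carrier (BirFol Y F)"
    then have A: "A \<in> carrier (Bir Y)" "\<forall>(U, f)\<in>A. pulls_back Y Y U f F F" by (auto simp: BirFol_def)
    then obtain f U V where f: "A = gm f" "birat Y U V f" unfolding carrier_Bir by blast
    have "pulls_back Y Y U f F F" using A(2) birat_in_gm[OF f(2)] f(1) by blast
    then show "A \<in> {gm f | f. (\<exists>U V. birat Y U V f) \<and> preserves d f}" using pb[OF f(2) birat_in_gm[OF f(2)]] f by blast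
  next
    fix A assume "A \<in> {gm f | f. (\<exists>U V. birat Y U V f) \<and> preserves d f}"
    then obtain f U V where f: "A = gm f" "birat Y U V f" "preserves d f" by blast
    then have "\<forall>(U, f)\<in>A. pulls_back Y Y U f F F" using pb[OF f(2)] by blast
    then show "A \<in> carrier (BirFol Y F)" unfolding BirFol_def using carrier_Bir f by fastforce
  qed
qed

lemma group_BirFol:
  assumes D: "D \<in> rvfields Y" "\<And>R. R \<in> L \<Longrightarrow> d R \<in> L \<and> D (cl R) = cl (d R)" and R0: "R0 \<in> L" "d R0 \<noteq> 0"
    and F: "F = {\<lambda>h\<in>carrier (ffield Y). f \<otimes>\<^bsub>ffield Y\<^esub> D h | f. f \<in> carrier (ffield Y)}"
  shows "group (BirFol Y F)"
proof -
  interpret Bir: group "Bir Y" by (rule group_Bir)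
  have car: "carrier (BirFol Y F) = {gm f | f. (\<exists>U V. birat Y U V f) \<and> preserves d f}"
    by (rule carrier_BirFol[OF D F])
  have dL: "d R \<in> L" if "R \<in> L" for R using D(2) that by blast
  have sg0: "sg f 0 = 0" if f: "birat Y U V f" for f U V
    using sg_cst[OF f, of 0] by (simp add: cst_simps)
  have sg_nz: "sg f R \<noteq> 0" if f: "birat Y U V f" "R \<in> L" "R \<noteq> 0" for f U V R
    using sg_inverse[OF f(1)] sg0 f by metis
  have "subgroup (carrier (BirFol Y F)) (Bir Y)"
  proof (rule Bir.subgroupI)
    show "carrier (BirFol Y F) \<subseteq> carrier (Bir Y)" by (auto simp: BirFol_def)
    have "preserves d id" unfolding preserves_def by (rule bexI[OF _ L_1]) (simp add: sg_id dL)
    then have "gm id \<in> carrier (BirFol Y F)"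
    proof -
      have "\<exists>U V. birat Y U V id" using birat_id by blast
      with \<open>preserves d id\<close> show ?thesis unfolding car mem_Collect_eq by (intro exI[of _ id]) simp
    qed
    then show "carrier (BirFol Y F) \<noteq> {}" by (metis empty_iff)
  next
    fix A assume "A \<in> carrier (BirFol Y F)"
    then obtain f U V where f: "A = gm f" "birat Y U V f" "preserves d f" unfolding car by blast
    obtain h where h: "birat Y V U h" "gm (h \<circ> f) = gm id" "gm (f \<circ> h) = gm id"
       and fh: "\<And>R. R \<in> L \<Longrightarrow> sg f (sg h R) = R" "\<And>R. R \<in> L \<Longrightarrow> sg h (sg f R) = R"
      using sg_inverse[OF f(2)] by metis
    have "gm h \<otimes>\<^bsub>Bir Y\<^esub> A = \<one>\<^bsub>Bir Y\<^esub>" unfolding f(1) mult_Bir[OF h(1) f(2)] h(2) one_Bir ..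
    then have inv: "inv\<^bsub>Bir Y\<^esub> A = gm h"
      using h(1) f(1,2) by (intro Bir.inv_equality) (auto simp: carrier_Bir)
    obtain g where g: "g \<in> L" "\<forall>R\<in>L. sg f (d R) = g * d (sg f R)" using f(3) by (auto simp: preserves_def)
    \<comment> \<open>The transform of the nonzero element \<open>d R0\<close> is nonzero, hence so
      is the factor; the inverse map then has the factor \<open>inverse (sg h g)\<close>.\<close>
    have g0: "g \<noteq> 0" using g(2) R0 sg_nz[OF f(2) dL[OF R0(1)] R0(2)] by auto
    have "sg h (d R) = inverse (sg h g) * d (sg h R)" if R: "R \<in> L" for R
    proof -
      have "sg f (d (sg h R)) = g * d R" using g(2) sg_L[OF h(1) R] fh(1)[OF R] by simp
      then have "d (sg h R) = sg h (g * d R)" using fh(2) dL sg_L[OF h(1) R] by metis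
      then have "d (sg h R) = sg h g * sg h (d R)" by (simp add: sg_mult[OF h(1)] g dL R)
      then show ?thesis using sg_nz[OF h(1) g(1) g0] by simp
    qed
    then have "preserves d h" unfolding preserves_def using L_inverse[OF sg_L[OF h(1) g(1)]] by blast
    then show "inv\<^bsub>Bir Y\<^esub> A \<in> carrier (BirFol Y F)" unfolding inv car using h(1) by blast
  next
    fix A B assume "A \<in> carrier (BirFol Y F)" "B \<in> carrier (BirFol Y F)"
    then obtain f U V g U' V' where f: "A = gm f" "birat Y U V f" "preserves d f" and g: "B = gm g" "birat Y U' V' g" "preserves d g"
      unfolding car by blast
    obtain a where a: "a \<in> L" "\<forall>R\<in>L. sg f (d R) = a * d (sg f R)" using f(3) by (auto simp: preserves_def)
    obtain b where b: "b \<in> L" "\<forall>R\<in>L. sg g (d R) = b * d (sg g R)" using g(3) by (auto simp: preserves_def)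
    obtain X1 X2 where fg: "birat Y X1 X2 (f \<circ> g)" using birat_comp[OF f(2) g(2)] by blast
    have "sg (f \<circ> g) (d R) = (sg g a * b) * d (sg (f \<circ> g) R)" if R: "R \<in> L" for R
      using a b R by (simp add: sg_comp[OF f(2) g(2)] dL sg_mult[OF g(2)] sg_L[OF f(2)] mult.assoc)
    then have "preserves d (f \<circ> g)" unfolding preserves_def using L_mult[OF sg_L[OF g(2) a(1)] b(1)] by blast
    then show "A \<otimes>\<^bsub>Bir Y\<^esub> B \<in> carrier (BirFol Y F)"
      unfolding f(1) g(1) mult_Bir[OF f(2) g(2)] car using fg by blast
  qed
  from Bir.subgroup_imp_group[OF this] show ?thesis by (simp add: BirFol_def)
qed

lemma mult_BirFol: "monoid.mult (BirFol Y F) = monoid.mult (Bir Y)" and one_BirFol: "monoid.one (BirFol Y F) = monoid.one (Bir Y)"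
  by (simp_all add: BirFol_def)

end

subsection \<open>The Zariski topology on products of projective spaces\<close>

lemma mscale_length [simp]: "length cs = length v \<Longrightarrow> length (mscale cs v) = length v"
  by (simp add: mscale_def)

lemma mscale_nth: "length cs = length v \<Longrightarrow> i < length v \<Longrightarrow> mscale cs v ! i = map ((*) (cs ! i)) (v ! i)"
  by (simp add: mscale_def)

lemma mvecs_length: "v \<in> mvecs ns \<Longrightarrow> length v = length ns"
  by (simp add: mvecs_def)

lemma mptD: "w \<in> mpt v \<Longrightarrow> \<exists>cs. length cs = length v \<and> 0 \<notin> set cs \<and> w = mscale cs v"
  by (auto simp: mpt_def)

lemma mscale_1: "mscale (replicate (length v) 1) v = v"
  by (rule nth_equalityI) (auto simp: mscale_nth intro!: nth_equalityI)

lemma self_in_mpt: "v \<in> mpt v"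
proof -
  have "mscale (replicate (length v) 1) v \<in> mpt v" unfolding mpt_def by fastforce
  then show ?thesis by (simp only: mscale_1)
qed

lemma mscale_mscale:
  assumes "length cs = length v" "length ds = length v"
  shows "mscale ds (mscale cs v) = mscale (map2 (*) ds cs) v"
  using assms by (intro nth_equalityI) (auto simp: mscale_nth mult.assoc)

lemma mpt_mscale:
  assumes "length cs = length v" "0 \<notin> set cs"
  shows "mpt (mscale cs v) = mpt v"
proof (intro equalityI subsetI)
  fix w assume "w \<in> mpt (mscale cs v)"
  then obtain ds where ds: "length ds = length v" "0 \<notin> set ds" "w = mscale ds (mscale cs v)"
    using mptD assms by fastforce
  have "0 \<notin> set (map2 (*) ds cs)" using ds assms by (auto simp: set_zip) (metis nth_mem)+
  then show "w \<in> mpt v" unfolding mpt_def ds(3) mscale_mscale[OF assms(1) ds(1)] using ds(1) assms(1) by fastforce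
next
  fix w assume "w \<in> mpt v"
  then obtain ds where ds: "length ds = length v" "0 \<notin> set ds" "w = mscale ds v" using mptD by blast
  define es where "es = map2 (\<lambda>d c. d / c) ds cs"
  have len: "length es = length v" using ds assms by (simp add: es_def)
  have "map2 (*) es cs = ds"
  proof (rule nth_equalityI)
    fix i assume "i < length (map2 (*) es cs)"
    then have i: "i < length v" using len assms by simp
    then have "cs ! i \<noteq> 0" using assms by (metis nth_mem)
    then show "map2 (*) es cs ! i = ds ! i" using i ds assms len by (simp add: es_def)
  qed (use len assms ds in simp)
  then have "w = mscale es (mscale cs v)" using mscale_mscale[OF assms(1) len] ds(3) by simp
  moreover have "0 \<notin> set es"
    using ds assms by (auto simp: es_def set_zip) (metis nth_mem)+
  ultimately show "w \<in> mpt (mscale cs v)" unfolding mpt_def using len assms by fastforce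
qed

lemma mpt_eqI: "w \<in> mpt v \<Longrightarrow> mpt w = mpt v"
  using mptD mpt_mscale by blast

lemma mscale_mvecs:
  assumes "v \<in> mvecs ns" "length cs = length v" "0 \<notin> set cs"
  shows "mscale cs v \<in> mvecs ns"
  unfolding mvecs_def
proof (intro CollectI conjI allI impI)
  show "length (mscale cs v) = length ns" using assms mvecs_length by simp
  fix i assume i: "i < length ns"
  have iv: "i < length v" using i assms mvecs_length by simp
  show "length (mscale cs v ! i) = Suc (ns ! i)" using assms i iv by (simp add: mscale_nth mvecs_def)
  obtain j where j: "j \<le> ns ! i" "v ! i ! j \<noteq> 0" using assms(1) i by (auto simp: mvecs_def)
  have "j < length (v ! i)" using j(1) assms(1) i by (simp add: mvecs_def)
  moreover have "cs ! i \<noteq> 0" using assms iv by (metis nth_mem)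
  ultimately have "mscale cs v ! i ! j \<noteq> 0" using j assms iv by (simp add: mscale_nth)
  then show "\<exists>j\<le>ns ! i. mscale cs v ! i ! j \<noteq> 0" using j by blast
qed

lemma mpoints_cases:
  assumes "p \<in> mpoints ns"
  obtains v where "v \<in> mvecs ns" "p = mpt v"
  using assms by (auto simp: mpoints_def)

lemma mpointsI: "v \<in> mvecs ns \<Longrightarrow> mpt v \<in> mpoints ns"
  by (simp add: mpoints_def)

lemma mhom_mpt:
  assumes "mhom ns d P" "v \<in> mvecs ns" "w \<in> mpt v"
  shows "\<exists>c. c \<noteq> 0 \<and> P w = c * P v"
proof -
  obtain cs where cs: "length cs = length v" "0 \<notin> set cs" "w = mscale cs v" using mptD assms(3) by blast
  have "cs ! i \<noteq> 0" if "i < length ns" for i using cs assms(2) that mvecs_length by (metis nth_mem)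
  then have "(\<Prod>i<length ns. cs ! i ^ d i) \<noteq> 0" by simp
  moreover have "P w = (\<Prod>i<length ns. cs ! i ^ d i) * P v"
    using assms cs by (auto simp: mhom_def mvecs_length)
  ultimately show ?thesis by blast
qed

lemma mhom_ratio:
  assumes "mhom ns d P" "mhom ns d Q" "v \<in> mvecs ns" "w \<in> mpt v"
  shows "P w / Q w = P v / Q v"
proof -
  obtain cs where cs: "length cs = length v" "0 \<notin> set cs" "w = mscale cs v" using mptD assms(4) by blast
  have "cs ! i \<noteq> 0" if "i < length ns" for i using cs assms(3) that mvecs_length by (metis nth_mem)
  then have "(\<Prod>i<length ns. cs ! i ^ d i) \<noteq> 0" by simp
  then show ?thesis using assms cs mvecs_length by (auto simp: mhom_def)
qed

lemma mhom_const: "mhom ns (\<lambda>_. 0) (\<lambda>v. c)"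
  by (simp add: mhom_def polyfun.const)

lemma mhom_mult: "mhom ns d P \<Longrightarrow> mhom ns e Q \<Longrightarrow> mhom ns (\<lambda>i. d i + e i) (\<lambda>v. P v * Q v)"
  by (auto simp: mhom_def power_add prod.distrib intro: polyfun.mult)

lemma mhom_add: "mhom ns d P \<Longrightarrow> mhom ns d Q \<Longrightarrow> mhom ns d (\<lambda>v. P v + Q v)"
  by (auto simp: mhom_def algebra_simps intro: polyfun.add)

lemma mhom_power: "mhom ns d P \<Longrightarrow> mhom ns (\<lambda>i. k * d i) (\<lambda>v. P v ^ k)"
proof (induction k)
  case 0
  show ?case using mhom_const[of ns 1] by simp
next
  case (Suc k)
  then show ?case using mhom_mult[of ns d P "\<lambda>i. k * d i" "\<lambda>v. P v ^ k"] by simp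
qed

lemma mhom_coord:
  assumes "i < length ns" "j \<le> ns ! i"
  shows "mhom ns (\<lambda>k. if k = i then 1 else 0) (\<lambda>v. v ! i ! j)"
  unfolding mhom_def
proof (intro conjI ballI allI impI)
  show "(\<lambda>v. v ! i ! j) \<in> polyfun ns" using assms by (rule polyfun.coord)
  fix v :: mvec and cs :: "complex list" assume v: "v \<in> mvecs ns" and cs: "length cs = length ns \<and> 0 \<notin> set cs"
  have "j < length (v ! i)" using v assms by (simp add: mvecs_def)
  then have "mscale cs v ! i ! j = cs ! i * v ! i ! j" using v cs assms by (simp add: mscale_nth mvecs_length)
  moreover have "(\<Prod>k<length ns. cs ! k ^ (if k = i then 1 else 0)) = (\<Prod>k<length ns. if k = i then cs ! i else 1)"
    by (rule prod.cong) auto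
  ultimately show "mscale cs v ! i ! j = (\<Prod>k<length ns. cs ! k ^ (if k = i then 1 else 0)) * v ! i ! j"
    using assms by simp
qed

lemma mhom_smult: "mhom ns d P \<Longrightarrow> mhom ns d (\<lambda>v. c * P v)"
  using mhom_mult[OF mhom_const, of ns d P c] by simp

definition basic :: "nat list \<Rightarrow> (mvec \<Rightarrow> complex) \<Rightarrow> mpoint set" where
  "basic ns P = {p \<in> mpoints ns. \<forall>v\<in>p. P v \<noteq> 0}"

lemma mpt_basic: "mhom ns d P \<Longrightarrow> v \<in> mvecs ns \<Longrightarrow> mpt v \<in> basic ns P \<longleftrightarrow> P v \<noteq> 0"
  using mhom_mpt self_in_mpt mpointsI unfolding basic_def by fastforce

lemma basic_Int: "mhom ns d P \<Longrightarrow> mhom ns e Q \<Longrightarrow> basic ns P \<inter> basic ns Q = basic ns (\<lambda>v. P v * Q v)"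
  by (auto simp: basic_def)

lemma openin_basic: "mhom ns d P \<Longrightarrow> openin (zariski ns) (basic ns P)"
  unfolding zariski_def basic_def by (intro topology_generated_by_Basis) blast

text \<open>Products of multihomogeneous polynomials are multihomogeneous, so the generating sets
  are stable under intersection and form a base.\<close>

lemma openin_zariski_basic:
  assumes "openin (zariski ns) U" "p \<in> U"
  shows "\<exists>P d. mhom ns d P \<and> p \<in> basic ns P \<and> basic ns P \<subseteq> U"
proof -
  have "generate_topology_on {{p \<in> mpoints ns. \<forall>v\<in>p. P v \<noteq> 0} | P d. mhom ns d P} U"
    using assms(1) by (simp add: zariski_def openin_topology_generated_by_iff)
  then show ?thesis using assms(2)
  proof (induction arbitrary: p rule: generate_topology_on.induct)
    case (Int a b)
    then have p: "p \<in> a" "p \<in> b" by auto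
    obtain P d where P: "mhom ns d P" "p \<in> basic ns P" "basic ns P \<subseteq> a" using Int.IH(1)[OF p(1)] by blast
    obtain Q e where Q: "mhom ns e Q" "p \<in> basic ns Q" "basic ns Q \<subseteq> b" using Int.IH(2)[OF p(2)] by blast
    have "p \<in> basic ns (\<lambda>v. P v * Q v)" "basic ns (\<lambda>v. P v * Q v) \<subseteq> a \<inter> b"
      using P Q by (auto simp flip: basic_Int[OF P(1) Q(1)])
    then show ?case using mhom_mult[OF P(1) Q(1)] by blast
  next
    case (UN K)
    then obtain k where k: "k \<in> K" "p \<in> k" by blast
    then obtain P d where "mhom ns d P" "p \<in> basic ns P" "basic ns P \<subseteq> k" using UN.IH by blast
    then show ?case using k by blast
  next
    case (Basis s)
    then show ?case by (auto simp: basic_def)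
  qed simp
qed

lemma topspace_zariski: "topspace (zariski ns) = mpoints ns"
proof
  show "topspace (zariski ns) \<subseteq> mpoints ns"
    using openin_zariski_basic[OF openin_topspace] by (fastforce simp: basic_def)
  have "basic ns (\<lambda>v. 1) = mpoints ns" by (simp add: basic_def)
  then show "mpoints ns \<subseteq> topspace (zariski ns)" using openin_subset[OF openin_basic[OF mhom_const]] by metis
qed

lemma tp_mp [simp]: "tp (mp ns Z) = subtopology (zariski ns) Z"
  by (simp add: mp_def)

lemma openin_mp_basic:
  assumes "openin (tp (mp ns Z)) U" "p \<in> U"
  shows "\<exists>P d. mhom ns d P \<and> p \<in> basic ns P \<and> basic ns P \<inter> Z \<subseteq> U"
proof -
  obtain G where G: "openin (zariski ns) G" "U = G \<inter> Z" using assms(1) by (auto simp: openin_subtopology)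
  then obtain P d where "mhom ns d P" "p \<in> basic ns P" "basic ns P \<subseteq> G"
    using openin_zariski_basic[OF G(1)] assms(2) by blast
  then show ?thesis using G(2) by blast
qed

lemma openin_mp: "mhom ns d P \<Longrightarrow> openin (tp (mp ns Z)) (basic ns P \<inter> Z)"
  unfolding tp_mp openin_subtopology using openin_basic by blast

lemma pts_mp: "pts (mp ns Z) = mpoints ns \<inter> Z"
  by (simp add: topspace_zariski)

lemma rg_mp: "f \<in> rg (mp ns Z) U \<longleftrightarrow> (\<forall>p\<in>U. \<exists>V P Q d. openin (tp (mp ns Z)) V \<and> p \<in> V \<and> V \<subseteq> U \<and>
        mhom ns d P \<and> mhom ns d Q \<and> (\<forall>q\<in>V. \<forall>v\<in>q. Q v \<noteq> 0 \<and> f q = P v / Q v))"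
  by (simp add: mp_def)

lemma presheaf_mp: "presheaf (mp ns Z)"
  unfolding presheaf_def
proof (intro conjI allI impI)
  fix U V f assume a: "openin (tp (mp ns Z)) V \<and> V \<subseteq> U \<and> f \<in> rg (mp ns Z) U"
  show "f \<in> rg (mp ns Z) V" unfolding rg_mp
  proof
    fix p assume p: "p \<in> V"
    then obtain W P Q d where W: "openin (tp (mp ns Z)) W" "p \<in> W" "mhom ns d P" "mhom ns d Q"
       "\<forall>q\<in>W. \<forall>v\<in>q. Q v \<noteq> 0 \<and> f q = P v / Q v" using a unfolding rg_mp by blast
    then show "\<exists>W P Q d. openin (tp (mp ns Z)) W \<and> p \<in> W \<and> W \<subseteq> V \<and>
        mhom ns d P \<and> mhom ns d Q \<and> (\<forall>q\<in>W. \<forall>v\<in>q. Q v \<noteq> 0 \<and> f q = P v / Q v)"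
      using a p by (intro exI[of _ "W \<inter> V"] exI[of _ P] exI[of _ Q] exI[of _ d]) auto
  qed
next
  fix U f g assume a: "f \<in> rg (mp ns Z) U \<and> (\<forall>x\<in>U. f x = g x)"
  show "g \<in> rg (mp ns Z) U" unfolding rg_mp
  proof
    fix p assume p: "p \<in> U"
    then obtain W P Q d where W: "openin (tp (mp ns Z)) W" "p \<in> W" "W \<subseteq> U" "mhom ns d P" "mhom ns d Q"
       "\<forall>q\<in>W. \<forall>v\<in>q. Q v \<noteq> 0 \<and> f q = P v / Q v" using a unfolding rg_mp by blast
    then have "\<forall>q\<in>W. \<forall>v\<in>q. Q v \<noteq> 0 \<and> g q = P v / Q v" using a by fastforce
    then show "\<exists>W P Q d. openin (tp (mp ns Z)) W \<and> p \<in> W \<and> W \<subseteq> U \<and>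
        mhom ns d P \<and> mhom ns d Q \<and> (\<forall>q\<in>W. \<forall>v\<in>q. Q v \<noteq> 0 \<and> g q = P v / Q v)" using W by blast
  qed
qed

definition ratio :: "(mvec \<Rightarrow> complex) \<Rightarrow> (mvec \<Rightarrow> complex) \<Rightarrow> mpoint \<Rightarrow> complex" where
  "ratio P Q p = (let v = (SOME v. v \<in> p) in P v / Q v)"

lemma ratio_mpt:
  assumes "mhom ns d P" "mhom ns d Q" "v \<in> mvecs ns"
  shows "ratio P Q (mpt v) = P v / Q v"
proof -
  have "(SOME w. w \<in> mpt v) \<in> mpt v" by (rule someI) (rule self_in_mpt)
  from mhom_ratio[OF assms this] show ?thesis by (simp add: ratio_def Let_def)
qed

lemma ratio_rg:
  assumes "mhom ns d P" "mhom ns d Q"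
  shows "ratio P Q \<in> rg (mp ns Z) (basic ns Q \<inter> Z)"
  unfolding rg_mp
proof
  fix p assume p: "p \<in> basic ns Q \<inter> Z"
  have "\<forall>q\<in>basic ns Q \<inter> Z. \<forall>v\<in>q. Q v \<noteq> 0 \<and> ratio P Q q = P v / Q v"
  proof (intro ballI conjI)
    fix q v assume q: "q \<in> basic ns Q \<inter> Z" "v \<in> q"
    then show "Q v \<noteq> 0" by (auto simp: basic_def)
    obtain w where w: "w \<in> mvecs ns" "q = mpt w" using q by (auto simp: basic_def elim: mpoints_cases)
    then show "ratio P Q q = P v / Q v" using ratio_mpt[OF assms w(1)] mhom_ratio[OF assms w(1)] q by simp
  qed
  then show "\<exists>V P' Q' d. openin (tp (mp ns Z)) V \<and> p \<in> V \<and> V \<subseteq> basic ns Q \<inter> Z \<and>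
        mhom ns d P' \<and> mhom ns d Q' \<and> (\<forall>q\<in>V. \<forall>v\<in>q. Q' v \<noteq> 0 \<and> ratio P Q q = P' v / Q' v)"
    using p assms openin_mp[OF assms(2)] by blast
qed

lemma rquot_ratio: "rquot X P Q = rcls X {p \<in> pts X. \<forall>v\<in>p. Q v \<noteq> 0} (ratio P Q)"
  by (simp add: rquot_def ratio_def[abs_def])

text \<open>The ratios to a homogeneous coordinate that is nonzero somewhere on \<open>Z\<close> are
  affine coordinates on a chart, and they determine the point.\<close>

lemma separated_projective:
  assumes "pts (mp [n] Z) \<noteq> {}"
  shows "separated_by_functions (mp [n] Z)"
proof -
  obtain p where p: "p \<in> mpoints [n]" "p \<in> Z" using assms by (auto simp: topspace_zariski)
  then obtain v where v: "v \<in> mvecs [n]" "p = mpt v" by (auto elim: mpoints_cases)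
  then obtain i0 where i0: "i0 \<le> n" "v ! 0 ! i0 \<noteq> 0" by (auto simp: mvecs_def)
  have mh: "mhom [n] (\<lambda>k. if k = 0 then 1 else 0) (\<lambda>v. v ! 0 ! i)" if "i \<le> n" for i
    by (rule mhom_coord) (use that in auto)
  define U where "U = basic [n] (\<lambda>v. v ! 0 ! i0) \<inter> Z"
  define k where "k i = ratio (\<lambda>v. v ! 0 ! i) (\<lambda>v. v ! 0 ! i0)" for i
  have "p \<in> U" using p v i0 mpt_basic[OF mh[OF i0(1)]] by (simp add: U_def)
  then have "nopen (mp [n] Z) U" using openin_mp[OF mh[OF i0(1)]] by (auto simp: nopen_def U_def)
  moreover have "\<forall>i\<in>{..n}. k i \<in> rg (mp [n] Z) U"
    unfolding k_def U_def using ratio_rg[OF mh mh[OF i0(1)]] by simp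
  moreover have "x = y" if x: "x \<in> U" and y: "y \<in> U" and eq: "\<forall>i\<in>{..n}. k i x = k i y" for x y
  proof -
    obtain a where a: "a \<in> mvecs [n]" "x = mpt a" using x by (auto simp: U_def basic_def elim: mpoints_cases)
    obtain b where b: "b \<in> mvecs [n]" "y = mpt b" using y by (auto simp: U_def basic_def elim: mpoints_cases)
    have nz: "a ! 0 ! i0 \<noteq> 0" "b ! 0 ! i0 \<noteq> 0"
      using x y mpt_basic[OF mh[OF i0(1)]] a b by (auto simp: U_def)
    have e: "a ! 0 ! i / a ! 0 ! i0 = b ! 0 ! i / b ! 0 ! i0" if "i \<le> n" for i
    proof -
      have "k i x = k i y" using eq that by simp
      then show ?thesis using ratio_mpt[OF mh[OF that] mh[OF i0(1)]] a b by (simp add: k_def)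
    qed
    define c where "c = b ! 0 ! i0 / a ! 0 ! i0"
    have len: "length a = 1" "length b = 1" "length (a ! 0) = Suc n" "length (b ! 0) = Suc n"
      using a b by (auto simp: mvecs_def)
    have "mscale [c] a = b"
    proof (rule nth_equalityI)
      fix i assume "i < length (mscale [c] a)"
      then have i: "i = 0" using len by simp
      have "map ((*) c) (a ! 0) = b ! 0"
      proof (rule nth_equalityI)
        fix j assume "j < length (map ((*) c) (a ! 0))"
        then have j: "j \<le> n" using len by simp
        show "map ((*) c) (a ! 0) ! j = b ! 0 ! j" using e[OF j] nz j len by (simp add: c_def field_simps)
      qed (use len in simp)
      then show "mscale [c] a ! i = b ! i" using len i by (simp add: mscale_nth)
    qed (use len in simp)
    then have "b \<in> mpt a" unfolding mpt_def using nz len by (intro CollectI exI[of _ "[c]"]) (auto simp: c_def)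
    then show ?thesis using mpt_eqI a b by simp
  qed
  ultimately show ?thesis unfolding separated_by_functions_def by (intro exI[of _ U] exI[of _ "{..n}"] exI[of _ k]) auto
qed

subsection \<open>Toric charts\<close>

text \<open>\<open>s\<close> embeds the torus into \<open>Z\<close>, with inverse given by
  \<open>Xn / m\<close> and \<open>Yn / m\<close>; \<open>recover\<close> says that it fills the
  locus where all three are nonzero. \<open>dense\<close> joins every point of \<open>Z\<close> to
  the torus by a polynomial curve, which is how irreducibility of \<open>Z\<close> enters.\<close>

locale chart =
  fixes ns :: "nat list" and Z :: "mpoint set" and s :: "complex \<times> complex \<Rightarrow> mvec"
    and Xn Yn m :: "mvec \<Rightarrow> complex" and e :: "nat \<Rightarrow> nat"
  assumes Z: "Z \<subseteq> mpoints ns"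
    and s: "q \<in> torus \<Longrightarrow> s q \<in> mvecs ns \<and> mpt (s q) \<in> Z"
    and s_poly: "i < length ns \<Longrightarrow> j \<le> ns ! i \<Longrightarrow> \<exists>A. \<forall>q. s q ! i ! j = ev2 A q"
    and hX: "mhom ns e Xn" and hY: "mhom ns e Yn" and hm: "mhom ns e m"
    and coords: "q \<in> torus \<Longrightarrow> m (s q) \<noteq> 0 \<and> Xn (s q) = fst q * m (s q) \<and> Yn (s q) = snd q * m (s q)"
    and recover: "v \<in> mvecs ns \<Longrightarrow> mpt v \<in> Z \<Longrightarrow> m v \<noteq> 0 \<Longrightarrow> Xn v \<noteq> 0 \<Longrightarrow> Yn v \<noteq> 0 \<Longrightarrow>
        mpt v = mpt (s (Xn v / m v, Yn v / m v))"
    and dense: "v \<in> mvecs ns \<Longrightarrow> mpt v \<in> Z \<Longrightarrow> \<exists>\<gamma> h. \<gamma> 0 = v \<and>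
        (\<forall>i<length ns. \<forall>j\<le>ns ! i. \<exists>p. \<forall>t. \<gamma> t ! i ! j = poly p t) \<and> h \<noteq> 0 \<and>
        (\<forall>t. poly h t \<noteq> 0 \<longrightarrow> \<gamma> t \<in> mvecs ns \<and> mpt (\<gamma> t) \<in> Z \<and> m (\<gamma> t) \<noteq> 0 \<and> Xn (\<gamma> t) \<noteq> 0 \<and> Yn (\<gamma> t) \<noteq> 0)"
begin

abbreviation X :: "mpoint fspace" where "X \<equiv> mp ns Z"

definition j :: "complex \<times> complex \<Rightarrow> mpoint" where "j q = mpt (s q)"

lemma polyfun_s: "P \<in> polyfun ns \<Longrightarrow> \<exists>A. \<forall>q. P (s q) = ev2 A q"
proof (induction rule: polyfun.induct)
  case (const c)
  show ?case by (intro exI[of _ "[:[:c:]:]"]) simp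
next
  case (coord i j)
  then show ?case using s_poly by blast
next
  case (add P Q)
  then obtain A B where "\<forall>q. P (s q) = ev2 A q" "\<forall>q. Q (s q) = ev2 B q" by blast
  then show ?case by (intro exI[of _ "A + B"]) simp
next
  case (mult P Q)
  then obtain A B where "\<forall>q. P (s q) = ev2 A q" "\<forall>q. Q (s q) = ev2 B q" by blast
  then show ?case by (intro exI[of _ "A * B"]) simp
qed

lemma polyfun_curve:
  assumes "P \<in> polyfun ns" "\<forall>i<length ns. \<forall>j\<le>ns ! i. \<exists>p. \<forall>t. \<gamma> t ! i ! j = poly p t"
  shows "\<exists>p. \<forall>t. P (\<gamma> t) = poly p t"
  using assms(1)
proof (induction rule: polyfun.induct)
  case (const c)
  show ?case by (intro exI[of _ "[:c:]"]) simp
next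
  case (coord i j)
  then show ?case using assms(2) by blast
next
  case (add P Q)
  then obtain A B where "\<forall>q. P (\<gamma> q) = poly A q" "\<forall>q. Q (\<gamma> q) = poly B q" by blast
  then show ?case by (intro exI[of _ "A + B"]) simp
next
  case (mult P Q)
  then obtain A B where "\<forall>q. P (\<gamma> q) = poly A q" "\<forall>q. Q (\<gamma> q) = poly B q" by blast
  then show ?case by (intro exI[of _ "A * B"]) simp
qed

text \<open>Homogenization with respect to \<open>m\<close>. The degree \<open>k\<close> is left
  free, so a sum is formed after raising both summands to a common degree by powers of
  \<open>m\<close>.\<close>

lemma homogenize: "\<exists>k P. mhom ns (\<lambda>i. k * e i) P \<and>
   (\<forall>v\<in>mvecs ns. m v \<noteq> 0 \<longrightarrow> P v = m v ^ k * ev2 A (Xn v / m v, Yn v / m v))"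
proof (induction A rule: bpoly_induct)
  case (cst c)
  show ?case using mhom_const[of ns c] by (intro exI[of _ 0] exI[of _ "\<lambda>v. c"]) simp
next
  case X
  show ?case using hX by (intro exI[of _ 1] exI[of _ Xn]) simp
next
  case Y
  show ?case using hY by (intro exI[of _ 1] exI[of _ Yn]) simp
next
  case (add A B)
  then obtain k P l Q where P: "mhom ns (\<lambda>i. k * e i) P" "\<forall>v\<in>mvecs ns. m v \<noteq> 0 \<longrightarrow> P v = m v ^ k * ev2 A (Xn v / m v, Yn v / m v)"
    and Q: "mhom ns (\<lambda>i. l * e i) Q" "\<forall>v\<in>mvecs ns. m v \<noteq> 0 \<longrightarrow> Q v = m v ^ l * ev2 B (Xn v / m v, Yn v / m v)" by blast
  have "mhom ns (\<lambda>i. k * e i + l * e i) (\<lambda>v. P v * m v ^ l)" "mhom ns (\<lambda>i. l * e i + k * e i) (\<lambda>v. Q v * m v ^ k)"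
    using mhom_mult[OF P(1) mhom_power[OF hm]] mhom_mult[OF Q(1) mhom_power[OF hm]] by simp_all
  then have "mhom ns (\<lambda>i. (k + l) * e i) (\<lambda>v. P v * m v ^ l + Q v * m v ^ k)"
    by (intro mhom_add) (simp_all add: algebra_simps)
  then show ?case using P(2) Q(2)
    by (intro exI[of _ "k + l"] exI[of _ "\<lambda>v. P v * m v ^ l + Q v * m v ^ k"]) (simp add: power_add algebra_simps)
next
  case (mult A B)
  then obtain k P l Q where P: "mhom ns (\<lambda>i. k * e i) P" "\<forall>v\<in>mvecs ns. m v \<noteq> 0 \<longrightarrow> P v = m v ^ k * ev2 A (Xn v / m v, Yn v / m v)"
    and Q: "mhom ns (\<lambda>i. l * e i) Q" "\<forall>v\<in>mvecs ns. m v \<noteq> 0 \<longrightarrow> Q v = m v ^ l * ev2 B (Xn v / m v, Yn v / m v)" by blast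
  have "mhom ns (\<lambda>i. (k + l) * e i) (\<lambda>v. P v * Q v)"
    using mhom_mult[OF P(1) Q(1)] by (simp add: algebra_simps)
  then show ?case using P(2) Q(2)
    by (intro exI[of _ "k + l"] exI[of _ "\<lambda>v. P v * Q v"]) (simp add: power_add algebra_simps)
qed

text \<open>Its nonvanishing locus on \<open>Z\<close> is the embedded torus, by
  \<open>j_torus\<close> and \<open>N_basic\<close>.\<close>

definition N :: "mvec \<Rightarrow> complex" where "N v = m v * Xn v * Yn v"

lemma hN: "mhom ns (\<lambda>i. e i + e i + e i) N"
  unfolding N_def by (intro mhom_mult hm hX hY)

lemma coords': "q \<in> torus \<Longrightarrow> (Xn (s q) / m (s q), Yn (s q) / m (s q)) = q"
  using coords by (simp add: prod_eq_iff)

lemma N_s: "q \<in> torus \<Longrightarrow> N (s q) \<noteq> 0"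
  using coords by (auto simp: N_def torus_def)

lemma N_basic:
  assumes "p \<in> basic ns N \<inter> Z"
  shows "\<exists>v q. v \<in> mvecs ns \<and> p = mpt v \<and> q \<in> torus \<and> p = j q \<and> q = (Xn v / m v, Yn v / m v) \<and> m v \<noteq> 0"
proof -
  obtain v where v: "v \<in> mvecs ns" "p = mpt v" using assms by (auto simp: basic_def elim: mpoints_cases)
  then have "N v \<noteq> 0" using assms mpt_basic[OF hN] by blast
  then have nz: "m v \<noteq> 0" "Xn v \<noteq> 0" "Yn v \<noteq> 0" by (auto simp: N_def)
  then show ?thesis using v recover[OF v(1)] assms by (intro exI[of _ v] exI[of _ "(Xn v / m v, Yn v / m v)"])
    (auto simp: torus_def j_def)
qed

lemma j_torus: "q \<in> torus \<Longrightarrow> j q \<in> basic ns N \<inter> Z"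
  using s N_s mpt_basic[OF hN] by (simp add: j_def)

text \<open>Along the curve from \<open>dense\<close>, \<open>P\<close> becomes a polynomial in one
  variable that is nonzero at \<open>0\<close>. Some parameter therefore gives a torus point with
  \<open>P\<close> nonzero, and then \<open>P\<close> is nonzero at general points.\<close>

lemma j_basic:
  assumes hP: "mhom ns d P" and p: "p \<in> basic ns P \<inter> Z"
  shows "\<forall>\<^sub>F q in generic. j q \<in> basic ns P \<inter> Z"
proof -
  obtain v where v: "v \<in> mvecs ns" "p = mpt v" using p by (auto simp: basic_def elim: mpoints_cases)
  have Pv: "P v \<noteq> 0" using mpt_basic[OF hP v(1)] p v by simp
  obtain \<gamma> h where \<gamma>: "\<gamma> 0 = v" "\<forall>i<length ns. \<forall>j\<le>ns ! i. \<exists>p. \<forall>t. \<gamma> t ! i ! j = poly p t" "h \<noteq> 0"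
      "\<forall>t. poly h t \<noteq> 0 \<longrightarrow> \<gamma> t \<in> mvecs ns \<and> mpt (\<gamma> t) \<in> Z \<and> m (\<gamma> t) \<noteq> 0 \<and> Xn (\<gamma> t) \<noteq> 0 \<and> Yn (\<gamma> t) \<noteq> 0"
    using dense[OF v(1)] p v by blast
  obtain pol where pol: "\<forall>t. P (\<gamma> t) = poly pol t" using polyfun_curve[of P \<gamma>] hP \<gamma>(2) by (auto simp: mhom_def)
  have "poly pol 0 \<noteq> 0" using pol \<gamma>(1) Pv by metis
  then have "pol * h \<noteq> 0" using \<gamma>(3) by auto
  then have "finite {t. poly (pol * h) t = 0}" by (rule poly_roots_finite)
  then obtain t where t: "poly (pol * h) t \<noteq> 0"
    using infinite_UNIV_char_0[where 'a = complex] by (metis (mono_tags, lifting) UNIV_eq_I mem_Collect_eq)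
  then have g: "\<gamma> t \<in> mvecs ns" "mpt (\<gamma> t) \<in> Z" "m (\<gamma> t) \<noteq> 0" "Xn (\<gamma> t) \<noteq> 0" "Yn (\<gamma> t) \<noteq> 0" using \<gamma>(4) by auto
  define q0 where "q0 = (Xn (\<gamma> t) / m (\<gamma> t), Yn (\<gamma> t) / m (\<gamma> t))"
  have q0: "q0 \<in> torus" "mpt (\<gamma> t) = mpt (s q0)" using g recover by (auto simp: q0_def torus_def)
  have "P (\<gamma> t) \<noteq> 0" using pol t by simp
  then have "P (s q0) \<noteq> 0" using mpt_basic[OF hP] g(1) s[OF q0(1)] q0(2) by metis
  moreover obtain A where A: "\<forall>q. P (s q) = ev2 A q" using polyfun_s[of P] hP unfolding mhom_def by blast
  ultimately have "A \<noteq> 0" by auto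
  from eventually_generic_ev2[OF this] eventually_torus show ?thesis
  proof eventually_elim
    case (elim q)
    have "P (s q) = ev2 A q" using A by blast
    then show ?case using elim s mpt_basic[OF hP] by (simp add: j_def)
  qed
qed

theorem model_chart: "model X j UNIV"
proof
  show "presheaf X" by (rule presheaf_mp)
  have fwd: "\<forall>\<^sub>F q in generic. j q \<in> W" if W: "nopen X W" for W
  proof -
    obtain p where p: "p \<in> W" using W by (auto simp: nopen_def)
    then obtain P d where P: "mhom ns d P" "p \<in> basic ns P" "basic ns P \<inter> Z \<subseteq> W"
      using openin_mp_basic W unfolding nopen_def by blast
    have "p \<in> Z" using W p openin_subset[of "tp X" W] unfolding nopen_def pts_mp by blast
    from j_basic[OF P(1), of p] this P show ?thesis by (auto elim: eventually_mono)
  qed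
  show "(\<exists>W. nopen X W \<and> (\<forall>y\<in>W. \<phi> y)) \<longleftrightarrow> (\<forall>\<^sub>F q in generic. \<phi> (j q))" for \<phi>
  proof
    assume "\<exists>W. nopen X W \<and> (\<forall>y\<in>W. \<phi> y)"
    then obtain W where W: "nopen X W" "\<forall>y\<in>W. \<phi> y" by blast
    from fwd[OF W(1)] show "\<forall>\<^sub>F q in generic. \<phi> (j q)" by eventually_elim (use W in blast)
  next
    assume "\<forall>\<^sub>F q in generic. \<phi> (j q)"
    then obtain A where A: "A \<noteq> 0" "\<forall>q. ev2 A q \<noteq> 0 \<longrightarrow> \<phi> (j q)" by (auto simp: eventually_generic)
    obtain k P where P: "mhom ns (\<lambda>i. k * e i) P"
      "\<forall>v\<in>mvecs ns. m v \<noteq> 0 \<longrightarrow> P v = m v ^ k * ev2 A (Xn v / m v, Yn v / m v)" using homogenize by blast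
    note hNP = mhom_mult[OF hN P(1)]
    have eq: "basic ns (\<lambda>v. N v * P v) = basic ns N \<inter> basic ns P" by (rule basic_Int[OF hN P(1), symmetric])
    obtain q0 where q0: "q0 \<in> torus" "ev2 A q0 \<noteq> 0" using ev2_nonzero[OF A(1)] .
    have s0: "s q0 \<in> mvecs ns" "mpt (s q0) \<in> Z" using s[OF q0(1)] by simp_all
    have "P (s q0) = m (s q0) ^ k * ev2 A q0" using P(2) s0 coords[OF q0(1)] coords'[OF q0(1)] by simp
    then have "P (s q0) \<noteq> 0" using coords[OF q0(1)] q0 by simp
    then have "mpt (s q0) \<in> basic ns (\<lambda>v. N v * P v) \<inter> Z"
      using mpt_basic[OF hNP s0(1)] s0(2) N_s[OF q0(1)] by simp
    then have "nopen X (basic ns (\<lambda>v. N v * P v) \<inter> Z)" using openin_mp[OF hNP] by (auto simp: nopen_def)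
    moreover have "\<phi> p" if p: "p \<in> basic ns (\<lambda>v. N v * P v) \<inter> Z" for p
    proof -
      have "p \<in> basic ns N \<inter> Z" using p eq by blast
      then obtain v q where v: "v \<in> mvecs ns" "p = mpt v" "q \<in> torus" "p = j q" "q = (Xn v / m v, Yn v / m v)" "m v \<noteq> 0"
        using N_basic by blast
      have "P v \<noteq> 0" using p eq v mpt_basic[OF P(1) v(1)] by blast
      then have "ev2 A q \<noteq> 0" using P(2) v by auto
      then have "\<phi> (j q)" using A(2) by blast
      then show ?thesis by (simp only: v(4))
    qed
    ultimately show "\<exists>W. nopen X W \<and> (\<forall>y\<in>W. \<phi> y)" by blast
  qed
  show "\<exists>R\<in>UNIV. \<forall>\<^sub>F q in generic. f (j q) = evF R q" if U: "nopen X U" and f: "f \<in> rg X U" for U f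
  proof -
    obtain p where p: "p \<in> U" using U by (auto simp: nopen_def)
    obtain V P Q d where V: "openin (tp X) V" "p \<in> V" "mhom ns d P" "mhom ns d Q"
        "\<forall>q\<in>V. \<forall>v\<in>q. Q v \<noteq> 0 \<and> f q = P v / Q v"
      using bspec[OF f[unfolded rg_mp] p] by (elim exE conjE)
    obtain A where A: "\<forall>q. P (s q) = ev2 A q" using polyfun_s[of P] V(3) unfolding mhom_def by blast
    obtain B where B: "\<forall>q. Q (s q) = ev2 B q" using polyfun_s[of Q] V(4) unfolding mhom_def by blast
    have gen: "\<forall>\<^sub>F q in generic. j q \<in> V" by (rule fwd) (use V in \<open>auto simp: nopen_def\<close>)
    have ev: "ev2 B q \<noteq> 0 \<and> f (j q) = ev2 A q / ev2 B q" if "j q \<in> V" for q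
      using V(5) that self_in_mpt[of "s q"] A B unfolding j_def by metis
    obtain q where "j q \<in> V" using eventually_generic_ex[OF gen] by blast
    then have "B \<noteq> 0" using ev by fastforce
    from evF_Fract[OF this, of A] gen have "\<forall>\<^sub>F q in generic. f (j q) = evF (Fract A B) q"
      by eventually_elim (simp add: ev)
    then show ?thesis by blast
  qed
  show "\<exists>U f. nopen X U \<and> f \<in> rg X U \<and> (\<forall>\<^sub>F q in generic. f (j q) = evF R q)" for R
  proof -
    obtain A B where R: "R = Fract A B" "B \<noteq> 0" by (cases R)
    obtain k P where P: "mhom ns (\<lambda>i. k * e i) P"
      "\<forall>v\<in>mvecs ns. m v \<noteq> 0 \<longrightarrow> P v = m v ^ k * ev2 A (Xn v / m v, Yn v / m v)" using homogenize by blast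
    obtain l Q where Q: "mhom ns (\<lambda>i. l * e i) Q"
      "\<forall>v\<in>mvecs ns. m v \<noteq> 0 \<longrightarrow> Q v = m v ^ l * ev2 B (Xn v / m v, Yn v / m v)" using homogenize by blast
    \<comment> \<open>The two homogenizations may have different degrees; multiplying each by the
      power of \<open>m\<close> belonging to the other makes the degrees equal.\<close>
    define P' Q' where "P' v = P v * m v ^ l" and "Q' v = Q v * m v ^ k" for v
    have hP: "mhom ns (\<lambda>i. k * e i + l * e i) P'"
      unfolding P'_def by (rule mhom_mult[OF P(1) mhom_power[OF hm]])
    have "mhom ns (\<lambda>i. l * e i + k * e i) Q'"
      unfolding Q'_def by (rule mhom_mult[OF Q(1) mhom_power[OF hm]])
    then have hQ: "mhom ns (\<lambda>i. k * e i + l * e i) Q'" by (simp add: add.commute)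
    have val: "P' (s q) = m (s q) ^ (k + l) * ev2 A q" "Q' (s q) = m (s q) ^ (k + l) * ev2 B q" if "q \<in> torus" for q
      using that P(2) Q(2) s[OF that] coords[OF that] coords'[OF that] by (simp_all add: P'_def Q'_def power_add)
    obtain q0 where q0: "q0 \<in> torus" "ev2 B q0 \<noteq> 0" using ev2_nonzero[OF R(2)] .
    have "mpt (s q0) \<in> basic ns Q' \<inter> Z"
      using mpt_basic[OF hQ] s[OF q0(1)] val(2)[OF q0(1)] coords[OF q0(1)] q0 by simp
    then have "nopen X (basic ns Q' \<inter> Z)" using openin_mp[OF hQ] by (auto simp: nopen_def)
    moreover have "\<forall>\<^sub>F q in generic. ratio P' Q' (j q) = evF R q"
      using evF_Fract[OF R(2), of A] eventually_torus
    proof eventually_elim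
      case (elim q)
      then have "ratio P' Q' (j q) = P' (s q) / Q' (s q)" using ratio_mpt[OF hP hQ] s by (simp add: j_def)
      then show ?case using elim val coords by (simp add: R)
    qed
    ultimately show ?thesis using ratio_rg[OF hP hQ] by blast
  qed
qed simp_all

sublocale X: model X j UNIV by (rule model_chart)

lemma rquot_cl:
  assumes "mhom ns d P" "mhom ns d Q" and "\<forall>\<^sub>F q in generic. Q (s q) \<noteq> 0 \<and> P (s q) / Q (s q) = evF R q"
  shows "rquot X P Q = X.cl R"
  unfolding rquot_ratio
proof (rule X.rcls_eq)
  show "\<forall>\<^sub>F q in generic. j q \<in> {p \<in> pts X. \<forall>v\<in>p. Q v \<noteq> 0}"
    using assms(3) eventually_torus
  proof eventually_elim
    case (elim q)
    then have "mpt (s q) \<in> basic ns Q" using mpt_basic[OF assms(2)] s by simp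
    then show ?case using s elim by (simp add: basic_def j_def topspace_zariski)
  qed
  show "\<forall>\<^sub>F q in generic. ratio P Q (j q) = evF R q"
    using assms(3) eventually_torus by eventually_elim (simp add: j_def ratio_mpt[OF assms(1,2)] s)
qed

text \<open>The equation expresses the derivative of \<open>y\<close> through that of
  \<open>x\<close>. With \<open>c\<close> the logarithmic derivative of \<open>x\<close>, the field
  is \<open>c\<close> times \<open>x d/dx + l y d/dy\<close> for
  \<open>l = - w' / w\<close>.\<close>

lemma form_kernel_eigen:
  assumes w: "w \<noteq> 0" and w': "w' \<noteq> 0"
    and D: "D \<in> form_kernel X (X.cl (cst w' * VY)) (X.cl VX) (X.cl (cst w * VX)) (X.cl VY)"
  shows "\<exists>c. \<forall>R. D (X.cl R) = X.cl (c * dF (- w' / w) R)"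
proof -
  have Dv: "D \<in> rvfields X" and eq: "(X.cl (cst w' * VY) \<otimes>\<^bsub>ffield X\<^esub> D (X.cl VX)) \<oplus>\<^bsub>ffield X\<^esub>
     (X.cl (cst w * VX) \<otimes>\<^bsub>ffield X\<^esub> D (X.cl VY)) = \<zero>\<^bsub>ffield X\<^esub>"
    using D by (auto simp: form_kernel_def)
  obtain d where d: "\<And>R. D (X.cl R) = X.cl (d R)" "\<And>R S. d (R + S) = d R + d S" "\<And>R S. d (R * S) = d R * S + R * d S"
     "\<And>c. d (cst c) = 0"
    using X.rvfields_derivation[OF Dv] by auto
  have "X.cl (cst w' * VY * d VX + cst w * VX * d VY) = X.cl 0"
    using eq by (simp add: d(1) X.ffield_mult X.ffield_add X.ffield_zero)
  then have e: "cst w' * VY * d VX + cst w * VX * d VY = 0" by (rule X.cl_inject) simp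
  define c where "c = d VX / VX"
  have "d R = c * dF (- w' / w) R" for R
  proof (rule derivation_ratfield_eqI[where D = d and E = "\<lambda>R. c * dF (- w' / w) R"])
    show "d VX = c * dF (- w' / w) VX" by (simp add: c_def dF_X)
    have "cst (- w' / w) * cst w = - cst w'" using w by (simp flip: cst_simps cst_minus)
    then have "cst (- w' / w) = - cst w' / cst w" using w by (simp add: field_simps)
    moreover have "d VY = - cst w' * VY * d VX / (cst w * VX)"
      using e w by (simp add: field_simps eq_neg_iff_add_eq_0)
    ultimately show "d VY = c * dF (- w' / w) VY" by (simp add: c_def dF_Y mult_ac)
  qed (simp_all add: d dF_add dF_mult dF_cst algebra_simps)
  then show ?thesis using d(1) by (intro exI[of _ c]) simp
qed

end

subsection \<open>The three surfaces\<close>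

lemma mvecs_Nil: "v \<in> mvecs [] \<longleftrightarrow> v = []"
  by (auto simp: mvecs_def)

lemma mvecs_Cons: "v \<in> mvecs (n # ns) \<longleftrightarrow>
    (\<exists>u w. v = u # w \<and> length u = Suc n \<and> (\<exists>j\<le>n. u ! j \<noteq> 0) \<and> w \<in> mvecs ns)"
  by (cases v) (auto simp: mvecs_def All_less_Suc2)

lemma ex_le_1: "(\<exists>j\<le>1. P j) \<longleftrightarrow> P 0 \<or> P (1::nat)"
  by (auto simp: le_Suc_eq)

lemma ex_le_2: "(\<exists>j\<le>2. P j) \<longleftrightarrow> P 0 \<or> P 1 \<or> P (2::nat)"
  by (auto simp: le_Suc_eq numeral_2_eq_2)

lemma length_2_conv: "length u = Suc 1 \<longleftrightarrow> (\<exists>x y. u = [x, y])"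
  by (auto simp: length_Suc_conv)

lemma length_3_conv: "length u = Suc 2 \<longleftrightarrow> (\<exists>x y z. u = [x, y, z])"
  by (auto simp: length_Suc_conv numeral_2_eq_2)

lemma mvecs_2: "v \<in> mvecs [2] \<longleftrightarrow> (\<exists>x y z. v = [[x, y, z]] \<and> (x \<noteq> 0 \<or> y \<noteq> 0 \<or> z \<noteq> 0))"
  unfolding mvecs_Cons mvecs_Nil ex_le_2 length_3_conv by auto

lemma mvecs_11: "v \<in> mvecs [1, 1] \<longleftrightarrow>
    (\<exists>x x' y y'. v = [[x, x'], [y, y']] \<and> (x \<noteq> 0 \<or> x' \<noteq> 0) \<and> (y \<noteq> 0 \<or> y' \<noteq> 0))"
  unfolding mvecs_Cons mvecs_Nil ex_le_1 length_2_conv by auto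

lemma mvecs_2111: "v \<in> mvecs [2, 1, 1, 1] \<longleftrightarrow>
    (\<exists>x y z a1 b1 a2 b2 a3 b3. v = [[x, y, z], [a1, b1], [a2, b2], [a3, b3]] \<and>
      (x \<noteq> 0 \<or> y \<noteq> 0 \<or> z \<noteq> 0) \<and> (a1 \<noteq> 0 \<or> b1 \<noteq> 0) \<and> (a2 \<noteq> 0 \<or> b2 \<noteq> 0) \<and> (a3 \<noteq> 0 \<or> b3 \<noteq> 0))"
  unfolding mvecs_Cons mvecs_Nil ex_le_1 ex_le_2 length_2_conv length_3_conv by fastforce

lemma mpt_1: "c \<noteq> 0 \<Longrightarrow> mpt [map ((*) c) u] = mpt [u]"
  using mpt_mscale[of "[c]" "[u]"] by (simp add: mscale_def)

lemma mpt_2: "c \<noteq> 0 \<Longrightarrow> d \<noteq> 0 \<Longrightarrow> mpt [map ((*) c) u, map ((*) d) v] = mpt [u, v]"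
  using mpt_mscale[of "[c, d]" "[u, v]"] by (simp add: mscale_def)

lemma mpt_4:
  "c1 \<noteq> 0 \<Longrightarrow> c2 \<noteq> 0 \<Longrightarrow> c3 \<noteq> 0 \<Longrightarrow> c4 \<noteq> 0 \<Longrightarrow>
    mpt [map ((*) c1) u1, map ((*) c2) u2, map ((*) c3) u3, map ((*) c4) u4] = mpt [u1, u2, u3, u4]"
  using mpt_mscale[of "[c1, c2, c3, c4]" "[u1, u2, u3, u4]"] by (simp add: mscale_def)

lemma in_mpt_1: "w \<in> mpt [u] \<longleftrightarrow> (\<exists>c. c \<noteq> 0 \<and> w = [map ((*) c) u])"
proof
  assume "w \<in> mpt [u]"
  then obtain cs where "length cs = 1" "0 \<notin> set cs" "w = mscale cs [u]" using mptD by fastforce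
  then show "\<exists>c. c \<noteq> 0 \<and> w = [map ((*) c) u]" by (auto simp: mscale_def length_Suc_conv)
next
  assume "\<exists>c. c \<noteq> 0 \<and> w = [map ((*) c) u]"
  then obtain c where "c \<noteq> 0" "w = [map ((*) c) u]" by blast
  then show "w \<in> mpt [u]" using mpt_1[of c u] self_in_mpt[of w] by simp
qed

lemma less_1_conv: "i < length [a] \<longleftrightarrow> i = 0" and less_2_conv: "i < length [a, b] \<longleftrightarrow> i = 0 \<or> i = 1"
  and less_4_conv: "i < length [a, b, c, d] \<longleftrightarrow> i = 0 \<or> i = 1 \<or> i = 2 \<or> i = (3::nat)"
  by auto

lemma le_1_conv: "j \<le> (1::nat) \<longleftrightarrow> j = 0 \<or> j = 1" and le_2_conv: "j \<le> (2::nat) \<longleftrightarrow> j = 0 \<or> j = 1 \<or> j = 2"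
  by auto

definition bpoly_fun :: "(complex \<times> complex \<Rightarrow> complex) \<Rightarrow> bool" where
  "bpoly_fun f \<longleftrightarrow> (\<exists>A. \<forall>q. f q = ev2 A q)"

lemma bpoly_fun_intros: "bpoly_fun fst" "bpoly_fun snd" "bpoly_fun (\<lambda>q. 1)"
proof -
  show "bpoly_fun fst" unfolding bpoly_fun_def by (intro exI[of _ "[:[:0, 1:]:]"] allI) (simp only: ev2_simps)
  show "bpoly_fun snd" unfolding bpoly_fun_def by (intro exI[of _ "[:0, 1:]"] allI) (simp only: ev2_simps)
  show "bpoly_fun (\<lambda>q. 1)" unfolding bpoly_fun_def by (intro exI[of _ "1"] allI) (simp only: ev2_simps)
qed

definition polynomial_fun :: "(complex \<Rightarrow> complex) \<Rightarrow> bool" where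
  "polynomial_fun f \<longleftrightarrow> (\<exists>p. \<forall>t. f t = poly p t)"

lemma polynomial_fun_intros:
  "polynomial_fun (\<lambda>t. c)" "polynomial_fun (\<lambda>t. t)"
  "polynomial_fun f \<Longrightarrow> polynomial_fun g \<Longrightarrow> polynomial_fun (\<lambda>t. f t + g t)"
  "polynomial_fun f \<Longrightarrow> polynomial_fun g \<Longrightarrow> polynomial_fun (\<lambda>t. f t * g t)"
  "polynomial_fun f \<Longrightarrow> polynomial_fun (\<lambda>t. f t / c)"
proof -
  show "polynomial_fun (\<lambda>t. f t / c)" if f: "polynomial_fun f"
  proof -
    obtain p where "\<forall>t. f t = poly p t" using f by (auto simp: polynomial_fun_def)
    then show ?thesis unfolding polynomial_fun_def by (intro exI[of _ "smult (inverse c) p"]) (simp add: divide_inverse mult.commute)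
  qed
  show "polynomial_fun (\<lambda>t. c)" unfolding polynomial_fun_def by (intro exI[of _ "[:c:]"]) simp
  show "polynomial_fun (\<lambda>t. t)" unfolding polynomial_fun_def by (intro exI[of _ "[:0, 1:]"]) simp
  show "polynomial_fun (\<lambda>t. f t + g t)" if f: "polynomial_fun f" and g: "polynomial_fun g"
  proof -
    obtain p q where "\<forall>t. f t = poly p t" "\<forall>t. g t = poly q t" using f g by (auto simp: polynomial_fun_def)
    then show ?thesis unfolding polynomial_fun_def by (intro exI[of _ "p + q"]) simp
  qed
  show "polynomial_fun (\<lambda>t. f t * g t)" if f: "polynomial_fun f" and g: "polynomial_fun g"
  proof -
    obtain p q where "\<forall>t. f t = poly p t" "\<forall>t. g t = poly q t" using f g by (auto simp: polynomial_fun_def)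
    then show ?thesis unfolding polynomial_fun_def by (intro exI[of _ "p * q"]) simp
  qed
qed

interpretation P2: chart "[2]" "mpoints [2]" "\<lambda>q. [[fst q, snd q, 1]]" "\<lambda>v. v ! 0 ! 0" "\<lambda>v. v ! 0 ! 1" "\<lambda>v. v ! 0 ! 2"
  "\<lambda>k. if k = 0 then 1 else 0"
proof
  show "[[fst q, snd q, 1]] \<in> mvecs [2] \<and> mpt [[fst q, snd q, 1]] \<in> mpoints [2]" for q :: "complex \<times> complex"
    using mpointsI[of "[[fst q, snd q, 1]]" "[2]"] by (simp add: mvecs_2)
  show "\<exists>A. \<forall>q. [[fst q, snd q, 1]] ! i ! j = ev2 A q" if "i < length [2::nat]" "j \<le> [2::nat] ! i" for i j
    using that bpoly_fun_intros unfolding bpoly_fun_def[symmetric] less_1_conv by (auto simp: le_2_conv)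
  show "mpt v = mpt [[fst (v ! 0 ! 0 / v ! 0 ! 2, v ! 0 ! 1 / v ! 0 ! 2), snd (v ! 0 ! 0 / v ! 0 ! 2, v ! 0 ! 1 / v ! 0 ! 2), 1]]"
    if v: "v \<in> mvecs [2]" and nz: "v ! 0 ! 2 \<noteq> 0" for v
  proof -
    obtain x y z where "v = [[x, y, z]]" using v by (auto simp: mvecs_2)
    then show ?thesis using nz mpt_1[of z "[x / z, y / z, 1]"] by simp
  qed
  show "\<exists>\<gamma> h. \<gamma> 0 = v \<and> (\<forall>i<length [2::nat]. \<forall>j\<le>[2::nat] ! i. \<exists>p. \<forall>t. \<gamma> t ! i ! j = poly p t) \<and> h \<noteq> 0 \<and>
      (\<forall>t. poly h t \<noteq> 0 \<longrightarrow> \<gamma> t \<in> mvecs [2] \<and> mpt (\<gamma> t) \<in> mpoints [2] \<and> \<gamma> t ! 0 ! 2 \<noteq> 0 \<and> \<gamma> t ! 0 ! 0 \<noteq> 0 \<and> \<gamma> t ! 0 ! 1 \<noteq> 0)"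
    if v: "v \<in> mvecs [2]" for v
  proof -
    obtain x y z where v: "v = [[x, y, z]]" using v by (auto simp: mvecs_2)
    \<comment> \<open>Translating all coordinates by \<open>t\<close> leaves the coordinate lines
      for all but finitely many \<open>t\<close>; in the polynomial below, \<open>[:x, 1:]\<close>
      stands for \<open>x + t\<close>.\<close>
    have "[[x + t, y + t, z + t]] \<in> mvecs [2] \<and> mpt [[x + t, y + t, z + t]] \<in> mpoints [2]" if "x + t \<noteq> 0" for t
      using that mpointsI[of "[[x + t, y + t, z + t]]" "[2]"] by (simp add: mvecs_2)
    then show ?thesis unfolding less_1_conv v polynomial_fun_def[symmetric]
      by (intro exI[of _ "\<lambda>t. [[x + t, y + t, z + t]]"] exI[of _ "[:x, 1:] * ([:y, 1:] * [:z, 1:])"] conjI)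
        (auto simp: le_2_conv simp del: mult_pCons_left mult_pCons_right intro!: polynomial_fun_intros)
  qed
qed (use mhom_coord[of 0 "[2]"] in \<open>auto simp: torus_def\<close>)

text \<open>The two affine coordinates are brought to the common denominator
  \<open>v ! 0 ! 1 * v ! 1 ! 1\<close>, because a chart requires numerators and denominator of the
  same bidegree.\<close>

interpretation P1P1: chart "[1, 1]" "mpoints [1, 1]" "\<lambda>q. [[fst q, 1], [snd q, 1]]" "\<lambda>v. v ! 0 ! 0 * v ! 1 ! 1"
  "\<lambda>v. v ! 0 ! 1 * v ! 1 ! 0" "\<lambda>v. v ! 0 ! 1 * v ! 1 ! 1" "\<lambda>k. (if k = 0 then 1 else 0) + (if k = 1 then 1 else 0)"
proof
  show "[[fst q, 1], [snd q, 1]] \<in> mvecs [1, 1] \<and> mpt [[fst q, 1], [snd q, 1]] \<in> mpoints [1, 1]" for q :: "complex \<times> complex"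
  proof -
    have "[[fst q, 1], [snd q, 1]] \<in> mvecs [1, 1]" unfolding mvecs_11 by simp
    then show ?thesis using mpointsI by blast
  qed
  show "\<exists>A. \<forall>q. [[fst q, 1], [snd q, 1]] ! i ! j = ev2 A q" if "i < length [1::nat, 1]" "j \<le> [1::nat, 1] ! i" for i j
    using that bpoly_fun_intros unfolding bpoly_fun_def[symmetric] less_2_conv by (auto simp: le_1_conv[unfolded One_nat_def])
  show "mpt v = mpt [[fst (v ! 0 ! 0 * v ! 1 ! 1 / (v ! 0 ! 1 * v ! 1 ! 1), v ! 0 ! 1 * v ! 1 ! 0 / (v ! 0 ! 1 * v ! 1 ! 1)), 1],
      [snd (v ! 0 ! 0 * v ! 1 ! 1 / (v ! 0 ! 1 * v ! 1 ! 1), v ! 0 ! 1 * v ! 1 ! 0 / (v ! 0 ! 1 * v ! 1 ! 1)), 1]]"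
    if v: "v \<in> mvecs [1, 1]" and nz: "v ! 0 ! 1 * v ! 1 ! 1 \<noteq> 0" for v
  proof -
    obtain x x' y y' where "v = [[x, x'], [y, y']]" using v unfolding mvecs_11 by blast
    then show ?thesis using nz mpt_2[of x' y' "[x / x', 1]" "[y / y', 1]"] by simp
  qed
  show "\<exists>\<gamma> h. \<gamma> 0 = v \<and> (\<forall>i<length [1::nat, 1]. \<forall>j\<le>[1::nat, 1] ! i. \<exists>p. \<forall>t. \<gamma> t ! i ! j = poly p t) \<and> h \<noteq> 0 \<and>
      (\<forall>t. poly h t \<noteq> 0 \<longrightarrow> \<gamma> t \<in> mvecs [1, 1] \<and> mpt (\<gamma> t) \<in> mpoints [1, 1] \<and> \<gamma> t ! 0 ! 1 * \<gamma> t ! 1 ! 1 \<noteq> 0 \<and>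
        \<gamma> t ! 0 ! 0 * \<gamma> t ! 1 ! 1 \<noteq> 0 \<and> \<gamma> t ! 0 ! 1 * \<gamma> t ! 1 ! 0 \<noteq> 0)"
    if v: "v \<in> mvecs [1, 1]" for v
  proof -
    obtain x x' y y' where v: "v = [[x, x'], [y, y']]" using v unfolding mvecs_11 by blast
    have "[[x + t, x' + t], [y + t, y' + t]] \<in> mvecs [1, 1] \<and> mpt [[x + t, x' + t], [y + t, y' + t]] \<in> mpoints [1, 1]"
      if "x + t \<noteq> 0" "y + t \<noteq> 0" for t
    proof -
      have "[[x + t, x' + t], [y + t, y' + t]] \<in> mvecs [1, 1]" unfolding mvecs_11 using that by simp
      then show ?thesis using mpointsI by blast
    qed
    then show ?thesis unfolding less_2_conv v polynomial_fun_def[symmetric]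
      by (intro exI[of _ "\<lambda>t. [[x + t, x' + t], [y + t, y' + t]]"]
          exI[of _ "[:x, 1:] * ([:x', 1:] * ([:y, 1:] * [:y', 1:]))"] conjI)
        (auto simp: le_1_conv[unfolded One_nat_def] simp del: mult_pCons_left mult_pCons_right intro!: polynomial_fun_intros)
  qed
  show "mhom [1, 1] (\<lambda>k. (if k = 0 then 1 else 0) + (if k = 1 then 1 else 0)) (\<lambda>v. v ! 0 ! 0 * v ! 1 ! 1)"
    "mhom [1, 1] (\<lambda>k. (if k = 0 then 1 else 0) + (if k = 1 then 1 else 0)) (\<lambda>v. v ! 0 ! 1 * v ! 1 ! 0)"
    "mhom [1, 1] (\<lambda>k. (if k = 0 then 1 else 0) + (if k = 1 then 1 else 0)) (\<lambda>v. v ! 0 ! 1 * v ! 1 ! 1)"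
    by (rule mhom_mult[OF mhom_coord mhom_coord]; simp)+
qed (auto simp: torus_def)

definition Bl3_set :: "mpoint set" where
  "Bl3_set = {p \<in> mpoints [2, 1, 1, 1]. \<forall>v\<in>p.
     v!0!1 * v!1!1 = v!0!2 * v!1!0 \<and> v!0!0 * v!2!1 = v!0!2 * v!2!0 \<and> v!0!0 * v!3!1 = v!0!1 * v!3!0}"

lemma mpt_Bl3:
  assumes v: "[[x, y, z], [a1, b1], [a2, b2], [a3, b3]] \<in> mvecs [2, 1, 1, 1]"
  shows "mpt [[x, y, z], [a1, b1], [a2, b2], [a3, b3]] \<in> Bl3_set \<longleftrightarrow> y * b1 = z * a1 \<and> x * b2 = z * a2 \<and> x * b3 = y * a3"
proof
  assume "mpt [[x, y, z], [a1, b1], [a2, b2], [a3, b3]] \<in> Bl3_set"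
  then show "y * b1 = z * a1 \<and> x * b2 = z * a2 \<and> x * b3 = y * a3"
    using self_in_mpt[of "[[x, y, z], [a1, b1], [a2, b2], [a3, b3]]"] unfolding Bl3_set_def by fastforce
next
  assume e: "y * b1 = z * a1 \<and> x * b2 = z * a2 \<and> x * b3 = y * a3"
  have "w!0!1 * w!1!1 = w!0!2 * w!1!0 \<and> w!0!0 * w!2!1 = w!0!2 * w!2!0 \<and> w!0!0 * w!3!1 = w!0!1 * w!3!0"
    if w: "w \<in> mpt [[x, y, z], [a1, b1], [a2, b2], [a3, b3]]" for w
  proof -
    obtain cs where cs: "length cs = Suc (Suc (Suc (Suc 0)))" "w = mscale cs [[x, y, z], [a1, b1], [a2, b2], [a3, b3]]"
      using mptD[OF w] by auto
    then obtain c1 c2 c3 c4 where "cs = [c1, c2, c3, c4]" unfolding length_Suc_conv length_0_conv by blast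
    then have "w = [[c1 * x, c1 * y, c1 * z], [c2 * a1, c2 * b1], [c3 * a2, c3 * b2], [c4 * a3, c4 * b3]]"
      using cs(2) by (simp add: mscale_def)
    moreover have "c1 * y * (c2 * b1) = c1 * c2 * (y * b1)" "c1 * x * (c3 * b2) = c1 * c3 * (x * b2)"
      "c1 * x * (c4 * b3) = c1 * c4 * (x * b3)" by simp_all
    ultimately show ?thesis using e by simp
  qed
  then show "mpt [[x, y, z], [a1, b1], [a2, b2], [a3, b3]] \<in> Bl3_set" using mpointsI[OF v] by (simp add: Bl3_set_def)
qed

lemma proportional:
  fixes a b y z :: complex
  assumes "y * b = z * a" "y \<noteq> 0 \<or> z \<noteq> 0" "a \<noteq> 0 \<or> b \<noteq> 0"
  shows "\<exists>c. c \<noteq> 0 \<and> a = c * y \<and> b = c * z"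
proof (cases "y = 0")
  case True
  then show ?thesis using assms by (intro exI[of _ "b / z"]) auto
next
  case False
  then have b: "b = a / y * z" using assms by (simp add: field_simps)
  then have "a \<noteq> 0" using assms(3) by auto
  then show ?thesis using b False by (intro exI[of _ "a / y"]) auto
qed

text \<open>Away from the exceptional curves a point is translated as in the plane, and the
  remaining coordinates follow proportionally. A point on an exceptional curve is moved off it in
  the tangent direction that it represents, perturbed so as to avoid the coordinate lines.\<close>

lemma Bl3_curve:
  assumes v: "v \<in> mvecs [2, 1, 1, 1]" "mpt v \<in> Bl3_set"
  shows "\<exists>x y z a1 b1 a2 b2 a3 b3 h.
      (\<forall>f\<in>{x, y, z, a1, b1, a2, b2, a3, b3}. polynomial_fun f) \<and> h \<noteq> 0 \<and>
      v = [[x 0, y 0, z 0], [a1 0, b1 0], [a2 0, b2 0], [a3 0, b3 0]] \<and>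
      (\<forall>t. poly h t \<noteq> 0 \<longrightarrow> x t \<noteq> 0 \<and> y t \<noteq> 0 \<and> z t \<noteq> 0 \<and> (a1 t \<noteq> 0 \<or> b1 t \<noteq> 0) \<and> (a2 t \<noteq> 0 \<or> b2 t \<noteq> 0) \<and> (a3 t \<noteq> 0 \<or> b3 t \<noteq> 0) \<and>
         y t * b1 t = z t * a1 t \<and> x t * b2 t = z t * a2 t \<and> x t * b3 t = y t * a3 t)"
proof -
  obtain X Y Z A1 B1 A2 B2 A3 B3 where v': "v = [[X, Y, Z], [A1, B1], [A2, B2], [A3, B3]]"
    and nz: "X \<noteq> 0 \<or> Y \<noteq> 0 \<or> Z \<noteq> 0" "A1 \<noteq> 0 \<or> B1 \<noteq> 0" "A2 \<noteq> 0 \<or> B2 \<noteq> 0" "A3 \<noteq> 0 \<or> B3 \<noteq> 0"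
    using v(1) unfolding mvecs_2111 by blast
  have e: "Y * B1 = Z * A1" "X * B2 = Z * A2" "X * B3 = Y * A3"
    using v mpt_Bl3 unfolding v' by blast+
  consider (A) "Y \<noteq> 0 \<or> Z \<noteq> 0" "X \<noteq> 0 \<or> Z \<noteq> 0" "X \<noteq> 0 \<or> Y \<noteq> 0" | (B) "Y = 0" "Z = 0" "X \<noteq> 0"
    | (C) "X = 0" "Z = 0" "Y \<noteq> 0" | (D) "X = 0" "Y = 0" "Z \<noteq> 0" using nz(1) by blast
  then show ?thesis
  proof cases
    case A
    obtain c1 where c1: "c1 \<noteq> 0" "A1 = c1 * Y" "B1 = c1 * Z" using proportional[OF e(1) A(1) nz(2)] by blast
    obtain c2 where c2: "c2 \<noteq> 0" "A2 = c2 * X" "B2 = c2 * Z" using proportional[OF e(2) A(2) nz(3)] by blast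
    obtain c3 where c3: "c3 \<noteq> 0" "A3 = c3 * X" "B3 = c3 * Y" using proportional[OF e(3) A(3) nz(4)] by blast
    show ?thesis unfolding v' using c1 c2 c3
      by - (rule exI[of _ "\<lambda>t. X + t"],
          rule exI[of _ "\<lambda>t. Y + t"],
          rule exI[of _ "\<lambda>t. Z + t"],
          rule exI[of _ "\<lambda>t. c1 * (Y + t)"],
          rule exI[of _ "\<lambda>t. c1 * (Z + t)"],
          rule exI[of _ "\<lambda>t. c2 * (X + t)"],
          rule exI[of _ "\<lambda>t. c2 * (Z + t)"],
          rule exI[of _ "\<lambda>t. c3 * (X + t)"],
          rule exI[of _ "\<lambda>t. c3 * (Y + t)"],
          rule exI[of _ "[:X, 1:] * ([:Y, 1:] * [:Z, 1:])"],
          auto simp del: mult_pCons_left mult_pCons_right intro!: polynomial_fun_intros)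
  next
    \<comment> \<open>Over the point \<open>(1:0:0)\<close> the pair \<open>(A1, B1)\<close> is the
      tangent direction; the curve leaves along \<open>(A1 + t, B1 + t)\<close>, and the factor
      \<open>t\<close> places its start on the exceptional curve.\<close>
    case B
    then have "B2 = 0" "B3 = 0" "A2 \<noteq> 0" "A3 \<noteq> 0" using e nz by auto
    then show ?thesis unfolding v' using B
      by - (rule exI[of _ "\<lambda>t. X"],
          rule exI[of _ "\<lambda>t. t * (A1 + t)"],
          rule exI[of _ "\<lambda>t. t * (B1 + t)"],
          rule exI[of _ "\<lambda>t. A1 + t"],
          rule exI[of _ "\<lambda>t. B1 + t"],
          rule exI[of _ "\<lambda>t. A2"],
          rule exI[of _ "\<lambda>t. A2 / X * (t * (B1 + t))"],
          rule exI[of _ "\<lambda>t. A3"],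
          rule exI[of _ "\<lambda>t. A3 / X * (t * (A1 + t))"],
          rule exI[of _ "[:0, 1:] * ([:A1, 1:] * [:B1, 1:])"],
          auto simp del: mult_pCons_left mult_pCons_right intro!: polynomial_fun_intros)
  next
    case C
    then have "B1 = 0" "A3 = 0" "A1 \<noteq> 0" "B3 \<noteq> 0" using e nz by auto
    then show ?thesis unfolding v' using C
      by - (rule exI[of _ "\<lambda>t. t * (A2 + t)"],
          rule exI[of _ "\<lambda>t. Y"],
          rule exI[of _ "\<lambda>t. t * (B2 + t)"],
          rule exI[of _ "\<lambda>t. A1"],
          rule exI[of _ "\<lambda>t. A1 / Y * (t * (B2 + t))"],
          rule exI[of _ "\<lambda>t. A2 + t"],
          rule exI[of _ "\<lambda>t. B2 + t"],
          rule exI[of _ "\<lambda>t. B3 / Y * (t * (A2 + t))"],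
          rule exI[of _ "\<lambda>t. B3"],
          rule exI[of _ "[:0, 1:] * ([:A2, 1:] * [:B2, 1:])"],
          auto simp del: mult_pCons_left mult_pCons_right intro!: polynomial_fun_intros)
  next
    case D
    then have "A1 = 0" "A2 = 0" "B1 \<noteq> 0" "B2 \<noteq> 0" using e nz by auto
    then show ?thesis unfolding v' using D
      by - (rule exI[of _ "\<lambda>t. t * (A3 + t)"],
          rule exI[of _ "\<lambda>t. t * (B3 + t)"],
          rule exI[of _ "\<lambda>t. Z"],
          rule exI[of _ "\<lambda>t. B1 / Z * (t * (B3 + t))"],
          rule exI[of _ "\<lambda>t. B1"],
          rule exI[of _ "\<lambda>t. B2 / Z * (t * (A3 + t))"],
          rule exI[of _ "\<lambda>t. B2"],
          rule exI[of _ "\<lambda>t. A3 + t"],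
          rule exI[of _ "\<lambda>t. B3 + t"],
          rule exI[of _ "[:0, 1:] * ([:A3, 1:] * [:B3, 1:])"],
          auto simp del: mult_pCons_left mult_pCons_right intro!: polynomial_fun_intros)
  qed
qed

interpretation Bl3: chart "[2, 1, 1, 1]" Bl3_set "\<lambda>q. [[fst q, snd q, 1], [snd q, 1], [fst q, 1], [fst q, snd q]]"
  "\<lambda>v. v ! 0 ! 0" "\<lambda>v. v ! 0 ! 1" "\<lambda>v. v ! 0 ! 2" "\<lambda>k. if k = 0 then 1 else 0"
proof
  show "Bl3_set \<subseteq> mpoints [2, 1, 1, 1]" by (auto simp: Bl3_set_def)
  show "[[fst q, snd q, 1], [snd q, 1], [fst q, 1], [fst q, snd q]] \<in> mvecs [2, 1, 1, 1] \<and>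
      mpt [[fst q, snd q, 1], [snd q, 1], [fst q, 1], [fst q, snd q]] \<in> Bl3_set" if "q \<in> torus" for q
  proof -
    have "[[fst q, snd q, 1], [snd q, 1], [fst q, 1], [fst q, snd q]] \<in> mvecs [2, 1, 1, 1]"
      using that unfolding mvecs_2111 by (simp add: torus_def)
    then show ?thesis using mpt_Bl3 by auto
  qed
  show "\<exists>A. \<forall>q. [[fst q, snd q, 1], [snd q, 1], [fst q, 1], [fst q, snd q]] ! i ! j = ev2 A q"
    if "i < length [2::nat, 1, 1, 1]" "j \<le> [2::nat, 1, 1, 1] ! i" for i j
    using that bpoly_fun_intros unfolding bpoly_fun_def[symmetric] less_4_conv by (auto simp: le_2_conv le_1_conv[unfolded One_nat_def])
  show "mpt v = mpt [[fst (v!0!0 / v!0!2, v!0!1 / v!0!2), snd (v!0!0 / v!0!2, v!0!1 / v!0!2), 1],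
     [snd (v!0!0 / v!0!2, v!0!1 / v!0!2), 1], [fst (v!0!0 / v!0!2, v!0!1 / v!0!2), 1],
     [fst (v!0!0 / v!0!2, v!0!1 / v!0!2), snd (v!0!0 / v!0!2, v!0!1 / v!0!2)]]"
    if v: "v \<in> mvecs [2, 1, 1, 1]" "mpt v \<in> Bl3_set" and nz: "v ! 0 ! 2 \<noteq> 0" "v ! 0 ! 0 \<noteq> 0" "v ! 0 ! 1 \<noteq> 0" for v
  proof -
    obtain x y z a1 b1 a2 b2 a3 b3 where v': "v = [[x, y, z], [a1, b1], [a2, b2], [a3, b3]]"
      and n: "a1 \<noteq> 0 \<or> b1 \<noteq> 0" "a2 \<noteq> 0 \<or> b2 \<noteq> 0" "a3 \<noteq> 0 \<or> b3 \<noteq> 0"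
      using v(1) unfolding mvecs_2111 by blast
    have xyz: "x \<noteq> 0" "y \<noteq> 0" "z \<noteq> 0" using nz by (simp_all add: v')
    have e: "y * b1 = z * a1" "x * b2 = z * a2" "x * b3 = y * a3" using v mpt_Bl3 unfolding v' by blast+
    obtain c1 where c1: "c1 \<noteq> 0" "a1 = c1 * y" "b1 = c1 * z" using proportional[OF e(1) _ n(1)] xyz by blast
    obtain c2 where c2: "c2 \<noteq> 0" "a2 = c2 * x" "b2 = c2 * z" using proportional[OF e(2) _ n(2)] xyz by blast
    obtain c3 where c3: "c3 \<noteq> 0" "a3 = c3 * x" "b3 = c3 * y" using proportional[OF e(3) _ n(3)] xyz by blast
    show ?thesis using xyz c1 c2 c3
      mpt_4[of z "c1 * z" "c2 * z" "c3 * z" "[x / z, y / z, 1]" "[y / z, 1]" "[x / z, 1]" "[x / z, y / z]"]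
      by (simp add: v')
  qed
  show "\<exists>\<gamma> h. \<gamma> 0 = v \<and> (\<forall>i<length [2::nat, 1, 1, 1]. \<forall>j\<le>[2::nat, 1, 1, 1] ! i. \<exists>p. \<forall>t. \<gamma> t ! i ! j = poly p t) \<and> h \<noteq> 0 \<and>
      (\<forall>t. poly h t \<noteq> 0 \<longrightarrow> \<gamma> t \<in> mvecs [2, 1, 1, 1] \<and> mpt (\<gamma> t) \<in> Bl3_set \<and> \<gamma> t ! 0 ! 2 \<noteq> 0 \<and> \<gamma> t ! 0 ! 0 \<noteq> 0 \<and> \<gamma> t ! 0 ! 1 \<noteq> 0)"
    if v: "v \<in> mvecs [2, 1, 1, 1]" "mpt v \<in> Bl3_set" for v
  proof -
    obtain x y z a1 b1 a2 b2 a3 b3 h where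
      pf: "\<forall>f\<in>{x, y, z, a1, b1, a2, b2, a3, b3}. polynomial_fun f" and h: "h \<noteq> 0"
      and v0: "v = [[x 0, y 0, z 0], [a1 0, b1 0], [a2 0, b2 0], [a3 0, b3 0]]"
      and t: "\<forall>t. poly h t \<noteq> 0 \<longrightarrow> x t \<noteq> 0 \<and> y t \<noteq> 0 \<and> z t \<noteq> 0 \<and> (a1 t \<noteq> 0 \<or> b1 t \<noteq> 0) \<and> (a2 t \<noteq> 0 \<or> b2 t \<noteq> 0) \<and> (a3 t \<noteq> 0 \<or> b3 t \<noteq> 0) \<and>
         y t * b1 t = z t * a1 t \<and> x t * b2 t = z t * a2 t \<and> x t * b3 t = y t * a3 t"
      using Bl3_curve[OF v] by (elim exE conjE) 
    define \<gamma> where "\<gamma> t = [[x t, y t, z t], [a1 t, b1 t], [a2 t, b2 t], [a3 t, b3 t]]" for t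
    have "\<gamma> t \<in> mvecs [2, 1, 1, 1] \<and> mpt (\<gamma> t) \<in> Bl3_set" if "poly h t \<noteq> 0" for t
    proof -
      have "\<gamma> t \<in> mvecs [2, 1, 1, 1]" unfolding \<gamma>_def mvecs_2111 using t that by auto
      then show ?thesis using mpt_Bl3 t that unfolding \<gamma>_def by blast
    qed
    moreover have "\<forall>i<length [2::nat, 1, 1, 1]. \<forall>j\<le>[2::nat, 1, 1, 1] ! i. polynomial_fun (\<lambda>t. \<gamma> t ! i ! j)"
      unfolding less_4_conv using pf by (auto simp: \<gamma>_def le_2_conv le_1_conv[unfolded One_nat_def])
    ultimately show ?thesis using h t v0 unfolding polynomial_fun_def
      by (intro exI[of _ \<gamma>] exI[of _ h]) (auto simp: \<gamma>_def)
  qed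
qed (use mhom_coord[of 0 "[2, 1, 1, 1]"] in \<open>auto simp: torus_def\<close>)

lemma P2_X: "P2 = P2.X" and P1P1_X: "P1P1 = P1P1.X" and Bl3_X: "Bl3 = Bl3.X"
  by (simp_all add: P2_def P1P1_def Bl3_def Bl3_set_def)

subsection \<open>The foliations\<close>

lemma evF_cst_mult: "\<forall>\<^sub>F q in generic. evF (cst c * u) q = c * evF u q"
  using evF_mult[of "cst c" u] by eventually_elim simp

lemma rquot_P2:
  "rquot P2 (\<lambda>v. c * v!0!1) (\<lambda>v. v!0!2) = P2.X.cl (cst c * VY)"
  "rquot P2 (\<lambda>v. c * v!0!0) (\<lambda>v. v!0!2) = P2.X.cl (cst c * VX)"
  "rquot P2 (\<lambda>v. v!0!1) (\<lambda>v. v!0!2) = P2.X.cl VY"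
  "rquot P2 (\<lambda>v. v!0!0) (\<lambda>v. v!0!2) = P2.X.cl VX"
proof -
  have h: "mhom [2] (\<lambda>k. if k = 0 then 1 else 0) (\<lambda>v. v ! 0 ! i)" if "i \<le> 2" for i
    by (rule mhom_coord) (use that in auto)
  show "rquot P2 (\<lambda>v. c * v!0!1) (\<lambda>v. v!0!2) = P2.X.cl (cst c * VY)" unfolding P2_X
    by (rule P2.rquot_cl[OF mhom_smult[OF h] h]) (use evF_cst_mult[of c VY] in \<open>auto elim: eventually_mono\<close>)
  show "rquot P2 (\<lambda>v. c * v!0!0) (\<lambda>v. v!0!2) = P2.X.cl (cst c * VX)" unfolding P2_X
    by (rule P2.rquot_cl[OF mhom_smult[OF h] h]) (use evF_cst_mult[of c VX] in \<open>auto elim: eventually_mono\<close>)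
  show "rquot P2 (\<lambda>v. v!0!1) (\<lambda>v. v!0!2) = P2.X.cl VY" unfolding P2_X
    by (rule P2.rquot_cl[OF h h]) auto
  show "rquot P2 (\<lambda>v. v!0!0) (\<lambda>v. v!0!2) = P2.X.cl VX" unfolding P2_X
    by (rule P2.rquot_cl[OF h h]) auto
qed

lemma rquot_P1P1:
  "rquot P1P1 (\<lambda>v. v!1!0) (\<lambda>v. v!1!1) = P1P1.X.cl VY"
  "rquot P1P1 (\<lambda>v. v!0!0) (\<lambda>v. v!0!1) = P1P1.X.cl VX"
  "rquot P1P1 (\<lambda>v. c * v!0!0) (\<lambda>v. v!0!1) = P1P1.X.cl (cst c * VX)"
proof -
  have h0: "mhom [1, 1] (\<lambda>k. if k = 0 then 1 else 0) (\<lambda>v. v ! 0 ! i)" if "i \<le> 1" for i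
    by (rule mhom_coord) (use that in auto)
  have h1: "mhom [1, 1] (\<lambda>k. if k = 1 then 1 else 0) (\<lambda>v. v ! 1 ! i)" if "i \<le> 1" for i
    by (rule mhom_coord) (use that in auto)
  show "rquot P1P1 (\<lambda>v. v!1!0) (\<lambda>v. v!1!1) = P1P1.X.cl VY" unfolding P1P1_X
    by (rule P1P1.rquot_cl[OF h1 h1]) auto
  show "rquot P1P1 (\<lambda>v. v!0!0) (\<lambda>v. v!0!1) = P1P1.X.cl VX" unfolding P1P1_X
    by (rule P1P1.rquot_cl[OF h0 h0]) auto
  show "rquot P1P1 (\<lambda>v. c * v!0!0) (\<lambda>v. v!0!1) = P1P1.X.cl (cst c * VX)" unfolding P1P1_X
    by (rule P1P1.rquot_cl[OF mhom_smult[OF h0] h0]) (use evF_cst_mult[of c VX] in \<open>auto elim: eventually_mono\<close>)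
qed

lemma E3_eigen:
  assumes "w \<noteq> 0" "D \<in> E3 w"
  shows "\<exists>c. \<forall>R. D (P2.X.cl R) = P2.X.cl (c * dF (- w) R)"
proof -
  have w: "- (w ^ 2) / w = - w" using assms(1) by (simp add: power2_eq_square)
  have "D \<in> form_kernel P2.X (P2.X.cl (cst (w ^ 2) * VY)) (P2.X.cl VX) (P2.X.cl (cst w * VX)) (P2.X.cl VY)"
    using assms(2) unfolding E3_def rquot_P2 unfolding P2_X .
  from P2.form_kernel_eigen[OF _ _ this] show ?thesis unfolding w using assms(1) by simp
qed

lemma E4_eigen:
  assumes "D \<in> E4"
  shows "\<exists>c. \<forall>R. D (P1P1.X.cl R) = P1P1.X.cl (c * dF (- \<i>) R)"
proof -
  have w: "- 1 / (- \<i>) = - \<i>" by (simp add: complex_eq_iff)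
  have "VY = cst 1 * VY" by (simp add: cst_simps)
  moreover have "D \<in> form_kernel P1P1.X (P1P1.X.cl VY) (P1P1.X.cl VX) (P1P1.X.cl (cst (- \<i>) * VX)) (P1P1.X.cl VY)"
    using assms unfolding E4_def rquot_P1P1 unfolding P1P1_X .
  ultimately have "D \<in> form_kernel P1P1.X (P1P1.X.cl (cst 1 * VY)) (P1P1.X.cl VX) (P1P1.X.cl (cst (- \<i>) * VX)) (P1P1.X.cl VY)"
    by simp
  from P1P1.form_kernel_eigen[OF _ _ this] show ?thesis unfolding w by (auto simp: complex_eq_iff)
qed

lemma image_in_mpt: "(\<lambda>v. [v ! 0]) ` mpt [[x, y, z], [a1, b1], [a2, b2], [a3, b3]] = mpt [[x, y, z]]"
proof (intro equalityI subsetI)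
  fix w assume "w \<in> (\<lambda>v. [v ! 0]) ` mpt [[x, y, z], [a1, b1], [a2, b2], [a3, b3]]"
  then obtain cs where cs: "length cs = Suc (Suc (Suc (Suc 0)))" "0 \<notin> set cs" 
      "w = [mscale cs [[x, y, z], [a1, b1], [a2, b2], [a3, b3]] ! 0]" using mptD by fastforce
  then obtain c1 c2 c3 c4 where "cs = [c1, c2, c3, c4]" unfolding length_Suc_conv length_0_conv by blast
  then show "w \<in> mpt [[x, y, z]]" using cs by (auto simp: in_mpt_1 mscale_def)
next
  fix w assume "w \<in> mpt [[x, y, z]]"
  then obtain c where c: "c \<noteq> 0" "w = [map ((*) c) [x, y, z]]" unfolding in_mpt_1 by blast
  have "mscale [c, 1, 1, 1] [[x, y, z], [a1, b1], [a2, b2], [a3, b3]] \<in> mpt [[x, y, z], [a1, b1], [a2, b2], [a3, b3]]"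
    unfolding mpt_def using c by (intro CollectI exI[of _ "[c, 1, 1, 1]"]) simp
  then show "w \<in> (\<lambda>v. [v ! 0]) ` mpt [[x, y, z], [a1, b1], [a2, b2], [a3, b3]]"
    by (rule rev_image_eqI) (simp add: c mscale_def)
qed

lemma blowdown_j: "blowdown (Bl3.j q) = P2.j q"
  by (simp add: blowdown_def Bl3.j_def P2.j_def image_in_mpt)

text \<open>The blow-down matches the two torus charts, so it identifies both function fields with
  the same field, and the lifted vector field is the same derivation.\<close>

lemma E6_eigen:
  assumes "w \<noteq> 0" "D \<in> E6 w"
  shows "\<exists>c. \<forall>R. D (Bl3.X.cl R) = Bl3.X.cl (c * dF (- w) R)"
proof -
  obtain D' where D': "D' \<in> E3 w" "related Bl3 P2 (pts Bl3) blowdown D D'" using assms(2) by (auto simp: E6_def)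
  obtain c where c: "\<forall>R. D' (P2.X.cl R) = P2.X.cl (c * dF (- w) R)" using E3_eigen[OF assms(1) D'(1)] by blast
  have pull: "pull Bl3.X (pts Bl3.X) blowdown (P2.X.cl R) = Bl3.X.cl R" for R
    by (rule pull_same[OF Bl3.model_chart P2.model_chart UNIV_I Bl3.X.generic_pts]) (simp add: blowdown_j)
  have "D (Bl3.X.cl R) = Bl3.X.cl (c * dF (- w) R)" for R
  proof -
    have "D (pull Bl3.X (pts Bl3.X) blowdown (P2.X.cl R)) = pull Bl3.X (pts Bl3.X) blowdown (D' (P2.X.cl R))"
      using D'(2) P2.X.carrier_ffield unfolding related_def P2_X Bl3_X by blast
    then show ?thesis by (simp only: c pull)
  qed
  then show ?thesis by blast
qed

subsection \<open>Maps given by polynomials in homogeneous coordinates\<close>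

lemma polyfun_comp:
  assumes "P \<in> polyfun ns" "\<And>i j. i < length ns \<Longrightarrow> j \<le> ns ! i \<Longrightarrow> (\<lambda>v. \<Phi> v ! i ! j) \<in> polyfun ns'"
  shows "(\<lambda>v. P (\<Phi> v)) \<in> polyfun ns'"
  using assms(1) by (induction rule: polyfun.induct) (auto intro: polyfun.intros assms(2))

text \<open>\<open>\<Phi>\<close> acts on homogeneous coordinates and may be undefined as a map of
  points where \<open>M\<close> vanishes. \<open>\<kappa>\<close> records how it transforms scalars
  and \<open>\<delta>\<close> how it transforms degrees; surjectivity of \<open>\<kappa>\<close>
  makes the image of a point, as a set of vectors, a full point.\<close>

locale homogeneous_map =
  fixes ns :: "nat list" and \<Phi> :: "mvec \<Rightarrow> mvec" and M :: "mvec \<Rightarrow> complex" and dM :: "nat \<Rightarrow> nat"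
    and \<kappa> :: "complex list \<Rightarrow> complex list" and \<delta> :: "(nat \<Rightarrow> nat) \<Rightarrow> nat \<Rightarrow> nat"
  assumes M: "mhom ns dM M"
    and poly: "i < length ns \<Longrightarrow> j \<le> ns ! i \<Longrightarrow> (\<lambda>v. \<Phi> v ! i ! j) \<in> polyfun ns"
    and \<Phi>: "v \<in> mvecs ns \<Longrightarrow> M v \<noteq> 0 \<Longrightarrow> \<Phi> v \<in> mvecs ns"
    and scale: "v \<in> mvecs ns \<Longrightarrow> length cs = length ns \<Longrightarrow> 0 \<notin> set cs \<Longrightarrow> \<Phi> (mscale cs v) = mscale (\<kappa> cs) (\<Phi> v)"
    and \<kappa>: "length cs = length ns \<Longrightarrow> 0 \<notin> set cs \<Longrightarrow> length (\<kappa> cs) = length ns \<and> 0 \<notin> set (\<kappa> cs)"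
    and \<kappa>_surj: "length ds = length ns \<Longrightarrow> 0 \<notin> set ds \<Longrightarrow> \<exists>cs. length cs = length ns \<and> 0 \<notin> set cs \<and> \<kappa> cs = ds"
    and \<delta>: "length cs = length ns \<Longrightarrow> (\<Prod>i<length ns. \<kappa> cs ! i ^ d i) = (\<Prod>i<length ns. cs ! i ^ \<delta> d i)"
begin

lemma image_mpt:
  assumes v: "v \<in> mvecs ns" "M v \<noteq> 0"
  shows "\<Phi> ` mpt v = mpt (\<Phi> v)"
proof (intro equalityI subsetI)
  fix w assume "w \<in> \<Phi> ` mpt v"
  then obtain cs where cs: "length cs = length v" "0 \<notin> set cs" "w = \<Phi> (mscale cs v)" using mptD by blast
  then show "w \<in> mpt (\<Phi> v)"
    using scale[OF v(1)] \<kappa>[of cs] mvecs_length[OF v(1)] mvecs_length[OF \<Phi>[OF v]] unfolding mpt_def by auto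
next
  fix w assume "w \<in> mpt (\<Phi> v)"
  then obtain ds where ds: "length ds = length ns" "0 \<notin> set ds" "w = mscale ds (\<Phi> v)"
    using mptD mvecs_length[OF \<Phi>[OF v]] by metis
  then obtain cs where cs: "length cs = length ns" "0 \<notin> set cs" "\<kappa> cs = ds" using \<kappa>_surj by blast
  then have "w = \<Phi> (mscale cs v)" using scale[OF v(1)] ds by simp
  moreover have "mscale cs v \<in> mpt v" unfolding mpt_def using cs mvecs_length[OF v(1)] by auto
  ultimately show "w \<in> \<Phi> ` mpt v" by blast
qed

text \<open>The factor \<open>M\<close> keeps the scaling law valid also where
  \<open>\<Phi> v\<close> may be the zero vector, since both sides vanish there. It also restricts
  the basic open set to the domain of the map.\<close>

lemma pullback:
  assumes P: "mhom ns d P"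
  shows "mhom ns (\<lambda>i. \<delta> d i + dM i) (\<lambda>v. P (\<Phi> v) * M v)"
  unfolding mhom_def
proof (intro conjI ballI allI impI)
  show "(\<lambda>v. P (\<Phi> v) * M v) \<in> polyfun ns"
  proof (rule polyfun.mult)
    show "(\<lambda>v. P (\<Phi> v)) \<in> polyfun ns" by (rule polyfun_comp[OF _ poly]) (use P in \<open>simp_all add: mhom_def\<close>)
    show "M \<in> polyfun ns" using M by (simp add: mhom_def)
  qed
  fix v :: mvec and cs :: "complex list" assume v: "v \<in> mvecs ns" and cs: "length cs = length ns \<and> 0 \<notin> set cs"
  have Mv: "M (mscale cs v) = (\<Prod>i<length ns. cs ! i ^ dM i) * M v" using M v cs by (simp add: mhom_def)
  show "P (\<Phi> (mscale cs v)) * M (mscale cs v) = (\<Prod>i<length ns. cs ! i ^ (\<delta> d i + dM i)) * (P (\<Phi> v) * M v)"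
  proof (cases "M v = 0")
    case False
    have "P (mscale (\<kappa> cs) (\<Phi> v)) = (\<Prod>i<length ns. \<kappa> cs ! i ^ d i) * P (\<Phi> v)"
      using P \<Phi>[OF v False] \<kappa>[of cs] cs by (simp add: mhom_def)
    then show ?thesis using cs by (simp add: scale[OF v] Mv \<delta> power_add prod.distrib)
  qed (simp add: Mv)
qed

abbreviation X where "X \<equiv> mp ns (mpoints ns)"

lemma image_basic:
  assumes P: "mhom ns d P" and p: "p \<in> basic ns M"
  shows "\<Phi> ` p \<in> basic ns P \<longleftrightarrow> p \<in> basic ns (\<lambda>v. P (\<Phi> v) * M v)"
proof -
  obtain v where v: "v \<in> mvecs ns" "p = mpt v" using p by (auto simp: basic_def elim: mpoints_cases)
  then have Mv: "M v \<noteq> 0" using p mpt_basic[OF M] by blast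
  show ?thesis unfolding v(2) image_mpt[OF v(1) Mv]
    using mpt_basic[OF P \<Phi>[OF v(1) Mv]] mpt_basic[OF pullback[OF P] v(1)] Mv by simp
qed

lemma openin_basic': "mhom ns d P \<Longrightarrow> openin (tp X) (basic ns P)"
  using openin_mp[of ns d P "mpoints ns"] by (simp add: basic_def Int_absorb2 subset_eq)

lemma basic_sub: "basic ns (\<lambda>v. P v * M v) \<subseteq> basic ns M"
  by (auto simp: basic_def)

lemma openin_preimage:
  assumes V: "openin (tp X) V"
  shows "openin (tp X) (basic ns M \<inter> (\<lambda>p. \<Phi> ` p) -` V)"
proof (subst openin_subopen, intro ballI)
  fix p assume p: "p \<in> basic ns M \<inter> (\<lambda>p. \<Phi> ` p) -` V"
  then obtain P d where P: "mhom ns d P" "\<Phi> ` p \<in> basic ns P" "basic ns P \<inter> mpoints ns \<subseteq> V"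
    using openin_mp_basic[OF V] by blast
  let ?B = "basic ns (\<lambda>v. P (\<Phi> v) * M v)"
  have "openin (tp X) ?B" by (rule openin_basic'[OF pullback[OF P(1)]])
  moreover have "p \<in> ?B" using image_basic[OF P(1)] p P(2) by blast
  moreover have "?B \<subseteq> basic ns M \<inter> (\<lambda>p. \<Phi> ` p) -` V"
  proof
    fix x assume x: "x \<in> ?B"
    have xM: "x \<in> basic ns M" using x by (rule subsetD[OF basic_sub])
    have "\<Phi> ` x \<in> basic ns P" using image_basic[OF P(1) xM] x by simp
    moreover from this have "\<Phi> ` x \<in> mpoints ns" by (simp add: basic_def)
    ultimately show "x \<in> basic ns M \<inter> (\<lambda>p. \<Phi> ` p) -` V" using xM P(3) by blast
  qed
  ultimately show "\<exists>T. openin (tp X) T \<and> p \<in> T \<and> T \<subseteq> basic ns M \<inter> (\<lambda>p. \<Phi> ` p) -` V" by blast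
qed

lemma pts_X: "pts X = mpoints ns"
  by (simp add: topspace_zariski)

lemma morphism_image: "morphism (open_sub X (basic ns M)) X (\<lambda>p. \<Phi> ` p)"
  unfolding morphism_def
proof (intro conjI allI impI)
  have Mo: "openin (tp X) (basic ns M)" by (rule openin_basic'[OF M])
  have sub: "basic ns M \<subseteq> mpoints ns" by (auto simp: basic_def)
  have ptsM: "pts (open_sub X (basic ns M)) = basic ns M" using sub unfolding pts_open_sub pts_X by blast
  show "continuous_map (tp (open_sub X (basic ns M))) (tp X) (\<lambda>p. \<Phi> ` p)"
    unfolding continuous_map_def
  proof (intro conjI allI impI)
    show "(\<lambda>p. \<Phi> ` p) \<in> topspace (tp (open_sub X (basic ns M))) \<rightarrow> topspace (tp X)"
    proof (rule funcsetI)
      fix p assume "p \<in> topspace (tp (open_sub X (basic ns M)))"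
      then have p: "p \<in> basic ns M" using ptsM by blast
      then obtain v where v: "v \<in> mvecs ns" "p = mpt v" by (auto simp: basic_def elim: mpoints_cases)
      then have Mv: "M v \<noteq> 0" using p mpt_basic[OF M] by blast
      show "\<Phi> ` p \<in> topspace (tp X)" unfolding pts_X v(2) image_mpt[OF v(1) Mv] by (rule mpointsI[OF \<Phi>[OF v(1) Mv]])
    qed
    fix V assume V: "openin (tp X) V"
    have "{x \<in> topspace (tp (open_sub X (basic ns M))). \<Phi> ` x \<in> V} = basic ns M \<inter> (\<lambda>p. \<Phi> ` p) -` V"
      using ptsM by auto
    then show "openin (tp (open_sub X (basic ns M))) {x \<in> topspace (tp (open_sub X (basic ns M))). \<Phi> ` x \<in> V}"
      using openin_preimage[OF V] Mo unfolding tp_open_sub by (simp only: openin_open_subtopology) blast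
  qed
  fix V g assume Vg: "openin (tp X) V \<and> g \<in> rg X V"
  have "g \<circ> (\<lambda>p. \<Phi> ` p) \<in> rg X (basic ns M \<inter> (\<lambda>p. \<Phi> ` p) -` V)"
    unfolding rg_mp
  proof
    fix p assume p: "p \<in> basic ns M \<inter> (\<lambda>p. \<Phi> ` p) -` V"
    have gV: "g \<in> rg X V" and pV: "\<Phi> ` p \<in> V" using Vg p by auto
    obtain W P Q d where W: "openin (tp X) W" "\<Phi> ` p \<in> W" "W \<subseteq> V" "mhom ns d P" "mhom ns d Q"
      "\<forall>q\<in>W. \<forall>v\<in>q. Q v \<noteq> 0 \<and> g q = P v / Q v"
      using bspec[OF gV[unfolded rg_mp] pV] by (elim exE conjE)
    let ?A = "basic ns M \<inter> (\<lambda>p. \<Phi> ` p) -` W"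
    have "Q (\<Phi> v) * M v \<noteq> 0 \<and> (g \<circ> (\<lambda>p. \<Phi> ` p)) q = (P (\<Phi> v) * M v) / (Q (\<Phi> v) * M v)"
      if q: "q \<in> ?A" "v \<in> q" for q v
    proof -
      have "M v \<noteq> 0" using q by (auto simp: basic_def)
      moreover have "\<Phi> v \<in> \<Phi> ` q" "\<Phi> ` q \<in> W" using q by auto
      then have "Q (\<Phi> v) \<noteq> 0 \<and> g (\<Phi> ` q) = P (\<Phi> v) / Q (\<Phi> v)" using W(6) by blast
      ultimately show ?thesis by simp
    qed
    then show "\<exists>W P Q d. openin (tp X) W \<and> p \<in> W \<and> W \<subseteq> basic ns M \<inter> (\<lambda>p. \<Phi> ` p) -` V \<and> mhom ns d P \<and> mhom ns d Q \<and>
        (\<forall>q\<in>W. \<forall>v\<in>q. Q v \<noteq> 0 \<and> (g \<circ> (\<lambda>p. \<Phi> ` p)) q = P v / Q v)"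
      using openin_preimage[OF W(1)] p W(2,3) pullback[OF W(4)] pullback[OF W(5)]
      by (intro exI[of _ ?A] exI[of _ "\<lambda>v. P (\<Phi> v) * M v"] exI[of _ "\<lambda>v. Q (\<Phi> v) * M v"] exI[of _ "\<lambda>i. \<delta> d i + dM i"]) auto
  qed
  then show "g \<circ> (\<lambda>p. \<Phi> ` p) \<in> rg (open_sub X (basic ns M)) (pts (open_sub X (basic ns M)) \<inter> (\<lambda>p. \<Phi> ` p) -` V)"
    unfolding ptsM by simp
qed

end

lemma morphism_into_open:
  assumes f: "morphism (open_sub X U) Y f" and V: "openin (tp Y) V" "\<And>x. x \<in> pts X \<Longrightarrow> x \<in> U \<Longrightarrow> f x \<in> V"
  shows "morphism (open_sub X U) (open_sub Y V) f"
  unfolding morphism_def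
proof (intro conjI allI impI)
  show "continuous_map (tp (open_sub X U)) (tp (open_sub Y V)) f"
    using f V(2) by (auto simp: morphism_def continuous_map_in_subtopology)
  fix W g assume "openin (tp (open_sub Y V)) W \<and> g \<in> rg (open_sub Y V) W"
  then show "g \<circ> f \<in> rg (open_sub X U) (pts (open_sub X U) \<inter> f -` W)"
    using morphism_rg[OF f, of W g] V(1) by (simp add: openin_open_subtopology)
qed

lemma length_1_conv: "length cs = length [n] \<longleftrightarrow> (\<exists>c. cs = [c])"
  by (auto simp: length_Suc_conv)

lemma length_2_conv': "length cs = length [n, m] \<longleftrightarrow> (\<exists>c d. cs = [c, d])"
  by (auto simp: length_Suc_conv)

lemma mscale_simps [simp]:
  "mscale [c] [u] = [map ((*) c) u]" "mscale [c, d] [u, v] = [map ((*) c) u, map ((*) d) v]"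
  by (simp_all add: mscale_def)

definition V3 :: "mvec \<Rightarrow> mvec" where "V3 v = [[v!0!2, v!0!0, v!0!1]]"
definition V4 :: "mvec \<Rightarrow> mvec" where "V4 v = [[v!1!0, v!1!1], [v!0!1, v!0!0]]"
text \<open>\<open>S3\<close> and \<open>Q3\<close> are the homogeneous forms of
  \<open>(x, y) \<mapsto> (c x, c^2 y)\<close> and \<open>(x, y) \<mapsto> (c / x, c^2 / y)\<close>,
  and \<open>S4\<close> is that of \<open>(x, y) \<mapsto> (c x, c y)\<close>.\<close>

definition S3 :: "complex \<Rightarrow> mvec \<Rightarrow> mvec" where "S3 c v = [[c * v!0!0, c ^ 2 * v!0!1, v!0!2]]"
definition Q3 :: "complex \<Rightarrow> mvec \<Rightarrow> mvec" where
  "Q3 c v = [[c * (v!0!1 * v!0!2), c ^ 2 * (v!0!2 * v!0!0), v!0!0 * v!0!1]]"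
definition S4 :: "complex \<Rightarrow> mvec \<Rightarrow> mvec" where "S4 c v = [[c * v!0!0, v!0!1], [c * v!1!0, v!1!1]]"

lemma polyfun_coord_2: "j \<le> 2 \<Longrightarrow> (\<lambda>v. v ! 0 ! j) \<in> polyfun [2]"
  by (rule polyfun.coord) auto

lemma polyfun_coords_11:
  "(\<lambda>v. v ! 0 ! 0) \<in> polyfun [1, 1]" "(\<lambda>v. v ! 0 ! Suc 0) \<in> polyfun [1, 1]"
  "(\<lambda>v. v ! Suc 0 ! 0) \<in> polyfun [1, 1]" "(\<lambda>v. v ! Suc 0 ! Suc 0) \<in> polyfun [1, 1]"
  by (rule polyfun.coord; simp)+

lemma index_11:
  assumes "i < length [1::nat, 1]" "j \<le> [1::nat, 1] ! i"
  shows "i = 0 \<and> j = 0 \<or> i = 0 \<and> j = Suc 0 \<or> i = Suc 0 \<and> j = 0 \<or> i = Suc 0 \<and> j = Suc 0"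
proof -
  have "i = 0 \<or> i = 1" using assms(1) by auto
  then show ?thesis using assms(2) by auto
qed

lemma homogeneous_map_V3: "homogeneous_map [2] V3 (\<lambda>v. 1) (\<lambda>_. 0) (\<lambda>cs. cs) (\<lambda>d. d)"
proof
  show "mhom [2] (\<lambda>_. 0) (\<lambda>v. 1)" by (rule mhom_const)
  show "(\<lambda>v. V3 v ! i ! j) \<in> polyfun [2]" if "i < length [2::nat]" "j \<le> [2::nat] ! i" for i j
    using that polyfun_coord_2 unfolding less_1_conv by (auto simp: le_2_conv V3_def)
  show "V3 v \<in> mvecs [2]" if "v \<in> mvecs [2]" for v using that unfolding mvecs_2 by (auto simp: V3_def)
  show "V3 (mscale cs v) = mscale cs (V3 v)" if "v \<in> mvecs [2]" "length cs = length [2::nat]" for v cs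
    using that unfolding mvecs_2 length_1_conv by (auto simp: V3_def)
qed auto

lemma mhom_N2: "mhom [2] (\<lambda>i. (if i = 0 then 1 else 0) + (if i = 0 then 1 else 0) + (if i = 0 then 1 else 0)) P2.N"
  by (rule P2.hN)

lemma P2_N: "P2.N [[x, y, z]] = z * x * y"
  unfolding P2.N_def by simp

lemma homogeneous_map_S3: "c \<noteq> 0 \<Longrightarrow> homogeneous_map [2] (S3 c) P2.N (\<lambda>i. (if i = 0 then 1 else 0) + (if i = 0 then 1 else 0) + (if i = 0 then 1 else 0)) (\<lambda>cs. cs) (\<lambda>d. d)"
proof
  show "(\<lambda>v. S3 c v ! i ! j) \<in> polyfun [2]" if "i < length [2::nat]" "j \<le> [2::nat] ! i" for i j
    using that unfolding less_1_conv
    by (auto simp: le_2_conv S3_def intro!: polyfun.mult polyfun.const polyfun_coord_2)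
  show "S3 c v \<in> mvecs [2]" if "c \<noteq> 0" "v \<in> mvecs [2]" for v using that unfolding mvecs_2 by (auto simp: S3_def)
  show "S3 c (mscale cs v) = mscale cs (S3 c v)" if "v \<in> mvecs [2]" "length cs = length [2::nat]" for v cs
    using that unfolding mvecs_2 length_1_conv by (auto simp: S3_def)
qed (use mhom_N2 in auto)

lemma homogeneous_map_Q3: "c \<noteq> 0 \<Longrightarrow> homogeneous_map [2] (Q3 c) P2.N (\<lambda>i. (if i = 0 then 1 else 0) + (if i = 0 then 1 else 0) + (if i = 0 then 1 else 0)) (map (\<lambda>c. c ^ 2)) (\<lambda>d i. 2 * d i)"
proof
  show "(\<lambda>v. Q3 c v ! i ! j) \<in> polyfun [2]" if "i < length [2::nat]" "j \<le> [2::nat] ! i" for i j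
    using that unfolding less_1_conv
    by (auto simp: le_2_conv Q3_def intro!: polyfun.mult polyfun.const polyfun_coord_2)
  show "Q3 c v \<in> mvecs [2]" if c: "c \<noteq> 0" and mv: "v \<in> mvecs [2]" and N: "P2.N v \<noteq> 0" for v
  proof -
    obtain x y z where v: "v = [[x, y, z]]" using mv unfolding mvecs_2 by blast
    have "z * x * y \<noteq> 0" using N unfolding v P2_N .
    then show ?thesis using c unfolding v mvecs_2 by (auto simp: Q3_def)
  qed
  show "Q3 c (mscale cs v) = mscale (map (\<lambda>c. c ^ 2) cs) (Q3 c v)" if "v \<in> mvecs [2]" "length cs = length [2::nat]" for v cs
    using that unfolding mvecs_2 length_1_conv by (auto simp: Q3_def power2_eq_square)
  show "\<exists>cs. length cs = length [2::nat] \<and> 0 \<notin> set cs \<and> map (\<lambda>c. c ^ 2) cs = ds"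
    if ds: "length ds = length [2::nat]" "0 \<notin> set ds" for ds :: "complex list"
  proof -
    obtain d where "ds = [d]" using ds(1) unfolding length_1_conv by blast
    \<comment> \<open>A quadratic map squares the scalar, so every scalar must have a square
      root.\<close>
    then show ?thesis using ds by (intro exI[of _ "[csqrt d]"]) auto
  qed
  show "(\<Prod>i<length [2::nat]. map (\<lambda>c. c ^ 2) cs ! i ^ d i) = (\<Prod>i<length [2::nat]. cs ! i ^ (2 * d i))"
    if "length cs = length [2::nat]" for cs :: "complex list" and d
    using that by (simp add: power_mult)
qed (use mhom_N2 in auto)

text \<open>\<open>T4\<close> exchanges the two factors: the scalars are reversed and the bidegree
  is swapped, \<open>1 - i\<close> interchanging the indices \<open>0\<close> and
  \<open>1\<close>.\<close>

lemma homogeneous_map_V4: "homogeneous_map [1, 1] V4 (\<lambda>v. 1) (\<lambda>_. 0) rev (\<lambda>d i. d (1 - i))"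
proof
  show "mhom [1, 1] (\<lambda>_. 0) (\<lambda>v. 1)" by (rule mhom_const)
  show "(\<lambda>v. V4 v ! i ! j) \<in> polyfun [1, 1]" if "i < length [1::nat, 1]" "j \<le> [1::nat, 1] ! i" for i j
    using index_11[OF that] polyfun_coords_11 by (elim disjE) (simp_all add: V4_def)
  show "V4 v \<in> mvecs [1, 1]" if "v \<in> mvecs [1, 1]" for v using that unfolding mvecs_11 by (auto simp: V4_def)
  show "V4 (mscale cs v) = mscale (rev cs) (V4 v)" if "v \<in> mvecs [1, 1]" "length cs = length [1::nat, 1]" for v cs
    using that unfolding mvecs_11 length_2_conv' by (auto simp: V4_def)
  show "\<exists>cs. length cs = length [1::nat, 1] \<and> 0 \<notin> set cs \<and> rev cs = ds"
    if "length ds = length [1::nat, 1]" "0 \<notin> set ds" for ds :: "complex list"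
    using that by (intro exI[of _ "rev ds"]) auto
  show "(\<Prod>i<length [1::nat, 1]. rev cs ! i ^ d i) = (\<Prod>i<length [1::nat, 1]. cs ! i ^ d (1 - i))"
    if "length cs = length [1::nat, 1]" for cs :: "complex list" and d
    using that unfolding length_2_conv' by (auto simp: mult.commute)
qed auto

lemma homogeneous_map_S4: "c \<noteq> 0 \<Longrightarrow> homogeneous_map [1, 1] (S4 c) P1P1.N
   (\<lambda>i. ((if i = 0 then 1 else 0) + (if i = 1 then 1 else 0)) + ((if i = 0 then 1 else 0) + (if i = 1 then 1 else 0)) +
     ((if i = 0 then 1 else 0) + (if i = 1 then 1 else 0))) (\<lambda>cs. cs) (\<lambda>d. d)"
proof
  show "(\<lambda>v. S4 c v ! i ! j) \<in> polyfun [1, 1]" if "i < length [1::nat, 1]" "j \<le> [1::nat, 1] ! i" for i j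
    using index_11[OF that] polyfun_coords_11 polyfun.mult[OF polyfun.const[of c]]
    by (elim disjE) (simp_all add: S4_def)
  show "S4 c v \<in> mvecs [1, 1]" if "c \<noteq> 0" "v \<in> mvecs [1, 1]" for v using that unfolding mvecs_11 by (auto simp: S4_def)
  show "S4 c (mscale cs v) = mscale cs (S4 c v)" if "v \<in> mvecs [1, 1]" "length cs = length [1::nat, 1]" for v cs
    using that unfolding mvecs_11 length_2_conv' by (auto simp: S4_def)
qed (use P1P1.hN in auto)

subsection \<open>The induced foliation on the minimal desingularization\<close>

text \<open>What remains of the geometry: \<open>M\<close> has the invariants as function field,
  \<open>d\<close> generates the foliation there and is a multiple of \<open>dF l\<close>, and
  \<open>realize\<close> lifts to \<open>M\<close> the maps of the quotient that come from torus
  maps.\<close>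

locale quotient_foliation = toric_quotient l t \<chi> n l' + model M \<rho> "{u. pb t u = u}"
  for l t \<chi> n l' and M :: "mpoint fspace" and \<rho> +
  fixes F :: "(mpoint ratfun \<Rightarrow> mpoint ratfun) set" and Q :: "'b fspace" and \<pi> :: "complex \<times> complex \<Rightarrow> 'b"
    and d :: "ratfield \<Rightarrow> ratfield" and f0 R0 :: ratfield
  assumes separated: "separated_by_functions M"
    and d_L: "pb t R = R \<Longrightarrow> pb t (d R) = d R" and d_\<delta>: "pb t R = R \<Longrightarrow> d R = f0 * dF l R"
    and R0: "pb t R0 = R0" "d R0 \<noteq> 0"
    and carrier: "carrier (BirFol M F) = {gm f | f. (\<exists>U V. birat M U V f) \<and> preserves d f}"
    and group: "group (BirFol M F)"
    and realize: "torus_map m \<Longrightarrow> birat Q A B \<psi> \<Longrightarrow> \<forall>\<^sub>F q in generic. \<psi> (\<pi> q) = \<pi> (m q) \<Longrightarrow>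
      \<exists>U V f. birat M U V f \<and> (\<forall>\<^sub>F q in generic. f (\<rho> q) = \<rho> (m q))"

definition field_span :: "'a fspace \<Rightarrow> ('a ratfun \<Rightarrow> 'a ratfun) \<Rightarrow> ('a ratfun \<Rightarrow> 'a ratfun) set" where
  "field_span X D = {\<lambda>h\<in>carrier (ffield X). f \<otimes>\<^bsub>ffield X\<^esub> D h | f. f \<in> carrier (ffield X)}"

lemma field_spanI:
  "f \<in> carrier (ffield X) \<Longrightarrow> (\<lambda>h\<in>carrier (ffield X). f \<otimes>\<^bsub>ffield X\<^esub> D h) \<in> field_span X D"
  unfolding field_span_def by (intro CollectI exI[of _ f] conjI refl)

lemma field_spanE:
  assumes "D' \<in> field_span X D"
  obtains f where "f \<in> carrier (ffield X)" "D' = (\<lambda>h\<in>carrier (ffield X). f \<otimes>\<^bsub>ffield X\<^esub> D h)"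
  using assms unfolding field_span_def mem_Collect_eq by (elim exE conjE) (rule that)

lemma foliationE:
  assumes "foliation X F"
  obtains D h where "D \<in> rvfields X" "h \<in> carrier (ffield X)" "D h \<noteq> \<zero>\<^bsub>ffield X\<^esub>"
    "F = field_span X D"
  using assms unfolding foliation_def field_span_def[symmetric] by (elim bexE conjE) (rule that)

text \<open>The foliation on the quotient mediates. Its generator acts on invariants as
  \<open>c * dF l\<close>, seen from \<open>X\<close>, and as \<open>b * d\<close>, seen from
  \<open>M\<close>; hence \<open>d\<close> is \<open>c / b\<close> times
  \<open>dF l\<close>.\<close>

lemma quotient_foliation_exists:
  assumes ind: "induced_on_desingularized_quotient X T E M F" and cm: "cyclic_model X j T t n"
    and tq: "toric_quotient l t \<chi> n l'"
    and eigen: "\<And>D. D \<in> E \<Longrightarrow> \<exists>c. \<forall>R. D (model.cl X j R) = model.cl X j (c * dF l R)"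
  shows "\<exists>\<rho> d f0 R0. quotient_foliation l t \<chi> n l' M \<rho> F (quot X T) (\<lambda>q. orb T (j q)) d f0 R0"
proof -
  interpret X: cyclic_model X j T t n by fact
  let ?L = "{u. pb t u = u}" and ?Q = "quot X T" and ?\<pi> = "\<lambda>q. orb T (j q)"
  have Qm: "model ?Q ?\<pi> ?L" by (rule X.model_quot)
  then interpret Q: model ?Q ?\<pi> ?L .
  obtain r G where fol: "foliation M F" and r: "minimal_desingularization M ?Q r" and G: "foliation ?Q G"
    and GE: "pulls_back X ?Q (pts X) (orb T) G E" and GF: "pulls_back M ?Q (pts M) r G F"
    using ind by (auto simp: induced_on_desingularized_quotient_def)
  have br: "birational_morphism M ?Q r" and "projective_variety M"
    using r by (auto simp: minimal_desingularization_def desingularization_def smooth_projective_surface_def)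
  then obtain a Z where Z: "M = mp [a] Z" "irreducible_space (tp M)" by (auto simp: projective_variety_def)
  have irr: "U \<inter> V \<noteq> {}" if "nopen M U" "nopen M V" for U V
    using Z(2) that by (auto simp: irreducible_space_def nopen_def)
  have "pts M \<noteq> {}" using Z(2) by (simp add: irreducible_space_def)
  then have sep: "separated_by_functions M" unfolding Z(1) by (rule separated_projective)
  have "presheaf M" unfolding Z(1) by (rule presheaf_mp)
  from model_birational[OF Qm br this irr] obtain \<rho> where Mm: "model M \<rho> ?L" and \<rho>: "\<forall>\<^sub>F q in generic. r (\<rho> q) = ?\<pi> q"
    and realize: "\<And>A B \<psi> m. birat ?Q A B \<psi> \<and> torus_map m \<and> (\<forall>\<^sub>F q in generic. \<psi> (?\<pi> q) = ?\<pi> (m q)) \<Longrightarrow>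
       (\<exists>U V f. birat M U V f \<and> (\<forall>\<^sub>F q in generic. f (\<rho> q) = \<rho> (m q)))"
    by blast
  interpret M: model M \<rho> ?L by (rule Mm)
  obtain DG h where DG: "DG \<in> rvfields ?Q" "h \<in> carrier (ffield ?Q)" "DG h \<noteq> \<zero>\<^bsub>ffield ?Q\<^esub>"
     "G = field_span ?Q DG"
    by (rule foliationE[OF G])
  obtain dG where dG: "\<forall>R\<in>?L. dG R \<in> ?L \<and> DG (Q.cl R) = Q.cl (dG R)" using Q.rvfields_derivation[OF DG(1)] by (elim exE conjE) (rule that)
  \<comment> \<open>To belong to its own span, the generator must equal its restricted multiple by
    one, and this uses that it is extensional.\<close>
  have "(\<lambda>h\<in>carrier (ffield ?Q). Q.cl 1 \<otimes>\<^bsub>ffield ?Q\<^esub> DG h) = DG"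
  proof (rule extensionalityI)
    show "DG \<in> extensional (carrier (ffield ?Q))" using DG(1) by (auto simp: rvfields_def PiE_def)
    fix x assume x: "x \<in> carrier (ffield ?Q)"
    then obtain R where "R \<in> ?L" "x = Q.cl R" unfolding Q.carrier_ffield by blast
    then show "(\<lambda>h\<in>carrier (ffield ?Q). Q.cl 1 \<otimes>\<^bsub>ffield ?Q\<^esub> DG h) x = DG x"
      using x dG Q.ffield_mult[OF Q.L_1, of "dG R"] by simp
  qed simp
  moreover have "Q.cl 1 \<in> carrier (ffield ?Q)" using Q.carrier_ffield Q.L_1 by blast
  ultimately have DGG: "DG \<in> G" unfolding DG(4) using field_spanI[of "Q.cl 1" ?Q DG] by simp
  obtain R1 where R1: "R1 \<in> ?L" "dG R1 \<noteq> 0"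
  proof -
    obtain R where "R \<in> ?L" "h = Q.cl R" using DG(2) unfolding Q.carrier_ffield by blast
    note R = this
    have "DG h = Q.cl (dG R)" unfolding R(2) using bspec[OF dG R(1)] by (rule conjunct2)
    then have "dG R \<noteq> 0" using DG(3) unfolding Q.ffield_zero by metis
    then show ?thesis by (rule that[OF R(1)])
  qed
  obtain D where D: "D \<in> E" "related X ?Q (pts X) (orb T) D DG"
    using bspec[OF GE[unfolded pulls_back_def] DGG] by (elim bexE)
  obtain c where c: "\<forall>R. D (X.cl R) = X.cl (c * dF l R)" using eigen[OF D(1)] by blast
  have pX: "pull X (pts X) (orb T) (Q.cl R) = X.cl R" if "R \<in> ?L" for R
    by (rule pull_same[OF X.model_axioms Qm that X.generic_pts]) simp
  have dG_\<delta>: "dG R = c * dF l R" if R: "R \<in> ?L" for R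
  proof -
    have GR: "dG R \<in> ?L" "DG (Q.cl R) = Q.cl (dG R)" using bspec[OF dG R] by blast+
    have "D (pull X (pts X) (orb T) (Q.cl R)) = pull X (pts X) (orb T) (DG (Q.cl R))"
      using D(2) imageI[OF R, of Q.cl] unfolding related_def Q.carrier_ffield by (rule bspec)
    then have "X.cl (c * dF l R) = X.cl (dG R)" unfolding GR(2) pX[OF R] pX[OF GR(1)] using c by simp
    from X.cl_inject[OF this] show ?thesis by simp
  qed
  obtain D1 h1 where D1: "D1 \<in> rvfields M" "h1 \<in> carrier (ffield M)" "D1 h1 \<noteq> \<zero>\<^bsub>ffield M\<^esub>"
     "F = field_span M D1"
    by (rule foliationE[OF fol])
  obtain d where d: "\<forall>R\<in>?L. d R \<in> ?L \<and> D1 (M.cl R) = M.cl (d R)" using M.rvfields_derivation[OF D1(1)] by (elim exE conjE) (rule that)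
  obtain R0 where R0: "R0 \<in> ?L" "d R0 \<noteq> 0"
  proof -
    obtain R where "R \<in> ?L" "h1 = M.cl R" using D1(2) unfolding M.carrier_ffield by blast
    note R = this
    have "D1 h1 = M.cl (d R)" unfolding R(2) using bspec[OF d R(1)] by (rule conjunct2)
    then have "d R \<noteq> 0" using D1(3) unfolding M.ffield_zero by metis
    then show ?thesis by (rule that[OF R(1)])
  qed
  obtain D2 where D2: "D2 \<in> F" "related M ?Q (pts M) r D2 DG" 
    using bspec[OF GF[unfolded pulls_back_def] DGG] by (elim bexE)
  from D2(1) obtain B where "B \<in> carrier (ffield M)" and D2B: "D2 = (\<lambda>h\<in>carrier (ffield M). B \<otimes>\<^bsub>ffield M\<^esub> D1 h)"
    unfolding D1(4) by (rule field_spanE)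
  then obtain b where b: "b \<in> ?L" "B = M.cl b" unfolding M.carrier_ffield by blast
  have pM: "pull M (pts M) r (Q.cl R) = M.cl R" if "R \<in> ?L" for R
    by (rule pull_same[OF Mm Qm that M.generic_pts \<rho>])
  have bd: "b * d R = c * dF l R" if R: "R \<in> ?L" for R
  proof -
    have GR: "dG R \<in> ?L" "DG (Q.cl R) = Q.cl (dG R)" using bspec[OF dG R] by blast+
    have dR: "d R \<in> ?L" "D1 (M.cl R) = M.cl (d R)" using bspec[OF d R] by blast+
    have "D2 (pull M (pts M) r (Q.cl R)) = pull M (pts M) r (DG (Q.cl R))"
      using D2(2) imageI[OF R, of Q.cl] unfolding related_def Q.carrier_ffield by (rule bspec)
    then have "D2 (M.cl R) = M.cl (dG R)" unfolding GR(2) pM[OF R] pM[OF GR(1)] .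
    moreover have "D2 (M.cl R) = M.cl b \<otimes>\<^bsub>ffield M\<^esub> D1 (M.cl R)"
      unfolding D2B b(2) by (rule restrict_apply') (use R in \<open>simp add: M.carrier_ffield\<close>)
    ultimately have "M.cl (dG R) = M.cl (b * d R)" unfolding dR(2) M.ffield_mult[OF b(1) dR(1)] by simp
    from M.cl_inject[OF this GR(1)] show ?thesis unfolding dG_\<delta>[OF R] by simp
  qed
  \<comment> \<open>\<open>R1\<close> witnesses that the foliation on the quotient is nonzero, so
    the multiple of the generator on \<open>M\<close> that lifts it cannot vanish.\<close>
  have "b \<noteq> 0" using bd[OF R1(1)] dG_\<delta>[OF R1(1)] R1(2) by auto
  then have d_\<delta>: "d R = c / b * dF l R" if "R \<in> ?L" for R using bd[OF that] by (simp add: field_simps)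
  have d': "R \<in> ?L \<Longrightarrow> d R \<in> ?L \<and> D1 (M.cl R) = M.cl (d R)" for R by (rule bspec[OF d])
  have "quotient_foliation l t \<chi> n l' M \<rho> F ?Q ?\<pi> d (c / b) R0"
  proof (intro quotient_foliation.intro quotient_foliation_axioms.intro tq Mm sep)
    show "carrier (BirFol M F) = {M.gm f | f. (\<exists>U V. birat M U V f) \<and> M.preserves d f}"
      by (rule M.carrier_BirFol[OF D1(1) d' D1(4)[unfolded field_span_def]])
    show "group (BirFol M F)" by (rule M.group_BirFol[OF D1(1) d' R0 D1(4)[unfolded field_span_def]])
  qed (use d R0 d_\<delta> realize in auto)
  then show ?thesis by blast
qed

context quotient_foliation
begin

lemma foliated_automorphism_sg:
  assumes f: "birat M U V f" "preserves d f"
  shows "\<exists>g. foliated_automorphism l t \<chi> n l' (sg f) d f0 g R0"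
proof -
  obtain g where g: "\<forall>R\<in>{u. pb t u = u}. sg f (d R) = g * d (sg f R)" using f(2) unfolding preserves_def by blast
  have L: "cf.L = {u. pb t u = u}" using L_iff by blast
  have "foliated_automorphism l t \<chi> n l' (sg f) d f0 g R0"
    by (intro foliated_automorphism.intro foliated_automorphism_axioms.intro toric_quotient_axioms; (unfold L)?)
      (use sg_surj[OF f(1)] sg_add[OF f(1)] sg_mult[OF f(1)] sg_cst[OF f(1)] d_L R0 d_\<delta> g in auto)
  then show ?thesis by blast
qed

text \<open>Torus maps that descend to a birational map of the quotient and multiply
  \<open>dF l\<close> by a nonzero constant; these yield the elements of the group.\<close>

definition realized :: "(complex \<times> complex \<Rightarrow> complex \<times> complex) \<Rightarrow> bool" where
  "realized m \<longleftrightarrow> torus_map m \<and> (\<exists>A B \<psi>. birat Q A B \<psi> \<and> (\<forall>\<^sub>F q in generic. \<psi> (\<pi> q) = \<pi> (m q))) \<and>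
     (\<exists>e. e \<noteq> 0 \<and> dF l (pb m VX) = cst e * pb m VX \<and> dF l (pb m VY) = cst (e * l) * pb m VY)"

definition realizes :: "(complex \<times> complex \<Rightarrow> complex \<times> complex) \<Rightarrow> (mpoint \<Rightarrow> mpoint) \<Rightarrow> bool" where
  "realizes m f \<longleftrightarrow> (\<exists>U V. birat M U V f) \<and> (\<forall>\<^sub>F q in generic. f (\<rho> q) = \<rho> (m q))"

text \<open>The choice is harmless: by \<open>realizes_aut\<close> any map on \<open>M\<close> lying
  over \<open>m\<close> gives the same class.\<close>

definition aut :: "(complex \<times> complex \<Rightarrow> complex \<times> complex) \<Rightarrow> mpoint ratmap" where
  "aut m = gm (SOME f. realizes m f)"

lemma aut_realizes:
  assumes "realized m"
  shows "\<exists>f. realizes m f \<and> aut m = gm f"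
proof -
  have "\<exists>f. realizes m f" using assms realize unfolding realized_def realizes_def by blast
  then have "realizes m (SOME f. realizes m f)" by (rule someI_ex)
  then show ?thesis unfolding aut_def by blast
qed

lemma realizes_aut: "realized m \<Longrightarrow> realizes m f \<Longrightarrow> aut m = gm f"
proof -
  assume "realized m" "realizes m f"
  then obtain h where h: "realizes m h" "aut m = gm h" using aut_realizes by blast
  have "gm h = gm f"
  proof (rule gm_cong)
    from h(1) \<open>realizes m f\<close> have "\<forall>\<^sub>F q in generic. h (\<rho> q) = \<rho> (m q)" "\<forall>\<^sub>F q in generic. f (\<rho> q) = \<rho> (m q)"
      by (auto simp: realizes_def)
    then show "\<forall>\<^sub>F q in generic. h (\<rho> q) = f (\<rho> q)" by eventually_elim simp
  qed
  then show ?thesis using h(2) by simp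
qed

lemma sg_realizes: "torus_map m \<Longrightarrow> realizes m f \<Longrightarrow> pb t u = u \<Longrightarrow> sg f u = pb m u"
  unfolding realizes_def using sg_torus_map by blast

lemma aut_carrier:
  assumes m: "realized m"
  shows "aut m \<in> carrier (BirFol M F)"
proof -
  obtain f where f: "realizes m f" "aut m = gm f" using aut_realizes[OF m] by blast
  then obtain U V where bf: "birat M U V f" by (auto simp: realizes_def)
  obtain e where tm: "torus_map m" and e: "e \<noteq> 0" "dF l (pb m VX) = cst e * pb m VX" "dF l (pb m VY) = cst (e * l) * pb m VY"
    using m by (auto simp: realized_def)
  have dpb: "dF l (pb m u) = cst e * pb m (dF l u)" for u by (rule dF_pb[OF tm e(2,3)])
  have sg: "sg f u = pb m u" if "pb t u = u" for u using sg_realizes[OF tm f(1) that] .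
  have L: "pb t (pb m u) = pb m u" if "pb t u = u" for u using sg_L[OF bf, of u] sg[OF that] that by simp
  \<comment> \<open>The factor in \<open>preserves\<close> must be invariant. The obvious expression
    contains \<open>f0\<close>, which need not be, so it is rewritten as a quotient of two
    invariants at \<open>R0\<close>.\<close>
  let ?g = "pb m (d R0) / d (pb m R0)"
  have nz: "f0 \<noteq> 0" "pb m f0 \<noteq> 0" "pb m (dF l R0) \<noteq> 0"
    using R0 d_\<delta>[OF R0(1)] pb_nonzero[OF tm] by auto
  have "sg f (d R) = ?g * d (sg f R)" if R: "pb t R = R" for R
  proof -
    have "pb m (d R) = pb m f0 * pb m (dF l R)" "pb m (d R0) = pb m f0 * pb m (dF l R0)"
      using d_\<delta>[OF R] d_\<delta>[OF R0(1)] by (simp_all add: pb_mult[OF tm])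
    moreover have "d (pb m R) = f0 * (cst e * pb m (dF l R))" "d (pb m R0) = f0 * (cst e * pb m (dF l R0))"
      using d_\<delta>[OF L[OF R]] d_\<delta>[OF L[OF R0(1)]] by (simp_all add: dpb)
    ultimately show ?thesis unfolding sg[OF R] sg[OF d_L[OF R]] using nz e(1) by (simp add: cst_eq_0)
  qed
  moreover have "?g \<in> {u. pb t u = u}"
    using L_mult[OF _ L_inverse, of "pb m (d R0)" "d (pb m R0)"] L d_L R0(1) by (simp add: divide_inverse)
  ultimately have "preserves d f" unfolding preserves_def by blast
  then show ?thesis unfolding carrier f(2) using bf by blast
qed

lemma aut_one: "aut (\<lambda>q. q) = \<one>\<^bsub>BirFol M F\<^esub>" if "realized (\<lambda>q. q)"
proof -
  have "realizes (\<lambda>q. q) id" unfolding realizes_def using birat_id by auto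
  then show ?thesis using realizes_aut[OF that] by (simp add: one_BirFol one_Bir)
qed

lemma aut_mult:
  assumes m: "realized m" "realized m'" "realized m''" and comp: "\<And>q. q \<in> torus \<Longrightarrow> m (m' q) = m'' q"
  shows "aut m \<otimes>\<^bsub>BirFol M F\<^esub> aut m' = aut m''"
proof -
  obtain f where f1: "realizes m f" "aut m = gm f" using aut_realizes[OF m(1)] by blast
  obtain f' where f2: "realizes m' f'" "aut m' = gm f'" using aut_realizes[OF m(2)] by blast
  note f = f1 f2
  obtain U V where b1: "birat M U V f" using f(1) by (auto simp: realizes_def)
  obtain U' V' where b2: "birat M U' V' f'" using f(3) by (auto simp: realizes_def)
  note b = b1 b2
  have t': "torus_map m'" using m by (simp add: realized_def)
  have "\<forall>\<^sub>F q in generic. f (\<rho> q) = \<rho> (m q)" using f(1) by (simp add: realizes_def)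
  from eventually_torus_map[OF t' this] have "\<forall>\<^sub>F q in generic. f (\<rho> (m' q)) = \<rho> (m (m' q))" .
  moreover have "\<forall>\<^sub>F q in generic. f' (\<rho> q) = \<rho> (m' q)" using f(3) by (simp add: realizes_def)
  ultimately have "\<forall>\<^sub>F q in generic. (f \<circ> f') (\<rho> q) = \<rho> (m'' q)"
    using eventually_torus by eventually_elim (simp add: comp)
  then have "realizes m'' (f \<circ> f')" unfolding realizes_def using birat_comp[OF b] by blast
  then have "aut m'' = gm (f \<circ> f')" by (rule realizes_aut[OF m(3)])
  then show ?thesis unfolding f mult_BirFol mult_Bir[OF b] by simp
qed

lemma aut_eqD:
  assumes m: "realized m" "realized m'" and eq: "aut m = aut m'" and u: "pb t u = u"
  shows "pb m u = pb m' u"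
proof -
  obtain f where f1: "realizes m f" "aut m = gm f" using aut_realizes[OF m(1)] by blast
  obtain f' where f2: "realizes m' f'" "aut m' = gm f'" using aut_realizes[OF m(2)] by blast
  note f = f1 f2
  obtain U V where b1: "birat M U V f" using f(1) by (auto simp: realizes_def)
  obtain U' V' where b2: "birat M U' V' f'" using f(3) by (auto simp: realizes_def)
  note b = b1 b2
  have "sg f u = sg f' u" by (rule sg_cong[OF b gm_eqD[OF b(1)]]) (use f eq u in auto)
  moreover have "torus_map m" "torus_map m'" using m by (auto simp: realized_def)
  ultimately show ?thesis using sg_realizes[OF _ f(1) u] sg_realizes[OF _ f(3) u] by simp
qed

text \<open>A foliated birational map and the class of the matching torus map act equally on the
  invariants; by \<open>sg_faithful\<close> they coincide.\<close>

lemma aut_cover: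
  assumes A: "A \<in> carrier (BirFol M F)"
    and m: "\<And>f0 g u0 \<sigma> D. foliated_automorphism l t \<chi> n l' \<sigma> D f0 g u0 \<Longrightarrow>
      \<exists>m\<in>S. realized m \<and> (\<forall>u. pb t u = u \<longrightarrow> (\<forall>\<^sub>F p in generic. evF (\<sigma> u) p = evF u (m p)))"
  shows "A \<in> aut ` S"
proof -
  obtain f U V where f: "A = gm f" "birat M U V f" "preserves d f" using A unfolding carrier by blast
  obtain g where "foliated_automorphism l t \<chi> n l' (sg f) d f0 g R0" using foliated_automorphism_sg[OF f(2,3)] by blast
  from m[OF this] obtain m where mS: "m \<in> S" "realized m" and
    m: "\<And>u. pb t u = u \<Longrightarrow> \<forall>\<^sub>F p in generic. evF (sg f u) p = evF u (m p)" by blast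
  obtain h where h: "realizes m h" "aut m = gm h" using aut_realizes[OF mS(2)] by blast
  then obtain U' V' where bh: "birat M U' V' h" by (auto simp: realizes_def)
  have tm: "torus_map m" using mS(2) by (simp add: realized_def)
  have "gm f = gm h"
  proof (rule sg_faithful[OF separated f(2) bh])
    fix R assume "R \<in> {u. pb t u = u}"
    then have R: "pb t R = R" by simp
    show "sg f R = sg h R" using pb_eqI[OF tm m[OF R]] sg_realizes[OF tm h(1) R] by simp
  qed
  then show ?thesis using f(1) h(2) mS(1) by blast
qed

end

subsection \<open>Lifting torus automorphisms to the quotients\<close>

definition diag :: "complex \<Rightarrow> complex \<Rightarrow> int \<Rightarrow> complex \<times> complex \<Rightarrow> complex \<times> complex" where
  "diag a b s q = (a * fst q powi s, b * snd q powi s)"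

lemma diag_torus: "a \<noteq> 0 \<Longrightarrow> b \<noteq> 0 \<Longrightarrow> q \<in> torus \<Longrightarrow> diag a b s q \<in> torus"
  by (simp add: diag_def torus_def)

lemma diag_comp: "diag a b s (diag a' b' s' q) = diag (a * a' powi s) (b * b' powi s) (s * s') q"
  by (simp add: diag_def power_int_mult_distrib power_int_mult mult.commute[of s s'])

lemma diag_id: "diag 1 1 1 = (\<lambda>q. q)"
  by (simp add: diag_def fun_eq_iff)

lemma torus_map_diag:
  assumes "a \<noteq> 0" "b \<noteq> 0" "s = 1 \<or> s = - 1"
  shows "torus_map (diag a b s)"
proof -
  have ss: "s * s = 1" using assms(3) by auto
  have "diag a b s ` torus = torus"
  proof (intro equalityI subsetI)
    fix q assume q: "q \<in> torus"
    have "diag a b s (diag (inverse a powi s) (inverse b powi s) s q) = q"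
      unfolding diag_comp power_int_mult[symmetric] ss using assms by (simp add: diag_def)
    moreover have "diag (inverse a powi s) (inverse b powi s) s q \<in> torus" using assms q by (simp add: diag_torus)
    ultimately show "q \<in> diag a b s ` torus" by (metis imageI)
  qed (use assms diag_torus in auto)
  then show ?thesis using assms(3)
    by (elim disjE) (auto simp: torus_map_def diag_def power_int_minus intro!: clearable_intros clearable_const)
qed

lemma dF_diag:
  assumes "a \<noteq> 0" "b \<noteq> 0" "s = 1 \<or> s = - 1"
  shows "dF l (pb (diag a b s) VX) = cst (of_int s) * pb (diag a b s) VX"
    "dF l (pb (diag a b s) VY) = cst (of_int s * l) * pb (diag a b s) VY"
proof -
  have X: "pb (diag a b s) VX = cst a * VX powi s * VY powi 0"
    by (rule pb_monomial[OF torus_map_diag[OF assms]]) (simp add: diag_def)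
  have Y: "pb (diag a b s) VY = cst b * VX powi 0 * VY powi s"
    by (rule pb_monomial[OF torus_map_diag[OF assms]]) (simp add: diag_def)
  show "dF l (pb (diag a b s) VX) = cst (of_int s) * pb (diag a b s) VX"
    unfolding X dF_monomial by simp
  show "dF l (pb (diag a b s) VY) = cst (of_int s * l) * pb (diag a b s) VY"
    unfolding Y dF_monomial by (simp add: mult.commute)
qed

lemma open_sub_pts: "open_sub X (pts X) = X"
  by (cases X) (simp add: open_sub_def)

lemma (in homogeneous_map) continuous_image:
  assumes "\<And>v. M v = 1"
  shows "continuous_map (tp X) (tp X) (\<lambda>p. \<Phi> ` p)"
proof -
  have "basic ns M = pts X" unfolding pts_X by (auto simp: basic_def assms)
  then have "morphism X X (\<lambda>p. \<Phi> ` p)" using morphism_image by (simp only: open_sub_pts)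
  then show ?thesis by (simp add: morphism_def)
qed

context chart
begin

lemma big_cell_isomorphism:
  assumes Z: "Z = mpoints ns"
    and \<Phi>: "homogeneous_map ns \<Phi> N d \<kappa> \<delta>" "\<And>q. q \<in> torus \<Longrightarrow> \<Phi> ` j q = j (u q)"
    and \<Psi>: "homogeneous_map ns \<Psi> N d' \<kappa>' \<delta>'" "\<And>q. q \<in> torus \<Longrightarrow> \<Psi> ` j q = j (u' q)"
    and u: "\<And>q. q \<in> torus \<Longrightarrow> u q \<in> torus \<and> u' (u q) = q" "\<And>q. q \<in> torus \<Longrightarrow> u' q \<in> torus \<and> u (u' q) = q"
  shows "isomorphism (open_sub X (basic ns N)) (open_sub X (basic ns N)) (\<lambda>p. \<Phi> ` p)"
proof -
  have Wj: "\<exists>q\<in>torus. p = j q" if "p \<in> basic ns N" for p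
    using N_basic[of p] that Z by (auto simp: basic_def)
  have jW: "j q \<in> basic ns N" if "q \<in> torus" for q using j_torus[OF that] by blast
  have o: "openin (tp X) (basic ns N)" using openin_mp[OF hN, of Z] j_torus unfolding Z
    by (simp add: basic_def Int_absorb2 subset_eq)
  have m1: "morphism (open_sub X (basic ns N)) (open_sub X (basic ns N)) (\<lambda>p. \<Phi> ` p)"
  proof (rule morphism_into_open[OF homogeneous_map.morphism_image[OF \<Phi>(1), folded Z] o])
    fix p assume "p \<in> basic ns N"
    then obtain q where q: "q \<in> torus" "p = j q" using Wj by blast
    show "\<Phi> ` p \<in> basic ns N" unfolding q(2) \<Phi>(2)[OF q(1)] using u(1)[OF q(1)] jW by blast
  qed
  have m2: "morphism (open_sub X (basic ns N)) (open_sub X (basic ns N)) (\<lambda>p. \<Psi> ` p)"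
  proof (rule morphism_into_open[OF homogeneous_map.morphism_image[OF \<Psi>(1), folded Z] o])
    fix p assume "p \<in> basic ns N"
    then obtain q where q: "q \<in> torus" "p = j q" using Wj by blast
    show "\<Psi> ` p \<in> basic ns N" unfolding q(2) \<Psi>(2)[OF q(1)] using u(2)[OF q(1)] jW by blast
  qed
  have pts: "pts (open_sub X (basic ns N)) \<subseteq> basic ns N" by simp
  have i1: "\<Psi> ` (\<Phi> ` p) = p" if p: "p \<in> basic ns N" for p
  proof -
    obtain q where q: "q \<in> torus" "p = j q" using Wj[OF p] by blast
    have uq: "u q \<in> torus" "u' (u q) = q" using u(1)[OF q(1)] by blast+
    show ?thesis unfolding q(2) \<Phi>(2)[OF q(1)] \<Psi>(2)[OF uq(1)] uq(2) ..
  qed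
  have i2: "\<Phi> ` (\<Psi> ` p) = p" if p: "p \<in> basic ns N" for p
  proof -
    obtain q where q: "q \<in> torus" "p = j q" using Wj[OF p] by blast
    have uq: "u' q \<in> torus" "u (u' q) = q" using u(2)[OF q(1)] by blast+
    show ?thesis unfolding q(2) \<Psi>(2)[OF q(1)] \<Phi>(2)[OF uq(1)] uq(2) ..
  qed
  show ?thesis unfolding isomorphism_def
    by (intro conjI m1 exI[of _ "\<lambda>p. \<Psi> ` p"] m2 ballI i1 i2) (use pts in blast)+
qed

text \<open>The embedded torus is a nonempty open set stable under \<open>T\<close>, and on it
  \<open>\<Phi>\<close> and \<open>\<Psi>\<close> are mutually inverse and commute with
  \<open>T\<close>. So \<open>birat_quot\<close> applies.\<close>

lemma quotient_realization:
  assumes Z: "Z = mpoints ns" and T: "cyclic_model X j T t n" "\<And>q. q \<in> torus \<Longrightarrow> T (j q) = j (t q)"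
    and \<Phi>: "homogeneous_map ns \<Phi> N d \<kappa> \<delta>" "\<And>q. q \<in> torus \<Longrightarrow> \<Phi> ` j q = j (u q)"
    and \<Psi>: "homogeneous_map ns \<Psi> N d' \<kappa>' \<delta>'" "\<And>q. q \<in> torus \<Longrightarrow> \<Psi> ` j q = j (u' q)"
    and u: "\<And>q. q \<in> torus \<Longrightarrow> u q \<in> torus \<and> u' (u q) = q" "\<And>q. q \<in> torus \<Longrightarrow> u' q \<in> torus \<and> u (u' q) = q"
    and comm: "\<And>q. q \<in> torus \<Longrightarrow> u (t q) = t (u q)"
  shows "\<exists>A B \<psi>. birat (quot X T) A B \<psi> \<and> (\<forall>\<^sub>F q in generic. \<psi> (orb T (j q)) = orb T (j (u q)))"
proof -
  interpret T: cyclic_model X j T t n by fact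
  have Wj: "\<exists>q\<in>torus. p = j q" if "p \<in> basic ns N" for p
    using N_basic[of p] that Z by (auto simp: basic_def)
  have jW: "j q \<in> basic ns N" if "q \<in> torus" for q using j_torus[OF that] by blast
  have tt: "t q \<in> torus" if "q \<in> torus" for q using torus_map_torus[OF T.t that] .
  have Tk: "(T ^^ k) (j q) = j ((t ^^ k) q) \<and> (t ^^ k) q \<in> torus" if "q \<in> torus" for q k
    by (induction k) (use that T(2) tt in auto)
  have o: "openin (tp X) (basic ns N)" using openin_mp[OF hN, of Z] unfolding Z
    by (simp add: basic_def Int_absorb2 subset_eq)
  have W: "nopen X (basic ns N)" unfolding nopen_def using o jW[of "(1, 1)"] by (auto simp: torus_def)
  have TW: "T p \<in> basic ns N \<and> (T ^^ n) p = p" if p: "p \<in> basic ns N" for p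
  proof -
    obtain q where q: "q \<in> torus" "p = j q" using Wj[OF p] by blast
    have "T p = j (t q)" "(T ^^ n) p = j ((t ^^ n) q)" using T(2)[OF q(1)] Tk[OF q(1), of n] q(2) by auto
    then show ?thesis using jW[OF tt[OF q(1)]] T.t_order[OF q(1)] q(2) by simp
  qed
  have cm: "\<Phi> ` T p = T (\<Phi> ` p)" if p: "p \<in> basic ns N" for p
  proof -
    obtain q where q: "q \<in> torus" "p = j q" using Wj[OF p] by blast
    have uq: "u q \<in> torus" using u(1)[OF q(1)] by blast
    show ?thesis unfolding q(2) T(2)[OF q(1)] \<Phi>(2)[OF q(1)] \<Phi>(2)[OF tt[OF q(1)]] T(2)[OF uq] comm[OF q(1)] ..
  qed
  have gen: "\<forall>\<^sub>F q in generic. \<Phi> ` j q = j (u q)" using eventually_torus by eventually_elim (rule \<Phi>(2))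
  from T.birat_quot[OF W TW big_cell_isomorphism[OF Z \<Phi> \<Psi> u] cm gen] show ?thesis by blast
qed

end

lemma P2_j: "P2.j q = mpt [[fst q, snd q, 1]]"
  by (simp add: P2.j_def)

lemma P2_s: "[[a, b, 1]] \<in> mvecs [2]"
  by (simp add: mvecs_2)

lemma P2_N_torus: "q \<in> torus \<Longrightarrow> P2.N [[fst q, snd q, 1]] \<noteq> 0"
  by (rule P2.N_s)

lemma P2_j_inject:
  assumes "P2.j q = P2.j q'"
  shows "q = q'"
proof -
  have "[[fst q', snd q', 1]] \<in> mpt [[fst q, snd q, 1]]" using assms self_in_mpt unfolding P2_j by metis
  then show ?thesis unfolding in_mpt_1 by (auto simp: prod_eq_iff)
qed

lemma T3_j:
  assumes "q \<in> torus"
  shows "T3 (P2.j q) = P2.j (t3 q)"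
proof -
  have y: "snd q \<noteq> 0" using assms by (simp add: torus_def)
  have "T3 (P2.j q) = V3 ` mpt [[fst q, snd q, 1]]" by (simp add: T3_def V3_def[abs_def] P2_j)
  also have "\<dots> = mpt (V3 [[fst q, snd q, 1]])"
    by (rule homogeneous_map.image_mpt[OF homogeneous_map_V3 P2_s]) simp
  also have "V3 [[fst q, snd q, 1]] = [map ((*) (snd q)) [fst (t3 q), snd (t3 q), 1]]"
    using y by (simp add: V3_def t3_def)
  finally show ?thesis unfolding mpt_1[OF y] P2_j .
qed

lemma S3_j:
  assumes "q \<in> torus" "c \<noteq> 0"
  shows "S3 c ` P2.j q = P2.j (diag c (c ^ 2) 1 q)"
  unfolding P2_j homogeneous_map.image_mpt[OF homogeneous_map_S3[OF assms(2)] P2_s P2_N_torus[OF assms(1)]]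
  by (simp add: S3_def diag_def)

lemma Q3_j:
  assumes "q \<in> torus" "c \<noteq> 0"
  shows "Q3 c ` P2.j q = P2.j (diag c (c ^ 2) (- 1) q)"
proof -
  have nz: "fst q * snd q \<noteq> 0" using assms by (simp add: torus_def)
  have "Q3 c [[fst q, snd q, 1]] = [map ((*) (fst q * snd q)) [fst (diag c (c ^ 2) (- 1) q), snd (diag c (c ^ 2) (- 1) q), 1]]"
    using nz by (simp add: Q3_def diag_def)
  then show ?thesis
    unfolding P2_j homogeneous_map.image_mpt[OF homogeneous_map_Q3[OF assms(2)] P2_s P2_N_torus[OF assms(1)]]
    by (simp only: mpt_1[OF nz])
qed

lemma cyclic_model_3: "cyclic_model P2.X P2.j T3 t3 3"
proof (intro cyclic_model.intro cyclic_model_axioms.intro P2.model_chart torus_map_t3)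
  have "T3 = (\<lambda>p. V3 ` p)" by (simp add: fun_eq_iff T3_def V3_def[abs_def])
  then show "continuous_map (tp P2.X) (tp P2.X) T3"
    using homogeneous_map.continuous_image[OF homogeneous_map_V3] by simp
  show "(t3 ^^ 3) p = p" if "p \<in> torus" for p
    using that by (simp add: numeral_3_eq_3 t3_def torus_def)
  show "\<forall>\<^sub>F q in generic. T3 (P2.j q) = P2.j (t3 q)" using eventually_torus by eventually_elim (rule T3_j)
qed simp

text \<open>\<open>c ^ 3 = 1\<close> is what makes these maps commute with
  \<open>t3\<close>.\<close>

lemma realization_3:
  assumes c: "c ^ 3 = 1" and s: "s = 1 \<or> s = - 1"
  shows "\<exists>A B \<psi>. birat (quot P2.X T3) A B \<psi> \<and>
    (\<forall>\<^sub>F q in generic. \<psi> (orb T3 (P2.j q)) = orb T3 (P2.j (diag c (c ^ 2) s q)))"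
proof -
  have c0: "c \<noteq> 0" using c by auto
  have inv: "inverse c = c ^ 2" using c by (intro inverse_unique) (simp add: power2_eq_square power3_eq_cube mult_ac)
  have c4: "c ^ 2 * c ^ 2 = c" "c * c ^ 2 = 1" "c ^ 2 * c = 1"
    using c by (simp_all add: power2_eq_square power3_eq_cube mult_ac)
  have tor: "diag c (c ^ 2) s q \<in> torus" if "q \<in> torus" for q s using diag_torus c0 that by simp
  have comm: "diag c (c ^ 2) s (t3 q) = t3 (diag c (c ^ 2) s q)" if "q \<in> torus" "s = 1 \<or> s = - 1" for q s
    using that c4 c0 inv unfolding diag_def t3_def torus_def
    by (elim disjE) (simp_all add: field_simps power2_eq_square)
  show ?thesis using s
  proof
    assume s: "s = 1"
    \<comment> \<open>As \<open>c ^ 3 = 1\<close>, the inverse belongs to the same family with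
      parameter \<open>c ^ 2\<close>; for \<open>s = - 1\<close> the map is its own inverse.\<close>
    have i: "diag (c ^ 2) ((c ^ 2) ^ 2) 1 (diag c (c ^ 2) 1 q) = q" "diag c (c ^ 2) 1 (diag (c ^ 2) ((c ^ 2) ^ 2) 1 q) = q" for q
      unfolding diag_comp using c4 by (simp_all add: diag_def power2_eq_square[of "c ^ 2"])
    have "c ^ 2 \<noteq> 0" using c0 by simp
    note H = P2.quotient_realization[OF refl cyclic_model_3 T3_j homogeneous_map_S3[OF c0] S3_j[OF _ c0]
       homogeneous_map_S3[OF \<open>c ^ 2 \<noteq> 0\<close>] S3_j[OF _ \<open>c ^ 2 \<noteq> 0\<close>]]
    show ?thesis unfolding s by (rule H) (use i tor comm diag_torus c0 in auto)
  next
    assume s: "s = - 1"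
    have i: "diag c (c ^ 2) (- 1) (diag c (c ^ 2) (- 1) q) = q" for q
      unfolding diag_comp using c0 by (simp add: diag_def)
    note H = P2.quotient_realization[OF refl cyclic_model_3 T3_j homogeneous_map_Q3[OF c0] Q3_j[OF _ c0]
       homogeneous_map_Q3[OF c0] Q3_j[OF _ c0]]
    show ?thesis unfolding s by (rule H) (use i tor comm in auto)
  qed
qed

lemma P1P1_j: "P1P1.j q = mpt [[fst q, 1], [snd q, 1]]"
  by (simp add: P1P1.j_def)

lemma P1P1_s: "[[a, 1], [b, 1]] \<in> mvecs [1, 1]"
  unfolding mvecs_11 by simp

lemma T4_j:
  assumes "q \<in> torus"
  shows "T4 (P1P1.j q) = P1P1.j (t4 q)"
proof -
  have x: "fst q \<noteq> 0" using assms by (simp add: torus_def)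
  have "T4 (P1P1.j q) = V4 ` mpt [[fst q, 1], [snd q, 1]]" unfolding T4_def V4_def[abs_def] P1P1_j ..
  also have "\<dots> = mpt (V4 [[fst q, 1], [snd q, 1]])"
    by (rule homogeneous_map.image_mpt[OF homogeneous_map_V4 P1P1_s]) simp
  also have "V4 [[fst q, 1], [snd q, 1]] = [map ((*) 1) [fst (t4 q), 1], map ((*) (fst q)) [snd (t4 q), 1]]"
    using x by (simp add: V4_def t4_def)
  finally show ?thesis unfolding mpt_2[OF one_neq_zero x] P1P1_j .
qed

lemma S4_j:
  assumes "q \<in> torus" "c \<noteq> 0"
  shows "S4 c ` P1P1.j q = P1P1.j (diag c c 1 q)"
  unfolding P1P1_j homogeneous_map.image_mpt[OF homogeneous_map_S4[OF assms(2)] P1P1_s P1P1.N_s[OF assms(1)]]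
  by (simp add: S4_def diag_def)

lemma cyclic_model_4: "cyclic_model P1P1.X P1P1.j T4 t4 4"
proof (intro cyclic_model.intro cyclic_model_axioms.intro P1P1.model_chart torus_map_t4)
  have "T4 = (\<lambda>p. V4 ` p)" unfolding T4_def[abs_def] V4_def[abs_def] ..
  then show "continuous_map (tp P1P1.X) (tp P1P1.X) T4"
    using homogeneous_map.continuous_image[OF homogeneous_map_V4 refl] by (simp only:)
  show "(t4 ^^ 4) p = p" if "p \<in> torus" for p
    using that by (simp add: eval_nat_numeral t4_def torus_def)
  show "\<forall>\<^sub>F q in generic. T4 (P1P1.j q) = P1P1.j (t4 q)" using eventually_torus by eventually_elim (rule T4_j)
qed simp

lemma realization_4:
  assumes c: "c = 1 \<or> c = - 1"
  shows "\<exists>A B \<psi>. birat (quot P1P1.X T4) A B \<psi> \<and>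
    (\<forall>\<^sub>F q in generic. \<psi> (orb T4 (P1P1.j q)) = orb T4 (P1P1.j (diag c c 1 q)))"
proof -
  have c0: "c \<noteq> 0" using c by auto
  note H = P1P1.quotient_realization[OF refl cyclic_model_4 T4_j homogeneous_map_S4[OF c0] S4_j[OF _ c0]
     homogeneous_map_S4[OF c0] S4_j[OF _ c0]]
  have i: "diag c c 1 (diag c c 1 q) = q" for q using c by (auto simp: diag_def)
  have comm: "diag c c 1 (t4 q) = t4 (diag c c 1 q)" for q using c by (auto simp: diag_def t4_def)
  show ?thesis by (rule H) (use i comm diag_torus[OF c0 c0] in auto)
qed

text \<open>\<open>T\<close> is prescribed only through the blow-down on some open set. Since
  general points are mapped into the torus and the torus chart of the plane is injective, this
  determines \<open>T\<close> at general points.\<close>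

lemma cyclic_model_6:
  assumes T: "is_T6 T"
  shows "cyclic_model Bl3.X Bl3.j T t6 6"
proof (intro cyclic_model.intro cyclic_model_axioms.intro Bl3.model_chart torus_map_t6)
  obtain W where iso: "isomorphism Bl3.X Bl3.X T" and W: "nopen Bl3.X W" "\<forall>p\<in>W. blowdown (T p) = T3 (Q2 (blowdown p))"
    using T unfolding is_T6_def Bl3_X by blast
  show "continuous_map (tp Bl3.X) (tp Bl3.X) T" using iso by (simp add: isomorphism_def morphism_def)
  show "(t6 ^^ 6) p = p" if "p \<in> torus" for p
    using that by (simp add: eval_nat_numeral t6_def torus_def prod_eq_iff)
  have "birat Bl3.X (pts Bl3.X) (pts Bl3.X) T" unfolding birat_def open_sub_pts using iso Bl3.X.nopen_pts by blast
  moreover have "\<forall>\<^sub>F q in generic. Bl3.j q \<in> basic [2, 1, 1, 1] Bl3.N \<inter> Bl3_set"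
    using eventually_torus by eventually_elim (rule Bl3.j_torus)
  ultimately have "\<forall>\<^sub>F q in generic. T (Bl3.j q) \<in> basic [2, 1, 1, 1] Bl3.N \<inter> Bl3_set" by (rule Bl3.X.birat_generic)
  with Bl3.X.nopen_generic[OF W(1)] eventually_torus show "\<forall>\<^sub>F q in generic. T (Bl3.j q) = Bl3.j (t6 q)"
  proof eventually_elim
    case (elim q)
    from Bl3.N_basic[OF elim(3)] obtain q' where q': "T (Bl3.j q) = Bl3.j q'" by blast
    have "P2.j q' = T3 (Q2 (P2.j q))" using bspec[OF W(2) elim(1)] unfolding q' blowdown_j .
    also have "Q2 (P2.j q) = Q3 1 ` P2.j q" by (simp add: Q2_def Q3_def[abs_def])
    also have "\<dots> = P2.j (diag 1 1 (- 1) q)" using Q3_j[OF elim(2), of 1] by simp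
    also have "T3 \<dots> = P2.j (t3 (diag 1 1 (- 1) q))" by (rule T3_j) (use elim(2) diag_torus in simp)
    also have "t3 (diag 1 1 (- 1) q) = t6 q" using elim(2) by (simp add: t3_def t6_def diag_def torus_def field_simps)
    finally have "q' = t6 q" by (rule P2_j_inject)
    then show ?case using q' by simp
  qed
qed simp

subsection \<open>The groups\<close>

lemma generic_polynomial_zero:
  assumes "\<forall>\<^sub>F q in generic. ev2 P q = 0"
  shows "P = 0"
proof (rule ccontr)
  assume "P \<noteq> 0"
  then have "\<forall>\<^sub>F q in generic. ev2 P q \<noteq> 0" unfolding eventually_generic by blast
  with assms have "\<forall>\<^sub>F q in generic. False" by eventually_elim simp
  then show False by simp
qed

text \<open>A test for distinctness: equal classes act equally on each invariant Laurent
  polynomial.\<close>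

lemma (in quotient_foliation) aut_eq_invariant:
  assumes m: "realized m" "realized m'" and eq: "aut m = aut m'" and U: "clearable U" "\<And>q. q \<in> torus \<Longrightarrow> U (t q) = U q"
  shows "\<forall>\<^sub>F q in generic. U (m q) = U (m' q)"
proof -
  obtain u where u: "\<forall>\<^sub>F p in generic. evF u p = U p" using clearable_ratfield[OF U(1)] by blast
  have "pb t u = u"
  proof (rule pb_eqI[OF t])
    from u eventually_torus_map[OF t u] eventually_torus show "\<forall>\<^sub>F p in generic. evF u p = evF u (t p)"
      by eventually_elim (simp add: U(2))
  qed
  from aut_eqD[OF m eq this] have e: "pb m u = pb m' u" .
  have tm: "torus_map m" "torus_map m'" using m by (auto simp: realized_def)
  from evF_pb[OF tm(1), of u] evF_pb[OF tm(2), of u] eventually_torus_map[OF tm(1) u] eventually_torus_map[OF tm(2) u]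
  show ?thesis by eventually_elim (simp add: e)
qed

lemma realization_id:
  assumes "cyclic_model X j T t n"
  shows "\<exists>A B \<psi>. birat (quot X T) A B \<psi> \<and> (\<forall>\<^sub>F q in generic. \<psi> (orb T (j q)) = orb T (j q))"
proof -
  interpret model "quot X T" "\<lambda>q. orb T (j q)" "{u. pb t u = u}" by (rule cyclic_model.model_quot[OF assms])
  show ?thesis using birat_id by fastforce
qed

text \<open>Both groups are compared through a common index set with a common composition of
  indices.\<close>

lemma is_iso_of_bij_betw:
  assumes e: "bij_betw e I (carrier G)" and P: "bij_betw P I (carrier H)"
    and hom: "\<And>a b. a \<in> I \<Longrightarrow> b \<in> I \<Longrightarrow> op a b \<in> I \<and> e a \<otimes>\<^bsub>G\<^esub> e b = e (op a b) \<and> P a \<otimes>\<^bsub>H\<^esub> P b = P (op a b)"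
  shows "G \<cong> H"
proof -
  define h where "h = P \<circ> the_inv_into I e"
  have h: "h (e a) = P a" if "a \<in> I" for a
    using the_inv_into_f_f[of e I a] e that by (simp add: h_def bij_betw_def)
  have "bij_betw h (carrier G) (carrier H)"
    unfolding h_def by (rule bij_betw_trans[OF bij_betw_the_inv_into[OF e] P])
  moreover have "h (x \<otimes>\<^bsub>G\<^esub> y) = h x \<otimes>\<^bsub>H\<^esub> h y" if xy: "x \<in> carrier G" "y \<in> carrier G" for x y
  proof -
    have "x \<in> e ` I" "y \<in> e ` I" using xy e by (simp_all add: bij_betw_def)
    then obtain a b where "a \<in> I" "x = e a" "b \<in> I" "y = e b" by blast
    then show ?thesis using hom[of a b] h by simp
  qed
  ultimately have "h \<in> iso G H" by (auto simp: iso_def hom_def bij_betw_def)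
  then show ?thesis by (auto simp: is_iso_def)
qed

text \<open>The pair \<open>(i, s)\<close> is the affine map \<open>k \<mapsto> s k + i\<close> of
  the integers modulo 3; the shifts by one represent the residues by \<open>1\<close>,
  \<open>2\<close>, \<open>3\<close>. The affine group of this field is the full symmetric group on
  three symbols.\<close>

definition affine_perm :: "int \<times> int \<Rightarrow> nat \<Rightarrow> nat" where
  "affine_perm a k = (if k \<in> {1..3} then 1 + nat ((snd a * int k + fst a - 1) mod 3) else k)"

definition affine_comp :: "int \<times> int \<Rightarrow> int \<times> int \<Rightarrow> int \<times> int" where
  "affine_comp a b = ((fst a + snd a * fst b) mod 3, snd a * snd b)"

abbreviation affine_group :: "(int \<times> int) set" where "affine_group \<equiv> {0, 1, 2} \<times> {1, - 1}"

lemma affine_comp_closed: "a \<in> affine_group \<Longrightarrow> b \<in> affine_group \<Longrightarrow> affine_comp a b \<in> affine_group"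
proof -
  assume ab: "a \<in> affine_group" "b \<in> affine_group"
  have "k mod 3 \<in> {0, 1, 2}" for k :: int by (simp only: insert_iff empty_iff) presburger
  moreover have "snd a * snd b \<in> {1, - 1}" using ab by auto
  ultimately show ?thesis unfolding affine_comp_def by (rule SigmaI)
qed

lemma affine_perm_comp: "affine_perm a \<circ> affine_perm b = affine_perm (affine_comp a b)"
proof
  fix k
  obtain i s i' s' where a: "a = (i, s)" "b = (i', s')" by (cases a, cases b)
  show "(affine_perm a \<circ> affine_perm b) k = affine_perm (affine_comp a b) k"
  proof (cases "k \<in> {1..3}")
    case True
    define r where "r = (s' * int k + i' - 1) mod 3"
    have r: "0 \<le> r" "r < 3" by (simp_all add: r_def)
    have "(s * (1 + r) + i - 1) mod 3 = (s * s' * int k + (i + s * i') mod 3 - 1) mod 3"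
    proof -
      have "(s * (1 + r) + i - 1) mod 3 = (s * (1 + (s' * int k + i' - 1)) + i - 1) mod 3"
        by (intro mod_diff_cong mod_add_cong mod_mult_cong refl) (simp add: r_def)
      also have "s * (1 + (s' * int k + i' - 1)) + i - 1 = s * s' * int k + (i + s * i') - 1"
        by (simp add: algebra_simps)
      also have "\<dots> mod 3 = (s * s' * int k + (i + s * i') mod 3 - 1) mod 3"
        by (intro mod_diff_cong mod_add_cong refl) simp
      finally show ?thesis .
    qed
    moreover have "affine_perm b k = 1 + nat r" using True by (simp add: affine_perm_def a r_def)
    moreover have "1 + nat r \<in> {1..3}" "int (1 + nat r) = 1 + r" using r by auto
    ultimately show ?thesis using True by (simp add: affine_perm_def affine_comp_def a del: of_nat_add)
  next
    case False
    have "affine_perm c k = k" for c unfolding affine_perm_def using False by (rule if_not_P)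
    then show ?thesis by simp
  qed
qed

lemma affine_perm_inj: "inj_on affine_perm affine_group"
proof (rule inj_onI)
  fix a b assume ab: "a \<in> affine_group" "b \<in> affine_group" and eq: "affine_perm a = affine_perm b"
  \<comment> \<open>The symbol \<open>3\<close> stands for the residue \<open>0\<close>, so its
    image gives the translation; the image of \<open>1\<close> then gives the sign.\<close>
  have "affine_perm a 3 = affine_perm b 3" "affine_perm a 1 = affine_perm b 1" using eq by simp_all
  then show "a = b" using ab by (auto simp: affine_perm_def)
qed

lemma affine_perm_permutes:
  assumes "a \<in> affine_group"
  shows "affine_perm a permutes {1..3}"
proof (rule bij_imp_permutes)
  have "affine_perm a ` {1..3} \<subseteq> {1..3}" by (auto simp: affine_perm_def)
  moreover have "inj_on (affine_perm a) {1..3}"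
  proof (rule inj_onI)
    fix x y :: nat assume "x \<in> {1..3}" "y \<in> {1..3}" and eq: "affine_perm a x = affine_perm a y"
    then have "x \<in> {1, 2, 3}" "y \<in> {1, 2, 3}" by auto
    then show "x = y" using assms eq by (auto simp: affine_perm_def)
  qed
  ultimately show "bij_betw (affine_perm a) {1..3} {1..3}"
    by (simp add: bij_betw_def endo_inj_surj)
  show "affine_perm a k = k" if "k \<notin> {1..3}" for k unfolding affine_perm_def using that by (rule if_not_P)
qed

text \<open>An injection between sets of the same size: there are six index pairs, and
  \<open>3! = 6\<close> permutations.\<close>

lemma bij_affine_perm: "bij_betw affine_perm affine_group (carrier (sym_group 3))"
proof -
  have sub: "affine_perm ` affine_group \<subseteq> carrier (sym_group 3)"
    using affine_perm_permutes by (auto simp: sym_group_def)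
  have "card (affine_perm ` affine_group) = card affine_group" by (rule card_image[OF affine_perm_inj])
  also have "\<dots> = 6" by (simp add: card_cartesian_product)
  also have "\<dots> = card (carrier (sym_group 3))" by (simp add: sym_group_card_carrier fact_numeral)
  finally have "affine_perm ` affine_group = carrier (sym_group 3)"
    using sub finite_permutations[of "{1..3::nat}"] by (intro card_subset_eq) (auto simp: sym_group_def)
  then show ?thesis using affine_perm_inj by (simp add: bij_betw_def)
qed

lemma very_special_foliation:
  assumes w: "w ^ 3 = 1" "w \<noteq> 1" and F: "is_F3 w M F"
  shows "group (BirFol M F) \<and> order (BirFol M F) = 6 \<and> BirFol M F \<cong> sym_group 3"
proof -
  have w0: "w \<noteq> 0" using w(1) by auto
  have ind: "induced_on_desingularized_quotient P2.X T3 (E3 w) M F" using F unfolding is_F3_def P2_X .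
  obtain \<rho> d f0 R0 where "quotient_foliation (- w) t3 w 3 (- (w ^ 2)) M \<rho> F (quot P2.X T3) (\<lambda>q. orb T3 (P2.j q)) d f0 R0"
    using quotient_foliation_exists[OF ind cyclic_model_3 toric_quotient_3[OF w] E3_eigen[OF w0]] by blast
  then interpret quotient_foliation "- w" t3 w 3 "- (w ^ 2)" M \<rho> F "quot P2.X T3" "\<lambda>q. orb T3 (P2.j q)" d f0 R0 .
  \<comment> \<open>The parameter \<open>c\<close> of \<open>foliated_automorphism_3\<close> is
    written as a power of \<open>w\<close>. The index pairs then compose as affine maps modulo 3:
    the translations add after a twist by the sign.\<close>
  define K where "K a = diag (w powi fst a) ((w powi fst a) ^ 2) (snd a)" for a :: "int \<times> int"
  have w3: "w powi 3 = 1" using w(1) by simp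
  have c3: "(w powi i) ^ 3 = 1" for i
  proof -
    have "(w powi i) ^ 3 = (w powi 3) powi i" by (simp add: power_int_power power_int_power' mult.commute)
    then show ?thesis using w(1) by simp
  qed
  have real: "realized (K a)" if a: "a \<in> affine_group" for a
  proof -
    have s: "snd a = 1 \<or> snd a = - 1" using a by auto
    have nz: "w powi fst a \<noteq> 0" "(w powi fst a) ^ 2 \<noteq> 0" using w0 by simp_all
    have "(of_int (snd a) :: complex) \<noteq> 0" using s by auto
    then show ?thesis unfolding realized_def K_def
      using torus_map_diag[OF nz s] realization_3[OF c3 s] dF_diag[OF nz s] by blast
  qed
  have comp: "K a (K b q) = K (affine_comp a b) q" for a b q
  proof -
    have "w powi k = w powi (k mod 3)" for k
    proof -
      have "w powi k = w powi (3 * (k div 3) + k mod 3)" by simp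
      also have "\<dots> = (w powi 3) powi (k div 3) * w powi (k mod 3)"
        using w0 by (simp only: power_int_add power_int_mult simp_thms)
      finally show ?thesis unfolding w3 by simp
    qed
    then have "w powi ((fst a + snd a * fst b) mod 3) = w powi (fst a + snd a * fst b)" by metis
    also have "\<dots> = w powi fst a * (w powi fst b) powi snd a"
      using w0 by (simp add: power_int_add power_int_mult mult.commute[of "snd a"])
    finally show ?thesis unfolding K_def diag_comp affine_comp_def
      by (simp add: power2_eq_square power_int_mult_distrib mult_ac)
  qed
  have mult: "aut (K a) \<otimes>\<^bsub>BirFol M F\<^esub> aut (K b) = aut (K (affine_comp a b))" if "a \<in> affine_group" "b \<in> affine_group" for a b
    by (rule aut_mult) (use real that affine_comp_closed comp in auto)
  have cover: "carrier (BirFol M F) = (\<lambda>a. aut (K a)) ` affine_group"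
  proof (intro equalityI subsetI)
    fix A assume A: "A \<in> carrier (BirFol M F)"
    have "A \<in> aut ` K ` affine_group"
    proof (rule aut_cover[OF A])
      fix f0 g u0 \<sigma> D assume fa: "foliated_automorphism (- w) t3 w 3 (- (w\<^sup>2)) \<sigma> D f0 g u0"
      obtain c s where cs: "c ^ 3 = 1" "s = 1 \<or> s = - 1" and
        ev: "\<forall>u. pb t3 u = u \<longrightarrow> (\<forall>\<^sub>F p in generic. evF (\<sigma> u) p = evF u (c * fst p powi s, c ^ 2 * snd p powi s))"
        using foliated_automorphism_3[OF w fa] by blast
      have "(c - 1) * (c - w) * (c - w ^ 2) = 0"
      proof -
        have "(c - 1) * (c - w) * (c - w ^ 2) = c ^ 3 - w ^ 3 - (w ^ 2 + w + 1) * (c ^ 2 - c * w)"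
          by (simp add: power2_eq_square power3_eq_cube algebra_simps)
        then show ?thesis using cs(1) w(1) cube_root_unity(1)[OF w] by simp
      qed
      then have "c = 1 \<or> c = w \<or> c = w ^ 2" by auto
      then have "\<exists>i\<in>{0, 1, 2}. c = w powi i" by auto
      then obtain i where i: "i \<in> {0, 1, 2}" "c = w powi i" by blast
      have iS: "(i, s) \<in> affine_group" using i cs(2) by auto
      have "\<forall>u. pb t3 u = u \<longrightarrow> (\<forall>\<^sub>F p in generic. evF (\<sigma> u) p = evF u (K (i, s) p))"
        using ev by (simp add: K_def diag_def i(2))
      then show "\<exists>m\<in>K ` affine_group. realized m \<and> (\<forall>u. pb t3 u = u \<longrightarrow> (\<forall>\<^sub>F p in generic. evF (\<sigma> u) p = evF u (m p)))"
        using real[OF iS] iS by blast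
    qed
    then show "A \<in> (\<lambda>a. aut (K a)) ` affine_group" by (simp only: image_image)
  qed (use aut_carrier real in auto)
  have inj: "inj_on (\<lambda>a. aut (K a)) affine_group"
  proof (rule inj_onI)
    fix a b assume ab: "a \<in> affine_group" "b \<in> affine_group" and eq: "aut (K a) = aut (K b)"
    \<comment> \<open>\<open>U\<close> and \<open>V\<close> are the sums over the
      \<open>t3\<close>-orbits of \<open>x\<close> and of \<open>1 / x\<close>. The map with index
      \<open>(i, s)\<close> takes \<open>U\<close> to \<open>w ^ i\<close> times \<open>U\<close> or
      \<open>V\<close>, so the single invariant \<open>U\<close> tells all six maps apart.\<close>
    define U :: "complex \<times> complex \<Rightarrow> complex" where "U = (\<lambda>q. fst q + inverse (snd q) + snd q * inverse (fst q))"
    define V :: "complex \<times> complex \<Rightarrow> complex" where "V = (\<lambda>q. inverse (fst q) + snd q + fst q * inverse (snd q))"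
    have "clearable U" unfolding U_def by (intro clearable_add clearable_intros)
    moreover have "U (t3 q) = U q" if "q \<in> torus" for q
    proof -
      have "U (t3 q) = 1 / snd q + snd q / fst q + fst q"
        using that by (simp add: U_def t3_def torus_def inverse_eq_divide)
      then show ?thesis by (simp add: U_def divide_inverse)
    qed
    ultimately have UK: "\<forall>\<^sub>F q in generic. U (K a q) = U (K b q)" by (rule aut_eq_invariant[OF real[OF ab(1)] real[OF ab(2)] eq])
    have KU: "U (K (i, s) q) = w powi i * (if s = 1 then U q else V q)" if "q \<in> torus" "s = 1 \<or> s = - 1" for i s q
    proof -
      define c where "c = w powi i"
      have c: "c * (c * c) = 1" using c3[of i] by (simp add: c_def power3_eq_cube mult.assoc)
      have ic1: "inverse (c ^ 2) = c" by (rule inverse_unique) (use c in \<open>simp add: power2_eq_square mult_ac\<close>)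
      have ic2: "inverse c = c ^ 2" by (rule inverse_unique) (use c in \<open>simp add: power2_eq_square mult_ac\<close>)
      note ic = ic1 ic2
      have "c ^ 2 * Y * inverse (c * X) = (c * (c * c)) * c * (Y * inverse X)" for X Y
        by (simp add: ic power2_eq_square mult_ac)
      then have "U (c * X, c ^ 2 * Y) = c * U (X, Y)" for X Y
        unfolding c by (simp add: U_def ic distrib_left)
      moreover have "U (inverse (fst q), inverse (snd q)) = V q"
        by (simp add: U_def V_def mult.commute)
      ultimately show ?thesis using that(2) unfolding K_def c_def[symmetric] diag_def
        by (elim disjE) (simp_all add: c_def[symmetric] power_int_minus)
    qed
    \<comment> \<open>Linear independence of \<open>U\<close> and \<open>V\<close>: multiplied by
      both coordinates, the combination becomes a polynomial whose nonzero coefficients can only be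
      \<open>x\<close> and \<open>y\<close>.\<close>
    have poly: "x = 0 \<and> y = 0" if "\<forall>\<^sub>F q in generic. x * U q + y * V q = 0" for x y
    proof -
      have "\<forall>\<^sub>F q in generic. ev2 [:[:0, x, y:], [:y, 0, x:], [:x, y:]:] q = 0"
        using that eventually_torus
      proof eventually_elim
        case (elim q)
        obtain X Y where q: "q = (X, Y)" by (cases q)
        have nz: "X \<noteq> 0" "Y \<noteq> 0" using elim(2) q by (auto simp: torus_def)
        have U: "U q * (X * Y) = X * X * Y + X + Y * Y" and V: "V q * (X * Y) = Y + X * Y * Y + X * X"
        proof -
          have a: "inverse X * X = 1" "inverse Y * Y = 1" using nz by simp_all
          have U': "(X + y' + Y * x') * (X * Y) = X * X * Y + (y' * Y) * X + (x' * X) * (Y * Y)"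
            and V': "(x' + Y + X * y') * (X * Y) = (x' * X) * Y + X * Y * Y + (y' * Y) * (X * X)" for x' y' :: complex
            by (simp_all add: algebra_simps)
          show "U q * (X * Y) = X * X * Y + X + Y * Y" unfolding q U_def fst_conv snd_conv U' a by simp
          show "V q * (X * Y) = Y + X * Y * Y + X * X" unfolding q V_def fst_conv snd_conv V' a by simp
        qed
        have "ev2 [:[:0, x, y:], [:y, 0, x:], [:x, y:]:] q = x * (X * X * Y + X + Y * Y) + y * (Y + X * Y * Y + X * X)"
          unfolding q by (simp add: ev2_def algebra_simps)
        also have "\<dots> = (x * U q + y * V q) * (X * Y)" unfolding U[symmetric] V[symmetric] by (simp add: algebra_simps)
        finally show ?case using elim(1) by simp
      qed
      from generic_polynomial_zero[OF this] show ?thesis by simp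
    qed
    obtain i s i' s' where ab': "a = (i, s)" "b = (i', s')" by (cases a, cases b)
    have s: "s = 1 \<or> s = - 1" "s' = 1 \<or> s' = - 1" and i: "i \<in> {0, 1, 2}" "i' \<in> {0, 1, 2}" using ab ab' by auto
    have ev: "\<forall>\<^sub>F q in generic. w powi i * (if s = 1 then U q else V q) = w powi i' * (if s' = 1 then U q else V q)"
      using UK eventually_torus by eventually_elim (simp add: ab' KU s)
    have ww: "w powi i \<noteq> 0" "w powi i' \<noteq> 0" using w0 by simp_all
    have "s = s' \<and> w powi i = w powi i'"
      using s
    proof (elim disjE)
      assume s: "s = 1" "s' = 1"
      show ?thesis using poly[of "w powi i - w powi i'" 0] ev s by (simp add: algebra_simps)
    next
      assume s: "s = 1" "s' = - 1"
      show ?thesis using poly[of "w powi i" "- (w powi i')"] ev s ww by (simp add: algebra_simps)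
    next
      assume s: "s = - 1" "s' = 1"
      show ?thesis using poly[of "- (w powi i')" "w powi i"] ev s ww by (simp add: algebra_simps)
    next
      assume s: "s = - 1" "s' = - 1"
      show ?thesis using poly[of 0 "w powi i - w powi i'"] ev s by (simp add: algebra_simps)
    qed
    moreover have "w ^ 2 \<noteq> 1" "w ^ 2 \<noteq> w" using w w0 by (auto simp: power2_eq_square power3_eq_cube)
    ultimately show "a = b" using i w(2) ab' by auto
  qed
  have bij: "bij_betw (\<lambda>a. aut (K a)) affine_group (carrier (BirFol M F))"
    using inj cover by (simp add: bij_betw_def)
  have "order (BirFol M F) = 6" using bij_betw_same_card[OF bij] by (simp add: Coset.order_def card_cartesian_product)
  moreover have "BirFol M F \<cong> sym_group 3"
    by (rule is_iso_of_bij_betw[OF bij bij_affine_perm, of affine_comp])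
      (use mult affine_comp_closed affine_perm_comp in \<open>simp add: sym_group_def\<close>)
  ultimately show ?thesis using group by blast
qed

lemma santos_foliation_4:
  assumes F: "is_F4 M F"
  shows "group (BirFol M F) \<and> order (BirFol M F) = 2 \<and>
    (\<exists>A\<in>carrier (BirFol M F). A \<noteq> \<one>\<^bsub>BirFol M F\<^esub> \<and> A \<otimes>\<^bsub>BirFol M F\<^esub> A = \<one>\<^bsub>BirFol M F\<^esub> \<and>
      carrier (BirFol M F) = generate (BirFol M F) {A})"
proof -
  have ind: "induced_on_desingularized_quotient P1P1.X T4 E4 M F" using F unfolding is_F4_def P1P1_X .
  obtain \<rho> d f0 R0 where "quotient_foliation (- \<i>) t4 (- \<i>) 4 \<i> M \<rho> F (quot P1P1.X T4) (\<lambda>q. orb T4 (P1P1.j q)) d f0 R0"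
    using quotient_foliation_exists[OF ind cyclic_model_4 toric_quotient_4 E4_eigen] by blast
  then interpret quotient_foliation "- \<i>" t4 "- \<i>" 4 \<i> M \<rho> F "quot P1P1.X T4" "\<lambda>q. orb T4 (P1P1.j q)" d f0 R0 .
  have real: "realized (diag c c 1)" if c: "c = 1 \<or> c = - 1" for c
  proof -
    have c0: "c \<noteq> 0" using c by auto
    have s: "1 = (1 :: int) \<or> 1 = - (1 :: int)" by simp
    have "(of_int 1 :: complex) \<noteq> 0" by simp
    then show ?thesis unfolding realized_def
      using torus_map_diag[OF c0 c0 s] realization_4[OF c] dF_diag[OF c0 c0 s] by blast
  qed
  define A where "A = aut (diag (- 1) (- 1) 1)"
  have one: "aut (diag 1 1 1) = \<one>\<^bsub>BirFol M F\<^esub>" using aut_one real[of 1] unfolding diag_id by simp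
  have AA: "A \<otimes>\<^bsub>BirFol M F\<^esub> A = \<one>\<^bsub>BirFol M F\<^esub>"
    unfolding A_def one[symmetric] by (rule aut_mult) (use real in \<open>auto simp: diag_comp\<close>)
  have car: "carrier (BirFol M F) = {\<one>\<^bsub>BirFol M F\<^esub>, A}"
  proof (intro equalityI subsetI)
    fix B assume B: "B \<in> carrier (BirFol M F)"
    have "B \<in> aut ` {diag 1 1 1, diag (- 1) (- 1) 1}"
    proof (rule aut_cover[OF B])
      fix f0 g u0 \<sigma> D assume fa: "foliated_automorphism (- \<i>) t4 (- \<i>) 4 \<i> \<sigma> D f0 g u0"
      obtain c where c: "c = 1 \<or> c = - 1" and
        "\<forall>u. pb t4 u = u \<longrightarrow> (\<forall>\<^sub>F p in generic. evF (\<sigma> u) p = evF u (c * fst p, c * snd p))"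
        using foliated_automorphism_4[OF fa] by blast
      then have "\<forall>u. pb t4 u = u \<longrightarrow> (\<forall>\<^sub>F p in generic. evF (\<sigma> u) p = evF u (diag c c 1 p))"
        by (simp add: diag_def)
      moreover have "diag c c 1 \<in> {diag 1 1 1, diag (- 1) (- 1) 1}" using c by auto
      ultimately show "\<exists>m\<in>{diag 1 1 1, diag (- 1) (- 1) 1}. realized m \<and>
          (\<forall>u. pb t4 u = u \<longrightarrow> (\<forall>\<^sub>F p in generic. evF (\<sigma> u) p = evF u (m p)))" using real[OF c] by blast
    qed
    then show "B \<in> {\<one>\<^bsub>BirFol M F\<^esub>, A}" using one by (auto simp: A_def)
  next
    fix B assume "B \<in> {\<one>\<^bsub>BirFol M F\<^esub>, A}"
    then show "B \<in> carrier (BirFol M F)"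
      using aut_carrier[OF real[of 1]] aut_carrier[OF real[of "- 1"]] one by (auto simp: A_def)
  qed
  have A1: "A \<noteq> \<one>\<^bsub>BirFol M F\<^esub>"
  proof
    assume "A = \<one>\<^bsub>BirFol M F\<^esub>"
    then have eq: "aut (diag (- 1) (- 1) 1) = aut (diag 1 1 1)" using one by (simp add: A_def)
    \<comment> \<open>The sum over the \<open>t4\<close>-orbit of \<open>x\<close>. It is odd under
      the sign change, so if the involution were trivial it would vanish at general points, against
      the nonzero polynomial obtained by clearing denominators.\<close>
    define U :: "complex \<times> complex \<Rightarrow> complex" where "U = (\<lambda>q. fst q + snd q + inverse (fst q) + inverse (snd q))"
    have "clearable U" unfolding U_def by (intro clearable_add clearable_intros)
    moreover have "U (t4 q) = U q" if "q \<in> torus" for q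
      using that by (simp add: U_def t4_def torus_def inverse_eq_divide)
    ultimately have "\<forall>\<^sub>F q in generic. U (diag (- 1) (- 1) 1 q) = U (diag 1 1 1 q)"
      by (rule aut_eq_invariant[OF real real eq, rotated 2]) auto
    then have "\<forall>\<^sub>F q in generic. ev2 [:[:0, 1:], [:1, 0, 1:], [:0, 1:]:] q = 0"
      using eventually_torus
    proof eventually_elim
      case (elim q)
      obtain X Y where q: "q = (X, Y)" by (cases q)
      have nz: "X \<noteq> 0" "Y \<noteq> 0" using elim(2) q by (auto simp: torus_def)
      have "U q * (X * Y) = X * X * Y + Y * Y * X + Y + X"
      proof -
        have a: "inverse X * X = 1" "inverse Y * Y = 1" using nz by simp_all
        have U': "(X + Y + x' + y') * (X * Y) = X * X * Y + Y * Y * X + (x' * X) * Y + (y' * Y) * X" for x' y' :: complex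
          by (simp add: algebra_simps)
        show ?thesis unfolding q U_def fst_conv snd_conv U' a by simp
      qed
      moreover have "ev2 [:[:0, 1:], [:1, 0, 1:], [:0, 1:]:] q = X * X * Y + Y * Y * X + Y + X"
        unfolding q by (simp add: ev2_def algebra_simps)
      ultimately have "ev2 [:[:0, 1:], [:1, 0, 1:], [:0, 1:]:] q = U q * (X * Y)" by simp
      moreover have "U (diag (- 1) (- 1) 1 q) = - U q" by (simp add: U_def diag_def)
      then have "U q = 0" using elim(1) by (simp add: diag_id)
      ultimately show ?case by simp
    qed
    from generic_polynomial_zero[OF this] show False by simp
  qed
  have "generate (BirFol M F) {A} = carrier (BirFol M F)"
    using group.generate_incl[OF group, of "{A}"] car
    by (intro equalityI) (auto intro: generate.one generate.incl)
  moreover have "order (BirFol M F) = 2" unfolding Coset.order_def car using A1 by auto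
  ultimately show ?thesis using group AA A1 car by blast
qed

lemma santos_foliation_6:
  assumes w: "w ^ 3 = 1" "w \<noteq> 1" and F: "is_F6 w M F"
  shows "group (BirFol M F) \<and> carrier (BirFol M F) = {\<one>\<^bsub>BirFol M F\<^esub>}"
proof -
  have w0: "w \<noteq> 0" using w(1) by auto
  obtain T where T: "is_T6 T" and ind: "induced_on_desingularized_quotient Bl3.X T (E6 w) M F"
    using F unfolding is_F6_def Bl3_X by blast
  note cm = cyclic_model_6[OF T]
  obtain \<rho> d f0 R0 where "quotient_foliation (- w) t6 (- w) 6 (- (w ^ 2)) M \<rho> F (quot Bl3.X T) (\<lambda>q. orb T (Bl3.j q)) d f0 R0"
    using quotient_foliation_exists[OF ind cm toric_quotient_6[OF w] E6_eigen[OF w0]] by blast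
  then interpret quotient_foliation "- w" t6 "- w" 6 "- (w ^ 2)" M \<rho> F "quot Bl3.X T" "\<lambda>q. orb T (Bl3.j q)" d f0 R0 .
  have s: "1 = (1 :: int) \<or> 1 = - (1 :: int)" by simp
  have "(of_int 1 :: complex) \<noteq> 0" by simp
  then have real: "realized (\<lambda>q. q)" unfolding realized_def
    using torus_map_id realization_id[OF cm] dF_diag[OF one_neq_zero one_neq_zero s, unfolded diag_id] by blast
  have "A \<in> aut ` {\<lambda>q. q}" if "A \<in> carrier (BirFol M F)" for A
  proof (rule aut_cover[OF that])
    fix f0 g u0 \<sigma> D assume "foliated_automorphism (- w) t6 (- w) 6 (- (w\<^sup>2)) \<sigma> D f0 g u0"
    from foliated_automorphism_6[OF w this]
    show "\<exists>m\<in>{\<lambda>q. q}. realized m \<and> (\<forall>u. pb t6 u = u \<longrightarrow> (\<forall>\<^sub>F p in generic. evF (\<sigma> u) p = evF u (m p)))"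
      using real by simp
  qed
  moreover have "aut (\<lambda>q. q) = \<one>\<^bsub>BirFol M F\<^esub>" by (rule aut_one[OF real])
  ultimately have "carrier (BirFol M F) \<subseteq> {\<one>\<^bsub>BirFol M F\<^esub>}" by auto
  then show ?thesis using group monoid.one_closed[OF group.is_monoid[OF group]] by blast
qed

theorem theorem5:
  fixes w :: complex
  assumes "w ^ 3 = 1" and "w \<noteq> 1"
  shows "(\<forall>M F. is_F3 w M F \<longrightarrow>
            group (BirFol M F) \<and> order (BirFol M F) = 6 \<and> BirFol M F \<cong> sym_group 3) \<and>
         (\<forall>M F. is_F4 M F \<longrightarrow>
            group (BirFol M F) \<and> order (BirFol M F) = 2 \<and>
            (\<exists>A\<in>carrier (BirFol M F). A \<noteq> \<one>\<^bsub>BirFol M F\<^esub> \<and>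
               A \<otimes>\<^bsub>BirFol M F\<^esub> A = \<one>\<^bsub>BirFol M F\<^esub> \<and>
               carrier (BirFol M F) = generate (BirFol M F) {A})) \<and>
         (\<forall>M F. is_F6 w M F \<longrightarrow>
            group (BirFol M F) \<and> carrier (BirFol M F) = {\<one>\<^bsub>BirFol M F\<^esub>})"
  using very_special_foliation[OF assms] santos_foliation_4 santos_foliation_6[OF assms] by blast

end
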